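(* For any $\infty$-cosmos $\mathcal{K}$ there is an $\infty$-cosmos $\mathcal{K}^{\mathbf{2}}$ which has: - objects: all isofibrations $p\colon E\twoheadrightarrow A$ in $\mathcal{K}$; - functor space from $p\colon E\twoheadrightarrow A$ to $q\colon F\twoheadrightarrow B$: the pullback in simplicial sets $$\mathrm{Fun}_{\mathcal{K}^{\mathbf{2}}}(p,q):=\mathrm{Fun}_{\mathcal{K}}(A,B)\times_{\mathrm{Fun}_{\mathcal{K}}(E,B)}\mathrm{Fun}_{\mathcal{K}}(E,F)$$ of $\mathrm{Fun}_{\mathcal{K}}(E,q)\colon\mathrm{Fun}_{\mathcal{K}}(E,F)\twoheadrightarrow\mathrm{Fun}_{\mathcal{K}}(E,B)$ along $\mathrm{Fun}_{\mathcal{K}}(p,B)\colon\mathrm{Fun}_{\mathcal{K}}(A,B)\to\mathrm{Fun}_{\mathcal{K}}(E,B)$; so, in particular, the $0$-arrows from $p$ to $q$ are commutative squares $(g,f)$ with $g\colon E\to F$, $f\colon A\to B$ and $qg=fp$; - equivalences: those squares $(g,f)$ whose components $f$ and $g$ are equivalences in $\mathcal{K}$; - isofibrations (resp. trivial fibrations): those squares $(g,f)$ for which the map $f$ and the induced map $E\to A\times_BF$ (and thus also $g$) are isofibrations (resp. trivial fibrations) in $\mathcal{K}$. The simplicial limits required by the completeness axiom of an $\infty$-cosmos are defined object-wise in $\mathcal{K}$, i.e. they are jointly created by the domain and codomain projections $\mathrm{dom},\mathrm{cod}\colon\mathcal{K}^{\mathbf{2}}\to\mathcal{K}$.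
   Context: An $\infty$-cosmos is a (possibly large) simplicially enriched category $\mathcal{K}$, whose objects are called $\infty$-categories, whose hom simplicial sets $\mathrm{Fun}_{\mathcal{K}}(A,B)$ are quasi-categories, equipped with a specified subcategory of isofibrations (denoted $\twoheadrightarrow$) such that: (a) (completeness) as a simplicially enriched category, $\mathcal{K}$ has a terminal object $1$, small products, cotensors $A^U$ by all small simplicial sets $U$, inverse limits of countable sequences of isofibrations, and pullbacks of isofibrations along any functor; (b) isofibrations contain the isomorphisms and all $A\to1$, are stable under pullback along all functors, are closed under small products and under inverse limits of countable sequences, and if $p\colon E\twoheadrightarrow B$ is an isofibration and $U\hookrightarrow V$ is an inclusion of simplicial sets then the Leibniz cotensor $E^V\to E^U\times_{B^U}B^V$ is an isofibration; moreover $\mathrm{Fun}_{\mathcal{K}}(X,p)$ is an isofibration of quasi-categories for every object $X$ and isofibration $p$. (An isofibration of quasi-categories is an inner fibration with the right lifting property against the inclusion of an endpoint into the nerve of the free-standing isomorphism.) In any $\infty$-cosmos, a functor (0-arrow) $f\colon A\to B$ is an equivalence if $\mathrm{Fun}_{\mathcal{K}}(X,f)$ is an equivalence of quasi-categories for all $X$; a trivial fibration is a functor that is both an equivalence and an isofibration. *)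

theory Defs
  imports "HOL-Library.FuncSet"
begin

unbundle cardinal_syntax

section \<open>Simplicial sets\<close>

text \<open>
  \<open>Delta m n\<close> is the set of morphisms from \<open>[m] = {0, ..., m}\<close> to \<open>[n]\<close> in the simplex category.
  They are kept extensional, so that equality of functions is equality of simplicial operators.
\<close>

definition Delta :: "nat \<Rightarrow> nat \<Rightarrow> (nat \<Rightarrow> nat) set" where
  "Delta m n = {\<alpha> \<in> {..m} \<rightarrow>\<^sub>E {..n}. mono_on {..m} \<alpha>}"

text \<open>For \<open>\<alpha> \<in> Delta m n\<close>, the function \<open>act X m n \<alpha>\<close> is the operator from \<open>X\<^sub>n\<close> to \<open>X\<^sub>m\<close>.\<close>

record 'a sset =
  simplices :: "nat \<Rightarrow> 'a set"
  act :: "nat \<Rightarrow> nat \<Rightarrow> (nat \<Rightarrow> nat) \<Rightarrow> 'a \<Rightarrow> 'a"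

locale simplicial_set =
  fixes X :: "'a sset"
  assumes act_closed:
      "\<lbrakk>\<alpha> \<in> Delta m n; x \<in> simplices X n\<rbrakk> \<Longrightarrow> act X m n \<alpha> x \<in> simplices X m"
    and act_id:
      "x \<in> simplices X n \<Longrightarrow> act X n n (\<lambda>i\<in>{..n}. i) x = x"
    and act_comp:
      "\<lbrakk>\<alpha> \<in> Delta l m; \<beta> \<in> Delta m n; x \<in> simplices X n\<rbrakk>
        \<Longrightarrow> act X l m \<alpha> (act X m n \<beta> x) = act X l n (compose {..l} \<beta> \<alpha>) x"

definition smap :: "'a sset \<Rightarrow> 'b sset \<Rightarrow> (nat \<Rightarrow> 'a \<Rightarrow> 'b) set" where
  "smap X Y = {f. (\<forall>n. f n \<in> simplices X n \<rightarrow>\<^sub>E simplices Y n) \<and>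
     (\<forall>m n. \<forall>\<alpha>\<in>Delta m n. \<forall>x\<in>simplices X n. f m (act X m n \<alpha> x) = act Y m n \<alpha> (f n x))}"

definition simplicial_iso :: "'a sset \<Rightarrow> 'b sset \<Rightarrow> (nat \<Rightarrow> 'a \<Rightarrow> 'b) \<Rightarrow> bool" where
  "simplicial_iso X Y f \<longleftrightarrow> f \<in> smap X Y \<and> (\<forall>n. bij_betw (f n) (simplices X n) (simplices Y n))"

text \<open>The totally degenerate \<open>n\<close>-simplex on a vertex.\<close>

definition degen :: "'a sset \<Rightarrow> nat \<Rightarrow> 'a \<Rightarrow> 'a" where
  "degen X n x = act X n 0 (\<lambda>i\<in>{..n}. 0) x"

definition std_simplex :: "nat \<Rightarrow> (nat \<Rightarrow> nat) sset" where
  "std_simplex n = \<lparr>simplices = (\<lambda>m. Delta m n), act = (\<lambda>l m \<alpha> \<beta>. compose {..l} \<beta> \<alpha>)\<rparr>"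

definition horn :: "nat \<Rightarrow> nat \<Rightarrow> (nat \<Rightarrow> nat) sset" where
  "horn n k = \<lparr>simplices = (\<lambda>m. {\<beta> \<in> Delta m n. \<exists>j\<in>{..n} - {k}. j \<notin> \<beta> ` {..m}}),
               act = (\<lambda>l m \<alpha> \<beta>. compose {..l} \<beta> \<alpha>)\<rparr>"

text \<open>
  The nerve of the free-standing isomorphism: there is exactly one arrow between any two of
  its objects \<open>0\<close> and \<open>1\<close>, so a functor from \<open>[m]\<close> to it is an arbitrary function on objects.
\<close>

definition iso_nerve :: "(nat \<Rightarrow> nat) sset" where
  "iso_nerve = \<lparr>simplices = (\<lambda>m. {..m} \<rightarrow>\<^sub>E {0, 1}), act = (\<lambda>l m \<alpha> \<beta>. compose {..l} \<beta> \<alpha>)\<rparr>"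

definition iso_endpoint :: "nat \<Rightarrow> (nat \<Rightarrow> nat) sset" where
  "iso_endpoint e = \<lparr>simplices = (\<lambda>m. {\<lambda>i\<in>{..m}. e}), act = (\<lambda>l m \<alpha> \<beta>. compose {..l} \<beta> \<alpha>)\<rparr>"

definition sprod :: "'a sset \<Rightarrow> 'b sset \<Rightarrow> ('a \<times> 'b) sset" where
  "sprod X Y = \<lparr>simplices = (\<lambda>n. simplices X n \<times> simplices Y n),
                act = (\<lambda>m n \<alpha> (x, y). (act X m n \<alpha> x, act Y m n \<alpha> y))\<rparr>"

definition spullback ::
    "'a sset \<Rightarrow> 'b sset \<Rightarrow> (nat \<Rightarrow> 'a \<Rightarrow> 'c) \<Rightarrow> (nat \<Rightarrow> 'b \<Rightarrow> 'c) \<Rightarrow> ('a \<times> 'b) sset" where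
  "spullback X Y f g =
    \<lparr>simplices = (\<lambda>n. {(x, y) \<in> simplices X n \<times> simplices Y n. f n x = g n y}),
     act = (\<lambda>m n \<alpha> (x, y). (act X m n \<alpha> x, act Y m n \<alpha> y))\<rparr>"

text \<open>The function complex \<open>Y\<^sup>U\<close>.\<close>

definition sexp :: "'u sset \<Rightarrow> 'a sset \<Rightarrow> (nat \<Rightarrow> (nat \<Rightarrow> nat) \<times> 'u \<Rightarrow> 'a) sset" where
  "sexp U Y =
    \<lparr>simplices = (\<lambda>n. smap (sprod (std_simplex n) U) Y),
     act = (\<lambda>m n \<alpha> \<phi> l. \<lambda>(\<beta>, x)\<in>Delta l m \<times> simplices U l. \<phi> l (compose {..l} \<alpha> \<beta>, x))\<rparr>"


section \<open>Quasi-categories\<close>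

text \<open>
  The right lifting property of \<open>p\<close> against the inclusion of a simplicial subset \<open>A\<close> of \<open>B\<close>.
\<close>

definition has_rlp :: "'c sset \<Rightarrow> 'c sset \<Rightarrow> 'a sset \<Rightarrow> 'b sset \<Rightarrow> (nat \<Rightarrow> 'a \<Rightarrow> 'b) \<Rightarrow> bool" where
  "has_rlp A B X Y p \<longleftrightarrow>
    (\<forall>u\<in>smap A X. \<forall>v\<in>smap B Y.
      (\<forall>n. \<forall>a\<in>simplices A n. p n (u n a) = v n a) \<longrightarrow>
      (\<exists>w\<in>smap B X. (\<forall>n. \<forall>a\<in>simplices A n. w n a = u n a) \<and>
                     (\<forall>n. \<forall>b\<in>simplices B n. p n (w n b) = v n b)))"

definition quasi_category :: "'a sset \<Rightarrow> bool" where
  "quasi_category X \<longleftrightarrow> simplicial_set X \<and>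
    (\<forall>n k. 0 < k \<and> k < n \<longrightarrow>
      (\<forall>u\<in>smap (horn n k) X. \<exists>w\<in>smap (std_simplex n) X.
        \<forall>m. \<forall>a\<in>simplices (horn n k) m. w m a = u m a))"

definition inner_fibration :: "'a sset \<Rightarrow> 'b sset \<Rightarrow> (nat \<Rightarrow> 'a \<Rightarrow> 'b) \<Rightarrow> bool" where
  "inner_fibration X Y p \<longleftrightarrow> p \<in> smap X Y \<and>
    (\<forall>n k. 0 < k \<and> k < n \<longrightarrow> has_rlp (horn n k) (std_simplex n) X Y p)"

definition qcat_isofibration :: "'a sset \<Rightarrow> 'b sset \<Rightarrow> (nat \<Rightarrow> 'a \<Rightarrow> 'b) \<Rightarrow> bool" where
  "qcat_isofibration X Y p \<longleftrightarrow> quasi_category X \<and> quasi_category Y \<and> inner_fibration X Y p \<and>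
    (\<forall>e\<in>{0, 1}. has_rlp (iso_endpoint e) iso_nerve X Y p)"

definition qcat_equivalence :: "'a sset \<Rightarrow> 'b sset \<Rightarrow> (nat \<Rightarrow> 'a \<Rightarrow> 'b) \<Rightarrow> bool" where
  "qcat_equivalence X Y f \<longleftrightarrow> quasi_category X \<and> quasi_category Y \<and> f \<in> smap X Y \<and>
    (\<exists>g\<in>smap Y X. \<exists>H\<in>smap (sprod X iso_nerve) X. \<exists>H'\<in>smap (sprod Y iso_nerve) Y.
      (\<forall>n. \<forall>x\<in>simplices X n. H n (x, \<lambda>i\<in>{..n}. 0) = x \<and> H n (x, \<lambda>i\<in>{..n}. 1) = g n (f n x)) \<and>
      (\<forall>n. \<forall>y\<in>simplices Y n. H' n (y, \<lambda>i\<in>{..n}. 0) = f n (g n y) \<and> H' n (y, \<lambda>i\<in>{..n}. 1) = y))"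


section \<open>Simplicially enriched categories\<close>

text \<open>
  \<open>Cmp K A B C n g f\<close> is the composite of the \<open>n\<close>-simplices \<open>f\<close> of \<open>Fun K A B\<close> and \<open>g\<close> of
  \<open>Fun K B C\<close>. Distinct function complexes need not be disjoint.
\<close>

record ('o, 'a) scat =
  Obj :: "'o set"
  Fun :: "'o \<Rightarrow> 'o \<Rightarrow> 'a sset"
  Cmp :: "'o \<Rightarrow> 'o \<Rightarrow> 'o \<Rightarrow> nat \<Rightarrow> 'a \<Rightarrow> 'a \<Rightarrow> 'a"
  Unit :: "'o \<Rightarrow> 'a"

abbreviation arr :: "('o, 'a, 'm) scat_scheme \<Rightarrow> 'o \<Rightarrow> 'o \<Rightarrow> 'a set" where
  "arr K A B \<equiv> simplices (Fun K A B) 0"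

abbreviation cmp0 :: "('o, 'a, 'm) scat_scheme \<Rightarrow> 'o \<Rightarrow> 'o \<Rightarrow> 'o \<Rightarrow> 'a \<Rightarrow> 'a \<Rightarrow> 'a" where
  "cmp0 K A B C g f \<equiv> Cmp K A B C 0 g f"

locale simplicial_category =
  fixes K :: "('o, 'a, 'm) scat_scheme"
  assumes Fun_simplicial_set:
      "\<lbrakk>A \<in> Obj K; B \<in> Obj K\<rbrakk> \<Longrightarrow> simplicial_set (Fun K A B)"
    and Cmp_closed:
      "\<lbrakk>A \<in> Obj K; B \<in> Obj K; C \<in> Obj K;
        f \<in> simplices (Fun K A B) n; g \<in> simplices (Fun K B C) n\<rbrakk>
        \<Longrightarrow> Cmp K A B C n g f \<in> simplices (Fun K A C) n"
    and Cmp_act: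
      "\<lbrakk>A \<in> Obj K; B \<in> Obj K; C \<in> Obj K; \<alpha> \<in> Delta m n;
        f \<in> simplices (Fun K A B) n; g \<in> simplices (Fun K B C) n\<rbrakk>
        \<Longrightarrow> act (Fun K A C) m n \<alpha> (Cmp K A B C n g f)
            = Cmp K A B C m (act (Fun K B C) m n \<alpha> g) (act (Fun K A B) m n \<alpha> f)"
    and Cmp_assoc:
      "\<lbrakk>A \<in> Obj K; B \<in> Obj K; C \<in> Obj K; D \<in> Obj K; f \<in> simplices (Fun K A B) n;
        g \<in> simplices (Fun K B C) n; h \<in> simplices (Fun K C D) n\<rbrakk>
        \<Longrightarrow> Cmp K A B D n (Cmp K B C D n h g) f = Cmp K A C D n h (Cmp K A B C n g f)"
    and Unit_closed:
      "A \<in> Obj K \<Longrightarrow> Unit K A \<in> arr K A A"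
    and Unit_left:
      "\<lbrakk>A \<in> Obj K; B \<in> Obj K; f \<in> simplices (Fun K A B) n\<rbrakk>
        \<Longrightarrow> Cmp K A B B n (degen (Fun K B B) n (Unit K B)) f = f"
    and Unit_right:
      "\<lbrakk>A \<in> Obj K; B \<in> Obj K; f \<in> simplices (Fun K A B) n\<rbrakk>
        \<Longrightarrow> Cmp K A A B n f (degen (Fun K A A) n (Unit K A)) = f"

definition isomorphism :: "('o, 'a, 'm) scat_scheme \<Rightarrow> 'o \<Rightarrow> 'o \<Rightarrow> 'a \<Rightarrow> bool" where
  "isomorphism K A B f \<longleftrightarrow> A \<in> Obj K \<and> B \<in> Obj K \<and> f \<in> arr K A B \<and>
    (\<exists>g\<in>arr K B A. cmp0 K A B A g f = Unit K A \<and> cmp0 K B A B f g = Unit K B)"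

text \<open>The maps \<open>Fun(X, f)\<close> and \<open>Fun(f, X)\<close> for a 0-arrow \<open>f\<close> from \<open>A\<close> to \<open>B\<close>.\<close>

definition post_map :: "('o, 'a, 'm) scat_scheme \<Rightarrow> 'o \<Rightarrow> 'o \<Rightarrow> 'o \<Rightarrow> 'a \<Rightarrow> nat \<Rightarrow> 'a \<Rightarrow> 'a" where
  "post_map K X A B f = (\<lambda>n. \<lambda>h\<in>simplices (Fun K X A) n. Cmp K X A B n (degen (Fun K A B) n f) h)"

definition pre_map :: "('o, 'a, 'm) scat_scheme \<Rightarrow> 'o \<Rightarrow> 'o \<Rightarrow> 'o \<Rightarrow> 'a \<Rightarrow> nat \<Rightarrow> 'a \<Rightarrow> 'a" where
  "pre_map K A B X f = (\<lambda>n. \<lambda>h\<in>simplices (Fun K B X) n. Cmp K A B X n h (degen (Fun K A B) n f))"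

definition equivalence :: "('o, 'a, 'm) scat_scheme \<Rightarrow> 'o \<Rightarrow> 'o \<Rightarrow> 'a \<Rightarrow> bool" where
  "equivalence K A B f \<longleftrightarrow> A \<in> Obj K \<and> B \<in> Obj K \<and> f \<in> arr K A B \<and>
    (\<forall>X\<in>Obj K. qcat_equivalence (Fun K X A) (Fun K X B) (post_map K X A B f))"

record ('o, 'p, 'a, 'b) sfunctor =
  FOb :: "'o \<Rightarrow> 'p"
  FAr :: "'o \<Rightarrow> 'o \<Rightarrow> nat \<Rightarrow> 'a \<Rightarrow> 'b"

definition simplicial_functor ::
    "('o, 'a, 'm) scat_scheme \<Rightarrow> ('p, 'b, 'n) scat_scheme \<Rightarrow> ('o, 'p, 'a, 'b) sfunctor \<Rightarrow> bool" where
  "simplicial_functor K L F \<longleftrightarrow>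
    (\<forall>A\<in>Obj K. FOb F A \<in> Obj L) \<and>
    (\<forall>A\<in>Obj K. \<forall>B\<in>Obj K. FAr F A B \<in> smap (Fun K A B) (Fun L (FOb F A) (FOb F B))) \<and>
    (\<forall>A\<in>Obj K. FAr F A A 0 (Unit K A) = Unit L (FOb F A)) \<and>
    (\<forall>A\<in>Obj K. \<forall>B\<in>Obj K. \<forall>C\<in>Obj K. \<forall>n. \<forall>f\<in>simplices (Fun K A B) n. \<forall>g\<in>simplices (Fun K B C) n.
      FAr F A C n (Cmp K A B C n g f)
        = Cmp L (FOb F A) (FOb F B) (FOb F C) n (FAr F B C n g) (FAr F A B n f))"


section \<open>Simplicial limits and cotensors\<close>

text \<open>
  A diagram is given on a generating graph of its shape (identities and composites are implied),
  which does not affect cones. At most one edge between two vertices is enough for products,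
  pullbacks and inverse limits of sequences.
\<close>

record ('v, 'o, 'a) diagram =
  Vert :: "'v set"
  Edge :: "('v \<times> 'v) set"
  Ob :: "'v \<Rightarrow> 'o"
  Ar :: "'v \<Rightarrow> 'v \<Rightarrow> 'a"

definition cone ::
    "('o, 'a, 'm) scat_scheme \<Rightarrow> ('v, 'o, 'a) diagram \<Rightarrow> 'o \<Rightarrow> ('v \<Rightarrow> 'a) \<Rightarrow> bool" where
  "cone K D L \<pi> \<longleftrightarrow> L \<in> Obj K \<and> \<pi> \<in> (\<Pi>\<^sub>E v\<in>Vert D. arr K L (Ob D v)) \<and>
    (\<forall>(v, w)\<in>Edge D. cmp0 K L (Ob D v) (Ob D w) (Ar D v w) (\<pi> v) = \<pi> w)"

text \<open>The \<open>n\<close>-simplices of the limit of the simplicial sets \<open>Fun(X, D v)\<close>.\<close>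

definition compatible_families ::
    "('o, 'a, 'm) scat_scheme \<Rightarrow> ('v, 'o, 'a) diagram \<Rightarrow> 'o \<Rightarrow> nat \<Rightarrow> ('v \<Rightarrow> 'a) set" where
  "compatible_families K D X n =
    {x \<in> \<Pi>\<^sub>E v\<in>Vert D. simplices (Fun K X (Ob D v)) n.
      \<forall>(v, w)\<in>Edge D. post_map K X (Ob D v) (Ob D w) (Ar D v w) n (x v) = x w}"

text \<open>Simplicially enriched (conical) limits: \<open>Fun(X, L)\<close> is the limit of the \<open>Fun(X, D v)\<close>.\<close>

definition limit_cone ::
    "('o, 'a, 'm) scat_scheme \<Rightarrow> ('v, 'o, 'a) diagram \<Rightarrow> 'o \<Rightarrow> ('v \<Rightarrow> 'a) \<Rightarrow> bool" where
  "limit_cone K D L \<pi> \<longleftrightarrow> cone K D L \<pi> \<and>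
    (\<forall>X\<in>Obj K. \<forall>n. bij_betw (\<lambda>h. \<lambda>v\<in>Vert D. post_map K X L (Ob D v) (\<pi> v) n h)
      (simplices (Fun K X L) n) (compatible_families K D X n))"

definition terminal :: "('o, 'a, 'm) scat_scheme \<Rightarrow> 'o \<Rightarrow> bool" where
  "terminal K T \<longleftrightarrow> T \<in> Obj K \<and> (\<forall>X\<in>Obj K. \<forall>n. \<exists>!h. h \<in> simplices (Fun K X T) n)"

definition product_diagram :: "'v set \<Rightarrow> ('v \<Rightarrow> 'o) \<Rightarrow> ('v, 'o, 'a) diagram" where
  "product_diagram I A = \<lparr>Vert = I, Edge = {}, Ob = A, Ar = (\<lambda>_ _. undefined)\<rparr>"

text \<open>\<open>p n\<close> goes from \<open>E (n + 1)\<close> to \<open>E n\<close>.\<close>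

definition sequence_diagram :: "(nat \<Rightarrow> 'o) \<Rightarrow> (nat \<Rightarrow> 'a) \<Rightarrow> (nat, 'o, 'a) diagram" where
  "sequence_diagram E p =
    \<lparr>Vert = UNIV, Edge = {(Suc n, n) |n. True}, Ob = E, Ar = (\<lambda>_ n. p n)\<rparr>"

datatype cospan_vertex = CLeft | CRight | CBase

text \<open>The cospan of \<open>f\<close> from \<open>A\<close> to \<open>B\<close> and \<open>q\<close> from \<open>F\<close> to \<open>B\<close>.\<close>

definition cospan :: "'o \<Rightarrow> 'a \<Rightarrow> 'o \<Rightarrow> 'a \<Rightarrow> 'o \<Rightarrow> (cospan_vertex, 'o, 'a) diagram" where
  "cospan A f B q F =
    \<lparr>Vert = UNIV, Edge = {(CLeft, CBase), (CRight, CBase)},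
     Ob = (\<lambda>v. case v of CLeft \<Rightarrow> A | CRight \<Rightarrow> F | CBase \<Rightarrow> B),
     Ar = (\<lambda>v _. if v = CLeft then f else q)\<rparr>"

text \<open>
  \<open>u\<close> exhibits \<open>C\<close> as the cotensor \<open>A\<^sup>U\<close>: it is a map from \<open>U\<close> to \<open>Fun(C, A)\<close> for which the induced
  maps from \<open>Fun(X, C)\<close> to \<open>Fun(X, A)\<^sup>U\<close> are isomorphisms.
\<close>

definition cotensor_cone ::
    "('o, 'a, 'm) scat_scheme \<Rightarrow> 'u sset \<Rightarrow> 'o \<Rightarrow> 'o \<Rightarrow> (nat \<Rightarrow> 'u \<Rightarrow> 'a) \<Rightarrow> bool" where
  "cotensor_cone K U A C u \<longleftrightarrow> C \<in> Obj K \<and> u \<in> smap U (Fun K C A)"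

definition cotensor ::
    "('o, 'a, 'm) scat_scheme \<Rightarrow> 'u sset \<Rightarrow> 'o \<Rightarrow> 'o \<Rightarrow> (nat \<Rightarrow> 'u \<Rightarrow> 'a) \<Rightarrow> bool" where
  "cotensor K U A C u \<longleftrightarrow> A \<in> Obj K \<and> cotensor_cone K U A C u \<and>
    (\<forall>X\<in>Obj K. simplicial_iso (Fun K X C) (sexp U (Fun K X A))
      (\<lambda>n. \<lambda>h\<in>simplices (Fun K X C) n.
        (\<lambda>m. \<lambda>(\<beta>, x)\<in>Delta m n \<times> simplices U m.
          Cmp K X C A m (u m x) (act (Fun K X C) m n \<beta> h))))"

text \<open>
  \<open>c\<close> is the map \<open>p\<^sup>U\<close> from \<open>C = E\<^sup>U\<close> to \<open>D = B\<^sup>U\<close>, where \<open>p\<close> goes from \<open>E\<close> to \<open>B\<close>.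
\<close>

definition cotensor_base_map ::
    "('o, 'a, 'm) scat_scheme \<Rightarrow> 'u sset \<Rightarrow> 'o \<Rightarrow> 'o \<Rightarrow> 'a \<Rightarrow>
      'o \<Rightarrow> (nat \<Rightarrow> 'u \<Rightarrow> 'a) \<Rightarrow> 'o \<Rightarrow> (nat \<Rightarrow> 'u \<Rightarrow> 'a) \<Rightarrow> 'a \<Rightarrow> bool" where
  "cotensor_base_map K U E B p C u D v c \<longleftrightarrow> c \<in> arr K C D \<and>
    (\<forall>n. \<forall>x\<in>simplices U n.
      pre_map K C D B c n (v n x) = post_map K C E B p n (u n x))"

text \<open>
  \<open>c\<close> is the map \<open>A\<^sup>i\<close> from \<open>C = A\<^sup>V\<close> to \<open>D = A\<^sup>U\<close>, where \<open>i\<close> goes from \<open>U\<close> to \<open>V\<close>.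
\<close>

definition cotensor_weight_map ::
    "('o, 'a, 'm) scat_scheme \<Rightarrow> 'u sset \<Rightarrow> (nat \<Rightarrow> 'u \<Rightarrow> 'u) \<Rightarrow> 'o \<Rightarrow>
      'o \<Rightarrow> (nat \<Rightarrow> 'u \<Rightarrow> 'a) \<Rightarrow> 'o \<Rightarrow> (nat \<Rightarrow> 'u \<Rightarrow> 'a) \<Rightarrow> 'a \<Rightarrow> bool" where
  "cotensor_weight_map K U i A C v D u c \<longleftrightarrow> c \<in> arr K C D \<and>
    (\<forall>n. \<forall>x\<in>simplices U n. pre_map K C D A c n (u n x) = v n (i n x))"

text \<open>
  \<open>k\<close> is the induced map from \<open>EV = E\<^sup>V\<close> to the pullback \<open>P\<close> of \<open>E\<^sup>U\<close> and \<open>B\<^sup>V\<close> over \<open>B\<^sup>U\<close>.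
\<close>

definition leibniz_cotensor ::
    "('o, 'a, 'm) scat_scheme \<Rightarrow> 'u sset \<Rightarrow> 'u sset \<Rightarrow> (nat \<Rightarrow> 'u \<Rightarrow> 'u) \<Rightarrow> 'o \<Rightarrow> 'o \<Rightarrow> 'a \<Rightarrow>
      'o \<Rightarrow> 'o \<Rightarrow> 'a \<Rightarrow> bool" where
  "leibniz_cotensor K U V i E B p EV P k \<longleftrightarrow>
    (\<exists>ev EU eu BU bu BV bv pU Bi \<pi>.
      cotensor K V E EV ev \<and> cotensor K U E EU eu \<and>
      cotensor K V B BV bv \<and> cotensor K U B BU bu \<and>
      cotensor_base_map K U E B p EU eu BU bu pU \<and>
      cotensor_weight_map K U i B BV bv BU bu Bi \<and>
      limit_cone K (cospan EU pU BU Bi BV) P \<pi> \<and>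
      k \<in> arr K EV P \<and>
      cotensor_weight_map K U i E EV ev EU eu (cmp0 K EV P EU (\<pi> CLeft) k) \<and>
      cotensor_base_map K V E B p EV ev BV bv (cmp0 K EV P BV (\<pi> CRight) k))"


section \<open>Infinity-cosmoi\<close>

text \<open>
  Smallness is relative to a regular uncountable cardinal \<open>\<kappa>\<close>: a set is small if it has fewer
  than \<open>\<kappa>\<close> elements. An inaccessible \<open>\<kappa>\<close> gives the sets of a Grothendieck universe; that \<open>\<kappa>\<close> is a
  strong limit is not assumed. Small sets are, up to bijection, sets of elements of the type \<open>'u\<close>
  that carries \<open>\<kappa>\<close>.
\<close>

definition universe_cardinal :: "'u rel \<Rightarrow> bool" where
  "universe_cardinal \<kappa> \<longleftrightarrow> Card_order \<kappa> \<and> natLeq <o \<kappa> \<and> regularCard \<kappa>"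

definition small_sset :: "'u rel \<Rightarrow> 'a sset \<Rightarrow> bool" where
  "small_sset \<kappa> X \<longleftrightarrow> simplicial_set X \<and> (\<forall>n. |simplices X n| <o \<kappa>)"

record ('o, 'a) cosmos = "('o, 'a) scat" +
  Isofib :: "'o \<Rightarrow> 'o \<Rightarrow> 'a set"

locale infinity_cosmos = simplicial_category K
  for K :: "('o, 'a) cosmos" +
  fixes \<kappa> :: "'u rel"
  assumes universe: "universe_cardinal \<kappa>"
    and Fun_small:
      "\<lbrakk>A \<in> Obj K; B \<in> Obj K\<rbrakk> \<Longrightarrow> small_sset \<kappa> (Fun K A B)"
    and Fun_quasi_category:
      "\<lbrakk>A \<in> Obj K; B \<in> Obj K\<rbrakk> \<Longrightarrow> quasi_category (Fun K A B)"
    and Isofib_arr: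
      "p \<in> Isofib K A B \<Longrightarrow> A \<in> Obj K \<and> B \<in> Obj K \<and> p \<in> arr K A B"
    and Isofib_comp:
      "\<lbrakk>p \<in> Isofib K A B; q \<in> Isofib K B C\<rbrakk> \<Longrightarrow> cmp0 K A B C q p \<in> Isofib K A C"
    \<comment> \<open>completeness\<close>
    and terminal_ex:
      "\<exists>T. terminal K T"
    and product_ex:
      "\<lbrakk>|I :: 'u set| <o \<kappa>; \<forall>i\<in>I. As i \<in> Obj K\<rbrakk> \<Longrightarrow> \<exists>P \<pi>. limit_cone K (product_diagram I As) P \<pi>"
    and cotensor_ex:
      "\<lbrakk>A \<in> Obj K; small_sset \<kappa> (U :: 'u sset)\<rbrakk> \<Longrightarrow> \<exists>C u. cotensor K U A C u"
    and sequence_limit_ex: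
      "\<forall>n. r n \<in> Isofib K (Y (Suc n)) (Y n) \<Longrightarrow> \<exists>L \<pi>. limit_cone K (sequence_diagram Y r) L \<pi>"
    and pullback_ex:
      "\<lbrakk>A \<in> Obj K; f \<in> arr K A B; q \<in> Isofib K F B\<rbrakk> \<Longrightarrow> \<exists>P \<pi>. limit_cone K (cospan A f B q F) P \<pi>"
    \<comment> \<open>isofibrations\<close>
    and isomorphism_Isofib:
      "isomorphism K A B f \<Longrightarrow> f \<in> Isofib K A B"
    and terminal_Isofib:
      "\<lbrakk>terminal K T; A \<in> Obj K; f \<in> arr K A T\<rbrakk> \<Longrightarrow> f \<in> Isofib K A T"
    and pullback_Isofib:
      "\<lbrakk>A \<in> Obj K; f \<in> arr K A B; q \<in> Isofib K F B; limit_cone K (cospan A f B q F) P \<tau>\<rbrakk>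
        \<Longrightarrow> \<tau> CLeft \<in> Isofib K P A"
    and product_Isofib:
      "\<lbrakk>|I :: 'u set| <o \<kappa>; \<forall>j\<in>I. ps j \<in> Isofib K (Es j) (Bs j);
        limit_cone K (product_diagram I Es) P \<pi>; limit_cone K (product_diagram I Bs) Q \<rho>;
        k \<in> arr K P Q;
        \<forall>j\<in>I. cmp0 K P Q (Bs j) (\<rho> j) k = cmp0 K P (Es j) (Bs j) (ps j) (\<pi> j)\<rbrakk>
        \<Longrightarrow> k \<in> Isofib K P Q"
    and sequence_limit_Isofib:
      "\<lbrakk>\<forall>n. r n \<in> Isofib K (Y (Suc n)) (Y n); limit_cone K (sequence_diagram Y r) L \<sigma>\<rbrakk>
        \<Longrightarrow> \<sigma> 0 \<in> Isofib K L (Y 0)"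
    and leibniz_Isofib:
      "\<lbrakk>small_sset \<kappa> (U :: 'u sset); small_sset \<kappa> V; i \<in> smap U V;
        \<forall>n. inj_on (i n) (simplices U n); p \<in> Isofib K E B;
        leibniz_cotensor K U V i E B p EV P k\<rbrakk>
        \<Longrightarrow> k \<in> Isofib K EV P"
    and Fun_Isofib:
      "\<lbrakk>X \<in> Obj K; p \<in> Isofib K E B\<rbrakk>
        \<Longrightarrow> qcat_isofibration (Fun K X E) (Fun K X B) (post_map K X E B p)"

definition trivial_fibration :: "('o, 'a) cosmos \<Rightarrow> 'o \<Rightarrow> 'o \<Rightarrow> 'a \<Rightarrow> bool" where
  "trivial_fibration K A B f \<longleftrightarrow> equivalence K A B f \<and> f \<in> Isofib K A B"


section \<open>The infinity-cosmos of isofibrations\<close>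

text \<open>
  \<open>k\<close> is the map from \<open>E\<close> to a pullback \<open>P\<close> of \<open>f\<close> and \<open>q\<close> that is induced by a square \<open>(g, f)\<close>
  from \<open>p\<close> to \<open>q\<close>.
\<close>

definition square_gap ::
    "('o, 'a, 'm) scat_scheme \<Rightarrow> 'o \<times> 'o \<times> 'a \<Rightarrow> 'o \<times> 'o \<times> 'a \<Rightarrow> 'a \<times> 'a \<Rightarrow> 'o \<Rightarrow> 'a \<Rightarrow> bool" where
  "square_gap K = (\<lambda>(E, A, p) (F, B, q) (g, f) P k.
    (\<exists>\<pi>. limit_cone K (cospan A f B q F) P \<pi> \<and> k \<in> arr K E P \<and>
      cmp0 K E P A (\<pi> CLeft) k = p \<and> cmp0 K E P F (\<pi> CRight) k = g))"

text \<open>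
  An object \<open>(E, A, p)\<close> is an isofibration \<open>p\<close> from \<open>E\<close> to \<open>A\<close>. The simplices of the function
  complexes are pairs \<open>(g, f)\<close> with the component \<open>g\<close> on domains first.
\<close>

definition arrow_Fun ::
    "('o, 'a, 'm) scat_scheme \<Rightarrow> 'o \<times> 'o \<times> 'a \<Rightarrow> 'o \<times> 'o \<times> 'a \<Rightarrow> ('a \<times> 'a) sset" where
  "arrow_Fun K = (\<lambda>(E, A, p) (F, B, q).
    spullback (Fun K E F) (Fun K A B) (post_map K E F B q) (pre_map K E A B p))"

definition arrow_cosmos :: "('o, 'a) cosmos \<Rightarrow> ('o \<times> 'o \<times> 'a, 'a \<times> 'a) cosmos" where
  "arrow_cosmos K =
    \<lparr>Obj = {(E, A, p). p \<in> Isofib K E A},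
     Fun = arrow_Fun K,
     Cmp = (\<lambda>(E, A, p) (F, B, q) (G, C, r) n (g', f') (g, f).
       (Cmp K E F G n g' g, Cmp K A B C n f' f)),
     Unit = (\<lambda>(E, A, p). (Unit K E, Unit K A)),
     Isofib = (\<lambda>(E, A, p) (F, B, q). {(g, f).
       p \<in> Isofib K E A \<and> q \<in> Isofib K F B \<and>
       (g, f) \<in> simplices (arrow_Fun K (E, A, p) (F, B, q)) 0 \<and>
       f \<in> Isofib K A B \<and>
       (\<exists>P k. square_gap K (E, A, p) (F, B, q) (g, f) P k \<and> k \<in> Isofib K E P)})\<rparr>"

definition dom_functor ::
    "('o, 'a) cosmos \<Rightarrow> ('o \<times> 'o \<times> 'a, 'o, 'a \<times> 'a, 'a) sfunctor" where
  "dom_functor K = \<lparr>FOb = (\<lambda>(E, A, p). E),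
    FAr = (\<lambda>x y n. \<lambda>(g, f)\<in>simplices (arrow_Fun K x y) n. g)\<rparr>"

definition cod_functor ::
    "('o, 'a) cosmos \<Rightarrow> ('o \<times> 'o \<times> 'a, 'o, 'a \<times> 'a, 'a) sfunctor" where
  "cod_functor K = \<lparr>FOb = (\<lambda>(E, A, p). A),
    FAr = (\<lambda>x y n. \<lambda>(g, f)\<in>simplices (arrow_Fun K x y) n. f)\<rparr>"


section \<open>Joint creation of limits\<close>

definition map_diagram ::
    "('o, 'p, 'a, 'b) sfunctor \<Rightarrow> ('v, 'o, 'a) diagram \<Rightarrow> ('v, 'p, 'b) diagram" where
  "map_diagram G D = \<lparr>Vert = Vert D, Edge = Edge D, Ob = (\<lambda>v. FOb G (Ob D v)),
    Ar = (\<lambda>v w. FAr G (Ob D v) (Ob D w) 0 (Ar D v w))\<rparr>"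

definition cone_lies_over ::
    "('o, 'p, 'a, 'b) sfunctor \<Rightarrow> ('v, 'o, 'a) diagram \<Rightarrow>
      'o \<Rightarrow> ('v \<Rightarrow> 'a) \<Rightarrow> 'p \<Rightarrow> ('v \<Rightarrow> 'b) \<Rightarrow> bool" where
  "cone_lies_over G D L \<pi> M \<mu> \<longleftrightarrow> FOb G L = M \<and>
    (\<forall>v\<in>Vert D. FAr G L (Ob D v) 0 (\<pi> v) = \<mu> v)"

text \<open>
  The pair of functors \<open>G\<close> and \<open>H\<close> strictly creates the limit of \<open>D\<close>: over any limit cones of the
  two image diagrams there is exactly one cone over \<open>D\<close>, and this cone is a limit cone.
\<close>

definition jointly_create_limit ::
    "('o, 'a, 'm) scat_scheme \<Rightarrow> ('p, 'b, 'n) scat_scheme \<Rightarrow>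
      ('o, 'p, 'a, 'b) sfunctor \<Rightarrow> ('o, 'p, 'a, 'b) sfunctor \<Rightarrow> ('v, 'o, 'a) diagram \<Rightarrow> bool" where
  "jointly_create_limit K L G H D \<longleftrightarrow>
    (\<forall>M \<mu> N \<nu>. limit_cone L (map_diagram G D) M \<mu> \<and> limit_cone L (map_diagram H D) N \<nu> \<longrightarrow>
      (\<exists>!(C, \<pi>). cone K D C \<pi> \<and> cone_lies_over G D C \<pi> M \<mu> \<and> cone_lies_over H D C \<pi> N \<nu>) \<and>
      (\<forall>C \<pi>. cone K D C \<pi> \<and> cone_lies_over G D C \<pi> M \<mu> \<and> cone_lies_over H D C \<pi> N \<nu>
        \<longrightarrow> limit_cone K D C \<pi>))"

definition cotensor_cone_lies_over ::
    "('o, 'p, 'a, 'b) sfunctor \<Rightarrow> 'u sset \<Rightarrow> 'o \<Rightarrow>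
      'o \<Rightarrow> (nat \<Rightarrow> 'u \<Rightarrow> 'a) \<Rightarrow> 'p \<Rightarrow> (nat \<Rightarrow> 'u \<Rightarrow> 'b) \<Rightarrow> bool" where
  "cotensor_cone_lies_over G U A C u M \<mu> \<longleftrightarrow> FOb G C = M \<and>
    (\<forall>n. \<forall>x\<in>simplices U n. FAr G C A n (u n x) = \<mu> n x)"

definition jointly_create_cotensor ::
    "('o, 'a, 'm) scat_scheme \<Rightarrow> ('p, 'b, 'n) scat_scheme \<Rightarrow>
      ('o, 'p, 'a, 'b) sfunctor \<Rightarrow> ('o, 'p, 'a, 'b) sfunctor \<Rightarrow> 'u sset \<Rightarrow> 'o \<Rightarrow> bool" where
  "jointly_create_cotensor K L G H U A \<longleftrightarrow>
    (\<forall>M \<mu> N \<nu>. cotensor L U (FOb G A) M \<mu> \<and> cotensor L U (FOb H A) N \<nu> \<longrightarrow>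
      (\<exists>!(C, u). cotensor_cone K U A C u \<and>
        cotensor_cone_lies_over G U A C u M \<mu> \<and> cotensor_cone_lies_over H U A C u N \<nu>) \<and>
      (\<forall>C u. cotensor_cone K U A C u \<and>
        cotensor_cone_lies_over G U A C u M \<mu> \<and> cotensor_cone_lies_over H U A C u N \<nu>
        \<longrightarrow> cotensor K U A C u))"

end

theory Submission
  imports Defs
begin

text \<open>
  Over limits of the domains and of the codomains of a diagram of isofibrations there is exactly one
  compatible map between them, so limits are created objectwise as soon as this map is an
  isofibration. This and the closure properties of isofibrations are statements about gap maps, the
  maps from \<open>E\<close> to the pullback of \<open>f\<close> and \<open>q\<close>: the gap map of a limit or Leibniz cotensor of squares is
  an isofibration because it is the limit or Leibniz cotensor of the gap maps, up to pullback.

  For the equivalences, lifting paths along the Leibniz cotensor with the inclusion of the endpoints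
  of the interval \<open>J\<close> makes homotopy (along \<open>J\<close>) an equivalence relation on 0-arrows, so that
  equivalences are homotopy equivalences in every infinity-cosmos. Hence an equivalence of squares has
  equivalences as components. Conversely, factor a square \<open>m\<close> whose components are equivalences as an
  equivalence followed by an isofibration \<open>r\<close>. The components of \<open>r\<close> are trivial fibrations, and so is
  its gap map since trivial fibrations are stable under pullback. Choosing sections gives a section
  of \<open>r\<close>, hence a right homotopy inverse of \<open>m\<close>. The components of this inverse are again equivalences,
  so it has a right homotopy inverse as well, and \<open>m\<close> is an equivalence.
\<close>

section \<open>Simplicial sets\<close>

text \<open>Homotopy inverses chosen separately for the components of a square need not commute with
  the isofibrations, and neither need the homotopies. Therefore the choices behind an inverse of a
  square are made strictly, as sections of trivial fibrations: a section over the codomains extends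
  to the domains through a section of the gap map. The factorization that makes this possible takes
  place among squares, so the arrow cosmos has to be established first; the homotopy theory of an
  arbitrary infinity-cosmos is then applied both to \<open>K\<close> and to
  \<open>arrow_cosmos K\<close>.

  Homotopies in \<open>qcat_equivalence\<close> are single paths along \<open>iso_nerve\<close>, and
  composability of paths is not part of that definition. Weights have their simplices in the type
  \<open>'u\<close>, so the finite levels of \<open>iso_nerve\<close> are copied into that infinite
  type before a path object can be formed.

  The closure axioms quantify over all limit cones, not over chosen ones. Each limit in the arrow
  cosmos is thus compared with the one built objectwise before its projections are known to be limit
  cones in \<open>K\<close>.\<close>

lemma Delta_id [simp]: "(\<lambda>i\<in>{..n}. i) \<in> Delta n n"
  by (auto simp: Delta_def mono_on_def)

lemma Delta_const: "k \<le> n \<Longrightarrow> (\<lambda>i\<in>{..m}. k) \<in> Delta m n"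
  by (auto simp: Delta_def mono_on_def)

lemma Delta_const0 [simp]: "(\<lambda>i\<in>{..m}. 0) \<in> Delta m n"
  by (rule Delta_const) simp

lemma Delta_compose [simp]:
  assumes "\<alpha> \<in> Delta l m" "\<beta> \<in> Delta m n"
  shows "compose {..l} \<beta> \<alpha> \<in> Delta l n"
proof -
  have a: "\<alpha> \<in> {..l} \<rightarrow> {..m}" "\<beta> \<in> {..m} \<rightarrow> {..n}" "mono_on {..l} \<alpha>" "mono_on {..m} \<beta>"
    using assms by (auto simp: Delta_def)
  have "mono_on {..l} (compose {..l} \<beta> \<alpha>)"
    unfolding mono_on_def
  proof (intro allI impI)
    fix r s assume "r \<in> {..l} \<and> s \<in> {..l} \<and> r \<le> s"
    then show "compose {..l} \<beta> \<alpha> r \<le> compose {..l} \<beta> \<alpha> s"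
      using a by (auto simp: compose_eq Pi_iff mono_on_def)
  qed
  then show ?thesis
    using funcset_compose[OF a(1,2)] by (simp add: Delta_def PiE_def)
qed

lemma Delta_funcset: "\<alpha> \<in> Delta m n \<Longrightarrow> \<alpha> \<in> {..m} \<rightarrow> {..n}"
  by (auto simp: Delta_def)

lemma Delta_zero: "\<alpha> \<in> Delta m 0 \<Longrightarrow> \<alpha> = (\<lambda>i\<in>{..m}. 0)"
  by (auto simp: Delta_def PiE_def extensional_def Pi_iff restrict_def fun_eq_iff)

lemma Delta_compose_id: "\<alpha> \<in> Delta m n \<Longrightarrow> compose {..m} \<alpha> (\<lambda>i\<in>{..m}. i) = \<alpha>"
  by (rule compose_Id) (auto simp: Delta_def PiE_def)

lemma Delta_compose_assoc:
  "\<alpha> \<in> Delta k l \<Longrightarrow> compose {..k} \<gamma> (compose {..k} \<beta> \<alpha>) = compose {..k} (compose {..l} \<gamma> \<beta>) \<alpha>"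
  by (rule compose_assoc) (rule Delta_funcset)

section \<open>Maps of simplicial sets\<close>

lemma smapI:
  assumes "\<And>n x. x \<in> simplices X n \<Longrightarrow> f n x \<in> simplices Y n"
    and "\<And>n x. x \<notin> simplices X n \<Longrightarrow> f n x = undefined"
    and "\<And>m n \<alpha> x. \<alpha> \<in> Delta m n \<Longrightarrow> x \<in> simplices X n \<Longrightarrow> f m (act X m n \<alpha> x) = act Y m n \<alpha> (f n x)"
  shows "f \<in> smap X Y"
  using assms by (auto simp: smap_def PiE_def extensional_def)

lemma smap_closed: "f \<in> smap X Y \<Longrightarrow> x \<in> simplices X n \<Longrightarrow> f n x \<in> simplices Y n"
  by (auto simp: smap_def)

lemma smap_undefined: "f \<in> smap X Y \<Longrightarrow> x \<notin> simplices X n \<Longrightarrow> f n x = undefined"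
  by (auto simp: smap_def PiE_def extensional_def)

lemma smap_act:
  "f \<in> smap X Y \<Longrightarrow> \<alpha> \<in> Delta m n \<Longrightarrow> x \<in> simplices X n \<Longrightarrow> f m (act X m n \<alpha> x) = act Y m n \<alpha> (f n x)"
  by (auto simp: smap_def)

lemma smap_eqI:
  assumes "f \<in> smap X Y" "g \<in> smap X Z" "\<And>n x. x \<in> simplices X n \<Longrightarrow> f n x = g n x"
  shows "f = g"
proof (intro ext)
  fix n x show "f n x = g n x"
    by (cases "x \<in> simplices X n") (use assms in \<open>auto simp: smap_undefined\<close>)
qed

lemma smap_restrictI:
  assumes "simplicial_set X"
    and "\<And>n x. x \<in> simplices X n \<Longrightarrow> g n x \<in> simplices Y n"
    and "\<And>m n \<alpha> x. \<alpha> \<in> Delta m n \<Longrightarrow> x \<in> simplices X n \<Longrightarrow> g m (act X m n \<alpha> x) = act Y m n \<alpha> (g n x)"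
  shows "(\<lambda>n. \<lambda>x\<in>simplices X n. g n x) \<in> smap X Y"
  using assms by (intro smapI) (auto simp: simplicial_set.act_closed)

lemma smap_comp:
  assumes "simplicial_set X" "f \<in> smap X Y" "g \<in> smap Y Z"
  shows "(\<lambda>n. \<lambda>x\<in>simplices X n. g n (f n x)) \<in> smap X Z"
  by (rule smap_restrictI[OF assms(1)]) (auto simp: smap_closed[OF assms(2)] smap_closed[OF assms(3)]
    smap_act[OF assms(2)] smap_act[OF assms(3)])

text \<open>Simplexwise choices need not commute with the operators; uniqueness forces them to,
  since both sides of the naturality equation satisfy \<open>P\<close> at
  \<open>act X m n \<alpha> x\<close>. This turns simplexwise universal properties into statements
  about maps of simplicial sets.\<close>

lemma smap_ex:
  assumes "simplicial_set X"
    and ex: "\<And>n x. x \<in> simplices X n \<Longrightarrow> \<exists>y. y \<in> simplices Y n \<and> P n x y"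
    and uniq: "\<And>n x y y'. x \<in> simplices X n \<Longrightarrow> y \<in> simplices Y n \<Longrightarrow> y' \<in> simplices Y n \<Longrightarrow>
      P n x y \<Longrightarrow> P n x y' \<Longrightarrow> y = y'"
    and nat: "\<And>m n \<alpha> x y. \<alpha> \<in> Delta m n \<Longrightarrow> x \<in> simplices X n \<Longrightarrow> y \<in> simplices Y n \<Longrightarrow> P n x y \<Longrightarrow>
      act Y m n \<alpha> y \<in> simplices Y m \<and> P m (act X m n \<alpha> x) (act Y m n \<alpha> y)"
  shows "\<exists>f\<in>smap X Y. \<forall>n. \<forall>x\<in>simplices X n. P n x (f n x)"
proof -
  define g where "g n x = (SOME y. y \<in> simplices Y n \<and> P n x y)" for n x
  have g: "g n x \<in> simplices Y n \<and> P n x (g n x)" if "x \<in> simplices X n" for n x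
    unfolding g_def using someI_ex[OF ex[OF that]] .
  have "(\<lambda>n. \<lambda>x\<in>simplices X n. g n x) \<in> smap X Y"
  proof (rule smap_restrictI[OF assms(1)])
    fix m n \<alpha> x assume a: "\<alpha> \<in> Delta m n" "x \<in> simplices X n"
    then have x: "act X m n \<alpha> x \<in> simplices X m"
      by (simp add: simplicial_set.act_closed assms(1))
    show "g m (act X m n \<alpha> x) = act Y m n \<alpha> (g n x)"
      by (rule uniq[OF x]) (use a g[OF x] g[of x n] nat[of \<alpha> m n x "g n x"] in auto)
  qed (simp add: g)
  then show ?thesis
    using g by (intro bexI[where x="\<lambda>n. \<lambda>x\<in>simplices X n. g n x"]) auto
qed

lemma (in simplicial_set) degen_closed: "x \<in> simplices X 0 \<Longrightarrow> degen X n x \<in> simplices X n"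
  by (auto simp: degen_def intro!: act_closed)

lemma (in simplicial_set) act_degen:
  assumes "\<alpha> \<in> Delta m n" "x \<in> simplices X 0"
  shows "act X m n \<alpha> (degen X n x) = degen X m x"
proof -
  have "compose {..m} (\<lambda>i\<in>{..n}. 0::nat) \<alpha> = (\<lambda>i\<in>{..m}. 0)"
    by (rule Delta_zero, rule Delta_compose[OF assms(1)]) simp
  then show ?thesis
    using assms by (simp add: degen_def act_comp)
qed

lemma (in simplicial_set) degen_0: "x \<in> simplices X 0 \<Longrightarrow> degen X 0 x = x"
  using act_id[of x 0] by (simp add: degen_def restrict_def cong: if_cong)

lemma smap_degen: "f \<in> smap X Y \<Longrightarrow> x \<in> simplices X 0 \<Longrightarrow> f n (degen X n x) = degen Y n (f 0 x)"
  by (simp add: degen_def smap_act)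

section \<open>Examples and constructions of simplicial sets\<close>

lemma simplicial_set_std_simplex: "simplicial_set (std_simplex n)"
  by (unfold_locales) (auto simp: std_simplex_def Delta_compose_id Delta_compose_assoc)

lemma simplicial_set_horn: "simplicial_set (horn n k)"
proof
  fix \<alpha> l m x assume "\<alpha> \<in> Delta l m" "x \<in> simplices (horn n k) m"
  then have "\<alpha> \<in> Delta l m" "x \<in> Delta m n" "\<exists>j\<in>{..n} - {k}. j \<notin> x ` {..m}"
    by (auto simp: horn_def)
  then show "act (horn n k) l m \<alpha> x \<in> simplices (horn n k) l"
    using Delta_funcset[of \<alpha> l m] by (fastforce simp: horn_def compose_eq Pi_iff)
qed (auto simp: horn_def Delta_compose_id Delta_compose_assoc)

lemma simplicial_set_iso_nerve: "simplicial_set iso_nerve"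
proof
  fix \<alpha> l m x assume "\<alpha> \<in> Delta l m" "x \<in> simplices iso_nerve m"
  then show "act iso_nerve l m \<alpha> x \<in> simplices iso_nerve l"
    using funcset_compose[of \<alpha> "{..l}" "{..m}" x "{0,1}"] Delta_funcset[of \<alpha> l m]
    by (auto simp: iso_nerve_def PiE_def)
qed (auto simp: iso_nerve_def Delta_compose_assoc PiE_def intro!: compose_Id)

lemma compose_const: "\<alpha> \<in> Delta l m \<Longrightarrow> compose {..l} (\<lambda>i\<in>{..m}. e) \<alpha> = (\<lambda>i\<in>{..l}. e)"
  using Delta_funcset[of \<alpha> l m] by (auto simp: compose_def restrict_def fun_eq_iff)

lemma simplicial_set_iso_endpoint: "simplicial_set (iso_endpoint e)"
  by unfold_locales (auto simp: iso_endpoint_def compose_const)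

lemma simplicial_set_sprod:
  assumes "simplicial_set X" "simplicial_set Y"
  shows "simplicial_set (sprod X Y)"
  by unfold_locales
    (use assms in \<open>auto simp: sprod_def simplicial_set.act_closed simplicial_set.act_id simplicial_set.act_comp\<close>)

lemma simplices_sprod [simp]: "simplices (sprod X Y) n = simplices X n \<times> simplices Y n"
  by (simp add: sprod_def)

lemma act_sprod [simp]: "act (sprod X Y) m n \<alpha> z = (act X m n \<alpha> (fst z), act Y m n \<alpha> (snd z))"
  by (simp add: sprod_def case_prod_beta)

lemma simplices_std_simplex [simp]: "simplices (std_simplex n) m = Delta m n"
  by (simp add: std_simplex_def)

lemma act_std_simplex [simp]: "act (std_simplex n) l m \<alpha> \<beta> = compose {..l} \<beta> \<alpha>"
  by (simp add: std_simplex_def)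

lemma simplices_spullback:
  "z \<in> simplices (spullback X Y f g) n \<longleftrightarrow>
    fst z \<in> simplices X n \<and> snd z \<in> simplices Y n \<and> f n (fst z) = g n (snd z)"
  by (auto simp: spullback_def)

lemma act_spullback: "act (spullback X Y f g) m n \<alpha> z = (act X m n \<alpha> (fst z), act Y m n \<alpha> (snd z))"
  by (simp add: spullback_def case_prod_beta)

lemma simplicial_set_spullback:
  assumes "simplicial_set X" "simplicial_set Y" "f \<in> smap X Z" "g \<in> smap Y Z"
  shows "simplicial_set (spullback X Y f g)"
  by unfold_locales
    (use assms in \<open>auto simp: simplices_spullback act_spullback simplicial_set.act_closed
      simplicial_set.act_id simplicial_set.act_comp smap_act[OF assms(3)] smap_act[OF assms(4)]\<close>)

lemma spullback_smapI:
  assumes "simplicial_set W" "a \<in> smap W X" "b \<in> smap W Y"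
    and "\<And>n w. w \<in> simplices W n \<Longrightarrow> f n (a n w) = g n (b n w)"
  shows "(\<lambda>n. \<lambda>w\<in>simplices W n. (a n w, b n w)) \<in> smap W (spullback X Y f g)"
  by (rule smap_restrictI[OF assms(1)])
    (use assms in \<open>auto simp: simplices_spullback act_spullback smap_act intro: smap_closed\<close>)

lemma spullback_smap_fst:
  assumes "simplicial_set W" "u \<in> smap W (spullback X Y f g)"
  shows "(\<lambda>n. \<lambda>w\<in>simplices W n. fst (u n w)) \<in> smap W X"
  by (rule smap_restrictI[OF assms(1)])
    (use smap_closed[OF assms(2)] in \<open>auto simp: simplices_spullback act_spullback smap_act[OF assms(2)]\<close>)

lemma spullback_smap_snd:
  assumes "simplicial_set W" "u \<in> smap W (spullback X Y f g)"
  shows "(\<lambda>n. \<lambda>w\<in>simplices W n. snd (u n w)) \<in> smap W Y"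
  by (rule smap_restrictI[OF assms(1)])
    (use smap_closed[OF assms(2)] in \<open>auto simp: simplices_spullback act_spullback smap_act[OF assms(2)]\<close>)

section \<open>Simplicially enriched categories\<close>

context simplicial_category
begin

lemma act_closed [simp]:
  "\<lbrakk>A \<in> Obj K; B \<in> Obj K; \<alpha> \<in> Delta m n; x \<in> simplices (Fun K A B) n\<rbrakk>
    \<Longrightarrow> act (Fun K A B) m n \<alpha> x \<in> simplices (Fun K A B) m"
  by (simp add: simplicial_set.act_closed Fun_simplicial_set)

lemma act_id [simp]:
  "\<lbrakk>A \<in> Obj K; B \<in> Obj K; x \<in> simplices (Fun K A B) n\<rbrakk> \<Longrightarrow> act (Fun K A B) n n (\<lambda>i\<in>{..n}. i) x = x"
  by (simp add: simplicial_set.act_id Fun_simplicial_set)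

lemma act_comp [simp]:
  "\<lbrakk>A \<in> Obj K; B \<in> Obj K; \<alpha> \<in> Delta l m; \<beta> \<in> Delta m n; x \<in> simplices (Fun K A B) n\<rbrakk>
    \<Longrightarrow> act (Fun K A B) l m \<alpha> (act (Fun K A B) m n \<beta> x) = act (Fun K A B) l n (compose {..l} \<beta> \<alpha>) x"
  by (simp add: simplicial_set.act_comp Fun_simplicial_set)

lemma degen_closed [simp]:
  "\<lbrakk>A \<in> Obj K; B \<in> Obj K; f \<in> arr K A B\<rbrakk> \<Longrightarrow> degen (Fun K A B) n f \<in> simplices (Fun K A B) n"
  by (simp add: simplicial_set.degen_closed Fun_simplicial_set)

lemma act_degen [simp]:
  "\<lbrakk>A \<in> Obj K; B \<in> Obj K; f \<in> arr K A B; \<alpha> \<in> Delta m n\<rbrakk>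
    \<Longrightarrow> act (Fun K A B) m n \<alpha> (degen (Fun K A B) n f) = degen (Fun K A B) m f"
  by (simp add: simplicial_set.act_degen Fun_simplicial_set)

lemma degen_0 [simp]:
  "\<lbrakk>A \<in> Obj K; B \<in> Obj K; f \<in> arr K A B\<rbrakk> \<Longrightarrow> degen (Fun K A B) 0 f = f"
  by (simp add: simplicial_set.degen_0 Fun_simplicial_set)

declare Cmp_closed [simp] Unit_closed [simp]

lemma degen_Cmp:
  "\<lbrakk>A \<in> Obj K; B \<in> Obj K; C \<in> Obj K; f \<in> arr K A B; g \<in> arr K B C\<rbrakk>
    \<Longrightarrow> degen (Fun K A C) n (cmp0 K A B C g f)
      = Cmp K A B C n (degen (Fun K B C) n g) (degen (Fun K A B) n f)"
  unfolding degen_def by (rule Cmp_act) auto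

section \<open>The maps of function complexes induced by an arrow\<close>

lemma post_map_eq:
  "h \<in> simplices (Fun K X A) n \<Longrightarrow> post_map K X A B f n h = Cmp K X A B n (degen (Fun K A B) n f) h"
  by (simp add: post_map_def)

lemma pre_map_eq:
  "h \<in> simplices (Fun K B X) n \<Longrightarrow> pre_map K A B X f n h = Cmp K A B X n h (degen (Fun K A B) n f)"
  by (simp add: pre_map_def)

lemma post_closed [simp]:
  "\<lbrakk>X \<in> Obj K; A \<in> Obj K; B \<in> Obj K; f \<in> arr K A B; h \<in> simplices (Fun K X A) n\<rbrakk>
    \<Longrightarrow> post_map K X A B f n h \<in> simplices (Fun K X B) n"
  by (simp add: post_map_eq)

lemma pre_closed [simp]:
  "\<lbrakk>X \<in> Obj K; A \<in> Obj K; B \<in> Obj K; f \<in> arr K A B; h \<in> simplices (Fun K B X) n\<rbrakk>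
    \<Longrightarrow> pre_map K A B X f n h \<in> simplices (Fun K A X) n"
  by (simp add: pre_map_eq)

lemma post_act [simp]:
  "\<lbrakk>X \<in> Obj K; A \<in> Obj K; B \<in> Obj K; f \<in> arr K A B; h \<in> simplices (Fun K X A) n; \<alpha> \<in> Delta m n\<rbrakk>
    \<Longrightarrow> post_map K X A B f m (act (Fun K X A) m n \<alpha> h) = act (Fun K X B) m n \<alpha> (post_map K X A B f n h)"
  by (simp add: post_map_eq Cmp_act)

lemma pre_act [simp]:
  "\<lbrakk>X \<in> Obj K; A \<in> Obj K; B \<in> Obj K; f \<in> arr K A B; h \<in> simplices (Fun K B X) n; \<alpha> \<in> Delta m n\<rbrakk>
    \<Longrightarrow> pre_map K A B X f m (act (Fun K B X) m n \<alpha> h) = act (Fun K A X) m n \<alpha> (pre_map K A B X f n h)"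
  by (simp add: pre_map_eq Cmp_act)

lemma post_smap [simp]:
  "\<lbrakk>X \<in> Obj K; A \<in> Obj K; B \<in> Obj K; f \<in> arr K A B\<rbrakk> \<Longrightarrow> post_map K X A B f \<in> smap (Fun K X A) (Fun K X B)"
  by (rule smapI) (simp_all, simp add: post_map_def)

lemma pre_smap [simp]:
  "\<lbrakk>X \<in> Obj K; A \<in> Obj K; B \<in> Obj K; f \<in> arr K A B\<rbrakk> \<Longrightarrow> pre_map K A B X f \<in> smap (Fun K B X) (Fun K A X)"
  by (rule smapI) (simp_all, simp add: pre_map_def)

lemma post_comp [simp]:
  "\<lbrakk>X \<in> Obj K; A \<in> Obj K; B \<in> Obj K; C \<in> Obj K; f \<in> arr K A B; g \<in> arr K B C;
    h \<in> simplices (Fun K X A) n\<rbrakk>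
    \<Longrightarrow> post_map K X A C (cmp0 K A B C g f) n h = post_map K X B C g n (post_map K X A B f n h)"
  by (simp add: post_map_eq degen_Cmp Cmp_assoc)

lemma pre_comp [simp]:
  "\<lbrakk>X \<in> Obj K; A \<in> Obj K; B \<in> Obj K; C \<in> Obj K; f \<in> arr K A B; g \<in> arr K B C;
    h \<in> simplices (Fun K C X) n\<rbrakk>
    \<Longrightarrow> pre_map K A C X (cmp0 K A B C g f) n h = pre_map K A B X f n (pre_map K B C X g n h)"
  by (simp add: pre_map_eq degen_Cmp Cmp_assoc)

lemma post_unit [simp]:
  "\<lbrakk>X \<in> Obj K; A \<in> Obj K; h \<in> simplices (Fun K X A) n\<rbrakk> \<Longrightarrow> post_map K X A A (Unit K A) n h = h"
  by (simp add: post_map_eq Unit_left)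

lemma pre_unit [simp]:
  "\<lbrakk>X \<in> Obj K; A \<in> Obj K; h \<in> simplices (Fun K A X) n\<rbrakk> \<Longrightarrow> pre_map K A A X (Unit K A) n h = h"
  by (simp add: pre_map_eq Unit_right)

lemma post_Cmp:
  "\<lbrakk>X \<in> Obj K; A \<in> Obj K; B \<in> Obj K; C \<in> Obj K; f \<in> arr K B C;
    a \<in> simplices (Fun K X A) n; b \<in> simplices (Fun K A B) n\<rbrakk>
    \<Longrightarrow> post_map K X B C f n (Cmp K X A B n b a) = Cmp K X A C n (post_map K A B C f n b) a"
  by (simp add: post_map_eq Cmp_assoc)

lemma pre_Cmp:
  "\<lbrakk>X \<in> Obj K; Y \<in> Obj K; A \<in> Obj K; B \<in> Obj K; f \<in> arr K X Y;
    a \<in> simplices (Fun K Y A) n; b \<in> simplices (Fun K A B) n\<rbrakk>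
    \<Longrightarrow> pre_map K X Y B f n (Cmp K Y A B n b a) = Cmp K X A B n b (pre_map K X Y A f n a)"
  by (simp add: pre_map_eq Cmp_assoc)

lemma Cmp_post:
  "\<lbrakk>X \<in> Obj K; Y \<in> Obj K; A \<in> Obj K; B \<in> Obj K; f \<in> arr K Y A;
    h \<in> simplices (Fun K X Y) n; b \<in> simplices (Fun K A B) n\<rbrakk>
    \<Longrightarrow> Cmp K X A B n b (post_map K X Y A f n h) = Cmp K X Y B n (pre_map K Y A B f n b) h"
  by (simp add: post_map_eq pre_map_eq Cmp_assoc)

lemma post_pre:
  "\<lbrakk>X \<in> Obj K; Y \<in> Obj K; A \<in> Obj K; B \<in> Obj K; f \<in> arr K X Y; g \<in> arr K A B;
    h \<in> simplices (Fun K Y A) n\<rbrakk>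
    \<Longrightarrow> post_map K X A B g n (pre_map K X Y A f n h) = pre_map K X Y B f n (post_map K Y A B g n h)"
  by (simp add: post_map_eq pre_map_eq Cmp_assoc)

lemma post_map_0:
  "\<lbrakk>X \<in> Obj K; A \<in> Obj K; B \<in> Obj K; f \<in> arr K A B; h \<in> arr K X A\<rbrakk>
    \<Longrightarrow> post_map K X A B f 0 h = cmp0 K X A B f h"
  by (simp add: post_map_eq)

lemma pre_map_0:
  "\<lbrakk>X \<in> Obj K; A \<in> Obj K; B \<in> Obj K; f \<in> arr K A B; h \<in> arr K B X\<rbrakk>
    \<Longrightarrow> pre_map K A B X f 0 h = cmp0 K A B X h f"
  by (simp add: pre_map_eq)

lemma post_degen:
  "\<lbrakk>X \<in> Obj K; A \<in> Obj K; B \<in> Obj K; f \<in> arr K A B; h \<in> arr K X A\<rbrakk>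
    \<Longrightarrow> post_map K X A B f n (degen (Fun K X A) n h) = degen (Fun K X B) n (cmp0 K X A B f h)"
  by (simp add: post_map_eq degen_Cmp)

lemma pre_degen:
  "\<lbrakk>X \<in> Obj K; A \<in> Obj K; B \<in> Obj K; f \<in> arr K A B; h \<in> arr K B X\<rbrakk>
    \<Longrightarrow> pre_map K A B X f n (degen (Fun K B X) n h) = degen (Fun K A X) n (cmp0 K A B X h f)"
  by (simp add: pre_map_eq degen_Cmp)

lemma cmp_unit_left [simp]: "\<lbrakk>A \<in> Obj K; B \<in> Obj K; f \<in> arr K A B\<rbrakk> \<Longrightarrow> cmp0 K A B B (Unit K B) f = f"
  using Unit_left[of A B f 0] by simp

lemma cmp_unit_right [simp]: "\<lbrakk>A \<in> Obj K; B \<in> Obj K; f \<in> arr K A B\<rbrakk> \<Longrightarrow> cmp0 K A A B f (Unit K A) = f"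
  using Unit_right[of A B f 0] by simp

lemma post_post_eq:
  assumes "cmp0 K P A B f l = cmp0 K P F B q r"
    and "X \<in> Obj K" "P \<in> Obj K" "A \<in> Obj K" "F \<in> Obj K" "B \<in> Obj K"
    and "f \<in> arr K A B" "l \<in> arr K P A" "q \<in> arr K F B" "r \<in> arr K P F"
    and "z \<in> simplices (Fun K X P) n"
  shows "post_map K X A B f n (post_map K X P A l n z) = post_map K X F B q n (post_map K X P F r n z)"
  using assms post_comp[of X P A B l f z n] post_comp[of X P F B r q z n] by simp

lemma isomorphism_inverse:
  assumes "isomorphism K A B f"
  obtains g where "g \<in> arr K B A" "isomorphism K B A g"
    "cmp0 K A B A g f = Unit K A" "cmp0 K B A B f g = Unit K B"
  using assms unfolding isomorphism_def by blast

end

section \<open>Limits in simplicially enriched categories\<close>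

text \<open>A \<open>diagram\<close> record does not force its edges to be arrows between its
  vertices, and \<open>limit_cone\<close> does not ask for it. It is recorded separately, because
  legs can be composed with edges only then.\<close>

definition wf_diagram :: "('o, 'a, 'm) scat_scheme \<Rightarrow> ('v, 'o, 'a) diagram \<Rightarrow> bool" where
  "wf_diagram K D \<longleftrightarrow> (\<forall>v\<in>Vert D. Ob D v \<in> Obj K) \<and>
    (\<forall>(v, w)\<in>Edge D. v \<in> Vert D \<and> w \<in> Vert D \<and> Ar D v w \<in> arr K (Ob D v) (Ob D w))"

lemma wf_diagramD:
  assumes "wf_diagram K D"
  shows "v \<in> Vert D \<Longrightarrow> Ob D v \<in> Obj K"
    and "(v, w) \<in> Edge D \<Longrightarrow> v \<in> Vert D"
    and "(v, w) \<in> Edge D \<Longrightarrow> w \<in> Vert D"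
    and "(v, w) \<in> Edge D \<Longrightarrow> Ar D v w \<in> arr K (Ob D v) (Ob D w)"
  using assms by (auto simp: wf_diagram_def)

text \<open>Enriched pullback squares without the leg to \<open>CBase\<close>, which the other legs
  determine, and symmetric in the two sides of the cospan.\<close>

definition is_pullback ::
    "('o, 'a, 'm) scat_scheme \<Rightarrow> 'o \<Rightarrow> 'o \<Rightarrow> 'o \<Rightarrow> 'o \<Rightarrow> 'a \<Rightarrow> 'a \<Rightarrow> 'a \<Rightarrow> 'a \<Rightarrow> bool" where
  "is_pullback K P A F B l r f q \<longleftrightarrow>
    P \<in> Obj K \<and> A \<in> Obj K \<and> F \<in> Obj K \<and> B \<in> Obj K \<and>
    l \<in> arr K P A \<and> r \<in> arr K P F \<and> f \<in> arr K A B \<and> q \<in> arr K F B \<and>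
    cmp0 K P A B f l = cmp0 K P F B q r \<and>
    (\<forall>X\<in>Obj K. \<forall>n. \<forall>a\<in>simplices (Fun K X A) n. \<forall>y\<in>simplices (Fun K X F) n.
      post_map K X A B f n a = post_map K X F B q n y \<longrightarrow>
      (\<exists>!z. z \<in> simplices (Fun K X P) n \<and> post_map K X P A l n z = a \<and> post_map K X P F r n z = y))"

lemma is_pullbackD:
  assumes "is_pullback K P A F B l r f q"
  shows "P \<in> Obj K" "A \<in> Obj K" "F \<in> Obj K" "B \<in> Obj K"
    "l \<in> arr K P A" "r \<in> arr K P F" "f \<in> arr K A B" "q \<in> arr K F B"
    "cmp0 K P A B f l = cmp0 K P F B q r"
  using assms by (simp_all add: is_pullback_def)

lemma is_pullback_sym: "is_pullback K P A F B l r f q \<Longrightarrow> is_pullback K P F A B r l q f"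
  unfolding is_pullback_def by (metis (no_types, lifting))

lemma is_pullback_ex:
  assumes "is_pullback K P A F B l r f q" "X \<in> Obj K"
    "a \<in> simplices (Fun K X A) n" "y \<in> simplices (Fun K X F) n"
    "post_map K X A B f n a = post_map K X F B q n y"
  obtains z where "z \<in> simplices (Fun K X P) n" "post_map K X P A l n z = a" "post_map K X P F r n z = y"
  using assms unfolding is_pullback_def by metis

context simplicial_category
begin

lemma is_pullback_commutes:
  assumes "is_pullback K P A F B l r f q" "X \<in> Obj K" "z \<in> simplices (Fun K X P) n"
  shows "post_map K X A B f n (post_map K X P A l n z) = post_map K X F B q n (post_map K X P F r n z)"
  using is_pullbackD[OF assms(1)] assms(2,3) by (intro post_post_eq)

lemma is_pullback_eqI:
  assumes pb: "is_pullback K P A F B l r f q" and X: "X \<in> Obj K"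
    and z: "z \<in> simplices (Fun K X P) n" "z' \<in> simplices (Fun K X P) n"
    and eq: "post_map K X P A l n z = post_map K X P A l n z'"
      "post_map K X P F r n z = post_map K X P F r n z'"
  shows "z = z'"
proof -
  note t = is_pullbackD[OF pb]
  have "\<exists>!z. z \<in> simplices (Fun K X P) n \<and> post_map K X P A l n z = post_map K X P A l n z'
      \<and> post_map K X P F r n z = post_map K X P F r n z'"
    using pb is_pullback_commutes[OF pb X z(2)] X z(2) t unfolding is_pullback_def by simp
  then show ?thesis
    using z eq by blast
qed

lemma is_pullbackI:
  assumes "P \<in> Obj K" "A \<in> Obj K" "F \<in> Obj K" "B \<in> Obj K"
    "l \<in> arr K P A" "r \<in> arr K P F" "f \<in> arr K A B" "q \<in> arr K F B"
    "cmp0 K P A B f l = cmp0 K P F B q r"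
    and "\<And>X n z z'. \<lbrakk>X \<in> Obj K; z \<in> simplices (Fun K X P) n; z' \<in> simplices (Fun K X P) n;
      post_map K X P A l n z = post_map K X P A l n z';
      post_map K X P F r n z = post_map K X P F r n z'\<rbrakk> \<Longrightarrow> z = z'"
    and "\<And>X n a y. \<lbrakk>X \<in> Obj K; a \<in> simplices (Fun K X A) n; y \<in> simplices (Fun K X F) n;
      post_map K X A B f n a = post_map K X F B q n y\<rbrakk> \<Longrightarrow>
      \<exists>z\<in>simplices (Fun K X P) n. post_map K X P A l n z = a \<and> post_map K X P F r n z = y"
  shows "is_pullback K P A F B l r f q"
  unfolding is_pullback_def using assms(1-9)
  apply (intro conjI ballI allI impI)
           apply assumption+
  subgoal for X n a y using assms(11)[of X a n y] assms(10)[of X _ n] by metis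
  done

lemma is_pullback_arr_eqI:
  assumes pb: "is_pullback K P A F B l r f q" and X: "X \<in> Obj K"
    and z: "z \<in> arr K X P" "z' \<in> arr K X P"
    and "cmp0 K X P A l z = cmp0 K X P A l z'" "cmp0 K X P F r z = cmp0 K X P F r z'"
  shows "z = z'"
  by (rule is_pullback_eqI[OF pb X z]) (use assms is_pullbackD[OF pb] in \<open>simp_all add: post_map_0\<close>)

lemma is_pullback_arr_ex:
  assumes pb: "is_pullback K P A F B l r f q" and X: "X \<in> Obj K" "a \<in> arr K X A" "y \<in> arr K X F"
    "cmp0 K X A B f a = cmp0 K X F B q y"
  obtains z where "z \<in> arr K X P" "cmp0 K X P A l z = a" "cmp0 K X P F r z = y"
proof -
  note t = is_pullbackD[OF pb]
  show ?thesis
    by (rule is_pullback_ex[OF pb X(1-3)]) (use X t that in \<open>simp_all add: post_map_0\<close>)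
qed

text \<open>The universal property concerns simplices of one dimension at a time; uniqueness makes
  the lifts natural. In this form homotopies into \<open>P\<close>, which are maps from
  \<open>iso_nerve\<close>, can be given by their two components.\<close>

lemma is_pullback_smap_ex:
  assumes pb: "is_pullback K P A F B l r f q" and X: "X \<in> Obj K" and W: "simplicial_set W"
    and a: "a \<in> smap W (Fun K X A)" and y: "y \<in> smap W (Fun K X F)"
    and eq: "\<And>n w. w \<in> simplices W n \<Longrightarrow> post_map K X A B f n (a n w) = post_map K X F B q n (y n w)"
  obtains z where "z \<in> smap W (Fun K X P)"
    "\<And>n w. w \<in> simplices W n \<Longrightarrow> post_map K X P A l n (z n w) = a n w"
    "\<And>n w. w \<in> simplices W n \<Longrightarrow> post_map K X P F r n (z n w) = y n w"
proof -
  note t = is_pullbackD[OF pb]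
  have "\<exists>z\<in>smap W (Fun K X P). \<forall>n. \<forall>w\<in>simplices W n.
      post_map K X P A l n (z n w) = a n w \<and> post_map K X P F r n (z n w) = y n w"
  proof (rule smap_ex[OF W])
    fix n w assume w: "w \<in> simplices W n"
    show "\<exists>z. z \<in> simplices (Fun K X P) n \<and> post_map K X P A l n z = a n w \<and> post_map K X P F r n z = y n w"
      using is_pullback_ex[OF pb X smap_closed[OF a w] smap_closed[OF y w] eq[OF w]] by metis
  next
    fix n w z z'
    assume "z \<in> simplices (Fun K X P) n" "z' \<in> simplices (Fun K X P) n"
      "post_map K X P A l n z = a n w \<and> post_map K X P F r n z = y n w"
      "post_map K X P A l n z' = a n w \<and> post_map K X P F r n z' = y n w"
    then show "z = z'" using is_pullback_eqI[OF pb X] by metis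
  qed (use X t in \<open>auto simp: smap_act[OF a] smap_act[OF y]\<close>)
  then show ?thesis using that by auto
qed

text \<open>Serves for Leibniz cotensors in which a corner of the cospan collapses to the terminal
  object.\<close>

lemma is_pullback_Unit:
  assumes "D \<in> Obj K" "T \<in> Obj K" "t \<in> arr K D T"
  shows "is_pullback K D T D T t (Unit K D) (Unit K T) t"
  by (rule is_pullbackI) (use assms in auto)

text \<open>Choosing \<open>F\<close> itself as the pullback along an isomorphism makes the gap map
  of an isomorphism of squares equal to its domain component.\<close>

lemma is_pullback_iso:
  assumes "isomorphism K A B f" "F \<in> Obj K" "q \<in> arr K F B" "g \<in> arr K B A"
    and "cmp0 K A B A g f = Unit K A" "cmp0 K B A B f g = Unit K B"
  shows "is_pullback K F A F B (cmp0 K F B A g q) (Unit K F) f q"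
proof -
  have t: "A \<in> Obj K" "B \<in> Obj K" "f \<in> arr K A B"
    using assms(1) by (auto simp: isomorphism_def)
  show ?thesis
  proof (rule is_pullbackI)
    show "cmp0 K F A B f (cmp0 K F B A g q) = cmp0 K F F B q (Unit K F)"
      using assms t Cmp_assoc[of F B A B q 0 g f] by simp
  next
    fix X n a y assume a: "X \<in> Obj K" "a \<in> simplices (Fun K X A) n" "y \<in> simplices (Fun K X F) n"
      "post_map K X A B f n a = post_map K X F B q n y"
    have "post_map K X A A (cmp0 K A B A g f) n a = post_map K X B A g n (post_map K X A B f n a)"
      using a t assms by (intro post_comp) auto
    then have "post_map K X B A g n (post_map K X F B q n y) = a"
      using a t assms by simp
    then show "\<exists>z\<in>simplices (Fun K X F) n.
        post_map K X F A (cmp0 K F B A g q) n z = a \<and> post_map K X F F (Unit K F) n z = y"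
      using a t assms by auto
  qed (use assms t in auto)
qed

section \<open>Limit cones of general diagrams\<close>

lemma limit_cone_wfD:
  assumes "wf_diagram K D" "limit_cone K D L \<pi>"
  shows "L \<in> Obj K" "v \<in> Vert D \<Longrightarrow> \<pi> v \<in> arr K L (Ob D v)"
    "(v, w) \<in> Edge D \<Longrightarrow> cmp0 K L (Ob D v) (Ob D w) (Ar D v w) (\<pi> v) = \<pi> w"
    "v \<notin> Vert D \<Longrightarrow> \<pi> v = undefined"
  using assms(2) by (auto simp: limit_cone_def cone_def PiE_def extensional_def)

lemma limit_cone_eqI:
  assumes "wf_diagram K D" "limit_cone K D L \<pi>" "X \<in> Obj K"
    and "z \<in> simplices (Fun K X L) n" "z' \<in> simplices (Fun K X L) n"
    and "\<And>v. v \<in> Vert D \<Longrightarrow> post_map K X L (Ob D v) (\<pi> v) n z = post_map K X L (Ob D v) (\<pi> v) n z'"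
  shows "z = z'"
proof -
  have "inj_on (\<lambda>h. \<lambda>v\<in>Vert D. post_map K X L (Ob D v) (\<pi> v) n h) (simplices (Fun K X L) n)"
    using assms(2,3) by (auto simp: limit_cone_def bij_betw_def)
  moreover have "(\<lambda>v\<in>Vert D. post_map K X L (Ob D v) (\<pi> v) n z) = (\<lambda>v\<in>Vert D. post_map K X L (Ob D v) (\<pi> v) n z')"
    using assms(6) by (auto simp: restrict_def)
  ultimately show ?thesis
    using assms(4,5) unfolding inj_on_def by blast
qed

lemma limit_cone_ex:
  assumes "limit_cone K D L \<pi>" "X \<in> Obj K"
    and "\<And>v. v \<in> Vert D \<Longrightarrow> x v \<in> simplices (Fun K X (Ob D v)) n"
    and "\<And>v w. (v, w) \<in> Edge D \<Longrightarrow> v \<in> Vert D \<and> w \<in> Vert D"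
    and "\<And>v w. (v, w) \<in> Edge D \<Longrightarrow> post_map K X (Ob D v) (Ob D w) (Ar D v w) n (x v) = x w"
  obtains z where "z \<in> simplices (Fun K X L) n" "\<And>v. v \<in> Vert D \<Longrightarrow> post_map K X L (Ob D v) (\<pi> v) n z = x v"
proof -
  have "restrict x (Vert D) \<in> compatible_families K D X n"
    using assms(3-5) by (auto simp: compatible_families_def)
  moreover have "bij_betw (\<lambda>h. \<lambda>v\<in>Vert D. post_map K X L (Ob D v) (\<pi> v) n h)
      (simplices (Fun K X L) n) (compatible_families K D X n)"
    using assms(1,2) by (auto simp: limit_cone_def)
  ultimately obtain z where z: "z \<in> simplices (Fun K X L) n"
      "restrict x (Vert D) = (\<lambda>v\<in>Vert D. post_map K X L (Ob D v) (\<pi> v) n z)"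
    unfolding bij_betw_def by blast
  have "post_map K X L (Ob D v) (\<pi> v) n z = x v" if "v \<in> Vert D" for v
    using fun_cong[OF z(2), of v] that by simp
  then show ?thesis using that z(1) by blast
qed

lemma limit_coneI:
  assumes wf: "wf_diagram K D" and L: "L \<in> Obj K"
    and \<pi>: "\<And>v. v \<in> Vert D \<Longrightarrow> \<pi> v \<in> arr K L (Ob D v)" "\<And>v. v \<notin> Vert D \<Longrightarrow> \<pi> v = undefined"
    and edge: "\<And>v w. (v, w) \<in> Edge D \<Longrightarrow> cmp0 K L (Ob D v) (Ob D w) (Ar D v w) (\<pi> v) = \<pi> w"
    and eqI: "\<And>X n z z'. \<lbrakk>X \<in> Obj K; z \<in> simplices (Fun K X L) n; z' \<in> simplices (Fun K X L) n;
      \<And>v. v \<in> Vert D \<Longrightarrow> post_map K X L (Ob D v) (\<pi> v) n z = post_map K X L (Ob D v) (\<pi> v) n z'\<rbrakk>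
      \<Longrightarrow> z = z'"
    and ex: "\<And>X n x. \<lbrakk>X \<in> Obj K; \<And>v. v \<in> Vert D \<Longrightarrow> x v \<in> simplices (Fun K X (Ob D v)) n;
      \<And>v w. (v, w) \<in> Edge D \<Longrightarrow> post_map K X (Ob D v) (Ob D w) (Ar D v w) n (x v) = x w\<rbrakk>
      \<Longrightarrow> \<exists>z\<in>simplices (Fun K X L) n. \<forall>v\<in>Vert D. post_map K X L (Ob D v) (\<pi> v) n z = x v"
  shows "limit_cone K D L \<pi>"
  unfolding limit_cone_def
proof (intro conjI ballI allI)
  show "cone K D L \<pi>"
    using L \<pi> edge by (auto simp: cone_def)
  fix X n assume X: "X \<in> Obj K"
  let ?f = "\<lambda>h. \<lambda>v\<in>Vert D. post_map K X L (Ob D v) (\<pi> v) n h"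
  show "bij_betw ?f (simplices (Fun K X L) n) (compatible_families K D X n)"
    unfolding bij_betw_def
  proof (intro conjI set_eqI iffI)
    show "inj_on ?f (simplices (Fun K X L) n)"
    proof (rule inj_onI)
      fix z z' assume z: "z \<in> simplices (Fun K X L) n" "z' \<in> simplices (Fun K X L) n" "?f z = ?f z'"
      show "z = z'"
      proof (rule eqI[OF X z(1,2)])
        fix v assume "v \<in> Vert D"
        then show "post_map K X L (Ob D v) (\<pi> v) n z = post_map K X L (Ob D v) (\<pi> v) n z'"
          using fun_cong[OF z(3), of v] by simp
      qed
    qed
  next
    fix x assume "x \<in> ?f ` simplices (Fun K X L) n"
    then obtain z where z: "z \<in> simplices (Fun K X L) n" "x = ?f z" by blast
    have "post_map K X (Ob D v) (Ob D w) (Ar D v w) n (x v) = x w" if e: "(v, w) \<in> Edge D" for v w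
    proof -
      note t = wf_diagramD(2-4)[OF wf e] wf_diagramD(1)[OF wf]
      have "post_map K X L (Ob D w) (\<pi> w) n z
          = post_map K X (Ob D v) (Ob D w) (Ar D v w) n (post_map K X L (Ob D v) (\<pi> v) n z)"
        using t \<pi> L X z(1) edge[OF e] post_comp[of X L "Ob D v" "Ob D w" "\<pi> v" "Ar D v w" z n] by simp
      then show ?thesis using t z(2) by simp
    qed
    then show "x \<in> compatible_families K D X n"
      using z L X \<pi> wf_diagramD(1)[OF wf] by (auto simp: compatible_families_def)
  next
    fix x assume x: "x \<in> compatible_families K D X n"
    then obtain z where z: "z \<in> simplices (Fun K X L) n" "\<forall>v\<in>Vert D. post_map K X L (Ob D v) (\<pi> v) n z = x v"
    proof -
      have "x v \<in> simplices (Fun K X (Ob D v)) n" if "v \<in> Vert D" for v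
        using x that by (auto simp: compatible_families_def)
      moreover have "post_map K X (Ob D v) (Ob D w) (Ar D v w) n (x v) = x w" if "(v, w) \<in> Edge D" for v w
        using x that by (auto simp: compatible_families_def)
      ultimately show ?thesis using ex[OF X, of x n] that by blast
    qed
    have "x = ?f z"
      using z x by (auto simp: compatible_families_def PiE_def extensional_def fun_eq_iff)
    then show "x \<in> ?f ` simplices (Fun K X L) n"
      using z(1) by blast
  qed
qed

section \<open>Pullbacks as limits of cospans\<close>

lemma wf_cospan:
  "\<lbrakk>A \<in> Obj K; F \<in> Obj K; B \<in> Obj K; f \<in> arr K A B; q \<in> arr K F B\<rbrakk> \<Longrightarrow> wf_diagram K (cospan A f B q F)"
  by (auto simp: wf_diagram_def cospan_def split: cospan_vertex.split)

lemma cospan_simps [simp]: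
  "Vert (cospan A f B q F) = UNIV" "Edge (cospan A f B q F) = {(CLeft, CBase), (CRight, CBase)}"
  "Ob (cospan A f B q F) CLeft = A" "Ob (cospan A f B q F) CRight = F" "Ob (cospan A f B q F) CBase = B"
  "Ar (cospan A f B q F) CLeft w = f" "Ar (cospan A f B q F) CRight w = q"
  by (auto simp: cospan_def)

text \<open>The cone conditions make the leg to \<open>CBase\<close> a composite, so that a family
  compatible over the cospan is the same as a pair with equal images in \<open>B\<close>.\<close>

lemma limit_cone_cospan_iff:
  assumes t: "A \<in> Obj K" "F \<in> Obj K" "B \<in> Obj K" "f \<in> arr K A B" "q \<in> arr K F B"
  shows "limit_cone K (cospan A f B q F) P \<pi> \<longleftrightarrow>
    is_pullback K P A F B (\<pi> CLeft) (\<pi> CRight) f q \<and> \<pi> CBase = cmp0 K P A B f (\<pi> CLeft)"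
    (is "limit_cone K ?D P \<pi> \<longleftrightarrow> _")
proof
  assume lim: "limit_cone K ?D P \<pi>"
  note wf = wf_cospan[OF t]
  have P: "P \<in> Obj K" using limit_cone_wfD[OF wf lim] by simp
  have l: "\<pi> CLeft \<in> arr K P A" "\<pi> CRight \<in> arr K P F" "\<pi> CBase \<in> arr K P B"
    using limit_cone_wfD(2)[OF wf lim, of CLeft] limit_cone_wfD(2)[OF wf lim, of CRight]
      limit_cone_wfD(2)[OF wf lim, of CBase] by simp_all
  have e: "cmp0 K P A B f (\<pi> CLeft) = \<pi> CBase" "cmp0 K P F B q (\<pi> CRight) = \<pi> CBase"
    using limit_cone_wfD(3)[OF wf lim, of CLeft CBase] limit_cone_wfD(3)[OF wf lim, of CRight CBase]
    by simp_all
  have "is_pullback K P A F B (\<pi> CLeft) (\<pi> CRight) f q"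
  proof (rule is_pullbackI)
    fix X n z z' assume z: "X \<in> Obj K" "z \<in> simplices (Fun K X P) n" "z' \<in> simplices (Fun K X P) n"
      "post_map K X P A (\<pi> CLeft) n z = post_map K X P A (\<pi> CLeft) n z'"
      "post_map K X P F (\<pi> CRight) n z = post_map K X P F (\<pi> CRight) n z'"
    show "z = z'"
    proof (rule limit_cone_eqI[OF wf lim z(1-3)])
      fix v
      have b: "post_map K X P B (\<pi> CBase) n w = post_map K X A B f n (post_map K X P A (\<pi> CLeft) n w)"
        if "w \<in> simplices (Fun K X P) n" for w
        using that P t l z(1) post_comp[of X P A B "\<pi> CLeft" f w n] e by simp
      show "post_map K X P (Ob ?D v) (\<pi> v) n z = post_map K X P (Ob ?D v) (\<pi> v) n z'"
        by (cases v) (use z b in simp_all)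
    qed
  next
    fix X n a y assume a: "X \<in> Obj K" "a \<in> simplices (Fun K X A) n" "y \<in> simplices (Fun K X F) n"
      "post_map K X A B f n a = post_map K X F B q n y"
    let ?x = "\<lambda>v. case v of CLeft \<Rightarrow> a | CRight \<Rightarrow> y | CBase \<Rightarrow> post_map K X A B f n a"
    have x: "?x v \<in> simplices (Fun K X (Ob ?D v)) n" for v
      using a t by (cases v) auto
    have xe: "(v, w) \<in> Edge ?D \<Longrightarrow> post_map K X (Ob ?D v) (Ob ?D w) (Ar ?D v w) n (?x v) = ?x w" for v w
      using a by auto
    obtain z where z: "z \<in> simplices (Fun K X P) n" "\<And>v. v \<in> Vert ?D \<Longrightarrow> post_map K X P (Ob ?D v) (\<pi> v) n z = ?x v"
      using limit_cone_ex[OF lim a(1), of ?x n] x xe by auto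
    then show "\<exists>z\<in>simplices (Fun K X P) n. post_map K X P A (\<pi> CLeft) n z = a \<and> post_map K X P F (\<pi> CRight) n z = y"
      using z(2)[of CLeft] z(2)[of CRight] by auto
  qed (use t l e P in auto)
  then show "is_pullback K P A F B (\<pi> CLeft) (\<pi> CRight) f q \<and> \<pi> CBase = cmp0 K P A B f (\<pi> CLeft)"
    using e by simp
next
  assume "is_pullback K P A F B (\<pi> CLeft) (\<pi> CRight) f q \<and> \<pi> CBase = cmp0 K P A B f (\<pi> CLeft)"
  then have pb: "is_pullback K P A F B (\<pi> CLeft) (\<pi> CRight) f q" and b: "\<pi> CBase = cmp0 K P A B f (\<pi> CLeft)"
    by auto
  note u = is_pullbackD[OF pb]
  have bq: "\<pi> CBase = cmp0 K P F B q (\<pi> CRight)" using b u by simp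
  show "limit_cone K ?D P \<pi>"
  proof (rule limit_coneI[OF wf_cospan[OF t] u(1)])
    show "\<pi> v \<in> arr K P (Ob ?D v)" for v
      by (cases v) (use u b in auto)
    show "cmp0 K P (Ob ?D v) (Ob ?D w) (Ar ?D v w) (\<pi> v) = \<pi> w" if "(v, w) \<in> Edge ?D" for v w
      using that b bq by auto
    show "z = z'" if "X \<in> Obj K" "z \<in> simplices (Fun K X P) n" "z' \<in> simplices (Fun K X P) n"
      and e: "\<And>v. v \<in> Vert ?D \<Longrightarrow> post_map K X P (Ob ?D v) (\<pi> v) n z = post_map K X P (Ob ?D v) (\<pi> v) n z'"
      for X n z z'
      by (rule is_pullback_eqI[OF pb that(1-3)]) (use e[of CLeft] e[of CRight] in simp_all)
    fix X n x assume X: "X \<in> Obj K" and x: "\<And>v. v \<in> Vert ?D \<Longrightarrow> x v \<in> simplices (Fun K X (Ob ?D v)) n"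
      and xe: "\<And>v w. (v, w) \<in> Edge ?D \<Longrightarrow> post_map K X (Ob ?D v) (Ob ?D w) (Ar ?D v w) n (x v) = x w"
    have "post_map K X A B f n (x CLeft) = post_map K X F B q n (x CRight)"
      using xe[of CLeft CBase] xe[of CRight CBase] by simp
    then obtain z where z: "z \<in> simplices (Fun K X P) n" "post_map K X P A (\<pi> CLeft) n z = x CLeft"
        "post_map K X P F (\<pi> CRight) n z = x CRight"
      using is_pullback_ex[OF pb X, of "x CLeft" n "x CRight"] x[of CLeft] x[of CRight] by auto
    have "post_map K X P (Ob ?D v) (\<pi> v) n z = x v" for v
    proof (cases v)
      case CBase
      then show ?thesis
        using b z u X xe[of CRight CBase] by simp
    qed (use z in simp_all)
    then show "\<exists>z\<in>simplices (Fun K X P) n. \<forall>v\<in>Vert ?D. post_map K X P (Ob ?D v) (\<pi> v) n z = x v"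
      using z(1) by auto
  qed simp
qed

lemma is_pullback_limit_cone:
  assumes pb: "is_pullback K P A F B l r f q"
  shows "limit_cone K (cospan A f B q F) P
    (\<lambda>v. case v of CLeft \<Rightarrow> l | CRight \<Rightarrow> r | CBase \<Rightarrow> cmp0 K P A B f l)"
  using is_pullbackD[OF pb] pb by (simp add: limit_cone_cospan_iff)

lemma limit_cone_arr_ex:
  assumes wf: "wf_diagram K D" and lim: "limit_cone K D L \<pi>" and X: "X \<in> Obj K"
    and x: "\<And>v. v \<in> Vert D \<Longrightarrow> x v \<in> arr K X (Ob D v)"
    and e: "\<And>v w. (v, w) \<in> Edge D \<Longrightarrow> cmp0 K X (Ob D v) (Ob D w) (Ar D v w) (x v) = x w"
  obtains z where "z \<in> arr K X L" "\<And>v. v \<in> Vert D \<Longrightarrow> cmp0 K X L (Ob D v) (\<pi> v) z = x v"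
proof -
  note t = wf_diagramD[OF wf] limit_cone_wfD[OF wf lim]
  obtain z where z: "z \<in> arr K X L" "\<And>v. v \<in> Vert D \<Longrightarrow> post_map K X L (Ob D v) (\<pi> v) 0 z = x v"
  proof (rule limit_cone_ex[OF lim X x])
    show "(v, w) \<in> Edge D \<Longrightarrow> post_map K X (Ob D v) (Ob D w) (Ar D v w) 0 (x v) = x w" for v w
      using x t(1-4) X e by (simp add: post_map_0)
  qed (use t in auto)
  have "cmp0 K X L (Ob D v) (\<pi> v) z = x v" if "v \<in> Vert D" for v
    using z that X t by (simp add: post_map_0[symmetric])
  then show ?thesis using that z by blast
qed

lemma limit_cone_arr_eqI:
  assumes wf: "wf_diagram K D" and lim: "limit_cone K D L \<pi>" and X: "X \<in> Obj K"
    and z: "z \<in> arr K X L" "z' \<in> arr K X L"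
    and e: "\<And>v. v \<in> Vert D \<Longrightarrow> cmp0 K X L (Ob D v) (\<pi> v) z = cmp0 K X L (Ob D v) (\<pi> v) z'"
  shows "z = z'"
proof -
  note t = wf_diagramD[OF wf] limit_cone_wfD[OF wf lim]
  show ?thesis
    by (rule limit_cone_eqI[OF wf lim X z]) (use X z t e in \<open>simp add: post_map_0\<close>)
qed

lemma limit_cone_unique:
  assumes wf: "wf_diagram K D" and lim: "limit_cone K D L \<pi>" "limit_cone K D L' \<pi>'"
  obtains \<theta> where "isomorphism K L L' \<theta>" "\<And>v. v \<in> Vert D \<Longrightarrow> cmp0 K L L' (Ob D v) (\<pi>' v) \<theta> = \<pi> v"
proof -
  note t = wf_diagramD[OF wf] limit_cone_wfD[OF wf lim(1)] and t' = limit_cone_wfD[OF wf lim(2)]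
  obtain \<theta> where \<theta>: "\<theta> \<in> arr K L L'" "\<And>v. v \<in> Vert D \<Longrightarrow> cmp0 K L L' (Ob D v) (\<pi>' v) \<theta> = \<pi> v"
    using limit_cone_arr_ex[OF wf lim(2) t(5), of \<pi>] t by blast
  obtain \<eta> where \<eta>: "\<eta> \<in> arr K L' L" "\<And>v. v \<in> Vert D \<Longrightarrow> cmp0 K L' L (Ob D v) (\<pi> v) \<eta> = \<pi>' v"
    using limit_cone_arr_ex[OF wf lim(1) t'(1), of \<pi>'] t' by blast
  have "cmp0 K L L' L \<eta> \<theta> = Unit K L"
  proof (rule limit_cone_arr_eqI[OF wf lim(1) t(5)])
    fix v assume v: "v \<in> Vert D"
    then show "cmp0 K L L (Ob D v) (\<pi> v) (cmp0 K L L' L \<eta> \<theta>) = cmp0 K L L (Ob D v) (\<pi> v) (Unit K L)"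
      using t t'(1) \<theta> \<eta> Cmp_assoc[of L L' L "Ob D v" \<theta> 0 \<eta> "\<pi> v"] by simp
  qed (use t t' \<theta> \<eta> in auto)
  moreover have "cmp0 K L' L L' \<theta> \<eta> = Unit K L'"
  proof (rule limit_cone_arr_eqI[OF wf lim(2) t'(1)])
    fix v assume v: "v \<in> Vert D"
    then show "cmp0 K L' L' (Ob D v) (\<pi>' v) (cmp0 K L' L L' \<theta> \<eta>) = cmp0 K L' L' (Ob D v) (\<pi>' v) (Unit K L')"
      using t t' \<theta> \<eta> Cmp_assoc[of L' L L' "Ob D v" \<eta> 0 \<theta> "\<pi>' v"] by simp
  qed (use t t' \<theta> \<eta> in auto)
  ultimately have "isomorphism K L L' \<theta>"
    using \<theta> \<eta> t(5) t'(1) by (auto simp: isomorphism_def)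
  then show ?thesis using that \<theta> by blast
qed

lemma post_iso_cancel:
  assumes iso: "isomorphism K A B f" and X: "X \<in> Obj K"
    and z: "z \<in> simplices (Fun K X A) n" "z' \<in> simplices (Fun K X A) n"
    and eq: "post_map K X A B f n z = post_map K X A B f n z'"
  shows "z = z'"
proof -
  obtain g where g: "g \<in> arr K B A" "cmp0 K A B A g f = Unit K A"
    using isomorphism_inverse[OF iso] by metis
  have t: "A \<in> Obj K" "B \<in> Obj K" "f \<in> arr K A B" using iso by (auto simp: isomorphism_def)
  have "post_map K X B A g n (post_map K X A B f n w) = w" if "w \<in> simplices (Fun K X A) n" for w
    using that g t X post_comp[of X A B A f g w n] by simp
  then show ?thesis using z eq by metis
qed

lemma post_iso_ex:
  assumes iso: "isomorphism K A B f" and X: "X \<in> Obj K" and y: "y \<in> simplices (Fun K X B) n"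
  obtains z where "z \<in> simplices (Fun K X A) n" "post_map K X A B f n z = y"
proof -
  obtain g where g: "g \<in> arr K B A" "cmp0 K B A B f g = Unit K B"
    using isomorphism_inverse[OF iso] by metis
  have t: "A \<in> Obj K" "B \<in> Obj K" "f \<in> arr K A B" using iso by (auto simp: isomorphism_def)
  have "post_map K X A B f n (post_map K X B A g n y) = y"
    using g t X y post_comp[of X B A B g f y n] by simp
  then show ?thesis using that[of "post_map K X B A g n y"] X y t g by simp
qed

text \<open>Together with \<open>limit_cone_unique\<close> this carries what is known about one
  constructed limit cone to every other one.\<close>

lemma limit_cone_transport:
  assumes wf: "wf_diagram K D" and lim: "limit_cone K D L \<pi>" and iso: "isomorphism K M L \<theta>"
    and \<mu>: "\<And>v. v \<in> Vert D \<Longrightarrow> cmp0 K M L (Ob D v) (\<pi> v) \<theta> = \<mu> v" "\<And>v. v \<notin> Vert D \<Longrightarrow> \<mu> v = undefined"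
  shows "limit_cone K D M \<mu>"
proof -
  note t = wf_diagramD[OF wf] limit_cone_wfD[OF wf lim]
  have i: "M \<in> Obj K" "\<theta> \<in> arr K M L" using iso by (auto simp: isomorphism_def)
  have post: "post_map K X M (Ob D v) (\<mu> v) n z = post_map K X L (Ob D v) (\<pi> v) n (post_map K X M L \<theta> n z)"
    if "v \<in> Vert D" "X \<in> Obj K" "z \<in> simplices (Fun K X M) n" for v X n z
    using that i t \<mu>(1) post_comp[of X M L "Ob D v" \<theta> "\<pi> v" z n] by simp
  show ?thesis
  proof (rule limit_coneI[OF wf i(1)])
    show "\<mu> v \<in> arr K M (Ob D v)" if "v \<in> Vert D" for v
      using that i t by (simp add: \<mu>(1)[symmetric])
    show "cmp0 K M (Ob D v) (Ob D w) (Ar D v w) (\<mu> v) = \<mu> w" if e: "(v, w) \<in> Edge D" for v w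
      using Cmp_assoc[of M L "Ob D v" "Ob D w" \<theta> 0 "\<pi> v" "Ar D v w"] t(1) t(2-4)[OF e] t(5) t(6)[of v] t(7)[OF e] i
        \<mu>(1)[of v] \<mu>(1)[of w] by simp
    show "z = z'" if z: "X \<in> Obj K" "z \<in> simplices (Fun K X M) n" "z' \<in> simplices (Fun K X M) n"
      and e: "\<And>v. v \<in> Vert D \<Longrightarrow> post_map K X M (Ob D v) (\<mu> v) n z = post_map K X M (Ob D v) (\<mu> v) n z'"
      for X n z z'
    proof (rule post_iso_cancel[OF iso z], rule limit_cone_eqI[OF wf lim z(1)])
      fix v assume "v \<in> Vert D"
      then show "post_map K X L (Ob D v) (\<pi> v) n (post_map K X M L \<theta> n z)
          = post_map K X L (Ob D v) (\<pi> v) n (post_map K X M L \<theta> n z')"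
        using e[of v] post[of v X z n] post[of v X z' n] z by simp
    qed (use z i t in auto)
    fix X n x assume X: "X \<in> Obj K" and x: "\<And>v. v \<in> Vert D \<Longrightarrow> x v \<in> simplices (Fun K X (Ob D v)) n"
      and xe: "\<And>v w. (v, w) \<in> Edge D \<Longrightarrow> post_map K X (Ob D v) (Ob D w) (Ar D v w) n (x v) = x w"
    obtain y where y: "y \<in> simplices (Fun K X L) n" "\<And>v. v \<in> Vert D \<Longrightarrow> post_map K X L (Ob D v) (\<pi> v) n y = x v"
      using limit_cone_ex[OF lim X x _ xe] t by blast
    obtain z where z: "z \<in> simplices (Fun K X M) n" "post_map K X M L \<theta> n z = y"
      using post_iso_ex[OF iso X y(1)] .
    then show "\<exists>z\<in>simplices (Fun K X M) n. \<forall>v\<in>Vert D. post_map K X M (Ob D v) (\<mu> v) n z = x v"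
      using y post X by auto
  qed (use \<mu> in auto)
qed

text \<open>Image diagrams under a functor agree with their expected form on vertices and edges
  only: elsewhere the action on arrows is applied outside the function complexes, where it is
  \<open>undefined\<close>. So their limit cones are compared instead of the records.\<close>

lemma limit_cone_cong:
  assumes "wf_diagram K D" "Vert D' = Vert D" "Edge D' = Edge D"
    and "\<And>v. v \<in> Vert D \<Longrightarrow> Ob D' v = Ob D v" "\<And>v w. (v, w) \<in> Edge D \<Longrightarrow> Ar D' v w = Ar D v w"
  shows "limit_cone K D' L \<pi> = limit_cone K D L \<pi>"
proof -
  note wf = wf_diagramD[OF assms(1)]
  have 1: "cone K D' L \<pi> = cone K D L \<pi>"
  proof -
    have "(\<forall>(v, w)\<in>Edge D. cmp0 K L (Ob D' v) (Ob D' w) (Ar D' v w) (\<pi> v) = \<pi> w) \<longleftrightarrow>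
        (\<forall>(v, w)\<in>Edge D. cmp0 K L (Ob D v) (Ob D w) (Ar D v w) (\<pi> v) = \<pi> w)"
      using assms(4,5) wf(2,3) by fastforce
    moreover have "(\<Pi>\<^sub>E v\<in>Vert D. arr K L (Ob D' v)) = (\<Pi>\<^sub>E v\<in>Vert D. arr K L (Ob D v))"
      by (rule PiE_cong) (simp add: assms(4))
    ultimately show ?thesis
      by (simp add: cone_def assms(2,3))
  qed
  have 2: "compatible_families K D' X n = compatible_families K D X n" for X n
  proof -
    have "(\<forall>(v, w)\<in>Edge D. post_map K X (Ob D' v) (Ob D' w) (Ar D' v w) n (x v) = x w) \<longleftrightarrow>
        (\<forall>(v, w)\<in>Edge D. post_map K X (Ob D v) (Ob D w) (Ar D v w) n (x v) = x w)" for x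
      using assms(4,5) wf(2,3) by fastforce
    moreover have "(\<Pi>\<^sub>E v\<in>Vert D. simplices (Fun K X (Ob D' v)) n) = (\<Pi>\<^sub>E v\<in>Vert D. simplices (Fun K X (Ob D v)) n)"
      by (rule PiE_cong) (simp add: assms(4))
    ultimately show ?thesis
      by (simp add: compatible_families_def assms(2,3))
  qed
  have 3: "(\<lambda>h. \<lambda>v\<in>Vert D'. post_map K X L (Ob D' v) (\<pi> v) n h) = (\<lambda>h. \<lambda>v\<in>Vert D. post_map K X L (Ob D v) (\<pi> v) n h)" for X n
    using assms(2,4) by (auto simp: fun_eq_iff restrict_def)
  show ?thesis
    unfolding limit_cone_def 1 2 3 ..
qed

text \<open>Terminal objects are empty products, and \<open>\<lambda>v. undefined\<close> is the
  only family over the empty set. Facts about limit cones of products thereby apply to terminal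
  objects.\<close>

lemma terminal_iff_limit_cone:
  "terminal K T \<longleftrightarrow> limit_cone K (product_diagram {} Y) T (\<lambda>v. undefined)"
proof -
  have "(\<exists>!h. h \<in> S) \<longleftrightarrow> bij_betw (\<lambda>h::'a. \<lambda>v\<in>{}::'b set. f h v :: 'a) S {\<lambda>v. undefined}" for f and S :: "'a set"
    by (auto simp: bij_betw_def inj_on_def restrict_def)
  then show ?thesis
    by (simp add: terminal_def limit_cone_def cone_def compatible_families_def product_diagram_def)
qed

end

section \<open>Cotensors\<close>

text \<open>This repeats the inner function of the definition of \<open>cotensor\<close> literally,
  so that the two match after unfolding.\<close>

abbreviation transpose_map ::
    "('o, 'a, 'm) scat_scheme \<Rightarrow> 'u sset \<Rightarrow> 'o \<Rightarrow> 'o \<Rightarrow> 'o \<Rightarrow> (nat \<Rightarrow> 'u \<Rightarrow> 'a) \<Rightarrow> nat \<Rightarrow> 'a \<Rightarrow>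
      nat \<Rightarrow> (nat \<Rightarrow> nat) \<times> 'u \<Rightarrow> 'a" where
  "transpose_map K U X C A u n h \<equiv> (\<lambda>m. \<lambda>(\<beta>, x)\<in>Delta m n \<times> simplices U m.
    Cmp K X C A m (u m x) (act (Fun K X C) m n \<beta> h))"

context simplicial_category
begin

lemma transpose_map_smap:
  assumes U: "simplicial_set U" and t: "X \<in> Obj K" "C \<in> Obj K" "A \<in> Obj K"
    and u: "u \<in> smap U (Fun K C A)" and h: "h \<in> simplices (Fun K X C) n"
  shows "transpose_map K U X C A u n h \<in> smap (sprod (std_simplex n) U) (Fun K X A)"
proof (rule smapI)
  note c = smap_closed[OF u] smap_act[OF u]
  show "transpose_map K U X C A u n h m z \<in> simplices (Fun K X A) m"
    if "z \<in> simplices (sprod (std_simplex n) U) m" for m z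
    using that t h c by (auto simp: std_simplex_def)
  show "transpose_map K U X C A u n h m z = undefined"
    if "z \<notin> simplices (sprod (std_simplex n) U) m" for m z
    using that by (auto simp: restrict_def)
  fix k m \<alpha> z assume "\<alpha> \<in> Delta k m" "z \<in> simplices (sprod (std_simplex n) U) m"
  then show "transpose_map K U X C A u n h k (act (sprod (std_simplex n) U) k m \<alpha> z)
      = act (Fun K X A) k m \<alpha> (transpose_map K U X C A u n h m z)"
    using t h c by (auto simp: Cmp_act simplicial_set.act_closed[OF U])
qed

lemma cotensorI:
  assumes U: "simplicial_set U" and t: "C \<in> Obj K" "A \<in> Obj K" and u: "u \<in> smap U (Fun K C A)"
    and eqI: "\<And>X n z z'. \<lbrakk>X \<in> Obj K; z \<in> simplices (Fun K X C) n; z' \<in> simplices (Fun K X C) n;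
      \<And>m \<beta> x. \<lbrakk>\<beta> \<in> Delta m n; x \<in> simplices U m\<rbrakk> \<Longrightarrow> Cmp K X C A m (u m x) (act (Fun K X C) m n \<beta> z)
        = Cmp K X C A m (u m x) (act (Fun K X C) m n \<beta> z')\<rbrakk> \<Longrightarrow> z = z'"
    and ex: "\<And>X n \<phi>. \<lbrakk>X \<in> Obj K; \<phi> \<in> smap (sprod (std_simplex n) U) (Fun K X A)\<rbrakk> \<Longrightarrow>
      \<exists>z\<in>simplices (Fun K X C) n. \<forall>m. \<forall>\<beta>\<in>Delta m n. \<forall>x\<in>simplices U m.
        Cmp K X C A m (u m x) (act (Fun K X C) m n \<beta> z) = \<phi> m (\<beta>, x)"
  shows "cotensor K U A C u"
  unfolding cotensor_def
proof (intro conjI ballI)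
  show "cotensor_cone K U A C u" "A \<in> Obj K"
    using t u by (auto simp: cotensor_cone_def)
  fix X assume X: "X \<in> Obj K"
  note c = smap_closed[OF u] smap_act[OF u]
  let ?T = "\<lambda>n. \<lambda>h\<in>simplices (Fun K X C) n. transpose_map K U X C A u n h"
  have smap: "transpose_map K U X C A u n h \<in> smap (sprod (std_simplex n) U) (Fun K X A)"
    if "h \<in> simplices (Fun K X C) n" for n h
    by (rule transpose_map_smap[OF U X t u that])
  show "simplicial_iso (Fun K X C) (sexp U (Fun K X A)) ?T"
    unfolding simplicial_iso_def
  proof (intro conjI allI)
    show "?T \<in> smap (Fun K X C) (sexp U (Fun K X A))"
    proof (rule smap_restrictI[OF Fun_simplicial_set[OF X t(1)]])
      show "transpose_map K U X C A u n h \<in> simplices (sexp U (Fun K X A)) n"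
        if "h \<in> simplices (Fun K X C) n" for n h
        using smap[OF that] by (simp add: sexp_def)
      fix m n \<alpha> h assume a: "\<alpha> \<in> Delta m n" "h \<in> simplices (Fun K X C) n"
      show "transpose_map K U X C A u m (act (Fun K X C) m n \<alpha> h)
          = act (sexp U (Fun K X A)) m n \<alpha> (transpose_map K U X C A u n h)"
        using a X t by (auto simp: sexp_def fun_eq_iff)
    qed
    fix n
    show "bij_betw (?T n) (simplices (Fun K X C) n) (simplices (sexp U (Fun K X A)) n)"
      unfolding bij_betw_def
    proof (intro conjI)
      show "inj_on (?T n) (simplices (Fun K X C) n)"
      proof (rule inj_onI)
        fix z z' assume z: "z \<in> simplices (Fun K X C) n" "z' \<in> simplices (Fun K X C) n" "?T n z = ?T n z'"
        show "z = z'"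
        proof (rule eqI[OF X z(1,2)])
          fix m \<beta> x assume "\<beta> \<in> Delta m n" "x \<in> simplices U m"
          then show "Cmp K X C A m (u m x) (act (Fun K X C) m n \<beta> z)
              = Cmp K X C A m (u m x) (act (Fun K X C) m n \<beta> z')"
            using fun_cong[OF fun_cong[OF z(3), of m], of "(\<beta>, x)"] z(1,2) by simp
        qed
      qed
      show "?T n ` simplices (Fun K X C) n = simplices (sexp U (Fun K X A)) n"
      proof (intro set_eqI iffI)
        fix \<phi> assume "\<phi> \<in> simplices (sexp U (Fun K X A)) n"
        then have \<phi>: "\<phi> \<in> smap (sprod (std_simplex n) U) (Fun K X A)" by (simp add: sexp_def)
        obtain z where z: "z \<in> simplices (Fun K X C) n"
          "\<forall>m. \<forall>\<beta>\<in>Delta m n. \<forall>x\<in>simplices U m. Cmp K X C A m (u m x) (act (Fun K X C) m n \<beta> z) = \<phi> m (\<beta>, x)"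
          using ex[OF X \<phi>] by blast
        have "transpose_map K U X C A u n z = \<phi>"
          by (rule smap_eqI[OF smap[OF z(1)] \<phi>]) (use z(2) in auto)
        then show "\<phi> \<in> ?T n ` simplices (Fun K X C) n"
          using z(1) by (intro image_eqI[of _ _ z]) auto
      qed (use smap in \<open>auto simp: sexp_def\<close>)
    qed
  qed
qed

lemma cotensorD:
  assumes "cotensor K U A C u"
  shows "A \<in> Obj K" "C \<in> Obj K" "u \<in> smap U (Fun K C A)"
  using assms by (auto simp: cotensor_def cotensor_cone_def)

lemma cotensor_bij:
  assumes "cotensor K U A C u" "X \<in> Obj K"
  shows "bij_betw (\<lambda>h\<in>simplices (Fun K X C) n. transpose_map K U X C A u n h)
    (simplices (Fun K X C) n) (smap (sprod (std_simplex n) U) (Fun K X A))"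
  using assms by (auto simp: cotensor_def simplicial_iso_def sexp_def)

lemma cotensor_eqI:
  assumes ct: "cotensor K U A C u" and X: "X \<in> Obj K"
    and z: "z \<in> simplices (Fun K X C) n" "z' \<in> simplices (Fun K X C) n"
    and eq: "\<And>m \<beta> x. \<lbrakk>\<beta> \<in> Delta m n; x \<in> simplices U m\<rbrakk> \<Longrightarrow> Cmp K X C A m (u m x) (act (Fun K X C) m n \<beta> z)
        = Cmp K X C A m (u m x) (act (Fun K X C) m n \<beta> z')"
  shows "z = z'"
proof -
  have "transpose_map K U X C A u n z = transpose_map K U X C A u n z'"
    using eq by (auto simp: fun_eq_iff restrict_def)
  then show ?thesis
    using cotensor_bij[OF ct X, of n] z by (auto simp: bij_betw_def inj_on_def)
qed

lemma cotensor_lift: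
  assumes ct: "cotensor K U A C u" and X: "X \<in> Obj K"
    and \<phi>: "\<phi> \<in> smap (sprod (std_simplex n) U) (Fun K X A)"
  obtains z where "z \<in> simplices (Fun K X C) n"
    "\<And>m \<beta> x. \<lbrakk>\<beta> \<in> Delta m n; x \<in> simplices U m\<rbrakk> \<Longrightarrow>
      Cmp K X C A m (u m x) (act (Fun K X C) m n \<beta> z) = \<phi> m (\<beta>, x)"
proof -
  obtain z where z: "z \<in> simplices (Fun K X C) n" "transpose_map K U X C A u n z = \<phi>"
  proof -
    have "\<phi> \<in> (\<lambda>h\<in>simplices (Fun K X C) n. transpose_map K U X C A u n h) ` simplices (Fun K X C) n"
      using cotensor_bij[OF ct X, of n] \<phi> unfolding bij_betw_def by blast
    then show ?thesis using that by auto
  qed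
  have "Cmp K X C A m (u m x) (act (Fun K X C) m n \<beta> z) = \<phi> m (\<beta>, x)"
    if "\<beta> \<in> Delta m n" "x \<in> simplices U m" for m \<beta> x
    using fun_cong[OF fun_cong[OF z(2), of m], of "(\<beta>, x)"] that by simp
  then show ?thesis using that z(1) by blast
qed

text \<open>The definition of a cotensor covers only maps out of the product of \<open>U\<close>
  with a standard simplex. For general \<open>W\<close>, every simplex \<sigma> of \<open>W\<close>
  restricts \<open>h\<close> to such a map, and uniqueness makes the transposes natural in
  \<sigma>.\<close>

lemma cotensor_curry:
  assumes ct: "cotensor K U A C u" and X: "X \<in> Obj K"
    and W: "simplicial_set W" and U: "simplicial_set U" and h: "h \<in> smap (sprod W U) (Fun K X A)"
  obtains w where "w \<in> smap W (Fun K X C)"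
    "\<And>n \<sigma> x. \<lbrakk>\<sigma> \<in> simplices W n; x \<in> simplices U n\<rbrakk> \<Longrightarrow> Cmp K X C A n (u n x) (w n \<sigma>) = h n (\<sigma>, x)"
proof -
  note t = cotensorD[OF ct] and c = smap_closed[OF cotensorD(3)[OF ct]]
  note hc = smap_closed[OF h] and ha = smap_act[OF h]
  note wc = simplicial_set.act_closed[OF W] simplicial_set.act_comp[OF W]
  \<comment> \<open>All operators \<beta> have to occur: equality for the identity operator alone
    need not determine \<open>z\<close>, as it sees the simplices of \<open>U\<close> in dimension
    \<open>n\<close> only.\<close>
  define P where "P n \<sigma> z \<longleftrightarrow> (\<forall>m \<beta> x. \<beta> \<in> Delta m n \<longrightarrow> x \<in> simplices U m \<longrightarrow>
      Cmp K X C A m (u m x) (act (Fun K X C) m n \<beta> z) = h m (act W m n \<beta> \<sigma>, x))" for n \<sigma> z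
  have "\<exists>w\<in>smap W (Fun K X C). \<forall>n. \<forall>\<sigma>\<in>simplices W n. P n \<sigma> (w n \<sigma>)"
  proof (rule smap_ex[OF W])
    fix n \<sigma> assume \<sigma>: "\<sigma> \<in> simplices W n"
    define \<phi> where "\<phi> = (\<lambda>m. \<lambda>(\<beta>, x)\<in>Delta m n \<times> simplices U m. h m (act W m n \<beta> \<sigma>, x))"
    have "\<phi> \<in> smap (sprod (std_simplex n) U) (Fun K X A)"
    proof (rule smapI)
      show "\<phi> m y \<in> simplices (Fun K X A) m" if "y \<in> simplices (sprod (std_simplex n) U) m" for m y
        using that \<sigma> wc by (auto simp: \<phi>_def intro!: hc)
      show "\<phi> m y = undefined" if "y \<notin> simplices (sprod (std_simplex n) U) m" for m y
        using that by (auto simp: \<phi>_def restrict_def)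
      fix l m \<alpha> y assume "\<alpha> \<in> Delta l m" "y \<in> simplices (sprod (std_simplex n) U) m"
      moreover from this have "h l (act (sprod W U) l m \<alpha> (act W m n (fst y) \<sigma>, snd y))
          = act (Fun K X A) l m \<alpha> (h m (act W m n (fst y) \<sigma>, snd y))"
        using \<sigma> wc by (intro ha) auto
      ultimately show "\<phi> l (act (sprod (std_simplex n) U) l m \<alpha> y) = act (Fun K X A) l m \<alpha> (\<phi> m y)"
        using \<sigma> wc by (auto simp: \<phi>_def simplicial_set.act_closed[OF U])
    qed
    then obtain z where "z \<in> simplices (Fun K X C) n"
      "\<And>m \<beta> x. \<lbrakk>\<beta> \<in> Delta m n; x \<in> simplices U m\<rbrakk> \<Longrightarrow> Cmp K X C A m (u m x) (act (Fun K X C) m n \<beta> z) = \<phi> m (\<beta>, x)"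
      using cotensor_lift[OF ct X] by metis
    then show "\<exists>z. z \<in> simplices (Fun K X C) n \<and> P n \<sigma> z"
      by (auto simp: P_def \<phi>_def)
  next
    show "z = z'" if "z \<in> simplices (Fun K X C) n" "z' \<in> simplices (Fun K X C) n" "P n \<sigma> z" "P n \<sigma> z'" for n \<sigma> z z'
      by (rule cotensor_eqI[OF ct X that(1,2)]) (use that in \<open>auto simp: P_def\<close>)
  next
    fix m n \<alpha> \<sigma> z assume a: "\<alpha> \<in> Delta m n" "\<sigma> \<in> simplices W n" "z \<in> simplices (Fun K X C) n" "P n \<sigma> z"
    then show "act (Fun K X C) m n \<alpha> z \<in> simplices (Fun K X C) m \<and> P m (act W m n \<alpha> \<sigma>) (act (Fun K X C) m n \<alpha> z)"
      using X t wc by (auto simp: P_def)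
  qed
  then obtain w where w: "w \<in> smap W (Fun K X C)" "\<forall>n. \<forall>\<sigma>\<in>simplices W n. P n \<sigma> (w n \<sigma>)" by blast
  have "Cmp K X C A n (u n x) (w n \<sigma>) = h n (\<sigma>, x)" if "\<sigma> \<in> simplices W n" "x \<in> simplices U n" for n \<sigma> x
  proof -
    have "Cmp K X C A n (u n x) (act (Fun K X C) n n (\<lambda>i\<in>{..n}. i) (w n \<sigma>)) = h n (act W n n (\<lambda>i\<in>{..n}. i) \<sigma>, x)"
      using w that by (auto simp: P_def)
    then show ?thesis
      using X t smap_closed[OF w(1)] that simplicial_set.act_id[OF W] by auto
  qed
  then show ?thesis using that w(1) by blast
qed

text \<open>In contrast to \<open>cotensor_eqI\<close>, agreement without operators is enough for
  maps, since the hypothesis can be applied to \<open>act W m n \<beta> \<sigma>\<close>.\<close>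

lemma cotensor_smap_eqI:
  assumes ct: "cotensor K U A C u" and X: "X \<in> Obj K" and W: "simplicial_set W"
    and w: "w \<in> smap W (Fun K X C)" "w' \<in> smap W (Fun K X C)"
    and eq: "\<And>n \<sigma> x. \<lbrakk>\<sigma> \<in> simplices W n; x \<in> simplices U n\<rbrakk> \<Longrightarrow>
      Cmp K X C A n (u n x) (w n \<sigma>) = Cmp K X C A n (u n x) (w' n \<sigma>)"
    and \<sigma>: "\<sigma> \<in> simplices W n"
  shows "w n \<sigma> = w' n \<sigma>"
proof (rule cotensor_eqI[OF ct X])
  fix m \<beta> x assume b: "\<beta> \<in> Delta m n" "x \<in> simplices U m"
  then have "act W m n \<beta> \<sigma> \<in> simplices W m"
    using \<sigma> by (simp add: simplicial_set.act_closed[OF W])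
  then show "Cmp K X C A m (u m x) (act (Fun K X C) m n \<beta> (w n \<sigma>)) = Cmp K X C A m (u m x) (act (Fun K X C) m n \<beta> (w' n \<sigma>))"
    using eq[of "act W m n \<beta> \<sigma>" m x] b \<sigma> by (simp add: smap_act[OF w(1)] smap_act[OF w(2)])
qed (use w \<sigma> in \<open>auto intro: smap_closed\<close>)

lemma cotensor_arr_eqI:
  assumes ct: "cotensor K U A C u" and X: "X \<in> Obj K" and c: "c \<in> arr K X C" "c' \<in> arr K X C"
    and eq: "\<And>n x. x \<in> simplices U n \<Longrightarrow> pre_map K X C A c n (u n x) = pre_map K X C A c' n (u n x)"
  shows "c = c'"
proof (rule cotensor_eqI[OF ct X c])
  note t = cotensorD[OF ct] and uc = smap_closed[OF cotensorD(3)[OF ct]]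
  fix m \<beta> x assume b: "\<beta> \<in> Delta m 0" "x \<in> simplices U m"
  \<comment> \<open>There is only one operator into dimension 0, and it produces the degenerate
    simplex.\<close>
  have "act (Fun K X C) m 0 \<beta> d = degen (Fun K X C) m d" if "d \<in> arr K X C" for d
    using Delta_zero[OF b(1)] by (simp add: degen_def)
  then show "Cmp K X C A m (u m x) (act (Fun K X C) m 0 \<beta> c) = Cmp K X C A m (u m x) (act (Fun K X C) m 0 \<beta> c')"
    using eq[OF b(2)] c uc[OF b(2)] by (simp add: pre_map_eq)
qed

text \<open>This is currying with \<open>W\<close> a point, realized as
  \<open>std_simplex 0\<close>; a map out of the point is given by the image of its only
  vertex.\<close>

lemma cotensor_arr_ex:
  assumes ct: "cotensor K U A C u" and U: "simplicial_set U" and X: "X \<in> Obj K"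
    and v: "v \<in> smap U (Fun K X A)"
  obtains c where "c \<in> arr K X C" "\<And>n x. x \<in> simplices U n \<Longrightarrow> pre_map K X C A c n (u n x) = v n x"
proof -
  note t = cotensorD[OF ct] and uc = smap_closed[OF cotensorD(3)[OF ct]]
  let ?W = "std_simplex 0"
  have "(\<lambda>n. \<lambda>z\<in>simplices (sprod ?W U) n. v n (snd z)) \<in> smap (sprod ?W U) (Fun K X A)"
    by (rule smap_restrictI[OF simplicial_set_sprod[OF simplicial_set_std_simplex U]])
      (use smap_closed[OF v] smap_act[OF v] in auto)
  from cotensor_curry[OF ct X simplicial_set_std_simplex U this]
  obtain w where w: "w \<in> smap ?W (Fun K X C)"
    "\<And>n \<sigma> x. \<lbrakk>\<sigma> \<in> simplices ?W n; x \<in> simplices U n\<rbrakk> \<Longrightarrow> Cmp K X C A n (u n x) (w n \<sigma>) = v n x"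
    by auto
  define c where "c = w 0 (\<lambda>i\<in>{..0}. 0)"
  have c: "c \<in> arr K X C" unfolding c_def by (rule smap_closed[OF w(1)]) (simp del: atMost_0)
  have "degen (Fun K X C) n c = w n (\<lambda>i\<in>{..n}. 0)" for n
    unfolding c_def
    using smap_degen[OF w(1), of "\<lambda>i\<in>{..0}. 0" n] compose_const[of "\<lambda>i\<in>{..n}. 0" n 0 "0::nat"]
    by (simp add: degen_def del: atMost_0)
  then have "pre_map K X C A c n (u n x) = v n x" if "x \<in> simplices U n" for n x
    using w(2)[of "\<lambda>i\<in>{..n}. 0" n x] that uc[OF that] by (simp add: pre_map_eq)
  then show ?thesis using that c by blast
qed

section \<open>Uniqueness of cotensors and the maps between them\<close>

lemma cotensor_unique:
  assumes U: "simplicial_set U" and ct: "cotensor K U A C u" "cotensor K U A C' u'"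
  obtains \<theta> where "isomorphism K C C' \<theta>" "\<And>n x. x \<in> simplices U n \<Longrightarrow> pre_map K C C' A \<theta> n (u' n x) = u n x"
proof -
  note t = cotensorD[OF ct(1)] and t' = cotensorD[OF ct(2)]
  note uc = smap_closed[OF t(3)] smap_closed[OF t'(3)]
  obtain \<theta> where \<theta>: "\<theta> \<in> arr K C C'" "\<And>n x. x \<in> simplices U n \<Longrightarrow> pre_map K C C' A \<theta> n (u' n x) = u n x"
    using cotensor_arr_ex[OF ct(2) U t(2,3)] by blast
  obtain \<eta> where \<eta>: "\<eta> \<in> arr K C' C" "\<And>n x. x \<in> simplices U n \<Longrightarrow> pre_map K C' C A \<eta> n (u n x) = u' n x"
    using cotensor_arr_ex[OF ct(1) U t'(2,3)] by blast
  have "cmp0 K C C' C \<eta> \<theta> = Unit K C"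
    by (rule cotensor_arr_eqI[OF ct(1) t(2)]) (use t t' uc \<theta> \<eta> in auto)
  moreover have "cmp0 K C' C C' \<theta> \<eta> = Unit K C'"
    by (rule cotensor_arr_eqI[OF ct(2) t'(2)]) (use t t' uc \<theta> \<eta> in auto)
  ultimately show ?thesis
    using that \<theta> \<eta> t t' by (auto simp: isomorphism_def)
qed

lemma cotensor_transport:
  assumes U: "simplicial_set U" and ct: "cotensor K U A C u" and iso: "isomorphism K D C \<theta>"
    and v: "v \<in> smap U (Fun K D A)" "\<And>n x. x \<in> simplices U n \<Longrightarrow> pre_map K D C A \<theta> n (u n x) = v n x"
  shows "cotensor K U A D v"
proof (rule cotensorI[OF U])
  note t = cotensorD[OF ct] and uc = smap_closed[OF cotensorD(3)[OF ct]]
  have i: "D \<in> Obj K" "\<theta> \<in> arr K D C" using iso by (auto simp: isomorphism_def)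
  show "D \<in> Obj K" "A \<in> Obj K" using i t by auto
  have eq: "Cmp K X D A m (v m x) (act (Fun K X D) m n \<beta> z)
      = Cmp K X C A m (u m x) (act (Fun K X C) m n \<beta> (post_map K X D C \<theta> n z))"
    if "X \<in> Obj K" "z \<in> simplices (Fun K X D) n" "\<beta> \<in> Delta m n" "x \<in> simplices U m" for X n z m \<beta> x
    using that i t uc by (simp add: v(2)[symmetric] Cmp_post post_act[symmetric] del: post_act)
  show "z = z'" if z: "X \<in> Obj K" "z \<in> simplices (Fun K X D) n" "z' \<in> simplices (Fun K X D) n"
    and e: "\<And>m \<beta> x. \<lbrakk>\<beta> \<in> Delta m n; x \<in> simplices U m\<rbrakk> \<Longrightarrow> Cmp K X D A m (v m x) (act (Fun K X D) m n \<beta> z)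
      = Cmp K X D A m (v m x) (act (Fun K X D) m n \<beta> z')" for X n z z'
    by (rule post_iso_cancel[OF iso z], rule cotensor_eqI[OF ct z(1)])
      (use i t z e eq in auto)
  fix X n \<phi> assume X: "X \<in> Obj K" and \<phi>: "\<phi> \<in> smap (sprod (std_simplex n) U) (Fun K X A)"
  obtain y where y: "y \<in> simplices (Fun K X C) n"
    "\<And>m \<beta> x. \<lbrakk>\<beta> \<in> Delta m n; x \<in> simplices U m\<rbrakk> \<Longrightarrow> Cmp K X C A m (u m x) (act (Fun K X C) m n \<beta> y) = \<phi> m (\<beta>, x)"
    using cotensor_lift[OF ct X \<phi>] by blast
  obtain z where "z \<in> simplices (Fun K X D) n" "post_map K X D C \<theta> n z = y"
    using post_iso_ex[OF iso X y(1)] .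
  then show "\<exists>z\<in>simplices (Fun K X D) n. \<forall>m. \<forall>\<beta>\<in>Delta m n. \<forall>x\<in>simplices U m.
      Cmp K X D A m (v m x) (act (Fun K X D) m n \<beta> z) = \<phi> m (\<beta>, x)"
    using eq y X by (intro bexI[of _ z]) auto
qed (use v in auto)

text \<open>A base map is defined by its effect on the universal element; composing with
  \<open>z\<close> extends the equation to all simplices of \<open>Fun K X C\<close>.\<close>

lemma base_map_Cmp:
  assumes ct: "cotensor K U E C u" "cotensor K U B D v" and c: "cotensor_base_map K U E B p C u D v c"
    and p: "p \<in> arr K E B" and X: "X \<in> Obj K" and z: "z \<in> simplices (Fun K X C) n" and x: "x \<in> simplices U n"
  shows "Cmp K X D B n (v n x) (post_map K X C D c n z) = post_map K X E B p n (Cmp K X C E n (u n x) z)"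
proof -
  note t = cotensorD[OF ct(1)] cotensorD[OF ct(2)]
  have "c \<in> arr K C D" "pre_map K C D B c n (v n x) = post_map K C E B p n (u n x)"
    using c x by (auto simp: cotensor_base_map_def)
  then show ?thesis
    using t p X z smap_closed[OF t(3) x] smap_closed[OF t(6) x] by (simp add: Cmp_post post_Cmp)
qed

lemma weight_map_Cmp:
  assumes ct: "cotensor K V A C v" "cotensor K U A D u" and c: "cotensor_weight_map K U i A C v D u c"
    and i: "i \<in> smap U V" and X: "X \<in> Obj K" and z: "z \<in> simplices (Fun K X C) n" and x: "x \<in> simplices U n"
  shows "Cmp K X D A n (u n x) (post_map K X C D c n z) = Cmp K X C A n (v n (i n x)) z"
proof -
  note t = cotensorD[OF ct(1)] cotensorD[OF ct(2)]
  have "c \<in> arr K C D" "pre_map K C D A c n (u n x) = v n (i n x)"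
    using c x by (auto simp: cotensor_weight_map_def)
  then show ?thesis
    using t X z smap_closed[OF t(3) smap_closed[OF i x]] smap_closed[OF t(6) x] by (simp add: Cmp_post)
qed

lemma base_map_ex:
  assumes "simplicial_set U" and ct: "cotensor K U E C u" "cotensor K U B D v" and p: "p \<in> arr K E B"
  obtains c where "cotensor_base_map K U E B p C u D v c"
proof -
  note t = cotensorD[OF ct(1)] cotensorD[OF ct(2)]
  have "(\<lambda>n. \<lambda>x\<in>simplices U n. post_map K C E B p n (u n x)) \<in> smap U (Fun K C B)"
    by (rule smap_comp) (use assms t in auto)
  from cotensor_arr_ex[OF ct(2) assms(1) t(2) this] obtain c where "c \<in> arr K C D"
    "\<And>n x. x \<in> simplices U n \<Longrightarrow> pre_map K C D B c n (v n x) = (\<lambda>x\<in>simplices U n. post_map K C E B p n (u n x)) x"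
    by blast
  then have "cotensor_base_map K U E B p C u D v c" by (simp add: cotensor_base_map_def)
  then show ?thesis by (rule that)
qed

lemma weight_map_ex:
  assumes "simplicial_set U" and ct: "cotensor K V A C v" "cotensor K U A D u" and i: "i \<in> smap U V"
  obtains c where "cotensor_weight_map K U i A C v D u c"
proof -
  note t = cotensorD[OF ct(1)] cotensorD[OF ct(2)]
  have "(\<lambda>n. \<lambda>x\<in>simplices U n. v n (i n x)) \<in> smap U (Fun K C A)"
    by (rule smap_comp) (use assms t in auto)
  from cotensor_arr_ex[OF ct(2) assms(1) t(2) this] obtain c where "c \<in> arr K C D"
    "\<And>n x. x \<in> simplices U n \<Longrightarrow> pre_map K C D A c n (u n x) = (\<lambda>x\<in>simplices U n. v n (i n x)) x"
    by blast
  then have "cotensor_weight_map K U i A C v D u c" by (simp add: cotensor_weight_map_def)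
  then show ?thesis by (rule that)
qed

lemma base_map_comp:
  assumes ct: "cotensor K U A C u" "cotensor K U B D v" "cotensor K U E G w"
    and c: "cotensor_base_map K U A B f C u D v c" and d: "cotensor_base_map K U B E g D v G w d"
    and f: "f \<in> arr K A B" and g: "g \<in> arr K B E"
  shows "cotensor_base_map K U A E (cmp0 K A B E g f) C u G w (cmp0 K C D G d c)"
  unfolding cotensor_base_map_def
proof (intro conjI allI ballI)
  note t = cotensorD[OF ct(1)] cotensorD[OF ct(2)] cotensorD[OF ct(3)]
  have cd: "c \<in> arr K C D" "d \<in> arr K D G"
    using c d by (auto simp: cotensor_base_map_def)
  then show "cmp0 K C D G d c \<in> arr K C G" using t by simp
  fix n x assume x: "x \<in> simplices U n"
  note xc = smap_closed[OF t(3) x] smap_closed[OF t(6) x] smap_closed[OF t(9) x]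
  have "pre_map K C D E c n (pre_map K D G E d n (w n x)) = pre_map K C D E c n (post_map K D B E g n (v n x))"
    using d x by (simp add: cotensor_base_map_def)
  also have "\<dots> = post_map K C B E g n (pre_map K C D B c n (v n x))"
    using t cd xc g by (simp add: post_pre)
  also have "\<dots> = post_map K C B E g n (post_map K C A B f n (u n x))"
    using c x by (simp add: cotensor_base_map_def)
  finally show "pre_map K C G E (cmp0 K C D G d c) n (w n x) = post_map K C A E (cmp0 K A B E g f) n (u n x)"
    using t cd xc f g by simp
qed

lemma base_map_unique:
  assumes "cotensor K U E C u" "cotensor K U B D v"
    and "cotensor_base_map K U E B p C u D v c" "cotensor_base_map K U E B p C u D v c'"
  shows "c = c'"
  by (rule cotensor_arr_eqI[OF assms(2) cotensorD(2)[OF assms(1)]])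
    (use assms(3,4) in \<open>auto simp: cotensor_base_map_def\<close>)

text \<open>The cotensor is a bifunctor: tested against the universal element at \<open>x\<close>,
  both composites become evaluation at \<open>i n x\<close> followed by \<open>p\<close>.\<close>

lemma base_weight_commute:
  assumes ct: "cotensor K V E EV ev" "cotensor K U E EU eu" "cotensor K V B BV bv" "cotensor K U B BU bu"
    and i: "i \<in> smap U V" and p: "p \<in> arr K E B"
    and bm: "cotensor_base_map K V E B p EV ev BV bv pV" "cotensor_base_map K U E B p EU eu BU bu pU"
    and wm: "cotensor_weight_map K U i E EV ev EU eu Ei" "cotensor_weight_map K U i B BV bv BU bu Bi"
  shows "cmp0 K EV EU BU pU Ei = cmp0 K EV BV BU Bi pV"
proof (rule cotensor_arr_eqI[OF ct(4)])
  note t = cotensorD[OF ct(1)] cotensorD[OF ct(2)] cotensorD[OF ct(3)] cotensorD[OF ct(4)]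
  have a: "pV \<in> arr K EV BV" "pU \<in> arr K EU BU" "Ei \<in> arr K EV EU" "Bi \<in> arr K BV BU"
    using bm wm by (auto simp: cotensor_base_map_def cotensor_weight_map_def)
  show "EV \<in> Obj K" "cmp0 K EV EU BU pU Ei \<in> arr K EV BU" "cmp0 K EV BV BU Bi pV \<in> arr K EV BU"
    using t a by auto
  fix n x assume x: "x \<in> simplices U n"
  note xc = smap_closed[OF t(3) smap_closed[OF i x]] smap_closed[OF t(6) x]
    smap_closed[OF t(9) smap_closed[OF i x]] smap_closed[OF t(12) x]
  have e: "pre_map K EU BU B pU n (bu n x) = post_map K EU E B p n (eu n x)"
    "pre_map K EV EU E Ei n (eu n x) = ev n (i n x)"
    "pre_map K BV BU B Bi n (bu n x) = bv n (i n x)"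
    "pre_map K EV BV B pV n (bv n (i n x)) = post_map K EV E B p n (ev n (i n x))"
    using bm wm x smap_closed[OF i x] by (auto simp: cotensor_base_map_def cotensor_weight_map_def)
  show "pre_map K EV BU B (cmp0 K EV EU BU pU Ei) n (bu n x) = pre_map K EV BU B (cmp0 K EV BV BU Bi pV) n (bu n x)"
    using t a xc p e by (simp add: post_pre[symmetric])
qed

text \<open>A simplex over \<open>PU\<close> is a map from \<open>sprod (std_simplex n) U\<close>
  into the function complex of \<open>P\<close>, hence a compatible pair of such maps for
  \<open>A\<close> and \<open>F\<close>: limits commute with cotensors.\<close>

lemma is_pullback_cotensor:
  assumes U: "simplicial_set U" and pb: "is_pullback K P A F B l r f q"
    and ct: "cotensor K U P PU pu" "cotensor K U A AU au" "cotensor K U F FU fu" "cotensor K U B BU bu"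
    and bm: "cotensor_base_map K U P A l PU pu AU au lU" "cotensor_base_map K U P F r PU pu FU fu rU"
      "cotensor_base_map K U A B f AU au BU bu fU" "cotensor_base_map K U F B q FU fu BU bu qU"
  shows "is_pullback K PU AU FU BU lU rU fU qU"
proof (rule is_pullbackI)
  note t = cotensorD[OF ct(1)] cotensorD[OF ct(2)] cotensorD[OF ct(3)] cotensorD[OF ct(4)]
    and s = is_pullbackD[OF pb]
  show a: "lU \<in> arr K PU AU" "rU \<in> arr K PU FU" "fU \<in> arr K AU BU" "qU \<in> arr K FU BU"
    using bm by (auto simp: cotensor_base_map_def)
  show "cmp0 K PU AU BU fU lU = cmp0 K PU FU BU qU rU"
    using base_map_unique[OF ct(1,4)] base_map_comp[OF ct(1,2,4) bm(1,3) s(5,7)]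
      base_map_comp[OF ct(1,3,4) bm(2,4) s(6,8)] s(9) by simp
  {
    fix X n z z' assume X: "X \<in> Obj K" and z: "z \<in> simplices (Fun K X PU) n" "z' \<in> simplices (Fun K X PU) n"
      and e: "post_map K X PU AU lU n z = post_map K X PU AU lU n z'"
        "post_map K X PU FU rU n z = post_map K X PU FU rU n z'"
    show "z = z'"
    proof (rule cotensor_eqI[OF ct(1) X z])
      fix m \<beta> x assume b: "\<beta> \<in> Delta m n" and x: "x \<in> simplices U m"
      let ?z = "act (Fun K X PU) m n \<beta> z" and ?z' = "act (Fun K X PU) m n \<beta> z'"
      have c: "?z \<in> simplices (Fun K X PU) m" "?z' \<in> simplices (Fun K X PU) m"
        using t X z b by auto
      have "post_map K X PU AU lU m ?z = post_map K X PU AU lU m ?z'"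
        "post_map K X PU FU rU m ?z = post_map K X PU FU rU m ?z'"
        using t X z b a e by auto
      then show "Cmp K X PU P m (pu m x) ?z = Cmp K X PU P m (pu m x) ?z'"
        using base_map_Cmp[OF ct(1,2) bm(1) s(5) X c(1) x] base_map_Cmp[OF ct(1,2) bm(1) s(5) X c(2) x]
          base_map_Cmp[OF ct(1,3) bm(2) s(6) X c(1) x] base_map_Cmp[OF ct(1,3) bm(2) s(6) X c(2) x]
          c X t smap_closed[OF t(3) x] is_pullback_eqI[OF pb X, of "Cmp K X PU P m (pu m x) ?z" m "Cmp K X PU P m (pu m x) ?z'"]
        by auto
    qed
  }
  fix X n a y assume X: "X \<in> Obj K" and ay: "a \<in> simplices (Fun K X AU) n" "y \<in> simplices (Fun K X FU) n"
    and e: "post_map K X AU BU fU n a = post_map K X FU BU qU n y"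
  \<comment> \<open>The two given simplices are transposed to maps out of \<open>?W\<close>,
    combined there through \<open>pb\<close>, and the result is transposed back.\<close>
  let ?W = "sprod (std_simplex n) U"
  let ?a = "transpose_map K U X AU A au n a" and ?y = "transpose_map K U X FU F fu n y"
  have W: "simplicial_set ?W" by (rule simplicial_set_sprod[OF simplicial_set_std_simplex U])
  have aW: "?a \<in> smap ?W (Fun K X A)" by (rule transpose_map_smap[OF U X t(5,4,6) ay(1)])
  have yW: "?y \<in> smap ?W (Fun K X F)" by (rule transpose_map_smap[OF U X t(8,7,9) ay(2)])
  have "post_map K X A B f m (?a m w) = post_map K X F B q m (?y m w)" if w': "w \<in> simplices ?W m" for m w
  proof -
    obtain \<beta> x where w: "w = (\<beta>, x)" "\<beta> \<in> Delta m n" "x \<in> simplices U m" using w' by (cases w) auto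
    have "post_map K X AU BU fU m (act (Fun K X AU) m n \<beta> a) = post_map K X FU BU qU m (act (Fun K X FU) m n \<beta> y)"
      using t X ay w assms e a by simp
    then have "post_map K X A B f m (Cmp K X AU A m (au m x) (act (Fun K X AU) m n \<beta> a))
        = post_map K X F B q m (Cmp K X FU F m (fu m x) (act (Fun K X FU) m n \<beta> y))"
      using base_map_Cmp[OF ct(2,4) bm(3) s(7) X _ w(3), of "act (Fun K X AU) m n \<beta> a"]
        base_map_Cmp[OF ct(3,4) bm(4) s(8) X _ w(3), of "act (Fun K X FU) m n \<beta> y"] t X ay w by simp
    then show ?thesis using w by simp
  qed
  then obtain \<phi> where \<phi>: "\<phi> \<in> smap ?W (Fun K X P)"
    "\<And>m w. w \<in> simplices ?W m \<Longrightarrow> post_map K X P A l m (\<phi> m w) = ?a m w"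
    "\<And>m w. w \<in> simplices ?W m \<Longrightarrow> post_map K X P F r m (\<phi> m w) = ?y m w"
    using is_pullback_smap_ex[OF pb X W aW yW] by blast
  obtain z where z: "z \<in> simplices (Fun K X PU) n"
    "\<And>m \<beta> x. \<lbrakk>\<beta> \<in> Delta m n; x \<in> simplices U m\<rbrakk> \<Longrightarrow> Cmp K X PU P m (pu m x) (act (Fun K X PU) m n \<beta> z) = \<phi> m (\<beta>, x)"
    using cotensor_lift[OF ct(1) X \<phi>(1)] by blast
  have "post_map K X PU AU lU n z = a"
  proof (rule cotensor_eqI[OF ct(2) X])
    fix m \<beta> x assume b: "\<beta> \<in> Delta m n" and x: "x \<in> simplices U m"
    show "Cmp K X AU A m (au m x) (act (Fun K X AU) m n \<beta> (post_map K X PU AU lU n z))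
        = Cmp K X AU A m (au m x) (act (Fun K X AU) m n \<beta> a)"
      using base_map_Cmp[OF ct(1,2) bm(1) s(5) X _ x, of "act (Fun K X PU) m n \<beta> z"] z t X b x a
        \<phi>(2)[of "(\<beta>, x)" m] by simp
  qed (use ay z t X a in auto)
  moreover have "post_map K X PU FU rU n z = y"
  proof (rule cotensor_eqI[OF ct(3) X])
    fix m \<beta> x assume b: "\<beta> \<in> Delta m n" and x: "x \<in> simplices U m"
    show "Cmp K X FU F m (fu m x) (act (Fun K X FU) m n \<beta> (post_map K X PU FU rU n z))
        = Cmp K X FU F m (fu m x) (act (Fun K X FU) m n \<beta> y)"
      using base_map_Cmp[OF ct(1,3) bm(2) s(6) X _ x, of "act (Fun K X PU) m n \<beta> z"] z t X b x a
        \<phi>(3)[of "(\<beta>, x)" m] by simp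
  qed (use ay z t X a in auto)
  ultimately show "\<exists>z\<in>simplices (Fun K X PU) n. post_map K X PU AU lU n z = a \<and> post_map K X PU FU rU n z = y"
    using z(1) by blast
qed (use cotensorD(2)[OF ct(1)] cotensorD(2)[OF ct(2)] cotensorD(2)[OF ct(3)] cotensorD(2)[OF ct(4)] in auto)

end

section \<open>Isofibrations in an infinity-cosmos\<close>

definition empty_sset :: "'a sset" where
  "empty_sset = \<lparr>simplices = (\<lambda>n. {}), act = (\<lambda>_ _ _ _. undefined)\<rparr>"

lemma smap_empty: "smap empty_sset X = {\<lambda>n x. undefined}"
  by (auto simp: smap_def empty_sset_def fun_eq_iff)

lemma empty_sset_simps [simp]: "simplices empty_sset n = {}"
  by (simp add: empty_sset_def)

lemma simplicial_set_empty: "simplicial_set empty_sset"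
  by unfold_locales (auto simp: empty_sset_def)

section \<open>Small sets\<close>

lemma universe_cardinal_Cinfinite: "universe_cardinal \<kappa> \<Longrightarrow> Cinfinite \<kappa>"
  unfolding universe_cardinal_def
  using cinfinite_mono[OF ordLess_imp_ordLeq natLeq_cinfinite] by blast

lemma universe_cardinal_finite:
  assumes "universe_cardinal \<kappa>" "finite A"
  shows "|A| <o \<kappa>"
  by (rule Cfinite_ordLess_Cinfinite)
    (use assms universe_cardinal_Cinfinite in \<open>auto simp: cfinite_def Field_card_of card_of_card_order_on\<close>)

text \<open>An infinite product is as large as its larger factor, and finite sets are small because
  \<kappa> is infinite. This bounds the function complexes of squares.\<close>

lemma universe_cardinal_Times:
  assumes \<kappa>: "universe_cardinal \<kappa>" and A: "|A| <o \<kappa>" and B: "|B| <o \<kappa>"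
  shows "|A \<times> B| <o \<kappa>"
proof (cases "finite (A \<times> B)")
  case True
  then show ?thesis by (rule universe_cardinal_finite[OF \<kappa>])
next
  case False
  then have ne: "A \<noteq> {}" "B \<noteq> {}" by auto
  consider "|A| \<le>o |B|" | "|B| \<le>o |A|"
    using ordLeq_total[OF card_of_Well_order card_of_Well_order] by blast
  then show ?thesis
  proof cases
    case 1
    then have "infinite B" using False card_of_ordLeq_finite[OF 1] by auto
    then have "|A \<times> B| =o |B|" by (rule conjunct2[OF card_of_Times_infinite[OF _ ne(1) 1]])
    then show ?thesis using B by (rule ordIso_ordLess_trans)
  next
    case 2
    then have "infinite A" using False card_of_ordLeq_finite[OF 2] by auto
    then have "|A \<times> B| =o |A|" by (rule conjunct1[OF card_of_Times_infinite[OF _ ne(2) 2]])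
    then show ?thesis using A by (rule ordIso_ordLess_trans)
  qed
qed

lemma small_sset_simplicial: "small_sset \<kappa> U \<Longrightarrow> simplicial_set U"
  by (simp add: small_sset_def)

context simplicial_category
begin

lemma terminal_unique: "\<lbrakk>terminal K T; X \<in> Obj K; z \<in> simplices (Fun K X T) n; z' \<in> simplices (Fun K X T) n\<rbrakk> \<Longrightarrow> z = z'"
  unfolding terminal_def by metis

lemma terminal_arr_ex: "\<lbrakk>terminal K T; X \<in> Obj K\<rbrakk> \<Longrightarrow> \<exists>t. t \<in> arr K X T"
  unfolding terminal_def by metis

text \<open>There is exactly one map out of the empty simplicial set, namely
  \<open>\<lambda>n x. undefined\<close>, so a cotensor with the empty weight is a terminal
  object.\<close>

lemma cotensor_empty:
  assumes T: "terminal K T" and A: "A \<in> Obj K"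
  shows "cotensor K empty_sset A T (\<lambda>n x. undefined)"
proof (rule cotensorI[OF simplicial_set_empty])
  show "T \<in> Obj K" "A \<in> Obj K" using T A by (auto simp: terminal_def)
  show "\<exists>z\<in>simplices (Fun K X T) n. \<forall>m. \<forall>\<beta>\<in>Delta m n. \<forall>x\<in>simplices empty_sset m.
      Cmp K X T A m undefined (act (Fun K X T) m n \<beta> z) = \<phi> m (\<beta>, x)" if "X \<in> Obj K" for X n \<phi>
    using T that unfolding terminal_def by fastforce
qed (use T in \<open>auto simp: smap_empty intro: terminal_unique\<close>)

end

context infinity_cosmos
begin

section \<open>First closure properties of isofibrations\<close>

lemma IsofibD:
  assumes "p \<in> Isofib K A B"
  shows "A \<in> Obj K" "B \<in> Obj K" "p \<in> arr K A B"
  using Isofib_arr[OF assms] by auto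

lemma is_pullback_exists:
  assumes "A \<in> Obj K" "f \<in> arr K A B" "q \<in> Isofib K F B"
  obtains P l r where "is_pullback K P A F B l r f q"
proof -
  obtain P \<pi> where "limit_cone K (cospan A f B q F) P \<pi>"
    using pullback_ex[OF assms] by blast
  then show ?thesis
    using that assms IsofibD[OF assms(3)] by (auto simp: limit_cone_cospan_iff)
qed

lemma is_pullback_Isofib:
  assumes pb: "is_pullback K P A F B l r f q" and q: "q \<in> Isofib K F B"
  shows "l \<in> Isofib K P A"
proof -
  note t = is_pullbackD[OF pb]
  show ?thesis
    using pullback_Isofib[OF t(2,7) q is_pullback_limit_cone[OF pb]] by simp
qed

lemma is_pullback_Isofib':
  assumes "is_pullback K P A F B l r f q" "f \<in> Isofib K A B"
  shows "r \<in> Isofib K P F"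
  using is_pullback_Isofib[OF is_pullback_sym[OF assms(1)] assms(2)] .

lemma small_empty: "small_sset \<kappa> empty_sset"
  by (auto simp: small_sset_def simplicial_set_empty intro: universe_cardinal_finite[OF universe])

text \<open>This is the Leibniz cotensor with the inclusion of the empty simplicial set.\<close>

lemma base_map_Isofib:
  assumes U: "small_sset \<kappa> (U :: 'u sset)" and p: "p \<in> Isofib K E B"
    and ct: "cotensor K U E C u" "cotensor K U B D v" and c: "cotensor_base_map K U E B p C u D v c"
  shows "c \<in> Isofib K C D"
proof -
  obtain T where T: "terminal K T" using terminal_ex by blast
  then have TO: "T \<in> Obj K" by (simp add: terminal_def)
  note t = cotensorD[OF ct(1)] cotensorD[OF ct(2)] IsofibD[OF p]
  obtain d where d: "d \<in> arr K D T" using terminal_arr_ex[OF T t(5)] by blast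
  obtain e where e: "e \<in> arr K C T" using terminal_arr_ex[OF T t(2)] by blast
  have ca: "c \<in> arr K C D" using c by (simp add: cotensor_base_map_def)
  \<comment> \<open>The cotensors of \<open>E\<close> and \<open>B\<close> with the empty weight are
    both \<open>T\<close>; the pullback is therefore \<open>D\<close>, and the induced map into it
    is \<open>c\<close>.\<close>
  let ?i = "\<lambda>n x. undefined" and ?\<pi> = "\<lambda>v. case v of CLeft \<Rightarrow> d | CRight \<Rightarrow> Unit K D | CBase \<Rightarrow> cmp0 K D T T (Unit K T) d"
  have "leibniz_cotensor K empty_sset U ?i E B p C D c"
    unfolding leibniz_cotensor_def
  proof (intro exI conjI)
    show "limit_cone K (cospan T (Unit K T) T d D) D ?\<pi>"
      by (rule is_pullback_limit_cone[OF is_pullback_Unit]) (use t TO d in auto)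
  qed (use T t ct c d TO ca in \<open>auto intro: cotensor_empty simp: cotensor_base_map_def cotensor_weight_map_def\<close>)
  then show ?thesis
    by (intro leibniz_Isofib[OF small_empty U _ _ p]) (auto simp: smap_empty smap_def)
qed

end

section \<open>The simplicial category of isofibrations\<close>

text \<open>The conclusions of \<open>jointly_create_limit\<close> and
  \<open>jointly_create_cotensor\<close> have this shape: once the pair is known to be unique, a
  claim about all such pairs is a claim about the constructed one.\<close>

lemma ex1_pairI:
  assumes "P a b" "\<And>x y. P x y \<Longrightarrow> x = a \<and> y = b" "Q a b"
  shows "(\<exists>!(x, y). P x y) \<and> (\<forall>x y. P x y \<longrightarrow> Q x y)"
proof (intro conjI allI impI)
  show "\<exists>!(x, y). P x y"
  proof (rule ex1I)
    show "case (a, b) of (x, y) \<Rightarrow> P x y" using assms(1) by simp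
    fix z assume "case z of (x, y) \<Rightarrow> P x y"
    then have "P (fst z) (snd z)" by (simp only: case_prod_beta)
    from assms(2)[OF this] show "z = (a, b)" by (simp only: prod_eq_iff fst_conv snd_conv)
  qed
  show "Q x y" if "P x y" for x y
    using conjunct1[OF assms(2)[OF that]] conjunct2[OF assms(2)[OF that]] assms(3) by (simp only:)
qed

text \<open>With projections in place of patterns, objects and squares remain variables and triples
  need not be split.\<close>

abbreviation (input) "dm x \<equiv> fst x"
abbreviation (input) "cd x \<equiv> fst (snd x)"
abbreviation (input) "ar x \<equiv> snd (snd x)"

lemma Obj_arrow: "Obj (arrow_cosmos K) = {(E, A, p). p \<in> Isofib K E A}"
  by (simp add: arrow_cosmos_def)

lemma Obj_arrow_iff: "x \<in> Obj (arrow_cosmos K) \<longleftrightarrow> ar x \<in> Isofib K (dm x) (cd x)"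
  by (simp add: arrow_cosmos_def case_prod_beta)

lemma arrow_Fun_eq: "arrow_Fun K x y = spullback (Fun K (dm x) (dm y)) (Fun K (cd x) (cd y))
    (post_map K (dm x) (dm y) (cd y) (ar y)) (pre_map K (dm x) (cd x) (cd y) (ar x))"
  by (simp add: arrow_Fun_def case_prod_beta)

lemma Fun_arrow: "Fun (arrow_cosmos K) x y = spullback (Fun K (dm x) (dm y)) (Fun K (cd x) (cd y))
    (post_map K (dm x) (dm y) (cd y) (ar y)) (pre_map K (dm x) (cd x) (cd y) (ar x))"
  by (simp add: arrow_cosmos_def arrow_Fun_eq)

lemma Fun_arrow_iff: "z \<in> simplices (Fun (arrow_cosmos K) x y) n \<longleftrightarrow>
    fst z \<in> simplices (Fun K (dm x) (dm y)) n \<and> snd z \<in> simplices (Fun K (cd x) (cd y)) n \<and>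
    post_map K (dm x) (dm y) (cd y) (ar y) n (fst z) = pre_map K (dm x) (cd x) (cd y) (ar x) n (snd z)"
  by (simp add: Fun_arrow simplices_spullback)

lemma act_arrow: "act (Fun (arrow_cosmos K) x y) m n \<alpha> z
    = (act (Fun K (dm x) (dm y)) m n \<alpha> (fst z), act (Fun K (cd x) (cd y)) m n \<alpha> (snd z))"
  by (simp add: Fun_arrow act_spullback)

lemma degen_arrow: "degen (Fun (arrow_cosmos K) x y) n z
    = (degen (Fun K (dm x) (dm y)) n (fst z), degen (Fun K (cd x) (cd y)) n (snd z))"
  by (simp add: degen_def act_arrow)

lemma Cmp_arrow: "Cmp (arrow_cosmos K) x y z n b a
    = (Cmp K (dm x) (dm y) (dm z) n (fst b) (fst a), Cmp K (cd x) (cd y) (cd z) n (snd b) (snd a))"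
  by (simp add: arrow_cosmos_def case_prod_beta)

lemma Unit_arrow: "Unit (arrow_cosmos K) x = (Unit K (dm x), Unit K (cd x))"
  by (simp add: arrow_cosmos_def case_prod_beta)

lemma post_map_arrow:
  assumes "z \<in> simplices (Fun (arrow_cosmos K) x y) n"
  shows "post_map (arrow_cosmos K) x y w f n z
    = (post_map K (dm x) (dm y) (dm w) (fst f) n (fst z), post_map K (cd x) (cd y) (cd w) (snd f) n (snd z))"
  proof -
  have "fst z \<in> simplices (Fun K (dm x) (dm y)) n" "snd z \<in> simplices (Fun K (cd x) (cd y)) n"
    using assms by (auto simp: Fun_arrow_iff)
  then show ?thesis using assms by (simp add: post_map_def Cmp_arrow degen_arrow)
qed

lemma pre_map_arrow:
  assumes "z \<in> simplices (Fun (arrow_cosmos K) y w) n"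
  shows "pre_map (arrow_cosmos K) x y w f n z
    = (pre_map K (dm x) (dm y) (dm w) (fst f) n (fst z), pre_map K (cd x) (cd y) (cd w) (snd f) n (snd z))"
  proof -
  have "fst z \<in> simplices (Fun K (dm y) (dm w)) n" "snd z \<in> simplices (Fun K (cd y) (cd w)) n"
    using assms by (auto simp: Fun_arrow_iff)
  then show ?thesis using assms by (simp add: pre_map_def Cmp_arrow degen_arrow)
qed

lemmas arrow_simps = Fun_arrow_iff act_arrow degen_arrow Cmp_arrow Unit_arrow post_map_arrow pre_map_arrow

lemma FAr_dom: "z \<in> simplices (Fun (arrow_cosmos K) x y) n \<Longrightarrow> FAr (dom_functor K) x y n z = fst z"
  by (simp add: dom_functor_def arrow_cosmos_def case_prod_beta)

lemma FAr_cod: "z \<in> simplices (Fun (arrow_cosmos K) x y) n \<Longrightarrow> FAr (cod_functor K) x y n z = snd z"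
  by (simp add: cod_functor_def arrow_cosmos_def case_prod_beta)

lemma FOb_dom [simp]: "FOb (dom_functor K) x = dm x"
  by (simp add: dom_functor_def case_prod_beta)

lemma FOb_cod [simp]: "FOb (cod_functor K) x = cd x"
  by (simp add: cod_functor_def case_prod_beta)

text \<open>Plain \<open>fst\<close> replaces the restricted action of \<open>dom_functor\<close>,
  which is awkward off the edges; \<open>limit_cone_map_diagram\<close> shows that the limit cones
  are the same.\<close>

definition dom_diagram :: "('v, 'o \<times> 'o \<times> 'a, 'a \<times> 'a) diagram \<Rightarrow> ('v, 'o, 'a) diagram" where
  "dom_diagram D = \<lparr>Vert = Vert D, Edge = Edge D, Ob = (\<lambda>v. dm (Ob D v)), Ar = (\<lambda>v w. fst (Ar D v w))\<rparr>"

definition cod_diagram :: "('v, 'o \<times> 'o \<times> 'a, 'a \<times> 'a) diagram \<Rightarrow> ('v, 'o, 'a) diagram" where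
  "cod_diagram D = \<lparr>Vert = Vert D, Edge = Edge D, Ob = (\<lambda>v. cd (Ob D v)), Ar = (\<lambda>v w. snd (Ar D v w))\<rparr>"

lemma dom_diagram_simps [simp]:
  "Vert (dom_diagram D) = Vert D" "Edge (dom_diagram D) = Edge D"
  "Ob (dom_diagram D) v = dm (Ob D v)" "Ar (dom_diagram D) v w = fst (Ar D v w)"
  by (simp_all add: dom_diagram_def)

lemma cod_diagram_simps [simp]:
  "Vert (cod_diagram D) = Vert D" "Edge (cod_diagram D) = Edge D"
  "Ob (cod_diagram D) v = cd (Ob D v)" "Ar (cod_diagram D) v w = snd (Ar D v w)"
  by (simp_all add: cod_diagram_def)

text \<open>The one condition that depends on the shape of the diagram. The comparison
  \<open>h\<close> between the two limits always exists as an arrow and is unique, but it is an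
  object of the arrow cosmos only if it is an isofibration.\<close>

definition isofib_limits :: "('o, 'a) cosmos \<Rightarrow> ('v, 'o \<times> 'o \<times> 'a, 'a \<times> 'a) diagram \<Rightarrow> bool" where
  "isofib_limits K D \<longleftrightarrow> (\<forall>M \<mu> N \<nu> h. limit_cone K (dom_diagram D) M \<mu> \<longrightarrow> limit_cone K (cod_diagram D) N \<nu> \<longrightarrow>
    h \<in> arr K M N \<longrightarrow> (\<forall>v\<in>Vert D. cmp0 K M N (cd (Ob D v)) (\<nu> v) h
      = cmp0 K M (dm (Ob D v)) (cd (Ob D v)) (ar (Ob D v)) (\<mu> v)) \<longrightarrow> h \<in> Isofib K M N)"

context infinity_cosmos
begin

abbreviation (input) "K2 \<equiv> arrow_cosmos K"

lemma Obj_arrowD: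
  assumes "x \<in> Obj (arrow_cosmos K)"
  shows "dm x \<in> Obj K" "cd x \<in> Obj K" "ar x \<in> arr K (dm x) (cd x)" "ar x \<in> Isofib K (dm x) (cd x)"
  using assms IsofibD unfolding Obj_arrow_iff by auto

lemma Cmp_arrow_closed:
  assumes o: "x \<in> Obj K2" "y \<in> Obj K2" "z \<in> Obj K2"
    and f: "f \<in> simplices (Fun K2 x y) n" and g: "g \<in> simplices (Fun K2 y z) n"
  shows "Cmp K2 x y z n g f \<in> simplices (Fun K2 x z) n"
proof -
  note t = Obj_arrowD[OF o(1)] Obj_arrowD[OF o(2)] Obj_arrowD[OF o(3)]
  have ff: "fst f \<in> simplices (Fun K (dm x) (dm y)) n" "snd f \<in> simplices (Fun K (cd x) (cd y)) n"
     "post_map K (dm x) (dm y) (cd y) (ar y) n (fst f) = pre_map K (dm x) (cd x) (cd y) (ar x) n (snd f)"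
    using f by (auto simp: Fun_arrow_iff)
  have gg: "fst g \<in> simplices (Fun K (dm y) (dm z)) n" "snd g \<in> simplices (Fun K (cd y) (cd z)) n"
     "post_map K (dm y) (dm z) (cd z) (ar z) n (fst g) = pre_map K (dm y) (cd y) (cd z) (ar y) n (snd g)"
    using g by (auto simp: Fun_arrow_iff)
  have "post_map K (dm x) (dm z) (cd z) (ar z) n (Cmp K (dm x) (dm y) (dm z) n (fst g) (fst f))
      = Cmp K (dm x) (dm y) (cd z) n (pre_map K (dm y) (cd y) (cd z) (ar y) n (snd g)) (fst f)"
    using t ff gg by (simp add: post_Cmp)
  also have "\<dots> = Cmp K (dm x) (cd y) (cd z) n (snd g) (pre_map K (dm x) (cd x) (cd y) (ar x) n (snd f))"
    using t ff(1,2) gg(1,2) by (simp add: Cmp_post[symmetric] ff(3))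
  also have "\<dots> = pre_map K (dm x) (cd x) (cd z) (ar x) n (Cmp K (cd x) (cd y) (cd z) n (snd g) (snd f))"
    using t ff(1,2) gg(1,2) by (simp add: pre_Cmp)
  finally show ?thesis
    using t ff(1,2) gg(1,2) by (simp add: Fun_arrow_iff Cmp_arrow)
qed

lemma simplicial_category_arrow: "simplicial_category (arrow_cosmos K)"
proof (rule simplicial_category.intro, goal_cases)
  case (1 x y)
  then show ?case
    unfolding Fun_arrow using Obj_arrowD[OF 1(1)] Obj_arrowD[OF 1(2)]
    by (intro simplicial_set_spullback[OF _ _ post_smap pre_smap] Fun_simplicial_set) auto
next
  case 2
  then show ?case by (rule Cmp_arrow_closed)
next
  case (3 x y z \<alpha> m n f g)
  then show ?case
    using Obj_arrowD[OF 3(1)] Obj_arrowD[OF 3(2)] Obj_arrowD[OF 3(3)]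
    by (auto simp: Fun_arrow_iff Cmp_arrow act_arrow Cmp_act)
next
  case (4 x y z w f n g h)
  then show ?case
    using Obj_arrowD[OF 4(1)] Obj_arrowD[OF 4(2)] Obj_arrowD[OF 4(3)] Obj_arrowD[OF 4(4)]
    by (auto simp: Fun_arrow_iff Cmp_arrow Cmp_assoc)
next
  case (5 x)
  then show ?case
    using Obj_arrowD[OF 5] by (simp add: Fun_arrow_iff Unit_arrow post_map_0 pre_map_0)
next
  case (6 x y f n)
  then show ?case
    using Obj_arrowD[OF 6(1)] Obj_arrowD[OF 6(2)]
    by (simp add: Fun_arrow_iff Unit_arrow Cmp_arrow degen_arrow Unit_left)
next
  case (7 x y f n)
  then show ?case
    using Obj_arrowD[OF 7(1)] Obj_arrowD[OF 7(2)]
    by (simp add: Fun_arrow_iff Unit_arrow Cmp_arrow degen_arrow Unit_right)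
qed

end

text \<open>All that was shown about limits, cotensors and their uniqueness in simplicial categories
  becomes available for squares under the prefix \<open>arrow\<close>.\<close>

sublocale infinity_cosmos \<subseteq> arrow: simplicial_category "arrow_cosmos K"
  by (rule simplicial_category_arrow)

context infinity_cosmos
begin

lemma arr_arrow_iff:
  assumes "x \<in> Obj K2" "y \<in> Obj K2"
  shows "m \<in> arr K2 x y \<longleftrightarrow> fst m \<in> arr K (dm x) (dm y) \<and> snd m \<in> arr K (cd x) (cd y) \<and>
    cmp0 K (dm x) (dm y) (cd y) (ar y) (fst m) = cmp0 K (dm x) (cd x) (cd y) (snd m) (ar x)"
  using Obj_arrowD[OF assms(1)] Obj_arrowD[OF assms(2)]
  by (auto simp: Fun_arrow_iff post_map_0 pre_map_0)

section \<open>Objectwise limits of isofibrations\<close>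

lemma wf_dom_diagram:
  assumes "wf_diagram K2 D"
  shows "wf_diagram K (dom_diagram D)"
  unfolding wf_diagram_def using wf_diagramD[OF assms] Obj_arrowD by (auto simp: Fun_arrow_iff)

lemma wf_cod_diagram:
  assumes "wf_diagram K2 D"
  shows "wf_diagram K (cod_diagram D)"
  unfolding wf_diagram_def using wf_diagramD[OF assms] Obj_arrowD by (auto simp: Fun_arrow_iff)

text \<open>The edges of \<open>D\<close> are commutative squares, so the composites of
  \<open>\<mu> v\<close> with the isofibrations \<open>ar (Ob D v)\<close> form a cone over the
  codomains, and \<open>N\<close> is universal for it.\<close>

lemma limit_comparison_ex:
  assumes wf: "wf_diagram K2 D"
    and M: "limit_cone K (dom_diagram D) M \<mu>" and N: "limit_cone K (cod_diagram D) N \<nu>"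
  obtains h where "h \<in> arr K M N" "\<And>v. v \<in> Vert D \<Longrightarrow>
    cmp0 K M N (cd (Ob D v)) (\<nu> v) h = cmp0 K M (dm (Ob D v)) (cd (Ob D v)) (ar (Ob D v)) (\<mu> v)"
proof -
  note w = wf_diagramD[OF wf]
  note m = limit_cone_wfD[OF wf_dom_diagram[OF wf] M, simplified] and k = limit_cone_wfD[OF wf_cod_diagram[OF wf] N, simplified]
  let ?x = "\<lambda>v. cmp0 K M (dm (Ob D v)) (cd (Ob D v)) (ar (Ob D v)) (\<mu> v)"
  have x: "?x v \<in> arr K M (Ob (cod_diagram D) v)" if "v \<in> Vert (cod_diagram D)" for v
    using that m Obj_arrowD[OF w(1)] by simp
  have e: "cmp0 K M (Ob (cod_diagram D) v) (Ob (cod_diagram D) u) (Ar (cod_diagram D) v u) (?x v) = ?x u"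
    if "(v, u) \<in> Edge (cod_diagram D)" for v u
  proof -
    have vu: "(v, u) \<in> Edge D" using that by simp
    note t = Obj_arrowD[OF w(1)[OF w(2)[OF vu]]] Obj_arrowD[OF w(1)[OF w(3)[OF vu]]]
    have a: "fst (Ar D v u) \<in> arr K (dm (Ob D v)) (dm (Ob D u))" "snd (Ar D v u) \<in> arr K (cd (Ob D v)) (cd (Ob D u))"
      "cmp0 K (dm (Ob D v)) (dm (Ob D u)) (cd (Ob D u)) (ar (Ob D u)) (fst (Ar D v u))
       = cmp0 K (dm (Ob D v)) (cd (Ob D v)) (cd (Ob D u)) (snd (Ar D v u)) (ar (Ob D v))"
      using w(4)[OF vu] arr_arrow_iff[OF w(1)[OF w(2)[OF vu]] w(1)[OF w(3)[OF vu]]] by auto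
    show ?thesis
      using t a m(1) m(2)[OF w(2)[OF vu]] m(3)[OF vu, symmetric]
      Cmp_assoc[of M "dm (Ob D v)" "cd (Ob D v)" "cd (Ob D u)" "\<mu> v" 0 "ar (Ob D v)" "snd (Ar D v u)"]
      Cmp_assoc[of M "dm (Ob D v)" "dm (Ob D u)" "cd (Ob D u)" "\<mu> v" 0 "fst (Ar D v u)" "ar (Ob D u)"]
      by simp
  qed
  obtain h where "h \<in> arr K M N" "\<And>v. v \<in> Vert (cod_diagram D) \<Longrightarrow> cmp0 K M N (Ob (cod_diagram D) v) (\<nu> v) h = ?x v"
    using limit_cone_arr_ex[OF wf_cod_diagram[OF wf] N m(1) x e] by blast
  then show ?thesis using that[of h] by simp
qed

lemma limit_comparison_unique:
  assumes wf: "wf_diagram K2 D" and M: "M \<in> Obj K" and N: "limit_cone K (cod_diagram D) N \<nu>"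
    and h: "h \<in> arr K M N" "h' \<in> arr K M N" "\<And>v. v \<in> Vert D \<Longrightarrow>
      cmp0 K M N (cd (Ob D v)) (\<nu> v) h = cmp0 K M N (cd (Ob D v)) (\<nu> v) h'"
  shows "h = h'"
  by (rule limit_cone_arr_eqI[OF wf_cod_diagram[OF wf] N M h(1,2)]) (use h(3) in simp)

text \<open>Function complexes of squares are pullbacks of function complexes of \<open>K\<close>,
  and limits commute with pullbacks: domain and codomain components are lifted separately.\<close>

lemma limit_cone_arrow:
  assumes wf: "wf_diagram K2 D"
    and M: "limit_cone K (dom_diagram D) M \<mu>" and N: "limit_cone K (cod_diagram D) N \<nu>"
    and h: "h \<in> Isofib K M N" "\<And>v. v \<in> Vert D \<Longrightarrow>
      cmp0 K M N (cd (Ob D v)) (\<nu> v) h = cmp0 K M (dm (Ob D v)) (cd (Ob D v)) (ar (Ob D v)) (\<mu> v)"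
    and \<pi>: "\<And>v. v \<in> Vert D \<Longrightarrow> \<pi> v = (\<mu> v, \<nu> v)" "\<And>v. v \<notin> Vert D \<Longrightarrow> \<pi> v = undefined"
  shows "limit_cone K2 D (M, N, h) \<pi>"
proof (rule arrow.limit_coneI[OF wf])
  note w = wf_diagramD[OF wf] and w1 = Obj_arrowD[OF wf_diagramD(1)[OF wf]]
  note m = limit_cone_wfD[OF wf_dom_diagram[OF wf] M, simplified] and k = limit_cone_wfD[OF wf_cod_diagram[OF wf] N, simplified]
  note hD = IsofibD[OF h(1)]
  show L: "(M, N, h) \<in> Obj K2" using h(1) by (simp add: Obj_arrow_iff)
  show \<pi>a: "\<pi> v \<in> arr K2 (M, N, h) (Ob D v)" if "v \<in> Vert D" for v
    using that m k w1 h hD \<pi> by (simp add: arr_arrow_iff[OF L w(1)])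
  show "cmp0 K2 (M, N, h) (Ob D v) (Ob D u) (Ar D v u) (\<pi> v) = \<pi> u" if "(v, u) \<in> Edge D" for v u
    using m(3)[OF that] k(3)[OF that] \<pi>(1)[OF w(2)[OF that]] \<pi>(1)[OF w(3)[OF that]] by (simp add: Cmp_arrow)
  show "z = z'" if X: "X \<in> Obj K2" and z: "z \<in> simplices (Fun K2 X (M, N, h)) n" "z' \<in> simplices (Fun K2 X (M, N, h)) n"
    and e: "\<And>v. v \<in> Vert D \<Longrightarrow> post_map K2 X (M, N, h) (Ob D v) (\<pi> v) n z = post_map K2 X (M, N, h) (Ob D v) (\<pi> v) n z'"
    for X n z z'
  proof (rule prod_eqI)
    note XD = Obj_arrowD[OF X]
    show "fst z = fst z'"
      by (rule limit_cone_eqI[OF wf_dom_diagram[OF wf] M XD(1)])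
        (use z e \<pi> in \<open>auto simp: post_map_arrow[OF z(1)] post_map_arrow[OF z(2)] Fun_arrow_iff\<close>)
    show "snd z = snd z'"
      by (rule limit_cone_eqI[OF wf_cod_diagram[OF wf] N XD(2)])
        (use z e \<pi> in \<open>auto simp: post_map_arrow[OF z(1)] post_map_arrow[OF z(2)] Fun_arrow_iff\<close>)
  qed
  fix X n x assume X: "X \<in> Obj K2" and x: "\<And>v. v \<in> Vert D \<Longrightarrow> x v \<in> simplices (Fun K2 X (Ob D v)) n"
    and xe: "\<And>v u. (v, u) \<in> Edge D \<Longrightarrow> post_map K2 X (Ob D v) (Ob D u) (Ar D v u) n (x v) = x u"
  note XD = Obj_arrowD[OF X]
  have x': "fst (x v) \<in> simplices (Fun K (dm X) (dm (Ob D v))) n" "snd (x v) \<in> simplices (Fun K (cd X) (cd (Ob D v))) n"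
    "post_map K (dm X) (dm (Ob D v)) (cd (Ob D v)) (ar (Ob D v)) n (fst (x v))
      = pre_map K (dm X) (cd X) (cd (Ob D v)) (ar X) n (snd (x v))" if "v \<in> Vert D" for v
    using x[OF that] by (auto simp: Fun_arrow_iff)
  have e': "post_map K (dm X) (dm (Ob D v)) (dm (Ob D u)) (fst (Ar D v u)) n (fst (x v)) = fst (x u)"
    "post_map K (cd X) (cd (Ob D v)) (cd (Ob D u)) (snd (Ar D v u)) n (snd (x v)) = snd (x u)"
    if "(v, u) \<in> Edge D" for v u
    using xe[OF that, symmetric] post_map_arrow[OF x[OF w(2)[OF that]]] by auto
  obtain z0 where z0: "z0 \<in> simplices (Fun K (dm X) M) n"
    "\<And>v. v \<in> Vert D \<Longrightarrow> post_map K (dm X) M (dm (Ob D v)) (\<mu> v) n z0 = fst (x v)"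
    using limit_cone_ex[OF M XD(1), of "\<lambda>v. fst (x v)" n] x' e' w(2,3) by auto
  obtain z1 where z1: "z1 \<in> simplices (Fun K (cd X) N) n"
    "\<And>v. v \<in> Vert D \<Longrightarrow> post_map K (cd X) N (cd (Ob D v)) (\<nu> v) n z1 = snd (x v)"
    using limit_cone_ex[OF N XD(2), of "\<lambda>v. snd (x v)" n] x' e' w(2,3) by auto
  \<comment> \<open>That the two lifts form a square is tested after each leg of the limit of the
    codomains, where it reduces to the squares \<open>x v\<close>.\<close>
  have "post_map K (dm X) M N h n z0 = pre_map K (dm X) (cd X) N (ar X) n z1"
  proof (rule limit_cone_eqI[OF wf_cod_diagram[OF wf] N XD(1)])
    fix v assume "v \<in> Vert (cod_diagram D)"
    then have v: "v \<in> Vert D" by simp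
    have "post_map K (dm X) N (cd (Ob D v)) (\<nu> v) n (post_map K (dm X) M N h n z0)
        = post_map K (dm X) (dm (Ob D v)) (cd (Ob D v)) (ar (Ob D v)) n (post_map K (dm X) M (dm (Ob D v)) (\<mu> v) n z0)"
      by (rule post_post_eq) (use h(2)[OF v] XD m(1,2) k(1,2) w1 hD z0 v w(1) in auto)
    also have "\<dots> = pre_map K (dm X) (cd X) (cd (Ob D v)) (ar X) n (post_map K (cd X) N (cd (Ob D v)) (\<nu> v) n z1)"
      using z0(2)[OF v] x'(3)[OF v] z1(2)[OF v] by simp
    finally show "post_map K (dm X) N (Ob (cod_diagram D) v) (\<nu> v) n (post_map K (dm X) M N h n z0)
        = post_map K (dm X) N (Ob (cod_diagram D) v) (\<nu> v) n (pre_map K (dm X) (cd X) N (ar X) n z1)"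
      using post_pre[of "dm X" "cd X" N "cd (Ob D v)" "ar X" "\<nu> v" z1 n] XD k(1) k(2)[OF v] w1[OF v] z1(1) by simp
  qed (use XD hD z0 z1 in auto)
  then have z: "(z0, z1) \<in> simplices (Fun K2 X (M, N, h)) n"
    using z0 z1 by (simp add: Fun_arrow_iff)
  show "\<exists>z\<in>simplices (Fun K2 X (M, N, h)) n. \<forall>v\<in>Vert D. post_map K2 X (M, N, h) (Ob D v) (\<pi> v) n z = x v"
    by (rule bexI[OF _ z]) (use z0 z1 \<pi> in \<open>auto simp: post_map_arrow[OF z]\<close>)
qed (use \<pi> in auto)

lemma limit_cone_arrow_ex:
  assumes wf: "wf_diagram K2 D" and il: "isofib_limits K D"
    and M: "limit_cone K (dom_diagram D) M \<mu>" and N: "limit_cone K (cod_diagram D) N \<nu>"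
  shows "\<exists>L \<pi>. limit_cone K2 D L \<pi>"
proof -
  obtain h where h: "h \<in> arr K M N" "\<And>v. v \<in> Vert D \<Longrightarrow>
    cmp0 K M N (cd (Ob D v)) (\<nu> v) h = cmp0 K M (dm (Ob D v)) (cd (Ob D v)) (ar (Ob D v)) (\<mu> v)"
    using limit_comparison_ex[OF wf M N] by blast
  then have "h \<in> Isofib K M N"
    using il M N unfolding isofib_limits_def by blast
  from limit_cone_arrow[OF wf M N this h(2), of "\<lambda>v\<in>Vert D. (\<mu> v, \<nu> v)"] show ?thesis by auto
qed

text \<open>An arbitrary limit cone of squares is isomorphic to the one built from \<open>M\<close>
  and \<open>N\<close>, and an isomorphism of squares is an isomorphism in both components. Through
  it the projections of the given cone become limit cones; this is why \<open>M\<close> and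
  \<open>N\<close> appear among the hypotheses.\<close>

lemma limit_cone_arrow_components:
  assumes wf: "wf_diagram K2 D" and il: "isofib_limits K D"
    and M: "limit_cone K (dom_diagram D) M \<mu>" and N: "limit_cone K (cod_diagram D) N \<nu>"
    and L: "limit_cone K2 D L \<pi>"
  shows "limit_cone K (dom_diagram D) (dm L) (\<lambda>v\<in>Vert D. fst (\<pi> v))"
    and "limit_cone K (cod_diagram D) (cd L) (\<lambda>v\<in>Vert D. snd (\<pi> v))"
proof -
  obtain h where h: "h \<in> arr K M N" "\<And>v. v \<in> Vert D \<Longrightarrow>
    cmp0 K M N (cd (Ob D v)) (\<nu> v) h = cmp0 K M (dm (Ob D v)) (cd (Ob D v)) (ar (Ob D v)) (\<mu> v)"
    using limit_comparison_ex[OF wf M N] by blast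
  then have hi: "h \<in> Isofib K M N"
    using il M N unfolding isofib_limits_def by blast
  let ?\<pi> = "\<lambda>v\<in>Vert D. (\<mu> v, \<nu> v)"
  have lim: "limit_cone K2 D (M, N, h) ?\<pi>"
    by (rule limit_cone_arrow[OF wf M N hi h(2)]) auto
  obtain \<theta> where \<theta>: "isomorphism K2 L (M, N, h) \<theta>"
    "\<And>v. v \<in> Vert D \<Longrightarrow> cmp0 K2 L (M, N, h) (Ob D v) (?\<pi> v) \<theta> = \<pi> v"
    using arrow.limit_cone_unique[OF wf L lim] by blast
  have iso: "isomorphism K (dm L) M (fst \<theta>)" "isomorphism K (cd L) N (snd \<theta>)"
    using \<theta>(1) IsofibD[OF hi] Obj_arrowD[of L]
    by (auto simp: isomorphism_def Cmp_arrow Unit_arrow Fun_arrow_iff)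
  have e: "cmp0 K (dm L) M (dm (Ob D v)) (\<mu> v) (fst \<theta>) = fst (\<pi> v)"
    "cmp0 K (cd L) N (cd (Ob D v)) (\<nu> v) (snd \<theta>) = snd (\<pi> v)" if "v \<in> Vert D" for v
    using \<theta>(2)[OF that, symmetric] that by (auto simp: Cmp_arrow)
  show "limit_cone K (dom_diagram D) (dm L) (\<lambda>v\<in>Vert D. fst (\<pi> v))"
    by (rule limit_cone_transport[OF wf_dom_diagram[OF wf] M iso(1)]) (use e in auto)
  show "limit_cone K (cod_diagram D) (cd L) (\<lambda>v\<in>Vert D. snd (\<pi> v))"
    by (rule limit_cone_transport[OF wf_cod_diagram[OF wf] N iso(2)]) (use e in auto)
qed

lemma limit_cone_map_diagram:
  assumes wf: "wf_diagram K2 D"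
  shows "limit_cone K (map_diagram (dom_functor K) D) = limit_cone K (dom_diagram D)"
    and "limit_cone K (map_diagram (cod_functor K) D) = limit_cone K (cod_diagram D)"
  by (intro ext limit_cone_cong wf_dom_diagram[OF wf] wf_cod_diagram[OF wf];
      use wf_diagramD[OF wf] in \<open>simp add: map_diagram_def FAr_dom FAr_cod\<close>)+

text \<open>A cone over the given limit cones has vertex \<open>(M, N, c)\<close> for some
  \<open>c\<close>. Its legs being squares, \<open>c\<close> satisfies the equations that
  characterize the comparison \<open>h\<close>; strict uniqueness is thus the uniqueness of arrows
  into \<open>N\<close>.\<close>

lemma jointly_create_limit_arrow:
  assumes wf: "wf_diagram K2 D" and il: "isofib_limits K D"
  shows "jointly_create_limit K2 K (dom_functor K) (cod_functor K) D"
  unfolding jointly_create_limit_def limit_cone_map_diagram[OF wf]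
proof (intro allI impI)
  fix M \<mu> N \<nu> assume "limit_cone K (dom_diagram D) M \<mu> \<and> limit_cone K (cod_diagram D) N \<nu>"
  then have M: "limit_cone K (dom_diagram D) M \<mu>" and N: "limit_cone K (cod_diagram D) N \<nu>" by auto
  note w = wf_diagramD[OF wf] and w1 = Obj_arrowD[OF wf_diagramD(1)[OF wf]]
  note m = limit_cone_wfD[OF wf_dom_diagram[OF wf] M, simplified] and k = limit_cone_wfD[OF wf_cod_diagram[OF wf] N, simplified]
  obtain h where h: "h \<in> arr K M N" "\<And>v. v \<in> Vert D \<Longrightarrow>
    cmp0 K M N (cd (Ob D v)) (\<nu> v) h = cmp0 K M (dm (Ob D v)) (cd (Ob D v)) (ar (Ob D v)) (\<mu> v)"
    using limit_comparison_ex[OF wf M N] by blast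
  then have hi: "h \<in> Isofib K M N"
    using il M N unfolding isofib_limits_def by blast
  let ?\<pi> = "\<lambda>v\<in>Vert D. (\<mu> v, \<nu> v)"
  have lim: "limit_cone K2 D (M, N, h) ?\<pi>"
    by (rule limit_cone_arrow[OF wf M N hi h(2)]) auto
  let ?P = "\<lambda>C \<pi>. cone K2 D C \<pi> \<and> cone_lies_over (dom_functor K) D C \<pi> M \<mu> \<and> cone_lies_over (cod_functor K) D C \<pi> N \<nu>"
  have c: "cone K2 D (M, N, h) ?\<pi>" using lim by (simp add: limit_cone_def)
  then have ex: "?P (M, N, h) ?\<pi>"
    by (auto simp: cone_lies_over_def cone_def PiE_iff FAr_dom FAr_cod)
  have uniq: "C = (M, N, h) \<and> \<pi> = ?\<pi>" if P: "?P C \<pi>" for C \<pi>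
  proof -
    have CO: "C \<in> Obj K2" using P by (simp add: cone_def)
    have \<pi>a: "\<pi> v \<in> arr K2 C (Ob D v)" if "v \<in> Vert D" for v
      using P that by (auto simp: cone_def PiE_iff)
    have \<pi>e: "\<pi> v = (\<mu> v, \<nu> v)" if "v \<in> Vert D" for v
      using P that FAr_dom[OF \<pi>a[OF that]] FAr_cod[OF \<pi>a[OF that]] by (simp add: cone_lies_over_def prod_eq_iff)
    obtain c where C: "C = (M, N, c)" using P by (cases C) (auto simp: cone_lies_over_def)
    have ca: "c \<in> arr K M N" using Obj_arrowD(3)[OF CO] C by simp
    have "cmp0 K M N (cd (Ob D v)) (\<nu> v) c = cmp0 K M N (cd (Ob D v)) (\<nu> v) h" if "v \<in> Vert D" for v
      using \<pi>a[OF that, unfolded C \<pi>e[OF that]] h(2)[OF that]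
        arr_arrow_iff[OF CO[unfolded C] w(1)[OF that], of "(\<mu> v, \<nu> v)"] by simp
    then have "c = h"
      by (rule limit_comparison_unique[OF wf m(1) N ca h(1)])
    moreover have "\<pi> = ?\<pi>"
    proof
      fix v show "\<pi> v = ?\<pi> v"
        using P \<pi>e by (cases "v \<in> Vert D") (auto simp: cone_def PiE_iff extensional_def)
    qed
    ultimately show ?thesis using C by simp
  qed
  show "(\<exists>!(C, \<pi>). ?P C \<pi>) \<and> (\<forall>C \<pi>. ?P C \<pi> \<longrightarrow> limit_cone K2 D C \<pi>)"
    by (rule ex1_pairI[of ?P "(M, N, h)" ?\<pi> "\<lambda>C \<pi>. limit_cone K2 D C \<pi>", OF ex uniq lim])
qed

section \<open>Objectwise cotensors of isofibrations\<close>

lemma cotensor_arrow: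
  assumes U: "simplicial_set U" and x: "x \<in> Obj K2"
    and M: "cotensor K U (dm x) M \<mu>" and N: "cotensor K U (cd x) N \<nu>"
    and h: "h \<in> Isofib K M N" "cotensor_base_map K U (dm x) (cd x) (ar x) M \<mu> N \<nu> h"
  shows "cotensor K2 U x (M, N, h) (\<lambda>n. \<lambda>s\<in>simplices U n. (\<mu> n s, \<nu> n s))" (is "cotensor _ _ _ ?C ?u")
proof (rule arrow.cotensorI[OF U])
  note t = Obj_arrowD[OF x] IsofibD[OF h(1)]
  note m = cotensorD[OF M] and k = cotensorD[OF N]
  have hb: "pre_map K M N (cd x) h n (\<nu> n s) = post_map K M (dm x) (cd x) (ar x) n (\<mu> n s)" if "s \<in> simplices U n" for n s
    using h(2) that by (simp add: cotensor_base_map_def)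
  show C: "?C \<in> Obj K2" "x \<in> Obj K2" using h(1) x by (auto simp: Obj_arrow_iff)
  show u: "?u \<in> smap U (Fun K2 ?C x)"
    by (rule smap_restrictI[OF U])
      (use m k hb in \<open>auto simp: arrow_simps smap_act intro: smap_closed\<close>)
  show "z = z'" if X: "X \<in> Obj K2" and z: "z \<in> simplices (Fun K2 X ?C) n" "z' \<in> simplices (Fun K2 X ?C) n"
    and e: "\<And>m \<beta> s. \<lbrakk>\<beta> \<in> Delta m n; s \<in> simplices U m\<rbrakk> \<Longrightarrow> Cmp K2 X ?C x m (?u m s) (act (Fun K2 X ?C) m n \<beta> z)
      = Cmp K2 X ?C x m (?u m s) (act (Fun K2 X ?C) m n \<beta> z')" for X n z z'
  proof (rule prod_eqI)
    note XD = Obj_arrowD[OF X]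
    show "fst z = fst z'"
      by (rule cotensor_eqI[OF M XD(1)]) (use z e in \<open>auto simp: arrow_simps\<close>)
    show "snd z = snd z'"
      by (rule cotensor_eqI[OF N XD(2)]) (use z e in \<open>auto simp: arrow_simps\<close>)
  qed
  fix X n \<phi> assume X: "X \<in> Obj K2" and \<phi>: "\<phi> \<in> smap (sprod (std_simplex n) U) (Fun K2 X x)"
  note XD = Obj_arrowD[OF X]
  let ?W = "sprod (std_simplex n) U"
  have W: "simplicial_set ?W" by (rule simplicial_set_sprod[OF simplicial_set_std_simplex U])
  note \<phi>' = \<phi>[unfolded Fun_arrow]
  note \<phi>0 = spullback_smap_fst[OF W \<phi>'] and \<phi>1 = spullback_smap_snd[OF W \<phi>']
  obtain z0 where z0: "z0 \<in> simplices (Fun K (dm X) M) n" "\<And>m \<beta> s. \<lbrakk>\<beta> \<in> Delta m n; s \<in> simplices U m\<rbrakk> \<Longrightarrow>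
      Cmp K (dm X) M (dm x) m (\<mu> m s) (act (Fun K (dm X) M) m n \<beta> z0) = fst (\<phi> m (\<beta>, s))"
    using cotensor_lift[OF M XD(1) \<phi>0] by (auto simp del: simplices_std_simplex simp: simplices_std_simplex)
  obtain z1 where z1: "z1 \<in> simplices (Fun K (cd X) N) n" "\<And>m \<beta> s. \<lbrakk>\<beta> \<in> Delta m n; s \<in> simplices U m\<rbrakk> \<Longrightarrow>
      Cmp K (cd X) N (cd x) m (\<nu> m s) (act (Fun K (cd X) N) m n \<beta> z1) = snd (\<phi> m (\<beta>, s))"
    using cotensor_lift[OF N XD(2) \<phi>1] by auto
  \<comment> \<open>As for limits, the components are lifted separately, and they form a square
    because this can be tested against the universal element of \<open>N\<close>.\<close>
  have "post_map K (dm X) M N h n z0 = pre_map K (dm X) (cd X) N (ar X) n z1"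
  proof (rule cotensor_eqI[OF N XD(1)])
    fix m \<beta> s assume b: "\<beta> \<in> Delta m n" and s: "s \<in> simplices U m"
    have "\<phi> m (\<beta>, s) \<in> simplices (Fun K2 X x) m" by (rule smap_closed[OF \<phi>]) (use b s in auto)
    then have "post_map K (dm X) (dm x) (cd x) (ar x) m (fst (\<phi> m (\<beta>, s)))
        = pre_map K (dm X) (cd X) (cd x) (ar X) m (snd (\<phi> m (\<beta>, s)))" by (simp add: Fun_arrow_iff)
    then show "Cmp K (dm X) N (cd x) m (\<nu> m s) (act (Fun K (dm X) N) m n \<beta> (post_map K (dm X) M N h n z0))
        = Cmp K (dm X) N (cd x) m (\<nu> m s) (act (Fun K (dm X) N) m n \<beta> (pre_map K (dm X) (cd X) N (ar X) n z1))"
      using base_map_Cmp[OF M N h(2) t(3) XD(1) _ s, of "act (Fun K (dm X) M) m n \<beta> z0"] z0 z1 b s t XD m k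
        smap_closed[OF k(3) s] pre_Cmp[of "dm X" "cd X" N "cd x" "ar X" "act (Fun K (cd X) N) m n \<beta> z1" m "\<nu> m s"]
      by simp
  qed (use XD t z0 z1 m k in auto)
  then have z: "(z0, z1) \<in> simplices (Fun K2 X ?C) n"
    using z0 z1 by (simp add: Fun_arrow_iff)
  show "\<exists>z\<in>simplices (Fun K2 X ?C) n. \<forall>m. \<forall>\<beta>\<in>Delta m n. \<forall>s\<in>simplices U m.
      Cmp K2 X ?C x m (?u m s) (act (Fun K2 X ?C) m n \<beta> z) = \<phi> m (\<beta>, s)"
    by (rule bexI[OF _ z]) (use z0 z1 in \<open>simp add: Cmp_arrow act_arrow\<close>)
qed

text \<open>Cotensors of isofibrations are isofibrations, so the counterpart of
  \<open>isofib_limits\<close> holds for every small weight.\<close>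

lemma cotensor_arrow_comparison:
  assumes U: "small_sset \<kappa> (U :: 'u sset)" and x: "x \<in> Obj K2"
    and M: "cotensor K U (dm x) M \<mu>" and N: "cotensor K U (cd x) N \<nu>"
  obtains h where "h \<in> Isofib K M N" "cotensor_base_map K U (dm x) (cd x) (ar x) M \<mu> N \<nu> h"
proof -
  note t = Obj_arrowD[OF x]
  obtain h where "cotensor_base_map K U (dm x) (cd x) (ar x) M \<mu> N \<nu> h"
    using base_map_ex[OF small_sset_simplicial[OF U] M N t(3)] .
  then show ?thesis
    using base_map_Isofib[OF U t(4) M N] that by blast
qed

lemma cotensor_arrow_ex:
  assumes U: "small_sset \<kappa> (U :: 'u sset)" and x: "x \<in> Obj K2"
  shows "\<exists>C u. cotensor K2 U x C u"
proof -
  note t = Obj_arrowD[OF x]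
  obtain M \<mu> where M: "cotensor K U (dm x) M \<mu>" using cotensor_ex[OF t(1) U] by blast
  obtain N \<nu> where N: "cotensor K U (cd x) N \<nu>" using cotensor_ex[OF t(2) U] by blast
  show ?thesis
    using cotensor_arrow_comparison[OF U x M N] cotensor_arrow[OF small_sset_simplicial[OF U] x M N] by metis
qed

text \<open>As for limits, the given cotensor is compared with the constructed one through the
  isomorphism between them, which is an isomorphism in each component.\<close>

lemma cotensor_arrow_components:
  assumes U: "small_sset \<kappa> (U :: 'u sset)" and ct: "cotensor K2 U x C u"
  shows "cotensor K U (dm x) (dm C) (\<lambda>n. \<lambda>s\<in>simplices U n. fst (u n s))"
    and "cotensor K U (cd x) (cd C) (\<lambda>n. \<lambda>s\<in>simplices U n. snd (u n s))"
proof -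
  have x: "x \<in> Obj K2" and C: "C \<in> Obj K2" and u: "u \<in> smap U (Fun K2 C x)" using arrow.cotensorD[OF ct] by auto
  note t = Obj_arrowD[OF x] Obj_arrowD[OF C] and Us = small_sset_simplicial[OF U]
  obtain M \<mu> where M: "cotensor K U (dm x) M \<mu>" using cotensor_ex[OF t(1) U] by blast
  obtain N \<nu> where N: "cotensor K U (cd x) N \<nu>" using cotensor_ex[OF t(2) U] by blast
  obtain h where h: "h \<in> Isofib K M N" "cotensor_base_map K U (dm x) (cd x) (ar x) M \<mu> N \<nu> h"
    using cotensor_arrow_comparison[OF U x M N] .
  note m = cotensorD[OF M] and k = cotensorD[OF N]
  let ?u = "\<lambda>n. \<lambda>s\<in>simplices U n. (\<mu> n s, \<nu> n s)"
  have ct': "cotensor K2 U x (M, N, h) ?u" by (rule cotensor_arrow[OF Us x M N h])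
  obtain \<theta> where \<theta>: "isomorphism K2 C (M, N, h) \<theta>"
    "\<And>n s. s \<in> simplices U n \<Longrightarrow> pre_map K2 C (M, N, h) x \<theta> n (?u n s) = u n s"
    using arrow.cotensor_unique[OF Us ct ct'] by blast
  have iso: "isomorphism K (dm C) M (fst \<theta>)" "isomorphism K (cd C) N (snd \<theta>)"
    using \<theta>(1) IsofibD[OF h(1)] t
    by (auto simp: isomorphism_def Cmp_arrow Unit_arrow Fun_arrow_iff)
  have e: "pre_map K (dm C) M (dm x) (fst \<theta>) n (\<mu> n s) = fst (u n s)"
    "pre_map K (cd C) N (cd x) (snd \<theta>) n (\<nu> n s) = snd (u n s)" if "s \<in> simplices U n" for n s
  proof -
    have "?u n s \<in> simplices (Fun K2 (M, N, h) x) n"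
      by (rule smap_closed[OF arrow.cotensorD(3)[OF ct'] that])
    then have "u n s = (pre_map K (dm C) M (dm x) (fst \<theta>) n (\<mu> n s), pre_map K (cd C) N (cd x) (snd \<theta>) n (\<nu> n s))"
      using pre_map_arrow[of "(\<mu> n s, \<nu> n s)" K "(M, N, h)" x n C \<theta>] \<theta>(2)[OF that] that by simp
    then show "pre_map K (dm C) M (dm x) (fst \<theta>) n (\<mu> n s) = fst (u n s)"
      "pre_map K (cd C) N (cd x) (snd \<theta>) n (\<nu> n s) = snd (u n s)" by simp_all
  qed
  note u' = u[unfolded Fun_arrow]
  show "cotensor K U (dm x) (dm C) (\<lambda>n. \<lambda>s\<in>simplices U n. fst (u n s))"
    by (rule cotensor_transport[OF Us M iso(1) spullback_smap_fst[OF Us u']]) (use e in auto)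
  show "cotensor K U (cd x) (cd C) (\<lambda>n. \<lambda>s\<in>simplices U n. snd (u n s))"
    by (rule cotensor_transport[OF Us N iso(2) spullback_smap_snd[OF Us u']]) (use e in auto)
qed

text \<open>A universal element consisting of squares forces the arrow of its vertex to be a base
  map for \<open>ar x\<close>, and base maps are unique.\<close>

lemma jointly_create_cotensor_arrow:
  assumes U: "small_sset \<kappa> (U :: 'u sset)" and x: "x \<in> Obj K2"
  shows "jointly_create_cotensor K2 K (dom_functor K) (cod_functor K) U x"
  unfolding jointly_create_cotensor_def FOb_dom FOb_cod
proof (intro allI impI)
  fix M \<mu> N \<nu> assume "cotensor K U (dm x) M \<mu> \<and> cotensor K U (cd x) N \<nu>"
  then have M: "cotensor K U (dm x) M \<mu>" and N: "cotensor K U (cd x) N \<nu>" by auto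
  note t = Obj_arrowD[OF x] and Us = small_sset_simplicial[OF U]
  obtain h where h: "h \<in> Isofib K M N" "cotensor_base_map K U (dm x) (cd x) (ar x) M \<mu> N \<nu> h"
    using cotensor_arrow_comparison[OF U x M N] .
  let ?u = "\<lambda>n. \<lambda>s\<in>simplices U n. (\<mu> n s, \<nu> n s)"
  have ct: "cotensor K2 U x (M, N, h) ?u" by (rule cotensor_arrow[OF Us x M N h])
  let ?P = "\<lambda>C u. cotensor_cone K2 U x C u \<and> cotensor_cone_lies_over (dom_functor K) U x C u M \<mu> \<and>
      cotensor_cone_lies_over (cod_functor K) U x C u N \<nu>"
  have ex: "?P (M, N, h) ?u"
    using arrow.cotensorD[OF ct] smap_closed[OF arrow.cotensorD(3)[OF ct]]
    by (auto simp: cotensor_cone_def cotensor_cone_lies_over_def FAr_dom FAr_cod)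
  have uniq: "C = (M, N, h) \<and> u = ?u" if P: "?P C u" for C u
  proof -
    have CO: "C \<in> Obj K2" and u: "u \<in> smap U (Fun K2 C x)" using P by (auto simp: cotensor_cone_def)
    have ua: "u n s \<in> simplices (Fun K2 C x) n" if "s \<in> simplices U n" for n s
      by (rule smap_closed[OF u that])
    have ue: "u n s = (\<mu> n s, \<nu> n s)" if "s \<in> simplices U n" for n s
      using P that FAr_dom[OF ua[OF that]] FAr_cod[OF ua[OF that]] by (simp add: cotensor_cone_lies_over_def prod_eq_iff)
    obtain c where C: "C = (M, N, c)" using P by (cases C) (auto simp: cotensor_cone_lies_over_def)
    have "c \<in> arr K M N" using Obj_arrowD(3)[OF CO] C by simp
    moreover have "pre_map K M N (cd x) c n (\<nu> n s) = post_map K M (dm x) (cd x) (ar x) n (\<mu> n s)"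
      if "s \<in> simplices U n" for n s
      using ua[OF that] unfolding ue[OF that] C by (simp add: Fun_arrow_iff)
    ultimately have "cotensor_base_map K U (dm x) (cd x) (ar x) M \<mu> N \<nu> c"
      by (simp add: cotensor_base_map_def)
    then have "c = h" using base_map_unique[OF M N h(2)] by blast
    moreover have "u = ?u"
      by (rule smap_eqI[OF u arrow.cotensorD(3)[OF ct]]) (simp add: ue)
    ultimately show ?thesis using C by simp
  qed
  show "(\<exists>!(C, u). ?P C u) \<and> (\<forall>C u. ?P C u \<longrightarrow> cotensor K2 U x C u)"
    by (rule ex1_pairI[of ?P "(M, N, h)" ?u "\<lambda>C u. cotensor K2 U x C u", OF ex uniq ct])
qed

end

section \<open>Isofibrations between isofibrations\<close>

context simplicial_category
begin

text \<open>This lemma, \<open>cmp_cmp_eq\<close> and \<open>post_cmp\<close> apply a known equation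
  between composites in front of a further arrow or simplex, where the bracketing keeps the equation
  from matching directly.\<close>

lemma cmp_cmp:
  "\<lbrakk>cmp0 K A B C g f = h; X \<in> Obj K; A \<in> Obj K; B \<in> Obj K; C \<in> Obj K; f \<in> arr K A B; g \<in> arr K B C;
    a \<in> arr K X A\<rbrakk> \<Longrightarrow> cmp0 K X B C g (cmp0 K X A B f a) = cmp0 K X A C h a"
  by (simp add: Cmp_assoc[symmetric])

lemma cmp_cmp_eq:
  "\<lbrakk>cmp0 K P A B f l = cmp0 K P F B q r; X \<in> Obj K; P \<in> Obj K; A \<in> Obj K; F \<in> Obj K; B \<in> Obj K;
    f \<in> arr K A B; l \<in> arr K P A; q \<in> arr K F B; r \<in> arr K P F; a \<in> arr K X P\<rbrakk>
    \<Longrightarrow> cmp0 K X A B f (cmp0 K X P A l a) = cmp0 K X F B q (cmp0 K X P F r a)"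
  by (simp add: Cmp_assoc[symmetric])

lemma post_cmp:
  "\<lbrakk>cmp0 K A B C g f = h; X \<in> Obj K; A \<in> Obj K; B \<in> Obj K; C \<in> Obj K; f \<in> arr K A B; g \<in> arr K B C;
    a \<in> simplices (Fun K X A) n\<rbrakk>
    \<Longrightarrow> post_map K X B C g n (post_map K X A B f n a) = post_map K X A C h n a"
  using post_comp[of X A B C f g a n] by simp

lemma wf_sequence: "\<lbrakk>\<And>n. Y n \<in> Obj K; \<And>n. r n \<in> arr K (Y (Suc n)) (Y n)\<rbrakk> \<Longrightarrow> wf_diagram K (sequence_diagram Y r)"
  by (auto simp: wf_diagram_def sequence_diagram_def)

lemma wf_product: "\<lbrakk>\<And>i. i \<in> I \<Longrightarrow> A i \<in> Obj K\<rbrakk> \<Longrightarrow> wf_diagram K (product_diagram I A)"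
  by (auto simp: wf_diagram_def product_diagram_def)

end

lemma product_diagram_simps [simp]:
  "Vert (product_diagram I A) = I" "Edge (product_diagram I A) = {}" "Ob (product_diagram I A) i = A i"
  by (simp_all add: product_diagram_def)

lemma sequence_diagram_simps [simp]:
  "Vert (sequence_diagram Y r) = UNIV" "Edge (sequence_diagram Y r) = {(Suc n, n) |n. True}"
  "Ob (sequence_diagram Y r) n = Y n" "Ar (sequence_diagram Y r) m n = r n"
  by (simp_all add: sequence_diagram_def)

text \<open>In contrast to membership in \<open>Isofib (arrow_cosmos K)\<close>, this does not
  presuppose that \<open>p\<close> is an isofibration; in limits of squares that is deduced from the
  gap, see \<open>gap_isofib_source\<close>.\<close>

definition gap_isofib ::
    "('o, 'a) cosmos \<Rightarrow> 'o \<Rightarrow> 'o \<Rightarrow> 'a \<Rightarrow> 'o \<Rightarrow> 'o \<Rightarrow> 'a \<Rightarrow> 'a \<Rightarrow> 'a \<Rightarrow> bool" where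
  "gap_isofib K E A p F B q g f \<longleftrightarrow> (\<exists>P l r k. is_pullback K P A F B l r f q \<and> k \<in> Isofib K E P \<and>
    cmp0 K E P A l k = p \<and> cmp0 K E P F r k = g)"

lemma gap_isofibI:
  "\<lbrakk>is_pullback K P A F B l r f q; k \<in> Isofib K E P; cmp0 K E P A l k = p; cmp0 K E P F r k = g\<rbrakk>
    \<Longrightarrow> gap_isofib K E A p F B q g f"
  unfolding gap_isofib_def by blast

lemma gap_isofibE:
  assumes "gap_isofib K E A p F B q g f"
  obtains P l r k where "is_pullback K P A F B l r f q" "k \<in> Isofib K E P"
    "cmp0 K E P A l k = p" "cmp0 K E P F r k = g"
  using assms unfolding gap_isofib_def by blast

section \<open>Closure properties of gap maps\<close>

context infinity_cosmos
begin

text \<open>\<open>p\<close> is the gap map followed by the pullback of \<open>q\<close>. In the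
  same way \<open>g\<close> is the gap map followed by the pullback of \<open>f\<close>.\<close>

lemma gap_isofib_source:
  assumes "gap_isofib K E A p F B q g f" "q \<in> Isofib K F B"
  shows "p \<in> Isofib K E A"
proof -
  obtain P l r k where *: "is_pullback K P A F B l r f q" "k \<in> Isofib K E P" "cmp0 K E P A l k = p"
    using gap_isofibE[OF assms(1)] by metis
  show ?thesis
    using Isofib_comp[OF *(2) is_pullback_Isofib[OF *(1) assms(2)]] *(3) by simp
qed

lemma gap_isofib_top:
  assumes "gap_isofib K E A p F B q g f" "f \<in> Isofib K A B"
  shows "g \<in> Isofib K E F"
proof -
  obtain P l r k where *: "is_pullback K P A F B l r f q" "k \<in> Isofib K E P" "cmp0 K E P F r k = g"
    using gap_isofibE[OF assms(1)] by metis
  show ?thesis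
    using Isofib_comp[OF *(2) is_pullback_Isofib'[OF *(1) assms(2)]] *(3) by simp
qed

text \<open>The gap map of the pasted square is \<open>k\<close> followed by \<open>d\<close> from
  \<open>P\<close> to \<open>Q\<close>. Here \<open>d\<close> is a pullback of the second gap map
  \<open>k'\<close>, since \<open>P\<close> is the pullback of \<open>Q\<close> and \<open>F\<close>
  over \<open>P'\<close>.\<close>

lemma gap_isofib_comp:
  assumes q: "q \<in> Isofib K F B" and w: "w \<in> Isofib K G C"
    and g: "g \<in> arr K E F" "f \<in> arr K A B" "g' \<in> arr K F G" "f' \<in> arr K B C"
    and sq: "cmp0 K F G C w g' = cmp0 K F B C f' q"
    and gap: "gap_isofib K E A p F B q g f" "gap_isofib K F B q G C w g' f'"
  shows "gap_isofib K E A p G C w (cmp0 K E F G g' g) (cmp0 K A B C f' f)"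
proof -
  obtain P l r k where P: "is_pullback K P A F B l r f q" "k \<in> Isofib K E P"
    "cmp0 K E P A l k = p" "cmp0 K E P F r k = g"
    using gap_isofibE[OF gap(1)] .
  obtain P' l' r' k' where P': "is_pullback K P' B G C l' r' f' w" "k' \<in> Isofib K F P'"
    "cmp0 K F P' B l' k' = q" "cmp0 K F P' G r' k' = g'"
    using gap_isofibE[OF gap(2)] .
  note t = is_pullbackD[OF P(1)] is_pullbackD[OF P'(1)] IsofibD[OF P(2)] IsofibD[OF P'(2)]
  have "cmp0 K A B C f' f \<in> arr K A C" using g t by simp
  then obtain Q a b where Q: "is_pullback K Q A G C a b (cmp0 K A B C f' f) w"
    using is_pullback_exists[OF t(2) _ w] by blast
  note u = is_pullbackD[OF Q]
  have "cmp0 K Q B C f' (cmp0 K Q A B f a) = cmp0 K Q G C w b"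
    using u t by (simp add: Cmp_assoc[symmetric])
  then obtain c where c: "c \<in> arr K Q P'" "cmp0 K Q P' B l' c = cmp0 K Q A B f a" "cmp0 K Q P' G r' c = b"
    using is_pullback_arr_ex[OF P'(1) u(1)] u t by (metis Cmp_closed)
  have "cmp0 K P A C (cmp0 K A B C f' f) l = cmp0 K P B C f' (cmp0 K P A B f l)"
    using t by (simp add: Cmp_assoc)
  also have "\<dots> = cmp0 K P G C w (cmp0 K P F G g' r)"
    using cmp_cmp_eq[OF sq, of P r] t g w IsofibD[OF q] IsofibD[OF w] by simp
  finally obtain d where d: "d \<in> arr K P Q" "cmp0 K P Q A a d = l" "cmp0 K P Q G b d = cmp0 K P F G g' r"
    using is_pullback_arr_ex[OF Q t(1)] u t g by (metis Cmp_closed)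
  have "is_pullback K P Q F P' d r c k'"
  proof (rule is_pullbackI)
    show "cmp0 K P Q P' c d = cmp0 K P F P' k' r"
    proof (rule is_pullback_arr_eqI[OF P'(1) t(1)])
      show "cmp0 K P P' B l' (cmp0 K P Q P' c d) = cmp0 K P P' B l' (cmp0 K P F P' k' r)"
        using t u c d cmp_cmp[OF c(2), of P d] cmp_cmp[OF P'(3), of P r] Cmp_assoc[of P Q A B d 0 a f] by simp
      show "cmp0 K P P' G r' (cmp0 K P Q P' c d) = cmp0 K P P' G r' (cmp0 K P F P' k' r)"
        using t u c d cmp_cmp[OF c(3), of P d] cmp_cmp[OF P'(4), of P r] by simp
    qed (use t u c d in auto)
    fix X n assume X: "X \<in> Obj K"
    have e: "post_map K X Q A a n (post_map K X P Q d n z) = post_map K X P A l n z"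
      "post_map K X Q G b n (post_map K X P Q d n z) = post_map K X F G g' n (post_map K X P F r n z)"
      if "z \<in> simplices (Fun K X P) n" for z
      using that X t u d g post_cmp[OF d(2), of X z n] post_cmp[OF d(3), of X z n] by simp_all
    {
      fix z z' assume z: "z \<in> simplices (Fun K X P) n" "z' \<in> simplices (Fun K X P) n"
        "post_map K X P Q d n z = post_map K X P Q d n z'" "post_map K X P F r n z = post_map K X P F r n z'"
      then show "z = z'"
        using e(1)[OF z(1)] e(1)[OF z(2)] is_pullback_eqI[OF P(1) X z(1,2)] by simp
    }
    fix y x assume y: "y \<in> simplices (Fun K X Q) n" and x: "x \<in> simplices (Fun K X F) n"
      and yx: "post_map K X Q P' c n y = post_map K X F P' k' n x"
    have "post_map K X P' B l' n (post_map K X Q P' c n y) = post_map K X P' B l' n (post_map K X F P' k' n x)"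
      "post_map K X P' G r' n (post_map K X Q P' c n y) = post_map K X P' G r' n (post_map K X F P' k' n x)"
      using yx by simp_all
    then have yx': "post_map K X A B f n (post_map K X Q A a n y) = post_map K X F B q n x"
      "post_map K X Q G b n y = post_map K X F G g' n x"
      using X t u c y x post_cmp[OF c(2), of X y n] post_cmp[OF c(3), of X y n] post_cmp[OF P'(3), of X x n]
        post_cmp[OF P'(4), of X x n] by simp_all
    obtain z where z: "z \<in> simplices (Fun K X P) n" "post_map K X P A l n z = post_map K X Q A a n y"
      "post_map K X P F r n z = x"
      using is_pullback_ex[OF P(1) X _ x yx'(1)] u y X by auto
    have "post_map K X P Q d n z = y"
      by (rule is_pullback_eqI[OF Q X]) (use X t u d y z e[OF z(1)] yx' in auto)
    then show "\<exists>z\<in>simplices (Fun K X P) n. post_map K X P Q d n z = y \<and> post_map K X P F r n z = x"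
      using z by blast
  qed (use t u c d in auto)
  then have "d \<in> Isofib K P Q" by (rule is_pullback_Isofib[OF _ P'(2)])
  then have "cmp0 K E P Q d k \<in> Isofib K E Q" by (rule Isofib_comp[OF P(2)])
  moreover have "cmp0 K E Q A a (cmp0 K E P Q d k) = p"
    using t u d P(3) cmp_cmp[OF d(2), of E k] by simp
  moreover have "cmp0 K E Q G b (cmp0 K E P Q d k) = cmp0 K E F G g' g"
    using t u d g P(4) cmp_cmp[OF d(3), of E k] Cmp_assoc[of E P F G k 0 r g'] by simp
  ultimately show ?thesis by (rule gap_isofibI[OF Q])
qed

text \<open>
  With \<open>W\<close> the pullback of \<open>N\<close> and \<open>E\<close> over \<open>A\<close>, the map from \<open>M\<close> to \<open>W\<close> is a pullback of the gap map
  of the square from \<open>q\<close> to \<open>c\<close>.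
\<close>

lemma gap_isofib_pullback:
  assumes p: "p \<in> Isofib K E A" and c: "c \<in> Isofib K G C" and q: "q \<in> arr K F B"
    and gap: "gap_isofib K F B q G C c g f"
    and sq: "cmp0 K E G C c s0 = cmp0 K E A C s1 p"
    and M: "is_pullback K M E F G mE mF s0 g" and N: "is_pullback K N A B C nA nB s1 f"
    and h: "h \<in> arr K M N" "cmp0 K M N A nA h = cmp0 K M E A p mE" "cmp0 K M N B nB h = cmp0 K M F B q mF"
  shows "gap_isofib K M N h E A p mE nA"
proof -
  obtain P l r k where P: "is_pullback K P B G C l r f c" "k \<in> Isofib K F P"
    "cmp0 K F P B l k = q" "cmp0 K F P G r k = g"
    using gap_isofibE[OF gap] .
  note t = is_pullbackD[OF P(1)] is_pullbackD[OF M] is_pullbackD[OF N] IsofibD[OF P(2)] IsofibD[OF p]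
  obtain W wN wE where W: "is_pullback K W N E A wN wE nA p"
    using is_pullback_exists[OF _ _ p] t by metis
  note u = is_pullbackD[OF W]
  have "cmp0 K W B C f (cmp0 K W N B nB wN) = cmp0 K W A C s1 (cmp0 K W N A nA wN)"
    using cmp_cmp_eq[OF t(27)[symmetric], of W wN] t u by simp
  also have "\<dots> = cmp0 K W G C c (cmp0 K W E G s0 wE)"
    using cmp_cmp_eq[OF sq, of W wE] t u by simp
  finally obtain b where b: "b \<in> arr K W P" "cmp0 K W P B l b = cmp0 K W N B nB wN"
    "cmp0 K W P G r b = cmp0 K W E G s0 wE"
    using is_pullback_arr_ex[OF P(1) u(1)] u t by (metis Cmp_closed)
  obtain d where d: "d \<in> arr K M W" "cmp0 K M W N wN d = h" "cmp0 K M W E wE d = mE"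
    using is_pullback_arr_ex[OF W t(10) h(1) t(14) h(2)] .
  have "is_pullback K M W F P d mF b k"
  proof (rule is_pullbackI)
    show "cmp0 K M W P b d = cmp0 K M F P k mF"
    proof (rule is_pullback_arr_eqI[OF P(1) t(10)])
      show "cmp0 K M P B l (cmp0 K M W P b d) = cmp0 K M P B l (cmp0 K M F P k mF)"
        using t u b d h cmp_cmp[OF b(2), of M d] cmp_cmp[OF P(3), of M mF] Cmp_assoc[of M W N B d 0 wN nB] by simp
      show "cmp0 K M P G r (cmp0 K M W P b d) = cmp0 K M P G r (cmp0 K M F P k mF)"
        using t u b d h cmp_cmp[OF b(3), of M d] cmp_cmp[OF P(4), of M mF] Cmp_assoc[of M W E G d 0 wE s0] by simp
    qed (use t u b d in auto)
    fix X n assume X: "X \<in> Obj K"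
    have e: "post_map K X W N wN n (post_map K X M W d n z) = post_map K X M N h n z"
      "post_map K X W E wE n (post_map K X M W d n z) = post_map K X M E mE n z"
      "post_map K X N A nA n (post_map K X M N h n z) = post_map K X E A p n (post_map K X M E mE n z)"
      "post_map K X N B nB n (post_map K X M N h n z) = post_map K X F B q n (post_map K X M F mF n z)"
      if "z \<in> simplices (Fun K X M) n" for z
      using that X t u d h q post_cmp[OF d(2), of X z n] post_cmp[OF d(3), of X z n]
        post_cmp[OF h(2), of X z n] post_cmp[OF h(3), of X z n] by simp_all
    {
      fix z z' assume z: "z \<in> simplices (Fun K X M) n" "z' \<in> simplices (Fun K X M) n"
        "post_map K X M W d n z = post_map K X M W d n z'" "post_map K X M F mF n z = post_map K X M F mF n z'"
      then show "z = z'"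
        using e(2)[OF z(1)] e(2)[OF z(2)] is_pullback_eqI[OF M X z(1,2)] by simp
    }
    fix y x assume y: "y \<in> simplices (Fun K X W) n" and x: "x \<in> simplices (Fun K X F) n"
      and yx: "post_map K X W P b n y = post_map K X F P k n x"
    have "post_map K X P B l n (post_map K X W P b n y) = post_map K X P B l n (post_map K X F P k n x)"
      "post_map K X P G r n (post_map K X W P b n y) = post_map K X P G r n (post_map K X F P k n x)"
      using yx by simp_all
    then have yx': "post_map K X N B nB n (post_map K X W N wN n y) = post_map K X F B q n x"
      "post_map K X E G s0 n (post_map K X W E wE n y) = post_map K X F G g n x"
      using X t u b y x post_cmp[OF b(2), of X y n] post_cmp[OF b(3), of X y n] post_cmp[OF P(3), of X x n]
        post_cmp[OF P(4), of X x n] by simp_all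
    obtain z where z: "z \<in> simplices (Fun K X M) n" "post_map K X M E mE n z = post_map K X W E wE n y"
      "post_map K X M F mF n z = x"
      using is_pullback_ex[OF M X _ x yx'(2)] u y X by auto
    \<comment> \<open>The \<open>N\<close>-component is compared in \<open>A\<close>, where it is
      known through \<open>E\<close>, and in \<open>B\<close>, where it is known through
      \<open>F\<close>.\<close>
    have hz: "post_map K X M N h n z = post_map K X W N wN n y"
      by (rule is_pullback_eqI[OF N X, where n = n]) (use X t u h y z e[OF z(1)] yx' is_pullback_commutes[OF W X y] in auto)
    have "post_map K X M W d n z = y"
      by (rule is_pullback_eqI[OF W X, where n = n]) (use hz X t u d y z e[OF z(1)] in auto)
    then show "\<exists>z\<in>simplices (Fun K X M) n. post_map K X M W d n z = y \<and> post_map K X M F mF n z = x"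
      using z by blast
  qed (use t u b d in auto)
  then have "d \<in> Isofib K M W" by (rule is_pullback_Isofib[OF _ P(2)])
  then show ?thesis using gap_isofibI[OF W _ d(2,3)] by blast
qed

text \<open>
  \<open>M\<close> is the limit of the pullbacks \<open>P n\<close> of \<open>N\<close> and \<open>E n\<close> over \<open>A n\<close>, and the map from \<open>P (Suc n)\<close> to
  \<open>P n\<close> is a pullback of the gap map of the square from \<open>p (Suc n)\<close> to \<open>p n\<close>.
\<close>

lemma gap_isofib_sequence:
  assumes p: "\<And>n. p n \<in> Isofib K (E n) (A n)"
    and g: "\<And>n. g n \<in> arr K (E (Suc n)) (E n)" and f: "\<And>n. f n \<in> arr K (A (Suc n)) (A n)"
    and sq: "\<And>n. cmp0 K (E (Suc n)) (E n) (A n) (p n) (g n) = cmp0 K (E (Suc n)) (A (Suc n)) (A n) (f n) (p (Suc n))"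
    and gap: "\<And>n. gap_isofib K (E (Suc n)) (A (Suc n)) (p (Suc n)) (E n) (A n) (p n) (g n) (f n)"
    and M: "limit_cone K (sequence_diagram E g) M \<mu>" and N: "limit_cone K (sequence_diagram A f) N \<nu>"
    and h: "h \<in> arr K M N" "\<And>n. cmp0 K M N (A n) (\<nu> n) h = cmp0 K M (E n) (A n) (p n) (\<mu> n)"
  shows "gap_isofib K M N h (E 0) (A 0) (p 0) (\<mu> 0) (\<nu> 0)"
proof -
  note t = IsofibD[OF p]
  have wfE: "wf_diagram K (sequence_diagram E g)" by (rule wf_sequence) (use t g in auto)
  have wfA: "wf_diagram K (sequence_diagram A f)" by (rule wf_sequence) (use t f in auto)
  have MO: "M \<in> Obj K" and NO: "N \<in> Obj K"
    using limit_cone_wfD(1)[OF wfE M] limit_cone_wfD(1)[OF wfA N] by auto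
  have \<mu>: "\<mu> n \<in> arr K M (E n)" "cmp0 K M (E (Suc n)) (E n) (g n) (\<mu> (Suc n)) = \<mu> n" for n
    using limit_cone_wfD(2)[OF wfE M, of n] limit_cone_wfD(3)[OF wfE M, of "Suc n" n] by auto
  have \<nu>: "\<nu> n \<in> arr K N (A n)" "cmp0 K N (A (Suc n)) (A n) (f n) (\<nu> (Suc n)) = \<nu> n" for n
    using limit_cone_wfD(2)[OF wfA N, of n] limit_cone_wfD(3)[OF wfA N, of "Suc n" n] by auto
  have "\<forall>n. \<exists>P l y. is_pullback K P N (E n) (A n) l y (\<nu> n) (p n)"
    using is_pullback_exists[OF NO \<nu>(1) p] by metis
  then obtain P l y where P: "\<And>n. is_pullback K (P n) N (E n) (A n) (l n) (y n) (\<nu> n) (p n)"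
    by metis
  note u = is_pullbackD[OF P]
  have "\<exists>s. s \<in> arr K (P (Suc n)) (P n) \<and> cmp0 K (P (Suc n)) (P n) N (l n) s = l (Suc n) \<and>
      cmp0 K (P (Suc n)) (P n) (E n) (y n) s = cmp0 K (P (Suc n)) (E (Suc n)) (E n) (g n) (y (Suc n))" for n
  proof -
    have "cmp0 K (P (Suc n)) N (A n) (\<nu> n) (l (Suc n))
        = cmp0 K (P (Suc n)) (A (Suc n)) (A n) (f n) (cmp0 K (P (Suc n)) N (A (Suc n)) (\<nu> (Suc n)) (l (Suc n)))"
      using cmp_cmp[OF \<nu>(2)[of n], of "P (Suc n)" "l (Suc n)"] u t f NO \<nu> by simp
    also have "\<dots> = cmp0 K (P (Suc n)) (E n) (A n) (p n) (cmp0 K (P (Suc n)) (E (Suc n)) (E n) (g n) (y (Suc n)))"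
      using cmp_cmp_eq[OF sq[of n], of "P (Suc n)" "y (Suc n)"] u(9)[of "Suc n"] u t f g by simp
    finally show ?thesis
      using is_pullback_arr_ex[OF P[of n] u(1)[of "Suc n"] u(5)[of "Suc n"]] u t g by (metis Cmp_closed)
  qed
  then obtain s where s: "\<And>n. s n \<in> arr K (P (Suc n)) (P n)"
    "\<And>n. cmp0 K (P (Suc n)) (P n) N (l n) (s n) = l (Suc n)"
    "\<And>n. cmp0 K (P (Suc n)) (P n) (E n) (y n) (s n) = cmp0 K (P (Suc n)) (E (Suc n)) (E n) (g n) (y (Suc n))"
    by metis
  have es: "post_map K X (P j) N (l j) n (post_map K X (P (Suc j)) (P j) (s j) n z) = post_map K X (P (Suc j)) N (l (Suc j)) n z"
    "post_map K X (P j) (E j) (y j) n (post_map K X (P (Suc j)) (P j) (s j) n z)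
      = post_map K X (E (Suc j)) (E j) (g j) n (post_map K X (P (Suc j)) (E (Suc j)) (y (Suc j)) n z)"
    if "X \<in> Obj K" "z \<in> simplices (Fun K X (P (Suc j))) n" for X z j n
    using that t u g s(1) post_cmp[OF s(2)[of j], of X z n] post_cmp[OF s(3)[of j], of X z n] by simp_all
  have s_Isofib: "s j \<in> Isofib K (P (Suc j)) (P j)" for j
  proof -
    obtain Q a b k where Q: "is_pullback K Q (A (Suc j)) (E j) (A j) a b (f j) (p j)" "k \<in> Isofib K (E (Suc j)) Q"
      "cmp0 K (E (Suc j)) Q (A (Suc j)) a k = p (Suc j)" "cmp0 K (E (Suc j)) Q (E j) b k = g j"
      using gap_isofibE[OF gap[of j]] .
    note v = is_pullbackD[OF Q(1)] IsofibD[OF Q(2)]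
    have "cmp0 K (P j) (A (Suc j)) (A j) (f j) (cmp0 K (P j) N (A (Suc j)) (\<nu> (Suc j)) (l j)) = cmp0 K (P j) (E j) (A j) (p j) (y j)"
      using cmp_cmp[OF \<nu>(2)[of j], of "P j" "l j"] u t f NO \<nu> by simp
    then obtain c where c: "c \<in> arr K (P j) Q" "cmp0 K (P j) Q (A (Suc j)) a c = cmp0 K (P j) N (A (Suc j)) (\<nu> (Suc j)) (l j)"
      "cmp0 K (P j) Q (E j) b c = y j"
      using is_pullback_arr_ex[OF Q(1) u(1)[of j] _ u(6)[of j]] u t \<nu> NO by (metis Cmp_closed)
    have "is_pullback K (P (Suc j)) (P j) (E (Suc j)) Q (s j) (y (Suc j)) c k"
    proof (rule is_pullbackI)
      show "cmp0 K (P (Suc j)) (P j) Q c (s j) = cmp0 K (P (Suc j)) (E (Suc j)) Q k (y (Suc j))"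
      proof (rule is_pullback_arr_eqI[OF Q(1) u(1)])
        show "cmp0 K (P (Suc j)) Q (A (Suc j)) a (cmp0 K (P (Suc j)) (P j) Q c (s j))
            = cmp0 K (P (Suc j)) Q (A (Suc j)) a (cmp0 K (P (Suc j)) (E (Suc j)) Q k (y (Suc j)))"
          using cmp_cmp[OF c(2), of "P (Suc j)" "s j"] cmp_cmp[OF Q(3), of "P (Suc j)" "y (Suc j)"]
            Cmp_assoc[of "P (Suc j)" "P j" N "A (Suc j)" "s j" 0 "l j" "\<nu> (Suc j)"] s(2)[of j] u(9)[of "Suc j"]
            u(1-8) v c(1) s(1) \<nu>(1) by simp
        show "cmp0 K (P (Suc j)) Q (E j) b (cmp0 K (P (Suc j)) (P j) Q c (s j))
            = cmp0 K (P (Suc j)) Q (E j) b (cmp0 K (P (Suc j)) (E (Suc j)) Q k (y (Suc j)))"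
          using cmp_cmp[OF c(3), of "P (Suc j)" "s j"] cmp_cmp[OF Q(4), of "P (Suc j)" "y (Suc j)"] s(3)[of j]
            u(1-8) v c(1) s(1) by simp
      qed (use u v c s in auto)
      fix X n assume X: "X \<in> Obj K"
      {
        fix z z' assume z: "z \<in> simplices (Fun K X (P (Suc j))) n" "z' \<in> simplices (Fun K X (P (Suc j))) n"
          "post_map K X (P (Suc j)) (P j) (s j) n z = post_map K X (P (Suc j)) (P j) (s j) n z'"
          "post_map K X (P (Suc j)) (E (Suc j)) (y (Suc j)) n z = post_map K X (P (Suc j)) (E (Suc j)) (y (Suc j)) n z'"
        then show "z = z'"
          using es(1)[OF X z(1)] es(1)[OF X z(2)] is_pullback_eqI[OF P X z(1,2)] by simp
      }
      fix w x assume w: "w \<in> simplices (Fun K X (P j)) n" and x: "x \<in> simplices (Fun K X (E (Suc j))) n"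
        and wx: "post_map K X (P j) Q c n w = post_map K X (E (Suc j)) Q k n x"
      have "post_map K X Q (A (Suc j)) a n (post_map K X (P j) Q c n w) = post_map K X Q (A (Suc j)) a n (post_map K X (E (Suc j)) Q k n x)"
        "post_map K X Q (E j) b n (post_map K X (P j) Q c n w) = post_map K X Q (E j) b n (post_map K X (E (Suc j)) Q k n x)"
        using wx by simp_all
      then have wx': "post_map K X N (A (Suc j)) (\<nu> (Suc j)) n (post_map K X (P j) N (l j) n w) = post_map K X (E (Suc j)) (A (Suc j)) (p (Suc j)) n x"
        "post_map K X (P j) (E j) (y j) n w = post_map K X (E (Suc j)) (E j) (g j) n x"
        using X u(1-8) v c(1) w x post_cmp[OF c(2), of X w n] post_cmp[OF c(3), of X w n] post_cmp[OF Q(3), of X x n]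
          post_cmp[OF Q(4), of X x n] \<nu>(1) by simp_all
      obtain z where z: "z \<in> simplices (Fun K X (P (Suc j))) n"
        "post_map K X (P (Suc j)) N (l (Suc j)) n z = post_map K X (P j) N (l j) n w"
        "post_map K X (P (Suc j)) (E (Suc j)) (y (Suc j)) n z = x"
        using is_pullback_ex[OF P X _ x wx'(1)] u w X by auto
      have "post_map K X (P (Suc j)) (P j) (s j) n z = w"
        by (rule is_pullback_eqI[OF P X]) (use X u(1-8) s(1) w z es[OF X z(1)] wx' in auto)
      then show "\<exists>z\<in>simplices (Fun K X (P (Suc j))) n. post_map K X (P (Suc j)) (P j) (s j) n z = w \<and>
          post_map K X (P (Suc j)) (E (Suc j)) (y (Suc j)) n z = x"
        using z by blast
    qed (use u v c s in auto)
    then show ?thesis by (rule is_pullback_Isofib[OF _ Q(2)])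
  qed
  have "\<exists>k. k \<in> arr K M (P n) \<and> cmp0 K M (P n) N (l n) k = h \<and> cmp0 K M (P n) (E n) (y n) k = \<mu> n" for n
    using is_pullback_arr_ex[OF P MO h(1) \<mu>(1) h(2)] by metis
  then obtain k where k: "\<And>n. k n \<in> arr K M (P n)" "\<And>n. cmp0 K M (P n) N (l n) (k n) = h"
    "\<And>n. cmp0 K M (P n) (E n) (y n) (k n) = \<mu> n" by metis
  have ek: "post_map K X (P j) N (l j) n (post_map K X M (P j) (k j) n z) = post_map K X M N h n z"
    "post_map K X (P j) (E j) (y j) n (post_map K X M (P j) (k j) n z) = post_map K X M (E j) (\<mu> j) n z"
    if "X \<in> Obj K" "z \<in> simplices (Fun K X M) n" for X z j n
    using that MO u k(1) post_cmp[OF k(2)[of j], of X z n] post_cmp[OF k(3)[of j], of X z n] by simp_all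
  have "limit_cone K (sequence_diagram P s) M k"
  proof (rule limit_coneI)
    show "wf_diagram K (sequence_diagram P s)" by (rule wf_sequence) (use u s in auto)
    show "cmp0 K M (Ob (sequence_diagram P s) v) (Ob (sequence_diagram P s) w) (Ar (sequence_diagram P s) v w) (k v) = k w"
      if vw: "(v, w) \<in> Edge (sequence_diagram P s)" for v w
    proof -
      have v: "v = Suc w" using vw by auto
      have "cmp0 K M (P (Suc w)) (P w) (s w) (k (Suc w)) = k w"
      proof (rule is_pullback_arr_eqI[OF P MO])
        show "cmp0 K M (P w) N (l w) (cmp0 K M (P (Suc w)) (P w) (s w) (k (Suc w))) = cmp0 K M (P w) N (l w) (k w)"
          using cmp_cmp[OF s(2)[of w], of M "k (Suc w)"] MO u k s(1) by simp
        show "cmp0 K M (P w) (E w) (y w) (cmp0 K M (P (Suc w)) (P w) (s w) (k (Suc w))) = cmp0 K M (P w) (E w) (y w) (k w)"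
          using cmp_cmp[OF s(3)[of w], of M "k (Suc w)"] MO u k s(1) g \<mu>(2)
            Cmp_assoc[of M "P (Suc w)" "E (Suc w)" "E w" "k (Suc w)" 0 "y (Suc w)" "g w"] by simp
      qed (use MO u k s in auto)
      then show ?thesis using v by simp
    qed
    fix X n assume X: "X \<in> Obj K"
    {
      fix z z' assume z: "z \<in> simplices (Fun K X M) n" "z' \<in> simplices (Fun K X M) n"
        and e: "\<And>v. v \<in> Vert (sequence_diagram P s) \<Longrightarrow> post_map K X M (Ob (sequence_diagram P s) v) (k v) n z
          = post_map K X M (Ob (sequence_diagram P s) v) (k v) n z'"
      show "z = z'"
      proof (rule limit_cone_eqI[OF wfE M X z])
        fix v show "post_map K X M (Ob (sequence_diagram E g) v) (\<mu> v) n z = post_map K X M (Ob (sequence_diagram E g) v) (\<mu> v) n z'"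
          using e[of v] ek(2)[OF X z(1), of v] ek(2)[OF X z(2), of v] by simp
      qed
    }
    fix x assume x: "\<And>v. v \<in> Vert (sequence_diagram P s) \<Longrightarrow> x v \<in> simplices (Fun K X (Ob (sequence_diagram P s) v)) n"
      and xe: "\<And>v w. (v, w) \<in> Edge (sequence_diagram P s) \<Longrightarrow> post_map K X (Ob (sequence_diagram P s) v)
        (Ob (sequence_diagram P s) w) (Ar (sequence_diagram P s) v w) n (x v) = x w"
    have x': "x v \<in> simplices (Fun K X (P v)) n" for v using x[of v] by simp
    have xe': "post_map K X (P (Suc v)) (P v) (s v) n (x (Suc v)) = x v" for v using xe[of "Suc v" v] by simp
    obtain z where z: "z \<in> simplices (Fun K X M) n"
      "\<And>v. v \<in> Vert (sequence_diagram E g) \<Longrightarrow> post_map K X M (Ob (sequence_diagram E g) v) (\<mu> v) n z = post_map K X (P v) (E v) (y v) n (x v)"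
    proof (rule limit_cone_ex[OF M X])
      show "post_map K X (P v) (E v) (y v) n (x v) \<in> simplices (Fun K X (Ob (sequence_diagram E g) v)) n" for v
        using x'[of v] X u by simp
      show "post_map K X (Ob (sequence_diagram E g) v) (Ob (sequence_diagram E g) w) (Ar (sequence_diagram E g) v w) n
          (post_map K X (P v) (E v) (y v) n (x v)) = post_map K X (P w) (E w) (y w) n (x w)"
        if "(v, w) \<in> Edge (sequence_diagram E g)" for v w
        using that es(2)[OF X x', of w] xe'[of w] by auto
    qed auto
    \<comment> \<open>All members of a compatible family have the same component in
      \<open>N\<close>, so a single simplex over \<open>N\<close> belongs to the whole
      family.\<close>
    have l: "post_map K X (P v) N (l v) n (x v) = post_map K X (P 0) N (l 0) n (x 0)" for v
      by (induction v) (use es(1)[OF X x'] xe' in auto)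
    have hz: "post_map K X M N h n z = post_map K X (P w) N (l w) n (x w)" for w
    proof (rule limit_cone_eqI[OF wfA N X])
      fix v
      have "post_map K X N (A v) (\<nu> v) n (post_map K X M N h n z) = post_map K X (E v) (A v) (p v) n (post_map K X M (E v) (\<mu> v) n z)"
        using post_post_eq[OF h(2)[of v], of X z n] X MO NO t h(1) \<mu>(1) \<nu>(1) z(1) by simp
      also have "\<dots> = post_map K X N (A v) (\<nu> v) n (post_map K X (P v) N (l v) n (x v))"
        using z(2)[of v] is_pullback_commutes[OF P X x', of v] by simp
      finally show "post_map K X N (Ob (sequence_diagram A f) v) (\<nu> v) n (post_map K X M N h n z)
          = post_map K X N (Ob (sequence_diagram A f) v) (\<nu> v) n (post_map K X (P w) N (l w) n (x w))"
        using l[of v] l[of w] by simp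
    qed (use X MO NO h z u x' in auto)
    have "post_map K X M (P v) (k v) n z = x v" for v
      by (rule is_pullback_eqI[OF P X]) (use X MO u(1-8) k(1) z(1) x' ek[OF X z(1), of v] hz[of v] z(2)[of v] in auto)
    then show "\<exists>z\<in>simplices (Fun K X M) n. \<forall>v\<in>Vert (sequence_diagram P s).
        post_map K X M (Ob (sequence_diagram P s) v) (k v) n z = x v"
      using z(1) by auto
  qed (use MO k in auto)
  \<comment> \<open>The projection of the limit \<open>M\<close> to its first stage
    \<open>P 0\<close> is the gap map in question.\<close>
  then have "k 0 \<in> Isofib K M (P 0)"
    using sequence_limit_Isofib[of s P M k] s_Isofib by simp
  then show ?thesis by (rule gap_isofibI[OF P _ k(2,3)])
qed

text \<open>
  The pullback of \<open>k1\<close> and \<open>h'\<close> is the product of the pullbacks of the \<open>f j\<close> and \<open>q j\<close>.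
\<close>

lemma gap_isofib_product:
  assumes I: "|I :: 'u set| <o \<kappa>"
    and p: "\<And>j. j \<in> I \<Longrightarrow> p j \<in> Isofib K (E j) (A j)" and q: "\<And>j. j \<in> I \<Longrightarrow> q j \<in> Isofib K (F j) (B j)"
    and g: "\<And>j. j \<in> I \<Longrightarrow> g j \<in> arr K (E j) (F j)" and f: "\<And>j. j \<in> I \<Longrightarrow> f j \<in> arr K (A j) (B j)"
    and gap: "\<And>j. j \<in> I \<Longrightarrow> gap_isofib K (E j) (A j) (p j) (F j) (B j) (q j) (g j) (f j)"
    and PE: "limit_cone K (product_diagram I E) PE \<pi>E" and PA: "limit_cone K (product_diagram I A) PA \<pi>A"
    and PF: "limit_cone K (product_diagram I F) PF \<pi>F" and PB: "limit_cone K (product_diagram I B) PB \<pi>B"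
    and h: "h \<in> Isofib K PE PA" "\<And>j. j \<in> I \<Longrightarrow> cmp0 K PE PA (A j) (\<pi>A j) h = cmp0 K PE (E j) (A j) (p j) (\<pi>E j)"
    and h': "h' \<in> Isofib K PF PB" "\<And>j. j \<in> I \<Longrightarrow> cmp0 K PF PB (B j) (\<pi>B j) h' = cmp0 K PF (F j) (B j) (q j) (\<pi>F j)"
    and k0: "k0 \<in> arr K PE PF" "\<And>j. j \<in> I \<Longrightarrow> cmp0 K PE PF (F j) (\<pi>F j) k0 = cmp0 K PE (E j) (F j) (g j) (\<pi>E j)"
    and k1: "k1 \<in> arr K PA PB" "\<And>j. j \<in> I \<Longrightarrow> cmp0 K PA PB (B j) (\<pi>B j) k1 = cmp0 K PA (A j) (B j) (f j) (\<pi>A j)"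
    and sq: "cmp0 K PE PF PB h' k0 = cmp0 K PE PA PB k1 h"
  shows "gap_isofib K PE PA h PF PB h' k0 k1"
proof -
  note t = IsofibD[OF p] IsofibD[OF q] and hD = IsofibD[OF h(1)] IsofibD[OF h'(1)]
  have wf: "wf_diagram K (product_diagram I E)" "wf_diagram K (product_diagram I A)"
    "wf_diagram K (product_diagram I F)" "wf_diagram K (product_diagram I B)"
    by (rule wf_product; use t in auto)+
  have \<pi>: "\<pi>E j \<in> arr K PE (E j)" "\<pi>A j \<in> arr K PA (A j)" "\<pi>F j \<in> arr K PF (F j)" "\<pi>B j \<in> arr K PB (B j)"
    if "j \<in> I" for j
    using that limit_cone_wfD(2)[OF wf(1) PE, of j] limit_cone_wfD(2)[OF wf(2) PA, of j]
      limit_cone_wfD(2)[OF wf(3) PF, of j] limit_cone_wfD(2)[OF wf(4) PB, of j] by auto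
  obtain W a b where W: "is_pullback K W PA PF PB a b k1 h'"
    using is_pullback_exists[OF _ k1(1) h'(1)] hD by metis
  note u = is_pullbackD[OF W]
  obtain c where c: "c \<in> arr K PE W" "cmp0 K PE W PA a c = h" "cmp0 K PE W PF b c = k0"
    using is_pullback_arr_ex[OF W hD(1) hD(3) k0(1) sq[symmetric]] .
  have "\<forall>j. \<exists>Q l r k. j \<in> I \<longrightarrow> (is_pullback K Q (A j) (F j) (B j) l r (f j) (q j) \<and> k \<in> Isofib K (E j) Q \<and>
      cmp0 K (E j) Q (A j) l k = p j \<and> cmp0 K (E j) Q (F j) r k = g j)"
    using gap unfolding gap_isofib_def by blast
  then obtain Q l r k where Q: "\<And>j. j \<in> I \<Longrightarrow> is_pullback K (Q j) (A j) (F j) (B j) (l j) (r j) (f j) (q j)"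
    "\<And>j. j \<in> I \<Longrightarrow> k j \<in> Isofib K (E j) (Q j)"
    "\<And>j. j \<in> I \<Longrightarrow> cmp0 K (E j) (Q j) (A j) (l j) (k j) = p j"
    "\<And>j. j \<in> I \<Longrightarrow> cmp0 K (E j) (Q j) (F j) (r j) (k j) = g j" by metis
  note v = is_pullbackD[OF Q(1)] and kD = IsofibD[OF Q(2)]
  have "\<exists>z. j \<in> I \<longrightarrow> (z \<in> arr K W (Q j) \<and> cmp0 K W (Q j) (A j) (l j) z = cmp0 K W PA (A j) (\<pi>A j) a \<and>
      cmp0 K W (Q j) (F j) (r j) z = cmp0 K W PF (F j) (\<pi>F j) b)" for j
  proof (cases "j \<in> I")
    case True
    have "cmp0 K W (A j) (B j) (f j) (cmp0 K W PA (A j) (\<pi>A j) a) = cmp0 K W PB (B j) (\<pi>B j) (cmp0 K W PA PB k1 a)"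
      by (rule cmp_cmp_eq[OF k1(2)[OF True, symmetric]]) (use u v[OF True] \<pi>[OF True] in auto)
    also have "\<dots> = cmp0 K W PB (B j) (\<pi>B j) (cmp0 K W PF PB h' b)" using u by simp
    also have "\<dots> = cmp0 K W (F j) (B j) (q j) (cmp0 K W PF (F j) (\<pi>F j) b)"
      by (rule cmp_cmp_eq[OF h'(2)[OF True]]) (use u v[OF True] \<pi>[OF True] in auto)
    finally show ?thesis
      using is_pullback_arr_ex[OF Q(1)[OF True] u(1)] u v[OF True] \<pi>[OF True] by (metis Cmp_closed)
  qed auto
  then obtain \<omega>0 where \<omega>0: "\<And>j. j \<in> I \<Longrightarrow> \<omega>0 j \<in> arr K W (Q j)"
    "\<And>j. j \<in> I \<Longrightarrow> cmp0 K W (Q j) (A j) (l j) (\<omega>0 j) = cmp0 K W PA (A j) (\<pi>A j) a"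
    "\<And>j. j \<in> I \<Longrightarrow> cmp0 K W (Q j) (F j) (r j) (\<omega>0 j) = cmp0 K W PF (F j) (\<pi>F j) b" by metis
  \<comment> \<open>Cones are extensional functions on the index set, so the chosen legs are cut
    down to \<open>I\<close>.\<close>
  define \<omega> where "\<omega> = restrict \<omega>0 I"
  have \<omega>: "\<And>j. j \<in> I \<Longrightarrow> \<omega> j \<in> arr K W (Q j)"
    "\<And>j. j \<in> I \<Longrightarrow> cmp0 K W (Q j) (A j) (l j) (\<omega> j) = cmp0 K W PA (A j) (\<pi>A j) a"
    "\<And>j. j \<in> I \<Longrightarrow> cmp0 K W (Q j) (F j) (r j) (\<omega> j) = cmp0 K W PF (F j) (\<pi>F j) b"
    "\<And>j. j \<notin> I \<Longrightarrow> \<omega> j = undefined"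
    using \<omega>0 by (auto simp: \<omega>_def)
  have lim: "limit_cone K (product_diagram I Q) W \<omega>"
  proof (rule limit_coneI[OF wf_product u(1)])
    fix X n assume X: "X \<in> Obj K"
    have e: "post_map K X (Q j) (A j) (l j) n (post_map K X W (Q j) (\<omega> j) n z) = post_map K X PA (A j) (\<pi>A j) n (post_map K X W PA a n z)"
      "post_map K X (Q j) (F j) (r j) n (post_map K X W (Q j) (\<omega> j) n z) = post_map K X PF (F j) (\<pi>F j) n (post_map K X W PF b n z)"
      if j: "j \<in> I" and "z \<in> simplices (Fun K X W) n" for j z
      using that X u v[OF j] \<pi>[OF j] \<omega>(1)[OF j] post_cmp[OF \<omega>(2)[OF j], of X z n] post_cmp[OF \<omega>(3)[OF j], of X z n] by simp_all
    {
      fix z z' assume z: "z \<in> simplices (Fun K X W) n" "z' \<in> simplices (Fun K X W) n"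
        and zz: "\<And>j. j \<in> Vert (product_diagram I Q) \<Longrightarrow> post_map K X W (Ob (product_diagram I Q) j) (\<omega> j) n z
          = post_map K X W (Ob (product_diagram I Q) j) (\<omega> j) n z'"
      have "post_map K X W PA a n z = post_map K X W PA a n z'"
      proof (rule limit_cone_eqI[OF wf(2) PA X])
        fix j assume "j \<in> Vert (product_diagram I A)"
        then show "post_map K X PA (Ob (product_diagram I A) j) (\<pi>A j) n (post_map K X W PA a n z)
            = post_map K X PA (Ob (product_diagram I A) j) (\<pi>A j) n (post_map K X W PA a n z')"
          using e(1)[of j z] e(1)[of j z'] zz[of j] z by simp
      qed (use X u z in auto)
      moreover have "post_map K X W PF b n z = post_map K X W PF b n z'"
      proof (rule limit_cone_eqI[OF wf(3) PF X])
        fix j assume "j \<in> Vert (product_diagram I F)"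
        then show "post_map K X PF (Ob (product_diagram I F) j) (\<pi>F j) n (post_map K X W PF b n z)
            = post_map K X PF (Ob (product_diagram I F) j) (\<pi>F j) n (post_map K X W PF b n z')"
          using e(2)[of j z] e(2)[of j z'] zz[of j] z by simp
      qed (use X u z in auto)
      ultimately show "z = z'" by (rule is_pullback_eqI[OF W X z])
    }
    fix x assume x: "\<And>j. j \<in> Vert (product_diagram I Q) \<Longrightarrow> x j \<in> simplices (Fun K X (Ob (product_diagram I Q) j)) n"
    have x': "x j \<in> simplices (Fun K X (Q j)) n" if "j \<in> I" for j using x[of j] that by simp
    obtain za where za: "za \<in> simplices (Fun K X PA) n" "\<And>j. j \<in> Vert (product_diagram I A) \<Longrightarrow>
        post_map K X PA (Ob (product_diagram I A) j) (\<pi>A j) n za = post_map K X (Q j) (A j) (l j) n (x j)"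
      by (rule limit_cone_ex[OF PA X, of "\<lambda>j. post_map K X (Q j) (A j) (l j) n (x j)" n]) (use x' X v in auto)
    obtain zf where zf: "zf \<in> simplices (Fun K X PF) n" "\<And>j. j \<in> Vert (product_diagram I F) \<Longrightarrow>
        post_map K X PF (Ob (product_diagram I F) j) (\<pi>F j) n zf = post_map K X (Q j) (F j) (r j) n (x j)"
      by (rule limit_cone_ex[OF PF X, of "\<lambda>j. post_map K X (Q j) (F j) (r j) n (x j)" n]) (use x' X v in auto)
    have "post_map K X PA PB k1 n za = post_map K X PF PB h' n zf"
    proof (rule limit_cone_eqI[OF wf(4) PB X])
      fix j assume "j \<in> Vert (product_diagram I B)"
      then have j: "j \<in> I" by simp
      have "post_map K X PB (B j) (\<pi>B j) n (post_map K X PA PB k1 n za) = post_map K X (A j) (B j) (f j) n (post_map K X PA (A j) (\<pi>A j) n za)"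
        by (rule post_post_eq[OF k1(2)[OF j]]) (use X u v[OF j] \<pi>[OF j] za in auto)
      also have "\<dots> = post_map K X (F j) (B j) (q j) n (post_map K X PF (F j) (\<pi>F j) n zf)"
        using za(2)[of j] zf(2)[of j] j is_pullback_commutes[OF Q(1)[OF j] X x'[OF j]] by simp
      also have "\<dots> = post_map K X PB (B j) (\<pi>B j) n (post_map K X PF PB h' n zf)"
        by (rule post_post_eq[OF h'(2)[OF j], symmetric]) (use X u v[OF j] \<pi>[OF j] zf in auto)
      finally show "post_map K X PB (Ob (product_diagram I B) j) (\<pi>B j) n (post_map K X PA PB k1 n za)
          = post_map K X PB (Ob (product_diagram I B) j) (\<pi>B j) n (post_map K X PF PB h' n zf)" by simp
    qed (use X u za zf in auto)
    then obtain z where z: "z \<in> simplices (Fun K X W) n" "post_map K X W PA a n z = za" "post_map K X W PF b n z = zf"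
      using is_pullback_ex[OF W X za(1) zf(1)] by metis
    have "post_map K X W (Q j) (\<omega> j) n z = x j" if j: "j \<in> I" for j
      by (rule is_pullback_eqI[OF Q(1)[OF j] X _ x'[OF j]])
        (use X u v[OF j] \<omega>(1)[OF j] z j e[OF j z(1)] za(2)[of j] zf(2)[of j] in auto)
    then show "\<exists>z\<in>simplices (Fun K X W) n. \<forall>j\<in>Vert (product_diagram I Q).
        post_map K X W (Ob (product_diagram I Q) j) (\<omega> j) n z = x j"
      using z(1) by auto
  qed (use v \<omega> in auto)
  have "cmp0 K PE W (Q j) (\<omega> j) c = cmp0 K PE (E j) (Q j) (k j) (\<pi>E j)" if j: "j \<in> I" for j
  proof (rule is_pullback_arr_eqI[OF Q(1)[OF j] hD(1)])
    show "cmp0 K PE (Q j) (A j) (l j) (cmp0 K PE W (Q j) (\<omega> j) c) = cmp0 K PE (Q j) (A j) (l j) (cmp0 K PE (E j) (Q j) (k j) (\<pi>E j))"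
      using cmp_cmp[OF \<omega>(2)[OF j], of PE c] cmp_cmp[OF Q(3)[OF j], of PE "\<pi>E j"] h(2)[OF j] c hD u v[OF j] kD[OF j] \<pi>[OF j] \<omega>(1)[OF j]
        Cmp_assoc[of PE W PA "A j" c 0 a "\<pi>A j"] by simp
    show "cmp0 K PE (Q j) (F j) (r j) (cmp0 K PE W (Q j) (\<omega> j) c) = cmp0 K PE (Q j) (F j) (r j) (cmp0 K PE (E j) (Q j) (k j) (\<pi>E j))"
      using cmp_cmp[OF \<omega>(3)[OF j], of PE c] cmp_cmp[OF Q(4)[OF j], of PE "\<pi>E j"] k0(2)[OF j] c hD u v[OF j] kD[OF j] \<pi>[OF j] \<omega>(1)[OF j]
        Cmp_assoc[of PE W PF "F j" c 0 b "\<pi>F j"] by simp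
  qed (use hD u c \<omega>(1)[OF j] kD[OF j] \<pi>[OF j] v[OF j] in auto)
  \<comment> \<open>By these equations \<open>c\<close> is the product of the gap maps
    \<open>k j\<close>.\<close>
  then have "c \<in> Isofib K PE W"
    by (intro product_Isofib[OF I _ PE lim c(1)]) (use Q(2) in auto)
  then show ?thesis using gap_isofibI[OF W _ c(2,3)] by blast
qed

end

context infinity_cosmos
begin

text \<open>
  Cotensors preserve pullbacks, so the Leibniz cotensor of the gap map \<open>k\<close> is the gap map of the
  square between the Leibniz cotensors of \<open>g\<close> and \<open>f\<close>.
\<close>

lemma gap_isofib_leibniz:
  assumes U: "small_sset \<kappa> (U :: 'u sset)" and V: "small_sset \<kappa> V" and i: "i \<in> smap U V"
    "\<forall>n. inj_on (i n) (simplices U n)"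
    and p: "p \<in> arr K E A" and q: "q \<in> arr K F B" and f: "f \<in> arr K A B" and g: "g \<in> arr K E F"
    and gap: "gap_isofib K E A p F B q g f"
    and E: "cotensor K V E EV ev" "cotensor K U E EU eu" and A: "cotensor K V A AV av" "cotensor K U A AU au"
    and F: "cotensor K V F FV fv" "cotensor K U F FU fu" and B: "cotensor K V B BV bv" "cotensor K U B BU bu"
    and pV: "cotensor_base_map K V E A p EV ev AV av pV" and pU: "cotensor_base_map K U E A p EU eu AU au pU"
    and qV: "cotensor_base_map K V F B q FV fv BV bv qV"
    and gU: "cotensor_base_map K U E F g EU eu FU fu gU" and fU: "cotensor_base_map K U A B f AU au BU bu fU"
    and Fi: "cotensor_weight_map K U i F FV fv FU fu Fi" and Bi: "cotensor_weight_map K U i B BV bv BU bu Bi"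
    and S: "is_pullback K S EU FV FU sE sF gU Fi" and R: "is_pullback K R AU BV BU rA rB fU Bi"
    and m: "m \<in> Isofib K S R" "cmp0 K S R AU rA m = cmp0 K S EU AU pU sE" "cmp0 K S R BV rB m = cmp0 K S FV BV qV sF"
    and k0: "k0 \<in> arr K EV S" "cotensor_weight_map K U i E EV ev EU eu (cmp0 K EV S EU sE k0)"
      "cotensor_base_map K V E F g EV ev FV fv (cmp0 K EV S FV sF k0)"
    and k1: "k1 \<in> arr K AV R" "cotensor_weight_map K U i A AV av AU au (cmp0 K AV R AU rA k1)"
      "cotensor_base_map K V A B f AV av BV bv (cmp0 K AV R BV rB k1)"
    and sq: "cmp0 K EV S R m k0 = cmp0 K EV AV R k1 pV"
  shows "gap_isofib K EV AV pV S R m k0 k1"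
proof -
  note Us = small_sset_simplicial[OF U] and Vs = small_sset_simplicial[OF V]
  obtain Q l r k where Q: "is_pullback K Q A F B l r f q" "k \<in> Isofib K E Q"
    "cmp0 K E Q A l k = p" "cmp0 K E Q F r k = g"
    using gap_isofibE[OF gap] .
  note tQ = is_pullbackD[OF Q(1)] IsofibD[OF Q(2)] and tS = is_pullbackD[OF S] and tR = is_pullbackD[OF R]
  note O = cotensorD(2)[OF E(1)] cotensorD(2)[OF E(2)] cotensorD(2)[OF A(1)] cotensorD(2)[OF A(2)]
    cotensorD(2)[OF F(1)] cotensorD(2)[OF F(2)] cotensorD(2)[OF B(1)] cotensorD(2)[OF B(2)]
  have a: "pV \<in> arr K EV AV" "pU \<in> arr K EU AU" "qV \<in> arr K FV BV" "gU \<in> arr K EU FU" "fU \<in> arr K AU BU"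
    "Fi \<in> arr K FV FU" "Bi \<in> arr K BV BU"
    using pV pU qV gU fU Fi Bi by (auto simp: cotensor_base_map_def cotensor_weight_map_def)
  obtain QV qv where QV: "cotensor K V Q QV qv" using cotensor_ex[OF tQ(1) V] by blast
  obtain QU qu where QU: "cotensor K U Q QU qu" using cotensor_ex[OF tQ(1) U] by blast
  note QO = cotensorD(2)[OF QV] cotensorD(2)[OF QU]
  obtain lV where lV: "cotensor_base_map K V Q A l QV qv AV av lV" using base_map_ex[OF Vs QV A(1) tQ(5)] .
  obtain rV where rV: "cotensor_base_map K V Q F r QV qv FV fv rV" using base_map_ex[OF Vs QV F(1) tQ(6)] .
  obtain fV where fV: "cotensor_base_map K V A B f AV av BV bv fV" using base_map_ex[OF Vs A(1) B(1) f] .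
  obtain lU where lU: "cotensor_base_map K U Q A l QU qu AU au lU" using base_map_ex[OF Us QU A(2) tQ(5)] .
  obtain rU where rU: "cotensor_base_map K U Q F r QU qu FU fu rU" using base_map_ex[OF Us QU F(2) tQ(6)] .
  obtain qU where qU: "cotensor_base_map K U F B q FU fu BU bu qU" using base_map_ex[OF Us F(2) B(2) q] .
  obtain kU where kU: "cotensor_base_map K U E Q k EU eu QU qu kU" using base_map_ex[OF Us E(2) QU tQ(12)] .
  obtain kV where kV: "cotensor_base_map K V E Q k EV ev QV qv kV" using base_map_ex[OF Vs E(1) QV tQ(12)] .
  obtain Qi where Qi: "cotensor_weight_map K U i Q QV qv QU qu Qi" using weight_map_ex[OF Us QV QU i(1)] .
  define Ai where "Ai = cmp0 K AV R AU rA k1"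
  have Ai: "cotensor_weight_map K U i A AV av AU au Ai" unfolding Ai_def by (rule k1(2))
  have b: "lV \<in> arr K QV AV" "rV \<in> arr K QV FV" "lU \<in> arr K QU AU" "rU \<in> arr K QU FU" "fV \<in> arr K AV BV"
     "qU \<in> arr K FU BU" "kU \<in> arr K EU QU" "kV \<in> arr K EV QV" "Qi \<in> arr K QV QU" "Ai \<in> arr K AV AU"
    using lV rV lU rU fV qU kU kV Qi Ai by (auto simp: cotensor_base_map_def cotensor_weight_map_def)
  \<comment> \<open>The legs of \<open>k0\<close> and \<open>k1\<close> are prescribed only as base
    and weight maps; uniqueness identifies them with the chosen cotensors of arrows.\<close>
  have rBk1: "cmp0 K AV R BV rB k1 = fV" by (rule base_map_unique[OF A(1) B(1) k1(3) fV])
  have PV: "is_pullback K QV AV FV BV lV rV fV qV"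
    by (rule is_pullback_cotensor[OF Vs Q(1) QV A(1) F(1) B(1) lV rV fV qV])
  have PU: "is_pullback K QU AU FU BU lU rU fU qU"
    by (rule is_pullback_cotensor[OF Us Q(1) QU A(2) F(2) B(2) lU rU fU qU])
  have lkU: "cmp0 K EU QU AU lU kU = pU"
    using base_map_unique[OF E(2) A(2) _ pU] base_map_comp[OF E(2) QU A(2) kU lU tQ(12,5)] Q(3) by simp
  have rkU: "cmp0 K EU QU FU rU kU = gU"
    using base_map_unique[OF E(2) F(2) _ gU] base_map_comp[OF E(2) QU F(2) kU rU tQ(12,6)] Q(4) by simp
  have lkV: "cmp0 K EV QV AV lV kV = pV"
    using base_map_unique[OF E(1) A(1) _ pV] base_map_comp[OF E(1) QV A(1) kV lV tQ(12,5)] Q(3) by simp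
  have rkV: "cmp0 K EV QV FV rV kV = cmp0 K EV S FV sF k0"
    using base_map_unique[OF E(1) F(1) _ k0(3)] base_map_comp[OF E(1) QV F(1) kV rV tQ(12,6)] Q(4) by simp
  have lQi: "cmp0 K QV QU AU lU Qi = cmp0 K QV AV AU Ai lV"
    by (rule base_weight_commute[OF QV QU A i(1) tQ(5) lV lU Qi Ai])
  have rQi: "cmp0 K QV QU FU rU Qi = cmp0 K QV FV FU Fi rV"
    by (rule base_weight_commute[OF QV QU F i(1) tQ(6) rV rU Qi Fi])
  obtain W wA wS where W: "is_pullback K W AV S R wA wS k1 m"
    using is_pullback_exists[OF O(3) k1(1) m(1)] .
  note u = is_pullbackD[OF W]
  define w1 where "w1 = cmp0 K W S EU sE wS"
  have w1: "w1 \<in> arr K W EU" unfolding w1_def using u tS by simp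
  have "cmp0 K W AV BV fV wA = cmp0 K W FV BV qV (cmp0 K W S FV sF wS)"
    using cmp_cmp[OF rBk1, of W wA] u O tR tS k1(1) a cmp_cmp_eq[OF m(3), of W wS] IsofibD[OF m(1)] by simp
  then obtain w2 where w2: "w2 \<in> arr K W QV" "cmp0 K W QV AV lV w2 = wA" "cmp0 K W QV FV rV w2 = cmp0 K W S FV sF wS"
    using is_pullback_arr_ex[OF PV u(1) u(5)] u tS by (metis Cmp_closed)
  \<comment> \<open>This identifies \<open>W\<close> with the target of the Leibniz cotensor of
    \<open>k\<close>: on both sides a simplex amounts to simplices over \<open>EU\<close>,
    \<open>AV\<close> and \<open>FV\<close> that agree in \<open>AU\<close>, \<open>FU\<close> and
    \<open>BV\<close>.\<close>
  have pbW: "is_pullback K W EU QV QU w1 w2 kU Qi"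
  proof (rule is_pullbackI)
    show "cmp0 K W EU QU kU w1 = cmp0 K W QV QU Qi w2"
    proof (rule is_pullback_arr_eqI[OF PU u(1)])
      have "cmp0 K W QU AU lU (cmp0 K W EU QU kU w1) = cmp0 K W S AU (cmp0 K S EU AU pU sE) wS"
        using cmp_cmp[OF lkU, of W w1] O QO u b w1 tS a by (simp add: w1_def Cmp_assoc)
      also have "\<dots> = cmp0 K W R AU rA (cmp0 K W S R m wS)"
        using m O u tR tS IsofibD[OF m(1)] by (simp add: Cmp_assoc[symmetric])
      also have "\<dots> = cmp0 K W AV AU Ai wA"
        using u(9) O u tR k1(1) cmp_cmp[OF Ai_def[symmetric], of W wA] by simp
      also have "\<dots> = cmp0 K W QU AU lU (cmp0 K W QV QU Qi w2)"
        using cmp_cmp_eq[OF lQi, of W w2] O QO u b w2 by simp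
      finally show "cmp0 K W QU AU lU (cmp0 K W EU QU kU w1) = cmp0 K W QU AU lU (cmp0 K W QV QU Qi w2)" .
      have "cmp0 K W QU FU rU (cmp0 K W EU QU kU w1) = cmp0 K W EU FU gU (cmp0 K W S EU sE wS)"
        using cmp_cmp[OF rkU, of W w1] O QO u b w1 tS a by (simp add: w1_def)
      also have "\<dots> = cmp0 K W FV FU Fi (cmp0 K W S FV sF wS)"
        using cmp_cmp_eq[OF tS(9), of W wS] O u tS by simp
      also have "\<dots> = cmp0 K W QU FU rU (cmp0 K W QV QU Qi w2)"
        using cmp_cmp_eq[OF rQi, of W w2] O QO u b w2 a by simp
      finally show "cmp0 K W QU FU rU (cmp0 K W EU QU kU w1) = cmp0 K W QU FU rU (cmp0 K W QV QU Qi w2)" .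
    qed (use O QO u b w1 w2 in auto)
    fix X n assume X: "X \<in> Obj K"
    have e: "post_map K X W EU w1 n z = post_map K X S EU sE n (post_map K X W S wS n z)"
      "post_map K X QV AV lV n (post_map K X W QV w2 n z) = post_map K X W AV wA n z"
      "post_map K X QV FV rV n (post_map K X W QV w2 n z) = post_map K X S FV sF n (post_map K X W S wS n z)"
      if "z \<in> simplices (Fun K X W) n" for z
      using that X O QO u b tS w2(1) post_cmp[OF w2(2), of X z n] post_cmp[OF w2(3), of X z n] by (simp_all add: w1_def)
    {
      fix z z' assume z: "z \<in> simplices (Fun K X W) n" "z' \<in> simplices (Fun K X W) n"
        "post_map K X W EU w1 n z = post_map K X W EU w1 n z'" "post_map K X W QV w2 n z = post_map K X W QV w2 n z'"
      have "post_map K X W S wS n z = post_map K X W S wS n z'"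
        by (rule is_pullback_eqI[OF S X, where n = n]) (use z e[OF z(1)] e[OF z(2)] X u in auto)
      then show "z = z'"
        using is_pullback_eqI[OF W X z(1,2)] e(2)[OF z(1)] e(2)[OF z(2)] z(4) by simp
    }
    fix x y assume x: "x \<in> simplices (Fun K X EU) n" and y: "y \<in> simplices (Fun K X QV) n"
      and xy: "post_map K X EU QU kU n x = post_map K X QV QU Qi n y"
    have "post_map K X QU FU rU n (post_map K X EU QU kU n x) = post_map K X QU FU rU n (post_map K X QV QU Qi n y)"
      "post_map K X QU AU lU n (post_map K X EU QU kU n x) = post_map K X QU AU lU n (post_map K X QV QU Qi n y)"
      using xy by simp_all
    then have xy': "post_map K X EU FU gU n x = post_map K X FV FU Fi n (post_map K X QV FV rV n y)"
      "post_map K X EU AU pU n x = post_map K X AV AU Ai n (post_map K X QV AV lV n y)"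
      using X O QO b x y a post_cmp[OF rkU, of X x n] post_cmp[OF lkU, of X x n] post_post_eq[OF rQi, of X y n]
        post_post_eq[OF lQi, of X y n] by simp_all
    obtain s where s: "s \<in> simplices (Fun K X S) n" "post_map K X S EU sE n s = x"
      "post_map K X S FV sF n s = post_map K X QV FV rV n y"
      using is_pullback_ex[OF S X x _ xy'(1)] y X O QO b by auto
    have "post_map K X AV R k1 n (post_map K X QV AV lV n y) = post_map K X S R m n s"
    proof (rule is_pullback_eqI[OF R X, where n = n])
      show "post_map K X R AU rA n (post_map K X AV R k1 n (post_map K X QV AV lV n y))
          = post_map K X R AU rA n (post_map K X S R m n s)"
        using X O QO b y s tS tR a xy'(2) k1(1) IsofibD[OF m(1)] post_cmp[OF Ai_def[symmetric], of X "post_map K X QV AV lV n y" n]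
          post_post_eq[OF m(2), of X s n] by simp
      show "post_map K X R BV rB n (post_map K X AV R k1 n (post_map K X QV AV lV n y))
          = post_map K X R BV rB n (post_map K X S R m n s)"
        using X O QO b y s tS tR a k1(1) IsofibD[OF m(1)] post_cmp[OF rBk1, of X "post_map K X QV AV lV n y" n]
          post_post_eq[OF m(3), of X s n] is_pullback_commutes[OF PV X y] by simp
    qed (use X O QO b y s tS k1(1) IsofibD[OF m(1)] in auto)
    then obtain z where z: "z \<in> simplices (Fun K X W) n" "post_map K X W AV wA n z = post_map K X QV AV lV n y"
      "post_map K X W S wS n z = s"
      using is_pullback_ex[OF W X _ s(1)] X O QO b y by (metis post_closed)
    have "post_map K X W QV w2 n z = y"
      by (rule is_pullback_eqI[OF PV X, where n = n]) (use X O QO u b w2(1) z y s e[OF z(1)] in auto)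
    then show "\<exists>z\<in>simplices (Fun K X W) n. post_map K X W EU w1 n z = x \<and> post_map K X W QV w2 n z = y"
      using z s e(1)[OF z(1)] by auto
  qed (use O QO u b w1 w2 in auto)
  obtain d where d: "d \<in> arr K EV W" "cmp0 K EV W AV wA d = pV" "cmp0 K EV W S wS d = k0"
    using is_pullback_arr_ex[OF W O(1) a(1) k0(1) sq[symmetric]] .
  have w1d: "cmp0 K EV W EU w1 d = cmp0 K EV S EU sE k0"
    using d O u tS by (simp add: w1_def Cmp_assoc)
  have w2d: "cmp0 K EV W QV w2 d = kV"
  proof (rule is_pullback_arr_eqI[OF PV O(1)])
    show "cmp0 K EV QV AV lV (cmp0 K EV W QV w2 d) = cmp0 K EV QV AV lV kV"
      using lkV d O QO u b w2(1) cmp_cmp[OF w2(2), of EV d] by simp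
    show "cmp0 K EV QV FV rV (cmp0 K EV W QV w2 d) = cmp0 K EV QV FV rV kV"
      using rkV d O QO u b tS w2(1) cmp_cmp[OF w2(3), of EV d] by (simp add: Cmp_assoc)
  qed (use O QO u b d w2 in auto)
  have "leibniz_cotensor K U V i E Q k EV W d"
    unfolding leibniz_cotensor_def
    by (intro exI conjI, rule E(1), rule E(2), rule QV, rule QU, rule kU, rule Qi, rule is_pullback_limit_cone[OF pbW], rule d(1))
      (simp_all add: w1d w2d k0(2) kV)
  then have "d \<in> Isofib K EV W"
    by (rule leibniz_Isofib[OF U V i Q(2)])
  then show ?thesis using gap_isofibI[OF W _ d(2,3)] by blast
qed

section \<open>Isofibrations of squares in terms of gap maps\<close>

lemma square_gap_iff:
  assumes "x \<in> Obj K2" "y \<in> Obj K2" "m \<in> arr K2 x y"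
  shows "square_gap K x y m P k \<longleftrightarrow> (\<exists>l r. is_pullback K P (cd x) (dm y) (cd y) l r (snd m) (ar y) \<and>
        k \<in> arr K (dm x) P \<and> cmp0 K (dm x) P (cd x) l k = ar x \<and> cmp0 K (dm x) P (dm y) r k = fst m)" (is "_ \<longleftrightarrow> ?G")
proof -
  note t = Obj_arrowD[OF assms(1)] Obj_arrowD[OF assms(2)]
  have m: "snd m \<in> arr K (cd x) (cd y)" using assms(3) by (simp add: Fun_arrow_iff)
  have lc: "limit_cone K (cospan (cd x) (snd m) (cd y) (ar y) (dm y)) P \<pi> \<longleftrightarrow>
      is_pullback K P (cd x) (dm y) (cd y) (\<pi> CLeft) (\<pi> CRight) (snd m) (ar y) \<and>
      \<pi> CBase = cmp0 K P (cd x) (cd y) (snd m) (\<pi> CLeft)" for P \<pi>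
    by (rule limit_cone_cospan_iff) (use t m in auto)
  show ?thesis
  proof
    assume "square_gap K x y m P k"
    then show ?G unfolding square_gap_def case_prod_beta lc by blast
  next
    assume ?G
    then obtain l r where G: "is_pullback K P (cd x) (dm y) (cd y) l r (snd m) (ar y)"
      "k \<in> arr K (dm x) P" "cmp0 K (dm x) P (cd x) l k = ar x" "cmp0 K (dm x) P (dm y) r k = fst m" by blast
    show "square_gap K x y m P k"
      unfolding square_gap_def case_prod_beta
      by (rule exI[of _ "\<lambda>v. case v of CLeft \<Rightarrow> l | CRight \<Rightarrow> r | CBase \<Rightarrow> cmp0 K P (cd x) (cd y) (snd m) l"])
        (use G is_pullback_limit_cone[OF G(1)] in simp)
  qed
qed

lemma Isofib_arrow_iff:
  "m \<in> Isofib K2 x y \<longleftrightarrow> x \<in> Obj K2 \<and> y \<in> Obj K2 \<and> m \<in> arr K2 x y \<and> snd m \<in> Isofib K (cd x) (cd y) \<and>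
    gap_isofib K (dm x) (cd x) (ar x) (dm y) (cd y) (ar y) (fst m) (snd m)" (is "?L \<longleftrightarrow> ?R")
proof -
  have "?L \<longleftrightarrow> x \<in> Obj K2 \<and> y \<in> Obj K2 \<and> m \<in> arr K2 x y \<and> snd m \<in> Isofib K (cd x) (cd y) \<and>
      (\<exists>P k. square_gap K x y m P k \<and> k \<in> Isofib K (dm x) P)"
    by (cases x; cases y; cases m) (auto simp: arrow_cosmos_def)
  moreover have "(\<exists>P k. square_gap K x y m P k \<and> k \<in> Isofib K (dm x) P) \<longleftrightarrow>
      gap_isofib K (dm x) (cd x) (ar x) (dm y) (cd y) (ar y) (fst m) (snd m)"
    if "x \<in> Obj K2" "y \<in> Obj K2" "m \<in> arr K2 x y"
    unfolding square_gap_iff[OF that] gap_isofib_def using IsofibD(3) by blast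
  ultimately show ?thesis by blast
qed

end

section \<open>The infinity-cosmos of isofibrations\<close>

context infinity_cosmos
begin

lemma Isofib_arrowD:
  assumes "m \<in> Isofib K2 x y"
  shows "x \<in> Obj K2" "y \<in> Obj K2" "m \<in> arr K2 x y" "snd m \<in> Isofib K (cd x) (cd y)"
    "gap_isofib K (dm x) (cd x) (ar x) (dm y) (cd y) (ar y) (fst m) (snd m)"
    "fst m \<in> Isofib K (dm x) (dm y)"
  using assms gap_isofib_top unfolding Isofib_arrow_iff by blast+

lemma arr_arrowD:
  assumes "m \<in> arr K2 x y" "x \<in> Obj K2" "y \<in> Obj K2"
  shows "fst m \<in> arr K (dm x) (dm y)" "snd m \<in> arr K (cd x) (cd y)"
    "cmp0 K (dm x) (dm y) (cd y) (ar y) (fst m) = cmp0 K (dm x) (cd x) (cd y) (snd m) (ar x)"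
  using assms(1) unfolding arr_arrow_iff[OF assms(2,3)] by auto

lemma Isofib_arrow_comp:
  assumes m: "m \<in> Isofib K2 x y" and m': "m' \<in> Isofib K2 y z"
  shows "cmp0 K2 x y z m' m \<in> Isofib K2 x z"
proof -
  note a = Isofib_arrowD[OF m] and b = Isofib_arrowD[OF m']
  note ta = arr_arrowD[OF a(3,1,2)] and tb = arr_arrowD[OF b(3,1,2)]
  have "gap_isofib K (dm x) (cd x) (ar x) (dm z) (cd z) (ar z)
      (cmp0 K (dm x) (dm y) (dm z) (fst m') (fst m)) (cmp0 K (cd x) (cd y) (cd z) (snd m') (snd m))"
    by (rule gap_isofib_comp[OF Obj_arrowD(4)[OF a(2)] Obj_arrowD(4)[OF b(2)] ta(1,2) tb a(5) b(5)])
  then show ?thesis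
    using a b Isofib_comp[OF a(4) b(4)] arrow.Cmp_closed[OF a(1,2) b(2) a(3) b(3)]
    by (simp add: Isofib_arrow_iff Cmp_arrow)
qed

lemma isomorphism_arrow_components:
  assumes "isomorphism K2 x y m"
  shows "isomorphism K (dm x) (dm y) (fst m)" "isomorphism K (cd x) (cd y) (snd m)"
  using assms Obj_arrowD[of x] Obj_arrowD[of y]
  by (auto simp: isomorphism_def Cmp_arrow Unit_arrow Fun_arrow_iff)

text \<open>With \<open>dm y\<close> as the pullback along the isomorphism \<open>snd m\<close>, the
  gap map is \<open>fst m\<close>, again an isomorphism.\<close>

lemma isomorphism_Isofib_arrow:
  assumes m: "isomorphism K2 x y m"
  shows "m \<in> Isofib K2 x y"
proof -
  have o: "x \<in> Obj K2" "y \<in> Obj K2" "m \<in> arr K2 x y" using m by (auto simp: isomorphism_def)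
  note c = isomorphism_arrow_components[OF m] and t = Obj_arrowD[OF o(1)] Obj_arrowD[OF o(2)]
    and ta = arr_arrowD[OF o(3,1,2)]
  obtain f' where f': "f' \<in> arr K (cd y) (cd x)" "cmp0 K (cd x) (cd y) (cd x) f' (snd m) = Unit K (cd x)"
    "cmp0 K (cd y) (cd x) (cd y) (snd m) f' = Unit K (cd y)"
    using isomorphism_inverse[OF c(2)] by metis
  have "gap_isofib K (dm x) (cd x) (ar x) (dm y) (cd y) (ar y) (fst m) (snd m)"
  proof (rule gap_isofibI[OF is_pullback_iso[OF c(2) t(5,7) f']])
    show "fst m \<in> Isofib K (dm x) (dm y)" by (rule isomorphism_Isofib[OF c(1)])
    have "cmp0 K (dm x) (dm y) (cd x) (cmp0 K (dm y) (cd y) (cd x) f' (ar y)) (fst m)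
        = cmp0 K (dm x) (cd y) (cd x) f' (cmp0 K (dm x) (cd x) (cd y) (snd m) (ar x))"
      using t ta f' by (simp add: Cmp_assoc)
    also have "\<dots> = ar x" using cmp_cmp[OF f'(2), of "dm x" "ar x"] t ta f' by simp
    finally show "cmp0 K (dm x) (dm y) (cd x) (cmp0 K (dm y) (cd y) (cd x) f' (ar y)) (fst m) = ar x" .
    show "cmp0 K (dm x) (dm y) (dm y) (Unit K (dm y)) (fst m) = fst m" using t ta by simp
  qed
  then show ?thesis
    using o isomorphism_Isofib[OF c(2)] by (simp add: Isofib_arrow_iff)
qed

section \<open>Function complexes of squares\<close>

lemma simplicial_set_arrow: "\<lbrakk>x \<in> Obj K2; y \<in> Obj K2\<rbrakk> \<Longrightarrow> simplicial_set (Fun K2 x y)"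
  by (rule arrow.Fun_simplicial_set)

lemma small_arrow:
  assumes "x \<in> Obj K2" "y \<in> Obj K2"
  shows "small_sset \<kappa> (Fun K2 x y)"
proof -
  note t = Obj_arrowD[OF assms(1)] Obj_arrowD[OF assms(2)]
  have "|simplices (Fun K2 x y) n| <o \<kappa>" for n
  proof -
    have "simplices (Fun K2 x y) n \<subseteq> simplices (Fun K (dm x) (dm y)) n \<times> simplices (Fun K (cd x) (cd y)) n"
      by (auto simp: Fun_arrow_iff)
    then have "|simplices (Fun K2 x y) n| \<le>o |simplices (Fun K (dm x) (dm y)) n \<times> simplices (Fun K (cd x) (cd y)) n|"
      by (rule card_of_mono1)
    moreover have "|simplices (Fun K (dm x) (dm y)) n \<times> simplices (Fun K (cd x) (cd y)) n| <o \<kappa>"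
      by (rule universe_cardinal_Times[OF universe])
        (use Fun_small[OF t(1,5)] Fun_small[OF t(2,6)] in \<open>auto simp: small_sset_def\<close>)
    ultimately show ?thesis by (rule ordLeq_ordLess_trans)
  qed
  then show ?thesis using simplicial_set_arrow[OF assms] by (simp add: small_sset_def)
qed

lemma has_rlp_Isofib:
  assumes "X \<in> Obj K" "p \<in> Isofib K E B"
  shows "0 < k \<Longrightarrow> k < n \<Longrightarrow> has_rlp (horn n k) (std_simplex n) (Fun K X E) (Fun K X B) (post_map K X E B p)"
    and "e \<in> {0, 1} \<Longrightarrow> has_rlp (iso_endpoint e) iso_nerve (Fun K X E) (Fun K X B) (post_map K X E B p)"
  using Fun_Isofib[OF assms] unfolding qcat_isofibration_def inner_fibration_def by blast+

lemma smap_arrow_components: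
  assumes S: "simplicial_set S" and u: "u \<in> smap S (Fun K2 X x)"
  shows "(\<lambda>n. \<lambda>s\<in>simplices S n. fst (u n s)) \<in> smap S (Fun K (dm X) (dm x))"
    "(\<lambda>n. \<lambda>s\<in>simplices S n. snd (u n s)) \<in> smap S (Fun K (cd X) (cd x))"
    "\<And>n s. s \<in> simplices S n \<Longrightarrow> post_map K (dm X) (dm x) (cd x) (ar x) n (fst (u n s))
      = pre_map K (dm X) (cd X) (cd x) (ar X) n (snd (u n s))"
proof -
  note u' = u[unfolded Fun_arrow]
  show "(\<lambda>n. \<lambda>s\<in>simplices S n. fst (u n s)) \<in> smap S (Fun K (dm X) (dm x))"
    "(\<lambda>n. \<lambda>s\<in>simplices S n. snd (u n s)) \<in> smap S (Fun K (cd X) (cd x))"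
    by (rule spullback_smap_fst[OF S u'], rule spullback_smap_snd[OF S u'])
  show "post_map K (dm X) (dm x) (cd x) (ar x) n (fst (u n s))
      = pre_map K (dm X) (cd X) (cd x) (ar X) n (snd (u n s))" if "s \<in> simplices S n" for n s
    using smap_closed[OF u that] by (simp add: Fun_arrow_iff)
qed

lemma has_rlpD:
  assumes "has_rlp S T X Y p" "u \<in> smap S X" "v \<in> smap T Y" "\<And>n s. s \<in> simplices S n \<Longrightarrow> p n (u n s) = v n s"
  obtains w where "w \<in> smap T X" "\<And>n s. s \<in> simplices S n \<Longrightarrow> w n s = u n s" "\<And>n s. s \<in> simplices T n \<Longrightarrow> p n (w n s) = v n s"
  using assms unfolding has_rlp_def by blast

text \<open>The lift is built in the order of a Reedy diagram: the codomain component is lifted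
  along \<open>snd m\<close>; with \<open>fst v\<close> it defines a map into the pullback
  \<open>P\<close>, and the domain component is lifted along the gap map \<open>k\<close>. A
  separate lift along \<open>fst m\<close> need not form a square with the first one. The hypothesis
  \<open>rlp\<close> is abstract so as to cover both the inner horns and the endpoints of
  \<open>iso_nerve\<close>.\<close>

lemma has_rlp_arrow:
  assumes S: "simplicial_set S" and T: "simplicial_set T" and ST: "\<And>n. simplices S n \<subseteq> simplices T n"
    and act: "\<And>m n \<alpha> s. s \<in> simplices S n \<Longrightarrow> act S m n \<alpha> s = act T m n \<alpha> s"
    and X: "X \<in> Obj K2" and m: "m \<in> Isofib K2 x y"
    and rlp: "\<And>X E B p. X \<in> Obj K \<Longrightarrow> p \<in> Isofib K E B \<Longrightarrow> has_rlp S T (Fun K X E) (Fun K X B) (post_map K X E B p)"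
  shows "has_rlp S T (Fun K2 X x) (Fun K2 X y) (post_map K2 X x y m)"
  unfolding has_rlp_def
proof (intro ballI impI)
  note a = Isofib_arrowD[OF m]
  note ta = arr_arrowD[OF a(3,1,2)] and t = Obj_arrowD[OF X] Obj_arrowD[OF a(1)] Obj_arrowD[OF a(2)]
  obtain P l r k where P: "is_pullback K P (cd x) (dm y) (cd y) l r (snd m) (ar y)" "k \<in> Isofib K (dm x) P"
    "cmp0 K (dm x) P (cd x) l k = ar x" "cmp0 K (dm x) P (dm y) r k = fst m"
    using gap_isofibE[OF a(5)] .
  note tP = is_pullbackD[OF P(1)] IsofibD[OF P(2)]
  fix u v assume u: "u \<in> smap S (Fun K2 X x)" and v: "v \<in> smap T (Fun K2 X y)"
    and uv: "\<forall>n. \<forall>s\<in>simplices S n. post_map K2 X x y m n (u n s) = v n s"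
  note uc = smap_closed[OF u, unfolded Fun_arrow_iff] and vc = smap_closed[OF v, unfolded Fun_arrow_iff]
  note u' = smap_arrow_components[OF S u] and v' = smap_arrow_components[OF T v]
  have uv': "post_map K (dm X) (dm x) (dm y) (fst m) n (fst (u n s)) = fst (v n s)"
    "post_map K (cd X) (cd x) (cd y) (snd m) n (snd (u n s)) = snd (v n s)" if "s \<in> simplices S n" for n s
    using uv that post_map_arrow[OF smap_closed[OF u that], of y m] by (auto dest!: bspec[OF _ that] spec[of _ n])
  obtain w1 where w1: "w1 \<in> smap T (Fun K (cd X) (cd x))" "\<And>n s. s \<in> simplices S n \<Longrightarrow> w1 n s = snd (u n s)"
    "\<And>n s. s \<in> simplices T n \<Longrightarrow> post_map K (cd X) (cd x) (cd y) (snd m) n (w1 n s) = snd (v n s)"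
    using has_rlpD[OF rlp[OF t(2) a(4)] u'(2) v'(2)] uv'(2) ST by (auto simp: subset_iff)
  have pre: "(\<lambda>n. \<lambda>s\<in>simplices T n. pre_map K (dm X) (cd X) (cd x) (ar X) n (w1 n s)) \<in> smap T (Fun K (dm X) (cd x))"
    by (rule smap_comp[OF T w1(1)]) (use t in auto)
  note w1c = smap_closed[OF w1(1)]
  obtain z where z: "z \<in> smap T (Fun K (dm X) P)"
    "\<And>n s. s \<in> simplices T n \<Longrightarrow> post_map K (dm X) P (cd x) l n (z n s) = pre_map K (dm X) (cd X) (cd x) (ar X) n (w1 n s)"
    "\<And>n s. s \<in> simplices T n \<Longrightarrow> post_map K (dm X) P (dm y) r n (z n s) = fst (v n s)"
  proof (rule is_pullback_smap_ex[OF P(1) t(1) T pre v'(1)])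
    fix n s assume s: "s \<in> simplices T n"
    then show "post_map K (dm X) (cd x) (cd y) (snd m) n ((\<lambda>s\<in>simplices T n. pre_map K (dm X) (cd X) (cd x) (ar X) n (w1 n s)) s)
        = post_map K (dm X) (dm y) (cd y) (ar y) n ((\<lambda>s\<in>simplices T n. fst (v n s)) s)"
      using w1(3)[OF s] v'(3)[OF s] t ta w1c[OF s] by (simp add: post_pre)
  qed auto
  note zc = smap_closed[OF z(1)]
  have kz: "post_map K (dm X) (dm x) P k n (fst (u n s)) = z n s" if s: "s \<in> simplices S n" for n s
  proof (rule is_pullback_eqI[OF P(1) t(1), where n = n])
    have sT: "s \<in> simplices T n" using s ST by blast
    show "post_map K (dm X) P (cd x) l n (post_map K (dm X) (dm x) P k n (fst (u n s))) = post_map K (dm X) P (cd x) l n (z n s)"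
      using z(2)[OF sT] w1(2)[OF s] u'(3)[OF s] uc[OF s] t tP post_cmp[OF P(3), of "dm X" "fst (u n s)" n] by simp
    show "post_map K (dm X) P (dm y) r n (post_map K (dm X) (dm x) P k n (fst (u n s))) = post_map K (dm X) P (dm y) r n (z n s)"
      using z(3)[OF sT] uv'(1)[OF s] uc[OF s] t tP post_cmp[OF P(4), of "dm X" "fst (u n s)" n] by simp
  qed (use t tP uc[OF s] zc s ST in auto)
  obtain w0 where w0: "w0 \<in> smap T (Fun K (dm X) (dm x))" "\<And>n s. s \<in> simplices S n \<Longrightarrow> w0 n s = fst (u n s)"
    "\<And>n s. s \<in> simplices T n \<Longrightarrow> post_map K (dm X) (dm x) P k n (w0 n s) = z n s"
    using has_rlpD[OF rlp[OF t(1) P(2)] u'(1) z(1)] kz by auto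
  note w0c = smap_closed[OF w0(1)]
  have pw: "post_map K (dm X) (dm x) (cd x) (ar x) n (w0 n s) = pre_map K (dm X) (cd X) (cd x) (ar X) n (w1 n s)"
    if s: "s \<in> simplices T n" for n s
    using z(2)[OF s] w0(3)[OF s] w0c[OF s] t tP post_cmp[OF P(3), of "dm X" "w0 n s" n] by simp
  let ?w = "\<lambda>n. \<lambda>s\<in>simplices T n. (w0 n s, w1 n s)"
  have w: "?w \<in> smap T (Fun K2 X x)"
    unfolding Fun_arrow by (rule spullback_smapI[OF T w0(1) w1(1)]) (rule pw)
  have v_eq: "post_map K2 X x y m n (?w n s) = v n s" if s: "s \<in> simplices T n" for n s
    using post_map_arrow[OF smap_closed[OF w s], of y m] w1(3)[OF s] z(3)[OF s] w0(3)[OF s] w0c[OF s] s t tP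
      post_cmp[OF P(4), of "dm X" "w0 n s" n] by (simp add: prod_eq_iff)
  have u_eq: "?w n s = u n s" if "s \<in> simplices S n" for n s
    using subsetD[OF ST that] w0(2)[OF that] w1(2)[OF that] by (simp add: prod_eq_iff)
  show "\<exists>w\<in>smap T (Fun K2 X x). (\<forall>n. \<forall>s\<in>simplices S n. w n s = u n s) \<and>
      (\<forall>n. \<forall>s\<in>simplices T n. post_map K2 X x y m n (w n s) = v n s)"
    by (intro bexI[OF _ w] conjI allI ballI u_eq v_eq)
qed

lemma horn_subset: "simplices (horn n k) m \<subseteq> simplices (std_simplex n) m"
  by (auto simp: horn_def)

lemma act_horn: "act (horn n k) l m \<alpha> s = act (std_simplex n) l m \<alpha> s"
  by (simp add: horn_def)

text \<open>The horn is filled in the codomains first; the filler in the domains is then a lift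
  along the isofibration \<open>ar x\<close>, so that both form a square.\<close>

lemma quasi_category_arrow:
  assumes X: "X \<in> Obj K2" and x: "x \<in> Obj K2"
  shows "quasi_category (Fun K2 X x)"
  unfolding quasi_category_def
proof (intro conjI allI impI ballI)
  note t = Obj_arrowD[OF X] Obj_arrowD[OF x]
  show "simplicial_set (Fun K2 X x)" by (rule simplicial_set_arrow[OF X x])
  fix n k :: nat and u assume nk: "0 < k \<and> k < n" and u: "u \<in> smap (horn n k) (Fun K2 X x)"
  note u' = smap_arrow_components[OF simplicial_set_horn u]
  let ?T = "std_simplex n"
  obtain w1 where w1: "w1 \<in> smap ?T (Fun K (cd X) (cd x))" "\<And>m s. s \<in> simplices (horn n k) m \<Longrightarrow> w1 m s = snd (u m s)"
    using conjunct2[OF Fun_quasi_category[OF t(2,6), unfolded quasi_category_def], rule_format, OF nk u'(2)] by auto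
  have pre: "(\<lambda>m. \<lambda>s\<in>simplices ?T m. pre_map K (dm X) (cd X) (cd x) (ar X) m (w1 m s)) \<in> smap ?T (Fun K (dm X) (cd x))"
    by (rule smap_comp[OF simplicial_set_std_simplex w1(1)]) (use t in auto)
  obtain w0 where w0: "w0 \<in> smap ?T (Fun K (dm X) (dm x))" "\<And>m s. s \<in> simplices (horn n k) m \<Longrightarrow> w0 m s = fst (u m s)"
    "\<And>m s. s \<in> simplices ?T m \<Longrightarrow> post_map K (dm X) (dm x) (cd x) (ar x) m (w0 m s) = pre_map K (dm X) (cd X) (cd x) (ar X) m (w1 m s)"
  proof (rule has_rlpD[OF has_rlp_Isofib(1)[OF t(1,8), of k n] u'(1) pre])
    fix m s assume s: "s \<in> simplices (horn n k) m"
    then show "post_map K (dm X) (dm x) (cd x) (ar x) m ((\<lambda>s\<in>simplices (horn n k) m. fst (u m s)) s)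
        = (\<lambda>s\<in>simplices ?T m. pre_map K (dm X) (cd X) (cd x) (ar X) m (w1 m s)) s"
      using u'(3)[OF s] w1(2)[OF s] horn_subset[of n k m] by (auto simp del: simplices_std_simplex)
  qed (use nk in auto)
  let ?w = "\<lambda>m. \<lambda>s\<in>simplices ?T m. (w0 m s, w1 m s)"
  have w: "?w \<in> smap ?T (Fun K2 X x)"
    unfolding Fun_arrow by (rule spullback_smapI[OF simplicial_set_std_simplex w0(1) w1(1)]) (rule w0(3))
  have u_eq: "?w m s = u m s" if "s \<in> simplices (horn n k) m" for m s
    using subsetD[OF horn_subset that] w0(2)[OF that] w1(2)[OF that]
    by (simp add: prod_eq_iff del: simplices_std_simplex)
  show "\<exists>w\<in>smap ?T (Fun K2 X x). \<forall>m. \<forall>s\<in>simplices (horn n k) m. w m s = u m s"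
    by (intro bexI[OF _ w] allI ballI u_eq)
qed

lemma Fun_Isofib_arrow:
  assumes X: "X \<in> Obj K2" and m: "m \<in> Isofib K2 x y"
  shows "qcat_isofibration (Fun K2 X x) (Fun K2 X y) (post_map K2 X x y m)"
  unfolding qcat_isofibration_def inner_fibration_def
proof (intro conjI allI impI ballI)
  note a = Isofib_arrowD[OF m]
  show "quasi_category (Fun K2 X x)" "quasi_category (Fun K2 X y)"
    using quasi_category_arrow X a by auto
  show "post_map K2 X x y m \<in> smap (Fun K2 X x) (Fun K2 X y)" using X a by simp
  show "has_rlp (horn n k) (std_simplex n) (Fun K2 X x) (Fun K2 X y) (post_map K2 X x y m)" if "0 < k \<and> k < n" for n k :: nat
    by (rule has_rlp_arrow[OF simplicial_set_horn simplicial_set_std_simplex horn_subset act_horn X m])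
      (use that has_rlp_Isofib(1) in auto)
  show "has_rlp (iso_endpoint e) iso_nerve (Fun K2 X x) (Fun K2 X y) (post_map K2 X x y m)" if "e \<in> {0, 1}" for e
    by (rule has_rlp_arrow[OF simplicial_set_iso_endpoint simplicial_set_iso_nerve _ _ X m])
      (use that has_rlp_Isofib(2) in \<open>auto simp: iso_endpoint_def iso_nerve_def\<close>)
qed

section \<open>Diagrams of squares and their components\<close>

lemma limit_cone_product_components:
  assumes "\<forall>i\<in>I. X i \<in> Obj K2"
  shows "limit_cone K (dom_diagram (product_diagram I X)) = limit_cone K (product_diagram I (\<lambda>i. dm (X i)))"
    and "limit_cone K (cod_diagram (product_diagram I X)) = limit_cone K (product_diagram I (\<lambda>i. cd (X i)))"
  \<comment> \<open>The images of a product diagram carry a projection of \<open>undefined\<close>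
    as arrows, so only their limit cones are compared; for sequences and cospans the diagrams
    themselves are equal.\<close>
  by (intro ext limit_cone_cong wf_product; use assms Obj_arrowD in auto)+

lemma dom_diagram_sequence: "dom_diagram (sequence_diagram X r) = sequence_diagram (\<lambda>n. dm (X n)) (\<lambda>n. fst (r n))"
  by (simp add: dom_diagram_def sequence_diagram_def)

lemma cod_diagram_sequence: "cod_diagram (sequence_diagram X r) = sequence_diagram (\<lambda>n. cd (X n)) (\<lambda>n. snd (r n))"
  by (simp add: cod_diagram_def sequence_diagram_def)

lemma dom_diagram_cospan: "dom_diagram (cospan X s Z r Y) = cospan (dm X) (fst s) (dm Z) (fst r) (dm Y)"
  by (auto simp: dom_diagram_def cospan_def fun_eq_iff split: cospan_vertex.split)

lemma cod_diagram_cospan: "cod_diagram (cospan X s Z r Y) = cospan (cd X) (snd s) (cd Z) (snd r) (cd Y)"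
  by (auto simp: cod_diagram_def cospan_def fun_eq_iff split: cospan_vertex.split)

lemma isofib_limits_product:
  assumes I: "|I :: 'u set| <o \<kappa>" and X: "\<forall>i\<in>I. X i \<in> Obj K2"
  shows "isofib_limits K (product_diagram I X)"
  unfolding isofib_limits_def limit_cone_product_components[OF X]
proof (intro allI impI)
  fix M \<mu> N \<nu> h
  assume "limit_cone K (product_diagram I (\<lambda>i. dm (X i))) M \<mu>" "limit_cone K (product_diagram I (\<lambda>i. cd (X i))) N \<nu>" "h \<in> arr K M N"
    "\<forall>v\<in>Vert (product_diagram I X). cmp0 K M N (cd (Ob (product_diagram I X) v)) (\<nu> v) h
      = cmp0 K M (dm (Ob (product_diagram I X) v)) (cd (Ob (product_diagram I X) v)) (ar (Ob (product_diagram I X) v)) (\<mu> v)"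
  then show "h \<in> Isofib K M N"
    using product_Isofib[OF I, of "\<lambda>i. ar (X i)" "\<lambda>i. dm (X i)" "\<lambda>i. cd (X i)" M \<mu> N \<nu> h] X Obj_arrowD(4) by auto
qed

text \<open>The map between the limits is the source of a square onto \<open>ar (X 0)\<close> whose
  gap map is an isofibration, and is therefore an isofibration itself. The gap is stated on its own
  because the projection to the first stage needs it.\<close>

lemma isofib_limits_sequence:
  assumes r: "\<forall>n. r n \<in> Isofib K2 (X (Suc n)) (X n)"
  shows "isofib_limits K (sequence_diagram X r)"
    and "\<lbrakk>limit_cone K (sequence_diagram (\<lambda>n. dm (X n)) (\<lambda>n. fst (r n))) M \<mu>;
      limit_cone K (sequence_diagram (\<lambda>n. cd (X n)) (\<lambda>n. snd (r n))) N \<nu>; h \<in> arr K M N;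
      \<And>n. cmp0 K M N (cd (X n)) (\<nu> n) h = cmp0 K M (dm (X n)) (cd (X n)) (ar (X n)) (\<mu> n)\<rbrakk>
      \<Longrightarrow> gap_isofib K M N h (dm (X 0)) (cd (X 0)) (ar (X 0)) (\<mu> 0) (\<nu> 0)"
proof -
  note a = Isofib_arrowD[OF r[rule_format]]
  note t = Obj_arrowD[OF a(2)] and ta = arr_arrowD[OF a(3) a(1) a(2)]
  have gap: "gap_isofib K M N h (dm (X 0)) (cd (X 0)) (ar (X 0)) (\<mu> 0) (\<nu> 0)"
    if "limit_cone K (sequence_diagram (\<lambda>n. dm (X n)) (\<lambda>n. fst (r n))) M \<mu>"
      "limit_cone K (sequence_diagram (\<lambda>n. cd (X n)) (\<lambda>n. snd (r n))) N \<nu>" "h \<in> arr K M N"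
      "\<And>n. cmp0 K M N (cd (X n)) (\<nu> n) h = cmp0 K M (dm (X n)) (cd (X n)) (ar (X n)) (\<mu> n)" for M \<mu> N \<nu> h
    by (rule gap_isofib_sequence[of "\<lambda>n. ar (X n)" "\<lambda>n. dm (X n)" "\<lambda>n. cd (X n)" "\<lambda>n. fst (r n)" "\<lambda>n. snd (r n)"])
      (use that t ta a in auto)
  then show "\<lbrakk>limit_cone K (sequence_diagram (\<lambda>n. dm (X n)) (\<lambda>n. fst (r n))) M \<mu>;
      limit_cone K (sequence_diagram (\<lambda>n. cd (X n)) (\<lambda>n. snd (r n))) N \<nu>; h \<in> arr K M N;
      \<And>n. cmp0 K M N (cd (X n)) (\<nu> n) h = cmp0 K M (dm (X n)) (cd (X n)) (ar (X n)) (\<mu> n)\<rbrakk>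
      \<Longrightarrow> gap_isofib K M N h (dm (X 0)) (cd (X 0)) (ar (X 0)) (\<mu> 0) (\<nu> 0)" .
  show "isofib_limits K (sequence_diagram X r)"
    unfolding isofib_limits_def dom_diagram_sequence cod_diagram_sequence
    using gap_isofib_source[OF gap t(4)[of 0]] by auto
qed

text \<open>Used twice: its source is an isofibration, which makes the objectwise pullback an object
  of the arrow cosmos, and the gap itself shows that the projection to \<open>X\<close> is an
  isofibration of squares.\<close>

lemma arrow_pullback_gap:
  assumes X: "X \<in> Obj K2" and s: "s \<in> arr K2 X Z" and r: "r \<in> Isofib K2 Y Z"
    and M: "is_pullback K M (dm X) (dm Y) (dm Z) mX mY (fst s) (fst r)"
    and N: "is_pullback K N (cd X) (cd Y) (cd Z) nX nY (snd s) (snd r)"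
    and h: "h \<in> arr K M N" "cmp0 K M N (cd X) nX h = cmp0 K M (dm X) (cd X) (ar X) mX"
      "cmp0 K M N (cd Y) nY h = cmp0 K M (dm Y) (cd Y) (ar Y) mY"
  shows "gap_isofib K M N h (dm X) (cd X) (ar X) mX nX"
proof -
  note a = Isofib_arrowD[OF r]
  show ?thesis
    by (rule gap_isofib_pullback[OF Obj_arrowD(4)[OF X] Obj_arrowD(4)[OF a(2)] Obj_arrowD(3)[OF a(1)] a(5)
          arr_arrowD(3)[OF s X a(2)] M N h])
qed

lemma wf_cospan_arrow:
  assumes X: "X \<in> Obj K2" and s: "s \<in> arr K2 X Z" and r: "r \<in> Isofib K2 Y Z"
  shows "wf_diagram K2 (cospan X s Z r Y)"
  using Isofib_arrowD[OF r] X s by (intro arrow.wf_cospan) auto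

lemma isofib_limits_cospan:
  assumes X: "X \<in> Obj K2" and s: "s \<in> arr K2 X Z" and r: "r \<in> Isofib K2 Y Z"
  shows "isofib_limits K (cospan X s Z r Y)"
  unfolding isofib_limits_def dom_diagram_cospan cod_diagram_cospan
proof (intro allI impI)
  note a = Isofib_arrowD[OF r]
  note t = Obj_arrowD[OF X] Obj_arrowD[OF a(1)] Obj_arrowD[OF a(2)] and ts = arr_arrowD[OF s X a(2)] and tr = arr_arrowD[OF a(3,1,2)]
  fix M \<mu> N \<nu> h
  assume M: "limit_cone K (cospan (dm X) (fst s) (dm Z) (fst r) (dm Y)) M \<mu>"
    and N: "limit_cone K (cospan (cd X) (snd s) (cd Z) (snd r) (cd Y)) N \<nu>" and h: "h \<in> arr K M N"
    and e: "\<forall>v\<in>Vert (cospan X s Z r Y). cmp0 K M N (cd (Ob (cospan X s Z r Y) v)) (\<nu> v) h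
      = cmp0 K M (dm (Ob (cospan X s Z r Y) v)) (cd (Ob (cospan X s Z r Y) v)) (ar (Ob (cospan X s Z r Y) v)) (\<mu> v)"
  have "is_pullback K M (dm X) (dm Y) (dm Z) (\<mu> CLeft) (\<mu> CRight) (fst s) (fst r)"
    using M limit_cone_cospan_iff[of "dm X" "dm Y" "dm Z"] t ts tr by blast
  moreover have "is_pullback K N (cd X) (cd Y) (cd Z) (\<nu> CLeft) (\<nu> CRight) (snd s) (snd r)"
    using N limit_cone_cospan_iff[of "cd X" "cd Y" "cd Z"] t ts tr by blast
  ultimately have "gap_isofib K M N h (dm X) (cd X) (ar X) (\<mu> CLeft) (\<nu> CLeft)"
    by (rule arrow_pullback_gap[OF X s r _ _ h]) (use e[rule_format, of CLeft] e[rule_format, of CRight] in auto)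
  then show "h \<in> Isofib K M N" by (rule gap_isofib_source[OF _ t(4)])
qed

text \<open>As \<open>q\<close> is an isofibration of squares, the pullbacks of its components exist
  in \<open>K\<close>, and the given pullback can be compared with the one built from them.\<close>

lemma is_pullback_arrow_components:
  assumes P: "is_pullback K2 P X Y Z l r s q" and q: "q \<in> Isofib K2 Y Z"
  shows "is_pullback K (dm P) (dm X) (dm Y) (dm Z) (fst l) (fst r) (fst s) (fst q)"
    and "is_pullback K (cd P) (cd X) (cd Y) (cd Z) (snd l) (snd r) (snd s) (snd q)"
proof -
  note tP = is_pullbackD[OF P]
  note a = Isofib_arrowD[OF q]
  note t = Obj_arrowD[OF tP(2)] Obj_arrowD[OF a(1)] Obj_arrowD[OF a(2)] and ts = arr_arrowD[OF tP(7,2,4)] and tr = arr_arrowD[OF a(3,1,2)]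
  obtain M \<mu> where M: "limit_cone K (dom_diagram (cospan X s Z q Y)) M \<mu>"
    unfolding dom_diagram_cospan using pullback_ex[OF t(1) ts(1) a(6)] by blast
  obtain N \<nu> where N: "limit_cone K (cod_diagram (cospan X s Z q Y)) N \<nu>"
    unfolding cod_diagram_cospan using pullback_ex[OF t(2) ts(2) a(4)] by blast
  let ?\<pi> = "\<lambda>v. case v of CLeft \<Rightarrow> l | CRight \<Rightarrow> r | CBase \<Rightarrow> cmp0 K2 P X Z s l"
  note c = limit_cone_arrow_components[OF wf_cospan_arrow[OF tP(2,7) q] isofib_limits_cospan[OF tP(2,7) q] M N
    arrow.is_pullback_limit_cone[OF P]]
  have "is_pullback K (dm P) (dm X) (dm Y) (dm Z) (fst (?\<pi> CLeft)) (fst (?\<pi> CRight)) (fst s) (fst q)"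
    using c(1)[unfolded dom_diagram_cospan] limit_cone_cospan_iff[of "dm X" "dm Y" "dm Z" "fst s" "fst q"] t ts tr by simp
  then show "is_pullback K (dm P) (dm X) (dm Y) (dm Z) (fst l) (fst r) (fst s) (fst q)" by simp
  have "is_pullback K (cd P) (cd X) (cd Y) (cd Z) (snd (?\<pi> CLeft)) (snd (?\<pi> CRight)) (snd s) (snd q)"
    using c(2)[unfolded cod_diagram_cospan] limit_cone_cospan_iff[of "cd X" "cd Y" "cd Z" "snd s" "snd q"] t ts tr by simp
  then show "is_pullback K (cd P) (cd X) (cd Y) (cd Z) (snd l) (snd r) (snd s) (snd q)" by simp
qed

lemma wf_sequence_arrow:
  assumes "\<forall>n. r n \<in> Isofib K2 (X (Suc n)) (X n)"
  shows "wf_diagram K2 (sequence_diagram X r)"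
  using Isofib_arrowD[OF assms[rule_format]] by (intro arrow.wf_sequence) auto

lemma sequence_limits_ex:
  assumes "\<forall>n. r n \<in> Isofib K2 (X (Suc n)) (X n)"
  obtains M \<mu> N \<nu> where "limit_cone K (dom_diagram (sequence_diagram X r)) M \<mu>" "limit_cone K (cod_diagram (sequence_diagram X r)) N \<nu>"
  unfolding dom_diagram_sequence cod_diagram_sequence
  using Isofib_arrowD[OF assms[rule_format]] sequence_limit_ex[of "\<lambda>n. fst (r n)" "\<lambda>n. dm (X n)"] sequence_limit_ex[of "\<lambda>n. snd (r n)" "\<lambda>n. cd (X n)"]
  by auto

lemma product_limits_ex:
  assumes I: "|I :: 'u set| <o \<kappa>" and X: "\<forall>i\<in>I. X i \<in> Obj K2"
  obtains M \<mu> N \<nu> where "limit_cone K (dom_diagram (product_diagram I X)) M \<mu>" "limit_cone K (cod_diagram (product_diagram I X)) N \<nu>"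
  unfolding limit_cone_product_components[OF X]
  using product_ex[OF I, of "\<lambda>i. dm (X i)"] product_ex[OF I, of "\<lambda>i. cd (X i)"] X Obj_arrowD by auto

lemma limit_cone_product_arrow_components:
  assumes I: "|I :: 'u set| <o \<kappa>" and X: "\<forall>i\<in>I. X i \<in> Obj K2" and L: "limit_cone K2 (product_diagram I X) L \<pi>"
  shows "limit_cone K (product_diagram I (\<lambda>i. dm (X i))) (dm L) (\<lambda>i\<in>I. fst (\<pi> i))"
    and "limit_cone K (product_diagram I (\<lambda>i. cd (X i))) (cd L) (\<lambda>i\<in>I. snd (\<pi> i))"
proof -
  have wf: "wf_diagram K2 (product_diagram I X)" using X by (intro arrow.wf_product) auto
  obtain M \<mu> N \<nu> where MN: "limit_cone K (dom_diagram (product_diagram I X)) M \<mu>" "limit_cone K (cod_diagram (product_diagram I X)) N \<nu>"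
    using product_limits_ex[OF I X] .
  note c = limit_cone_arrow_components[OF wf isofib_limits_product[OF I X] MN L]
  show "limit_cone K (product_diagram I (\<lambda>i. dm (X i))) (dm L) (\<lambda>i\<in>I. fst (\<pi> i))"
    and "limit_cone K (product_diagram I (\<lambda>i. cd (X i))) (cd L) (\<lambda>i\<in>I. snd (\<pi> i))"
    using c unfolding limit_cone_product_components[OF X] by simp_all
qed

section \<open>Terminal objects\<close>

lemma terminal_arrow:
  assumes S: "terminal K S" and T: "terminal K T" and h: "h \<in> arr K S T"
  shows "terminal K2 (S, T, h)"
proof -
  have o: "S \<in> Obj K" "T \<in> Obj K" using S T by (auto simp: terminal_def)
  have O: "(S, T, h) \<in> Obj K2" using terminal_Isofib[OF T o(1) h] by (simp add: Obj_arrow_iff)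
  have "\<exists>!z. z \<in> simplices (Fun K2 X (S, T, h)) n" if X: "X \<in> Obj K2" for X n
  proof -
    note t = Obj_arrowD[OF X]
    obtain a where a: "a \<in> simplices (Fun K (dm X) S) n" using S t unfolding terminal_def by blast
    obtain b where b: "b \<in> simplices (Fun K (cd X) T) n" using T t unfolding terminal_def by blast
    have "post_map K (dm X) S T h n a = pre_map K (dm X) (cd X) T (ar X) n b"
      by (rule terminal_unique[OF T t(1), where n = n]) (use t o h a b in auto)
    then have "(a, b) \<in> simplices (Fun K2 X (S, T, h)) n" using a b by (simp add: Fun_arrow_iff)
    moreover have "z = (a, b)" if "z \<in> simplices (Fun K2 X (S, T, h)) n" for z
      using that terminal_unique[OF S t(1) _ a] terminal_unique[OF T t(2) _ b] by (auto simp: Fun_arrow_iff prod_eq_iff)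
    ultimately show ?thesis by blast
  qed
  then show ?thesis using O by (simp add: terminal_def)
qed

text \<open>A terminal object is treated as an empty product, to which the comparison with
  objectwise limits applies.\<close>

lemma terminal_arrow_components:
  assumes L: "terminal K2 L"
  shows "terminal K (dm L)" "terminal K (cd L)"
proof -
  have I: "|{} :: 'u set| <o \<kappa>" by (rule universe_cardinal_finite[OF universe]) simp
  have "limit_cone K2 (product_diagram ({} :: 'u set) Y) L (\<lambda>v. undefined)" for Y
    using L arrow.terminal_iff_limit_cone by blast
  from limit_cone_product_arrow_components[OF I _ this]
  have "limit_cone K (product_diagram ({} :: 'u set) (\<lambda>i. dm (undefined :: 'o \<times> 'o \<times> 'a))) (dm L) (\<lambda>i. undefined)"
    "limit_cone K (product_diagram ({} :: 'u set) (\<lambda>i. cd (undefined :: 'o \<times> 'o \<times> 'a))) (cd L) (\<lambda>i. undefined)"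
    by (auto simp: restrict_def)
  then show "terminal K (dm L)" "terminal K (cd L)"
    using terminal_iff_limit_cone by blast+
qed

lemma terminal_arrow_ex: "\<exists>T. terminal K2 T"
proof -
  obtain T where T: "terminal K T" using terminal_ex by blast
  then have "Unit K T \<in> arr K T T" by (simp add: terminal_def)
  then show ?thesis using terminal_arrow[OF T T] by blast
qed

text \<open>Both components of \<open>T\<close> are terminal, so \<open>cd x\<close> itself is the
  pullback and the gap map is \<open>ar x\<close>.\<close>

lemma terminal_Isofib_arrow:
  assumes T: "terminal K2 T" and x: "x \<in> Obj K2" and m: "m \<in> arr K2 x T"
  shows "m \<in> Isofib K2 x T"
proof -
  note c = terminal_arrow_components[OF T]
  have TO: "T \<in> Obj K2" using T by (simp add: terminal_def)
  note t = Obj_arrowD[OF x] Obj_arrowD[OF TO] and tm = arr_arrowD[OF m x TO]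
  obtain r where r: "r \<in> arr K (cd x) (dm T)" using terminal_arr_ex[OF c(1) t(2)] by blast
  have eqT: "z = z'" if "X \<in> Obj K" "z \<in> simplices (Fun K X (cd T)) n" "z' \<in> simplices (Fun K X (cd T)) n" for X z z' n
    using terminal_unique[OF c(2) that] .
  have eqS: "z = z'" if "X \<in> Obj K" "z \<in> simplices (Fun K X (dm T)) n" "z' \<in> simplices (Fun K X (dm T)) n" for X z z' n
    using terminal_unique[OF c(1) that] .
  have "is_pullback K (cd x) (cd x) (dm T) (cd T) (Unit K (cd x)) r (snd m) (ar T)"
  proof (rule is_pullbackI)
    show "cmp0 K (cd x) (cd x) (cd T) (snd m) (Unit K (cd x)) = cmp0 K (cd x) (dm T) (cd T) (ar T) r"
      by (rule eqT[of "cd x" _ 0]) (use t r tm in auto)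
    show "\<exists>z\<in>simplices (Fun K X (cd x)) n. post_map K X (cd x) (cd x) (Unit K (cd x)) n z = a \<and>
        post_map K X (cd x) (dm T) r n z = y"
      if that: "X \<in> Obj K" "a \<in> simplices (Fun K X (cd x)) n" "y \<in> simplices (Fun K X (dm T)) n" for X n a y
    proof -
      have "post_map K X (cd x) (dm T) r n a = y"
        by (rule eqS[OF that(1) _ that(3)]) (use that t r in auto)
      then show ?thesis using that t by auto
    qed
  qed (use t r tm in auto)
  moreover have "cmp0 K (dm x) (cd x) (dm T) r (ar x) = fst m"
    by (rule eqS[of "dm x" _ 0]) (use t r tm in auto)
  ultimately have "gap_isofib K (dm x) (cd x) (ar x) (dm T) (cd T) (ar T) (fst m) (snd m)"
    by (intro gap_isofibI[OF _ t(4)]) (use t in auto)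
  then show ?thesis
    using terminal_Isofib[OF c(2) t(2) tm(2)] x TO m by (simp add: Isofib_arrow_iff)
qed

section \<open>Stability of isofibrations of squares under limits\<close>

lemma pullback_Isofib_arrow:
  assumes X: "X \<in> Obj K2" and s: "s \<in> arr K2 X Z" and q: "q \<in> Isofib K2 Y Z"
    and P: "limit_cone K2 (cospan X s Z q Y) P \<tau>"
  shows "\<tau> CLeft \<in> Isofib K2 P X"
proof -
  note a = Isofib_arrowD[OF q]
  have pb: "is_pullback K2 P X Y Z (\<tau> CLeft) (\<tau> CRight) s q"
    using P arrow.limit_cone_cospan_iff[OF X a(1,2) s a(3)] by blast
  note tP = is_pullbackD[OF pb] and c = is_pullback_arrow_components[OF pb q]
  note tl = arr_arrowD[OF tP(5,1,2)] and tr = arr_arrowD[OF tP(6,1,3)]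
  have "gap_isofib K (dm P) (cd P) (ar P) (dm X) (cd X) (ar X) (fst (\<tau> CLeft)) (snd (\<tau> CLeft))"
    by (rule arrow_pullback_gap[OF X s q c Obj_arrowD(3)[OF tP(1)]]) (use tl tr in auto)
  moreover have "snd (\<tau> CLeft) \<in> Isofib K (cd P) (cd X)"
    by (rule is_pullback_Isofib[OF c(2) a(4)])
  ultimately show ?thesis using tP by (simp add: Isofib_arrow_iff)
qed

lemma product_Isofib_arrow:
  assumes I: "|I :: 'u set| <o \<kappa>" and ps: "\<forall>j\<in>I. ps j \<in> Isofib K2 (Es j) (Bs j)"
    and P: "limit_cone K2 (product_diagram I Es) P \<pi>" and Q: "limit_cone K2 (product_diagram I Bs) Q \<rho>"
    and k: "k \<in> arr K2 P Q" "\<forall>j\<in>I. cmp0 K2 P Q (Bs j) (\<rho> j) k = cmp0 K2 P (Es j) (Bs j) (ps j) (\<pi> j)"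
  shows "k \<in> Isofib K2 P Q"
proof -
  note a = Isofib_arrowD[OF ps[rule_format]]
  have E: "\<forall>j\<in>I. Es j \<in> Obj K2" and B: "\<forall>j\<in>I. Bs j \<in> Obj K2" using a(1,2) by blast+
  note cP = limit_cone_product_arrow_components[OF I E P] and cQ = limit_cone_product_arrow_components[OF I B Q]
  have wf: "wf_diagram K2 (product_diagram I Es)" "wf_diagram K2 (product_diagram I Bs)"
    using E B by (auto intro!: arrow.wf_product)
  note wP = arrow.limit_cone_wfD[OF wf(1) P] and wQ = arrow.limit_cone_wfD[OF wf(2) Q]
  note tk = arr_arrowD[OF k(1) wP(1) wQ(1)]
  have kj: "cmp0 K (dm P) (dm Q) (dm (Bs j)) (fst (\<rho> j)) (fst k) = cmp0 K (dm P) (dm (Es j)) (dm (Bs j)) (fst (ps j)) (fst (\<pi> j))"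
    "cmp0 K (cd P) (cd Q) (cd (Bs j)) (snd (\<rho> j)) (snd k) = cmp0 K (cd P) (cd (Es j)) (cd (Bs j)) (snd (ps j)) (snd (\<pi> j))"
    if "j \<in> I" for j using k(2) that by (auto simp: Cmp_arrow)
  have \<pi>j: "cmp0 K (dm P) (cd P) (cd (Es j)) (snd (\<pi> j)) (ar P) = cmp0 K (dm P) (dm (Es j)) (cd (Es j)) (ar (Es j)) (fst (\<pi> j))"
    "cmp0 K (dm Q) (cd Q) (cd (Bs j)) (snd (\<rho> j)) (ar Q) = cmp0 K (dm Q) (dm (Bs j)) (cd (Bs j)) (ar (Bs j)) (fst (\<rho> j))"
    if j: "j \<in> I" for j
    using arr_arrowD(3)[OF _ wP(1) E[rule_format, OF j], of "\<pi> j"] arr_arrowD(3)[OF _ wQ(1) B[rule_format, OF j], of "\<rho> j"]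
      wP(2)[of j] wQ(2)[of j] j by auto
  have "snd k \<in> Isofib K (cd P) (cd Q)"
    by (rule product_Isofib[OF I _ cP(2) cQ(2) tk(2), of "\<lambda>j. snd (ps j)"]) (use a(4) kj in auto)
  moreover have "gap_isofib K (dm P) (cd P) (ar P) (dm Q) (cd Q) (ar Q) (fst k) (snd k)"
    by (rule gap_isofib_product[OF I, of "\<lambda>j. ar (Es j)" _ _ "\<lambda>j. ar (Bs j)" _ _ "\<lambda>j. fst (ps j)" "\<lambda>j. snd (ps j)",
          OF _ _ _ _ _ cP cQ Obj_arrowD(4)[OF wP(1)] _ Obj_arrowD(4)[OF wQ(1)] _ tk(1) _ tk(2) _ tk(3)])
      (use a arr_arrowD[OF a(3) a(1) a(2)] Obj_arrowD(4)[OF a(1)] Obj_arrowD(4)[OF a(2)] kj \<pi>j in auto)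
  ultimately show ?thesis using wP(1) wQ(1) k(1) by (simp add: Isofib_arrow_iff)
qed

lemma sequence_limit_Isofib_arrow:
  assumes r: "\<forall>n. r n \<in> Isofib K2 (X (Suc n)) (X n)" and L: "limit_cone K2 (sequence_diagram X r) L \<sigma>"
  shows "\<sigma> 0 \<in> Isofib K2 L (X 0)"
proof -
  note a = Isofib_arrowD[OF r[rule_format]]
  note wf = wf_sequence_arrow[OF r]
  obtain M \<mu> N \<nu> where MN: "limit_cone K (dom_diagram (sequence_diagram X r)) M \<mu>" "limit_cone K (cod_diagram (sequence_diagram X r)) N \<nu>"
    using sequence_limits_ex[OF r] .
  have c: "limit_cone K (sequence_diagram (\<lambda>n. dm (X n)) (\<lambda>n. fst (r n))) (dm L) (\<lambda>n. fst (\<sigma> n))"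
    "limit_cone K (sequence_diagram (\<lambda>n. cd (X n)) (\<lambda>n. snd (r n))) (cd L) (\<lambda>n. snd (\<sigma> n))"
    using limit_cone_arrow_components[OF wf isofib_limits_sequence(1)[OF r] MN L]
    by (simp_all add: dom_diagram_sequence cod_diagram_sequence restrict_UNIV)
  have LO: "L \<in> Obj K2" and \<sigma>: "\<sigma> n \<in> arr K2 L (X n)" for n
    using arrow.limit_cone_wfD(1)[OF wf L] arrow.limit_cone_wfD(2)[OF wf L, of n] by auto
  note ts = arr_arrowD[OF \<sigma> LO a(2)]
  have "snd (\<sigma> 0) \<in> Isofib K (cd L) (cd (X 0))"
    by (rule sequence_limit_Isofib[OF _ c(2)]) (use a(4) in auto)
  moreover have "gap_isofib K (dm L) (cd L) (ar L) (dm (X 0)) (cd (X 0)) (ar (X 0)) (fst (\<sigma> 0)) (snd (\<sigma> 0))"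
    by (rule isofib_limits_sequence(2)[OF r c Obj_arrowD(3)[OF LO]]) (use ts in auto)
  ultimately show ?thesis using LO a(2)[of 0] \<sigma>[of 0] by (simp add: Isofib_arrow_iff)
qed

section \<open>Cotensors and Leibniz cotensors of squares\<close>

lemma base_map_arrow_components:
  assumes U: "simplicial_set U" and ct: "cotensor K2 U x C u" "cotensor K2 U y D v" and c: "cotensor_base_map K2 U x y m C u D v c"
  shows "cotensor_base_map K U (dm x) (dm y) (fst m) (dm C) (\<lambda>n. \<lambda>s\<in>simplices U n. fst (u n s))
      (dm D) (\<lambda>n. \<lambda>s\<in>simplices U n. fst (v n s)) (fst c)"
    and "cotensor_base_map K U (cd x) (cd y) (snd m) (cd C) (\<lambda>n. \<lambda>s\<in>simplices U n. snd (u n s))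
      (cd D) (\<lambda>n. \<lambda>s\<in>simplices U n. snd (v n s)) (snd c)"
proof -
  note t = arrow.cotensorD[OF ct(1)] arrow.cotensorD[OF ct(2)]
  have ca: "c \<in> arr K2 C D" using c by (simp add: cotensor_base_map_def)
  have e: "pre_map K (dm C) (dm D) (dm y) (fst c) n (fst (v n s)) = post_map K (dm C) (dm x) (dm y) (fst m) n (fst (u n s)) \<and>
    pre_map K (cd C) (cd D) (cd y) (snd c) n (snd (v n s)) = post_map K (cd C) (cd x) (cd y) (snd m) n (snd (u n s))"
    if s: "s \<in> simplices U n" for n s
    using c s pre_map_arrow[OF smap_closed[OF t(6) s], of C c] post_map_arrow[OF smap_closed[OF t(3) s], of y m]
    by (simp add: cotensor_base_map_def)
  show "cotensor_base_map K U (dm x) (dm y) (fst m) (dm C) (\<lambda>n. \<lambda>s\<in>simplices U n. fst (u n s))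
      (dm D) (\<lambda>n. \<lambda>s\<in>simplices U n. fst (v n s)) (fst c)"
    and "cotensor_base_map K U (cd x) (cd y) (snd m) (cd C) (\<lambda>n. \<lambda>s\<in>simplices U n. snd (u n s))
      (cd D) (\<lambda>n. \<lambda>s\<in>simplices U n. snd (v n s)) (snd c)"
    using e arr_arrowD[OF ca t(2,5)] by (auto simp: cotensor_base_map_def)
qed

lemma weight_map_arrow_components:
  assumes i: "i \<in> smap U V" and ct: "cotensor K2 V x C v" "cotensor K2 U x D u" and c: "cotensor_weight_map K2 U i x C v D u c"
  shows "cotensor_weight_map K U i (dm x) (dm C) (\<lambda>n. \<lambda>s\<in>simplices V n. fst (v n s))
      (dm D) (\<lambda>n. \<lambda>s\<in>simplices U n. fst (u n s)) (fst c)"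
    and "cotensor_weight_map K U i (cd x) (cd C) (\<lambda>n. \<lambda>s\<in>simplices V n. snd (v n s))
      (cd D) (\<lambda>n. \<lambda>s\<in>simplices U n. snd (u n s)) (snd c)"
proof -
  note t = arrow.cotensorD[OF ct(1)] arrow.cotensorD[OF ct(2)]
  have ca: "c \<in> arr K2 C D" using c by (simp add: cotensor_weight_map_def)
  have e: "pre_map K (dm C) (dm D) (dm x) (fst c) n (fst (u n s)) = fst (v n (i n s)) \<and>
    pre_map K (cd C) (cd D) (cd x) (snd c) n (snd (u n s)) = snd (v n (i n s))"
    if s: "s \<in> simplices U n" for n s
  proof -
    have "pre_map K2 C D x c n (u n s) = v n (i n s)" using c s by (simp add: cotensor_weight_map_def)
    then show ?thesis using pre_map_arrow[OF smap_closed[OF t(6) s], of C c] by (metis fst_conv snd_conv)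
  qed
  show "cotensor_weight_map K U i (dm x) (dm C) (\<lambda>n. \<lambda>s\<in>simplices V n. fst (v n s))
      (dm D) (\<lambda>n. \<lambda>s\<in>simplices U n. fst (u n s)) (fst c)"
    and "cotensor_weight_map K U i (cd x) (cd C) (\<lambda>n. \<lambda>s\<in>simplices V n. snd (v n s))
      (cd D) (\<lambda>n. \<lambda>s\<in>simplices U n. snd (u n s)) (snd c)"
    using e arr_arrowD[OF ca t(2,5)] smap_closed[OF i] by (auto simp: cotensor_weight_map_def)
qed

text \<open>That the values of \<open>u\<close> are squares is the very equation that makes
  \<open>ar C\<close> the cotensor of \<open>ar x\<close>.\<close>

lemma cotensor_arrow_base:
  assumes U: "simplicial_set U" and ct: "cotensor K2 U x C u"
  shows "cotensor_base_map K U (dm x) (cd x) (ar x) (dm C) (\<lambda>n. \<lambda>s\<in>simplices U n. fst (u n s))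
      (cd C) (\<lambda>n. \<lambda>s\<in>simplices U n. snd (u n s)) (ar C)"
  using arrow.cotensorD[OF ct] smap_arrow_components(3)[OF U arrow.cotensorD(3)[OF ct]] Obj_arrowD[of C]
  by (simp add: cotensor_base_map_def)

text \<open>Cotensors preserve pullbacks, so the gap map of the cotensored square is the cotensor of
  the gap map. A direct proof is given because the Leibniz axiom for squares relies on it: it is
  what lets the pullback there be taken componentwise.\<close>

lemma base_map_Isofib_arrow:
  assumes U: "small_sset \<kappa> (U :: 'u sset)" and m: "m \<in> Isofib K2 x y"
    and ct: "cotensor K2 U x C u" "cotensor K2 U y D v" and c: "cotensor_base_map K2 U x y m C u D v c"
  shows "c \<in> Isofib K2 C D"
proof -
  note Us = small_sset_simplicial[OF U] and a = Isofib_arrowD[OF m]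
  note ct0 = cotensor_arrow_components[OF U ct(1)] and ct1 = cotensor_arrow_components[OF U ct(2)]
  note b = base_map_arrow_components[OF Us ct c]
  note bC = cotensor_arrow_base[OF Us ct(1)] and bD = cotensor_arrow_base[OF Us ct(2)]
  note t = arrow.cotensorD[OF ct(1)] arrow.cotensorD[OF ct(2)]
  have ca: "c \<in> arr K2 C D" using c by (simp add: cotensor_base_map_def)
  have s: "snd c \<in> Isofib K (cd C) (cd D)" by (rule base_map_Isofib[OF U a(4) ct0(2) ct1(2) b(2)])
  obtain P l r k where P: "is_pullback K P (cd x) (dm y) (cd y) l r (snd m) (ar y)" "k \<in> Isofib K (dm x) P"
    "cmp0 K (dm x) P (cd x) l k = ar x" "cmp0 K (dm x) P (dm y) r k = fst m"
    using gap_isofibE[OF a(5)] .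
  note tP = is_pullbackD[OF P(1)] IsofibD[OF P(2)]
  obtain PU pu where PU: "cotensor K U P PU pu" using cotensor_ex[OF tP(1) U] by blast
  obtain lU where lU: "cotensor_base_map K U P (cd x) l PU pu (cd C) (\<lambda>n. \<lambda>s\<in>simplices U n. snd (u n s)) lU"
    using base_map_ex[OF Us PU ct0(2) tP(5)] .
  obtain rU where rU: "cotensor_base_map K U P (dm y) r PU pu (dm D) (\<lambda>n. \<lambda>s\<in>simplices U n. fst (v n s)) rU"
    using base_map_ex[OF Us PU ct1(1) tP(6)] .
  obtain kU where kU: "cotensor_base_map K U (dm x) P k (dm C) (\<lambda>n. \<lambda>s\<in>simplices U n. fst (u n s)) PU pu kU"
    using base_map_ex[OF Us ct0(1) PU tP(12)] .
  have "gap_isofib K (dm C) (cd C) (ar C) (dm D) (cd D) (ar D) (fst c) (snd c)"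
  proof (rule gap_isofibI)
    show "is_pullback K PU (cd C) (dm D) (cd D) lU rU (snd c) (ar D)"
      by (rule is_pullback_cotensor[OF Us P(1) PU ct0(2) ct1(1) ct1(2) lU rU b(2) bD])
    show "kU \<in> Isofib K (dm C) PU" by (rule base_map_Isofib[OF U P(2) ct0(1) PU kU])
    show "cmp0 K (dm C) PU (cd C) lU kU = ar C"
      using base_map_unique[OF ct0(1) ct0(2) _ bC] base_map_comp[OF ct0(1) PU ct0(2) kU lU tP(12,5)] P(3) by simp
    show "cmp0 K (dm C) PU (dm D) rU kU = fst c"
      using base_map_unique[OF ct0(1) ct1(1) _ b(1)] base_map_comp[OF ct0(1) PU ct1(1) kU rU tP(12,6)] P(4) by simp
  qed
  then show ?thesis using t ca s by (simp add: Isofib_arrow_iff)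
qed

lemma leibniz_Isofib_arrow:
  assumes U: "small_sset \<kappa> (U :: 'u sset)" and V: "small_sset \<kappa> V" and i: "i \<in> smap U V"
    "\<forall>n. inj_on (i n) (simplices U n)" and m: "m \<in> Isofib K2 x y"
    and L: "leibniz_cotensor K2 U V i x y m XV P k"
  shows "k \<in> Isofib K2 XV P"
proof -
  note Us = small_sset_simplicial[OF U] and Vs = small_sset_simplicial[OF V] and a = Isofib_arrowD[OF m]
  note tm = arr_arrowD[OF a(3,1,2)] and tx = Obj_arrowD[OF a(1)] Obj_arrowD[OF a(2)]
  obtain xv XU xu YU yu YV yv mU Yi \<pi> where
    xv: "cotensor K2 V x XV xv" and xu: "cotensor K2 U x XU xu" and yv: "cotensor K2 V y YV yv" and yu: "cotensor K2 U y YU yu"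
    and mU: "cotensor_base_map K2 U x y m XU xu YU yu mU" and Yi: "cotensor_weight_map K2 U i y YV yv YU yu Yi"
    and \<pi>: "limit_cone K2 (cospan XU mU YU Yi YV) P \<pi>" and k: "k \<in> arr K2 XV P"
    and kw: "cotensor_weight_map K2 U i x XV xv XU xu (cmp0 K2 XV P XU (\<pi> CLeft) k)"
    and kb: "cotensor_base_map K2 V x y m XV xv YV yv (cmp0 K2 XV P YV (\<pi> CRight) k)"
    using L unfolding leibniz_cotensor_def by blast
  note O = arrow.cotensorD(2)[OF xv] arrow.cotensorD(2)[OF xu] arrow.cotensorD(2)[OF yv] arrow.cotensorD(2)[OF yu]
  \<comment> \<open>This side of the cospan makes its pullback decompose into pullbacks of domains
    and of codomains.\<close>
  have mUi: "mU \<in> Isofib K2 XU YU" by (rule base_map_Isofib_arrow[OF U m xu yu mU])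
  have Yia: "Yi \<in> arr K2 YV YU" using Yi by (simp add: cotensor_weight_map_def)
  have pb: "is_pullback K2 P XU YV YU (\<pi> CLeft) (\<pi> CRight) mU Yi"
    using \<pi> arrow.limit_cone_cospan_iff[OF O(2,3,4) Isofib_arrowD(3)[OF mUi] Yia] by blast
  note tpb = is_pullbackD[OF pb]
  note pbc = is_pullback_arrow_components[OF is_pullback_sym[OF pb] mUi, THEN is_pullback_sym]
  note tl = arr_arrowD[OF tpb(5,1,2)] and tr = arr_arrowD[OF tpb(6,1,3)] and tk = arr_arrowD[OF k O(1) tpb(1)]
  note cxv = cotensor_arrow_components[OF V xv] and cxu = cotensor_arrow_components[OF U xu]
    and cyv = cotensor_arrow_components[OF V yv] and cyu = cotensor_arrow_components[OF U yu]
  note bm = base_map_arrow_components[OF Us xu yu mU] and wm = weight_map_arrow_components[OF i(1) yv yu Yi]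
  note kw' = weight_map_arrow_components[OF i(1) xv xu kw, unfolded Cmp_arrow fst_conv snd_conv]
    and kb' = base_map_arrow_components[OF Vs xv yv kb, unfolded Cmp_arrow fst_conv snd_conv]
  have "leibniz_cotensor K U V i (cd x) (cd y) (snd m) (cd XV) (cd P) (snd k)"
    unfolding leibniz_cotensor_def
    by (intro exI conjI, rule cxv(2), rule cxu(2), rule cyv(2), rule cyu(2), rule bm(2), rule wm(2),
      rule is_pullback_limit_cone[OF pbc(2)], rule tk(2)) (simp_all add: kw'(2) kb'(2))
  then have s: "snd k \<in> Isofib K (cd XV) (cd P)"
    by (rule leibniz_Isofib[OF U V i a(4)])
  have "gap_isofib K (dm XV) (cd XV) (ar XV) (dm P) (cd P) (ar P) (fst k) (snd k)"
    by (rule gap_isofib_leibniz[OF U V i tx(3,7) tm(2,1) a(5) cxv(1) cxu(1) cxv(2) cxu(2) cyv(1) cyu(1) cyv(2) cyu(2)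
        cotensor_arrow_base[OF Vs xv] cotensor_arrow_base[OF Us xu] cotensor_arrow_base[OF Vs yv] bm wm pbc
        Obj_arrowD(4)[OF tpb(1)] tl(3)[symmetric] tr(3)[symmetric] tk(1) kw'(1) kb'(1) tk(2) kw'(2) kb'(2) tk(3)])
  then show ?thesis using O tpb(1) k s by (simp add: Isofib_arrow_iff)
qed

section \<open>The axioms of an infinity-cosmos for squares\<close>

lemma infinity_cosmos_arrow: "infinity_cosmos (arrow_cosmos K) \<kappa>"
proof (intro infinity_cosmos.intro[OF simplicial_category_arrow] infinity_cosmos_axioms.intro, goal_cases)
  case 1 show ?case by (rule universe)
next
  case 2 then show ?case by (rule small_arrow)
next
  case 3 then show ?case by (rule quasi_category_arrow)
next
  case 4 then show ?case using Isofib_arrowD by blast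
next
  case 5 then show ?case by (rule Isofib_arrow_comp)
next
  case 6 show ?case by (rule terminal_arrow_ex)
next
  case (7 I X)
  obtain M \<mu> N \<nu> where "limit_cone K (dom_diagram (product_diagram I X)) M \<mu>" "limit_cone K (cod_diagram (product_diagram I X)) N \<nu>"
    using product_limits_ex[OF 7] .
  then show ?case using 7 by (intro limit_cone_arrow_ex[OF arrow.wf_product isofib_limits_product]) auto
next
  case 8 then show ?case by (rule cotensor_arrow_ex[rotated])
next
  case (9 r X)
  obtain M \<mu> N \<nu> where "limit_cone K (dom_diagram (sequence_diagram X r)) M \<mu>" "limit_cone K (cod_diagram (sequence_diagram X r)) N \<nu>"
    using sequence_limits_ex[OF 9] .
  then show ?case by (rule limit_cone_arrow_ex[OF wf_sequence_arrow[OF 9] isofib_limits_sequence(1)[OF 9]])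
next
  case (10 X s Z q Y)
  note a = Isofib_arrowD[OF 10(3)]
  note t = Obj_arrowD[OF 10(1)] and ts = arr_arrowD[OF 10(2,1) a(2)]
  obtain M \<mu> where M: "limit_cone K (dom_diagram (cospan X s Z q Y)) M \<mu>"
    unfolding dom_diagram_cospan using pullback_ex[OF t(1) ts(1) a(6)] by blast
  obtain N \<nu> where N: "limit_cone K (cod_diagram (cospan X s Z q Y)) N \<nu>"
    unfolding cod_diagram_cospan using pullback_ex[OF t(2) ts(2) a(4)] by blast
  show ?case by (rule limit_cone_arrow_ex[OF wf_cospan_arrow[OF 10] isofib_limits_cospan[OF 10] M N])
next
  case 11 then show ?case by (rule isomorphism_Isofib_arrow)
next
  case 12 then show ?case by (rule terminal_Isofib_arrow)
next
  case 13 then show ?case by (rule pullback_Isofib_arrow)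
next
  case 14 then show ?case by (rule product_Isofib_arrow)
next
  case 15 then show ?case by (rule sequence_limit_Isofib_arrow)
next
  case 16 then show ?case by (rule leibniz_Isofib_arrow)
next
  case 17 then show ?case by (rule Fun_Isofib_arrow)
qed

end

section \<open>Homotopies\<close>

lemma simplices_iso_nerve [simp]: "simplices iso_nerve n = {..n} \<rightarrow>\<^sub>E {0, 1}"
  by (simp add: iso_nerve_def)

lemma act_iso_nerve [simp]: "act iso_nerve m n \<alpha> \<sigma> = compose {..m} \<sigma> \<alpha>"
  by (simp add: iso_nerve_def)

lemma simplices_iso_endpoint [simp]: "simplices (iso_endpoint e) n = {\<lambda>i\<in>{..n}. e}"
  by (simp add: iso_endpoint_def)

lemma act_iso_endpoint [simp]: "act (iso_endpoint e) m n \<alpha> \<sigma> = compose {..m} \<sigma> \<alpha>"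
  by (simp add: iso_endpoint_def)

lemma iso_nerve_const: "e \<in> {0, 1} \<Longrightarrow> (\<lambda>i\<in>{..n}. e) \<in> simplices iso_nerve n"
  by auto

text \<open>The two endpoints of the interval as a discrete simplicial set: in each dimension only
  the two constant simplices remain.\<close>

definition iso_boundary :: "(nat \<Rightarrow> nat) sset" where
  "iso_boundary = \<lparr>simplices = (\<lambda>n. {\<lambda>i\<in>{..n}. 0, \<lambda>i\<in>{..n}. 1}), act = (\<lambda>m n \<alpha> \<sigma>. compose {..m} \<sigma> \<alpha>)\<rparr>"

lemma simplices_iso_boundary [simp]: "simplices iso_boundary n = {\<lambda>i\<in>{..n}. 0, \<lambda>i\<in>{..n}. 1}"
  by (simp add: iso_boundary_def)

lemma act_iso_boundary [simp]: "act iso_boundary m n \<alpha> \<sigma> = compose {..m} \<sigma> \<alpha>"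
  by (simp add: iso_boundary_def)

lemma simplicial_set_iso_boundary: "simplicial_set iso_boundary"
  by unfold_locales (auto simp: compose_const)

lemma const_0_neq_1: "(\<lambda>i\<in>{..n::nat}. 0::nat) \<noteq> (\<lambda>i\<in>{..n}. 1)"
proof
  assume "(\<lambda>i\<in>{..n::nat}. 0::nat) = (\<lambda>i\<in>{..n}. 1)"
  from fun_cong[OF this, of 0] show False by simp
qed

text \<open>
  Since \<open>iso_nerve\<close> is determined by its vertices, operations on \<open>{0, 1}\<close> act on its simplices.
\<close>

definition vertexwise :: "(nat \<Rightarrow> nat \<Rightarrow> nat) \<Rightarrow> nat \<Rightarrow> (nat \<Rightarrow> nat) \<Rightarrow> (nat \<Rightarrow> nat) \<Rightarrow> nat \<Rightarrow> nat" where
  "vertexwise \<phi> n \<sigma> \<tau> = (\<lambda>i\<in>{..n}. \<phi> (\<sigma> i) (\<tau> i))"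

lemma vertexwise_closed:
  assumes "\<And>a b. a \<in> {0, 1} \<Longrightarrow> b \<in> {0, 1} \<Longrightarrow> \<phi> a b \<in> {0, 1}"
    and "\<sigma> \<in> {..n} \<rightarrow>\<^sub>E {0, 1}" "\<tau> \<in> {..n} \<rightarrow>\<^sub>E {0, 1}"
  shows "vertexwise \<phi> n \<sigma> \<tau> \<in> {..n} \<rightarrow>\<^sub>E {0, 1}"
  unfolding vertexwise_def
proof (rule restrict_PiE_iff[THEN iffD2], intro ballI)
  fix i assume "i \<in> {..n}"
  then show "\<phi> (\<sigma> i) (\<tau> i) \<in> {0, 1}" using assms(1)[OF PiE_mem[OF assms(2)] PiE_mem[OF assms(3)]] by blast
qed

lemma vertexwise_unit:
  assumes \<sigma>: "\<sigma> \<in> {..n} \<rightarrow>\<^sub>E {0, 1}"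
  shows "(\<And>a. a \<in> {0, 1} \<Longrightarrow> \<phi> a b = a) \<Longrightarrow> vertexwise \<phi> n \<sigma> (\<lambda>i\<in>{..n}. b) = \<sigma>"
    and "(\<And>a. a \<in> {0, 1} \<Longrightarrow> \<phi> b a = a) \<Longrightarrow> vertexwise \<phi> n (\<lambda>i\<in>{..n}. b) \<sigma> = \<sigma>"
proof -
  have *: "vertexwise \<phi> n \<sigma>' \<tau>' = \<sigma>" if "\<And>i. i \<in> {..n} \<Longrightarrow> \<phi> (\<sigma>' i) (\<tau>' i) = \<sigma> i" for \<sigma>' \<tau>'
  proof
    fix i show "vertexwise \<phi> n \<sigma>' \<tau>' i = \<sigma> i"
      using that[of i] PiE_arb[OF \<sigma>, of i] by (cases "i \<in> {..n}") (auto simp: vertexwise_def)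
  qed
  show "vertexwise \<phi> n \<sigma> (\<lambda>i\<in>{..n}. b) = \<sigma>" if "\<And>a. a \<in> {0, 1} \<Longrightarrow> \<phi> a b = a"
    using that[OF PiE_mem[OF \<sigma>]] by (intro *) auto
  show "vertexwise \<phi> n (\<lambda>i\<in>{..n}. b) \<sigma> = \<sigma>" if "\<And>a. a \<in> {0, 1} \<Longrightarrow> \<phi> b a = a"
    using that[OF PiE_mem[OF \<sigma>]] by (intro *) auto
qed

lemma vertexwise_compose:
  "\<alpha> \<in> Delta m n \<Longrightarrow> vertexwise \<phi> m (compose {..m} \<sigma> \<alpha>) (compose {..m} \<tau> \<alpha>) = compose {..m} (vertexwise \<phi> n \<sigma> \<tau>) \<alpha>"
  using Delta_funcset[of \<alpha> m n] by (auto simp: vertexwise_def compose_def fun_eq_iff)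

text \<open>A single path, without taking a closure. Reflexivity and symmetry hold in any simplicial
  category; transitivity is proved in infinity-cosmoi.\<close>

definition homotopic :: "('o, 'a, 'm) scat_scheme \<Rightarrow> 'o \<Rightarrow> 'o \<Rightarrow> 'a \<Rightarrow> 'a \<Rightarrow> bool" where
  "homotopic K X A a b \<longleftrightarrow> (\<exists>H\<in>smap iso_nerve (Fun K X A). H 0 (\<lambda>i\<in>{..0}. 0) = a \<and> H 0 (\<lambda>i\<in>{..0}. 1) = b)"

lemma homotopicI:
  "\<lbrakk>H \<in> smap iso_nerve (Fun K X A); H 0 (\<lambda>i\<in>{..0}. 0) = a; H 0 (\<lambda>i\<in>{..0}. 1) = b\<rbrakk> \<Longrightarrow> homotopic K X A a b"
  unfolding homotopic_def by blast

lemma smap_const: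
  assumes "H \<in> smap iso_nerve Y" "e \<in> {0, 1}"
  shows "H n (\<lambda>i\<in>{..n}. e) = degen Y n (H 0 (\<lambda>i\<in>{..0}. e))"
proof -
  have "degen iso_nerve n (\<lambda>i\<in>{..0}. e) = (\<lambda>i\<in>{..n}. e)"
    unfolding degen_def act_iso_nerve by (rule compose_const) simp
  then show ?thesis
    using smap_degen[OF assms(1) iso_nerve_const[OF assms(2)], of n] by simp
qed

text \<open>The two-parameter families needed later arise from one path: \<open>min a b\<close>
  grows the path from its start, and \<open>min a (1 - b)\<close> contracts it back to its
  start.\<close>

lemma smap_vertexwise:
  assumes H: "H \<in> smap iso_nerve Y" and \<phi>: "\<And>a b. a \<in> {0, 1} \<Longrightarrow> b \<in> {0, 1} \<Longrightarrow> \<phi> a b \<in> {0, 1}"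
  shows "(\<lambda>n. \<lambda>z\<in>simplices (sprod iso_nerve iso_nerve) n. H n (vertexwise \<phi> n (fst z) (snd z))) \<in> smap (sprod iso_nerve iso_nerve) Y"
proof (rule smap_restrictI[OF simplicial_set_sprod[OF simplicial_set_iso_nerve simplicial_set_iso_nerve]])
  have c: "vertexwise \<phi> n (fst z) (snd z) \<in> {..n} \<rightarrow>\<^sub>E {0, 1}" if "z \<in> simplices (sprod iso_nerve iso_nerve) n" for n z
  proof (rule vertexwise_closed)
    show "\<phi> a b \<in> {0, 1}" if "a \<in> {0, 1}" "b \<in> {0, 1}" for a b by (rule \<phi>[OF that])
    show "fst z \<in> {..n} \<rightarrow>\<^sub>E {0, 1}" "snd z \<in> {..n} \<rightarrow>\<^sub>E {0, 1}"
      using that by (simp_all add: mem_Times_iff)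
  qed
  show "H n (vertexwise \<phi> n (fst z) (snd z)) \<in> simplices Y n" if "z \<in> simplices (sprod iso_nerve iso_nerve) n" for n z
    using smap_closed[OF H] c[OF that] by simp
  fix m n \<alpha> z assume a: "\<alpha> \<in> Delta m n" "z \<in> simplices (sprod iso_nerve iso_nerve) n"
  then have "vertexwise \<phi> n (fst z) (snd z) \<in> simplices iso_nerve n"
    using c by simp
  from smap_act[OF H a(1) this]
  show "H m (vertexwise \<phi> m (fst (act (sprod iso_nerve iso_nerve) m n \<alpha> z)) (snd (act (sprod iso_nerve iso_nerve) m n \<alpha> z)))
      = act Y m n \<alpha> (H n (vertexwise \<phi> n (fst z) (snd z)))"
    by (simp add: vertexwise_compose[OF a(1)])
qed

text \<open>The reversed path. As \<open>vertexwise\<close> is binary, the operation is applied to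
  \<sigma> twice and ignores its second argument.\<close>

lemma smap_swap:
  assumes H: "H \<in> smap iso_nerve Y"
  shows "(\<lambda>n. \<lambda>\<sigma>\<in>simplices iso_nerve n. H n (vertexwise (\<lambda>a b. 1 - a) n \<sigma> \<sigma>)) \<in> smap iso_nerve Y"
proof (rule smap_restrictI[OF simplicial_set_iso_nerve])
  have c: "vertexwise (\<lambda>a b. 1 - a) n \<sigma> \<sigma> \<in> {..n} \<rightarrow>\<^sub>E {0, 1}" if "\<sigma> \<in> simplices iso_nerve n" for n \<sigma>
    by (rule vertexwise_closed) (use that in auto)
  show "H n (vertexwise (\<lambda>a b. 1 - a) n \<sigma> \<sigma>) \<in> simplices Y n" if "\<sigma> \<in> simplices iso_nerve n" for n \<sigma>
    using smap_closed[OF H] c[OF that] by simp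
  fix m n \<alpha> \<sigma> assume a: "\<alpha> \<in> Delta m n" "\<sigma> \<in> simplices iso_nerve n"
  then show "H m (vertexwise (\<lambda>a b. 1 - a) m (act iso_nerve m n \<alpha> \<sigma>) (act iso_nerve m n \<alpha> \<sigma>))
      = act Y m n \<alpha> (H n (vertexwise (\<lambda>a b. 1 - a) n \<sigma> \<sigma>))"
    using smap_act[OF H a(1), of "vertexwise (\<lambda>a b. 1 - a) n \<sigma> \<sigma>"] c[OF a(2)] by (simp add: vertexwise_compose)
qed

lemma vertexwise_const [simp]: "vertexwise \<phi> n (\<lambda>i\<in>{..n}. a) (\<lambda>i\<in>{..n}. b) = (\<lambda>i\<in>{..n}. \<phi> a b)"
  by (auto simp: vertexwise_def)

section \<open>Homotopy of arrows\<close>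

context simplicial_category
begin

lemma constant_homotopy:
  assumes "X \<in> Obj K" "A \<in> Obj K" "a \<in> arr K X A" "simplicial_set W"
  shows "(\<lambda>n. \<lambda>s\<in>simplices W n. degen (Fun K X A) n a) \<in> smap W (Fun K X A)"
  by (rule smap_restrictI[OF assms(4)]) (use assms in auto)

lemma homotopic_refl: "\<lbrakk>X \<in> Obj K; A \<in> Obj K; a \<in> arr K X A\<rbrakk> \<Longrightarrow> homotopic K X A a a"
  by (rule homotopicI[OF constant_homotopy[OF _ _ _ simplicial_set_iso_nerve]]) auto

lemma homotopic_sym:
  assumes "homotopic K X A a b"
  shows "homotopic K X A b a"
proof -
  obtain H where H: "H \<in> smap iso_nerve (Fun K X A)" "H 0 (\<lambda>i\<in>{..0}. 0) = a" "H 0 (\<lambda>i\<in>{..0}. 1) = b"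
    using assms by (auto simp: homotopic_def)
  show ?thesis
    by (rule homotopicI[OF smap_swap[OF H(1)]]) (use H in \<open>auto simp del: atMost_0\<close>)
qed

lemma homotopic_arr:
  assumes "homotopic K X A a b"
  shows "a \<in> arr K X A" "b \<in> arr K X A"
  using assms smap_closed[of _ iso_nerve "Fun K X A"] iso_nerve_const[of _ 0] unfolding homotopic_def by blast+

lemma homotopic_post:
  assumes "homotopic K X A a b" and t: "X \<in> Obj K" "A \<in> Obj K" "B \<in> Obj K" "f \<in> arr K A B"
  shows "homotopic K X B (cmp0 K X A B f a) (cmp0 K X A B f b)"
proof -
  obtain H where H: "H \<in> smap iso_nerve (Fun K X A)" "H 0 (\<lambda>i\<in>{..0}. 0) = a" "H 0 (\<lambda>i\<in>{..0}. 1) = b"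
    using assms by (auto simp: homotopic_def)
  show ?thesis
    by (rule homotopicI[OF smap_comp[OF simplicial_set_iso_nerve H(1) post_smap[OF t]]])
      (use H(2,3) homotopic_arr[OF assms(1)] t in \<open>auto simp: post_map_0 simp del: atMost_0\<close>)
qed

lemma homotopic_pre:
  assumes "homotopic K X A a b" and t: "X \<in> Obj K" "A \<in> Obj K" "Y \<in> Obj K" "x \<in> arr K Y X"
  shows "homotopic K Y A (cmp0 K Y X A a x) (cmp0 K Y X A b x)"
proof -
  obtain H where H: "H \<in> smap iso_nerve (Fun K X A)" "H 0 (\<lambda>i\<in>{..0}. 0) = a" "H 0 (\<lambda>i\<in>{..0}. 1) = b"
    using assms by (auto simp: homotopic_def)
  show ?thesis
    by (rule homotopicI[OF smap_comp[OF simplicial_set_iso_nerve H(1) pre_smap[OF t(2,3,1,4)]]])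
      (use H(2,3) homotopic_arr[OF assms(1)] t in \<open>auto simp: pre_map_0 simp del: atMost_0\<close>)
qed

end

text \<open>
  Weights are simplicial sets of elements of the type \<open>'u\<close>; this copies other simplicial sets there.
\<close>

definition transport_sset :: "(nat \<Rightarrow> 'a \<Rightarrow> 'b) \<Rightarrow> 'a sset \<Rightarrow> 'b sset" where
  "transport_sset \<phi> X = \<lparr>simplices = (\<lambda>n. \<phi> n ` simplices X n),
    act = (\<lambda>m n \<alpha> y. \<phi> m (act X m n \<alpha> (inv_into (simplices X n) (\<phi> n) y)))\<rparr>"

lemma simplices_transport [simp]: "simplices (transport_sset \<phi> X) n = \<phi> n ` simplices X n"
  by (simp add: transport_sset_def)

lemma act_transport:
  "\<lbrakk>inj_on (\<phi> n) (simplices X n); x \<in> simplices X n\<rbrakk> \<Longrightarrow> act (transport_sset \<phi> X) m n \<alpha> (\<phi> n x) = \<phi> m (act X m n \<alpha> x)"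
  by (simp add: transport_sset_def)

lemma simplicial_set_transport:
  assumes X: "simplicial_set X" and \<phi>: "\<And>n. inj_on (\<phi> n) (simplices X n)"
  shows "simplicial_set (transport_sset \<phi> X)"
  by unfold_locales
    (use \<phi> in \<open>auto simp: act_transport simplicial_set.act_closed[OF X] simplicial_set.act_id[OF X] simplicial_set.act_comp[OF X]\<close>)

section \<open>The interval as a weight\<close>

context simplicial_category
begin

text \<open>Currying against the copy of \<open>S\<close> among the weights, phrased so that later
  arguments mention simplices of \<open>S\<close> only.\<close>

lemma cotensor_curry_transport:
  assumes S: "simplicial_set S" and \<phi>: "\<And>n. inj_on (\<phi> n) (simplices S n)"
    and ct: "cotensor K (transport_sset \<phi> S) A C u" and X: "X \<in> Obj K" and W: "simplicial_set W"
    and h: "h \<in> smap (sprod W S) (Fun K X A)"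
  obtains w where "w \<in> smap W (Fun K X C)"
    "\<And>n \<sigma> x. \<lbrakk>\<sigma> \<in> simplices W n; x \<in> simplices S n\<rbrakk> \<Longrightarrow> Cmp K X C A n (u n (\<phi> n x)) (w n \<sigma>) = h n (\<sigma>, x)"
proof -
  note V = simplicial_set_transport[OF S \<phi>]
  let ?V = "transport_sset \<phi> S"
  let ?h = "\<lambda>n. \<lambda>z\<in>simplices (sprod W ?V) n. h n (fst z, inv_into (simplices S n) (\<phi> n) (snd z))"
  have "?h \<in> smap (sprod W ?V) (Fun K X A)"
  proof (rule smap_restrictI[OF simplicial_set_sprod[OF W V]])
    fix m n \<alpha> z assume a: "\<alpha> \<in> Delta m n" "z \<in> simplices (sprod W ?V) n"
    then obtain \<sigma> x where z: "z = (\<sigma>, \<phi> n x)" "\<sigma> \<in> simplices W n" "x \<in> simplices S n" by auto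
    have "act S m n \<alpha> x \<in> simplices S m" using z a simplicial_set.act_closed[OF S] by blast
    then show "h m (fst (act (sprod W ?V) m n \<alpha> z), inv_into (simplices S m) (\<phi> m) (snd (act (sprod W ?V) m n \<alpha> z)))
        = act (Fun K X A) m n \<alpha> (h n (fst z, inv_into (simplices S n) (\<phi> n) (snd z)))"
      using z \<phi>[of n] \<phi>[of m] smap_act[OF h a(1), of "(\<sigma>, x)"] by (simp add: act_transport)
  next
    fix n z assume "z \<in> simplices (sprod W ?V) n"
    then obtain \<sigma> x where z: "z = (\<sigma>, \<phi> n x)" "\<sigma> \<in> simplices W n" "x \<in> simplices S n" by auto
    then show "h n (fst z, inv_into (simplices S n) (\<phi> n) (snd z)) \<in> simplices (Fun K X A) n"
      using \<phi>[of n] smap_closed[OF h, of "(\<sigma>, x)" n] by simp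
  qed
  from cotensor_curry[OF ct X W V this] obtain w where w: "w \<in> smap W (Fun K X C)"
    "\<And>n \<sigma> y. \<lbrakk>\<sigma> \<in> simplices W n; y \<in> simplices ?V n\<rbrakk> \<Longrightarrow> Cmp K X C A n (u n y) (w n \<sigma>) = ?h n (\<sigma>, y)" by blast
  have "Cmp K X C A n (u n (\<phi> n x)) (w n \<sigma>) = h n (\<sigma>, x)" if "\<sigma> \<in> simplices W n" "x \<in> simplices S n" for n \<sigma> x
    using w(2)[of \<sigma> n "\<phi> n x"] that \<phi>[of n] by simp
  then show ?thesis using that w(1) by blast
qed

lemma cotensor_arr_ex_transport:
  assumes S: "simplicial_set S" and \<phi>: "\<And>n. inj_on (\<phi> n) (simplices S n)"
    and ct: "cotensor K (transport_sset \<phi> S) A C u" and X: "X \<in> Obj K" and v: "v \<in> smap S (Fun K X A)"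
  obtains c where "c \<in> arr K X C" "\<And>n x. x \<in> simplices S n \<Longrightarrow> pre_map K X C A c n (u n (\<phi> n x)) = v n x"
proof -
  note V = simplicial_set_transport[OF S \<phi>]
  let ?V = "transport_sset \<phi> S"
  let ?v = "\<lambda>n. \<lambda>y\<in>simplices ?V n. v n (inv_into (simplices S n) (\<phi> n) y)"
  have "?v \<in> smap ?V (Fun K X A)"
  proof (rule smap_restrictI[OF V])
    show "v n (inv_into (simplices S n) (\<phi> n) y) \<in> simplices (Fun K X A) n" if "y \<in> simplices ?V n" for n y
      using that \<phi>[of n] smap_closed[OF v] by auto
    show "v m (inv_into (simplices S m) (\<phi> m) (act ?V m n \<alpha> y)) = act (Fun K X A) m n \<alpha> (v n (inv_into (simplices S n) (\<phi> n) y))"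
      if "\<alpha> \<in> Delta m n" "y \<in> simplices ?V n" for m n \<alpha> y
      using that \<phi>[of n] \<phi>[of m] smap_act[OF v] simplicial_set.act_closed[OF S] by (auto simp: act_transport)
  qed
  from cotensor_arr_ex[OF ct V X this] obtain c where c: "c \<in> arr K X C"
    "\<And>n y. y \<in> simplices ?V n \<Longrightarrow> pre_map K X C A c n (u n y) = ?v n y" by blast
  have "pre_map K X C A c n (u n (\<phi> n x)) = v n x" if "x \<in> simplices S n" for n x
    using c(2)[of "\<phi> n x" n] that \<phi>[of n] by simp
  then show ?thesis using that c(1) by blast
qed

text \<open>Function complexes into \<open>T\<close> are points, and so are their powers. This lets
  the Leibniz axiom be applied to the map from an object to \<open>T\<close>.\<close>

lemma cotensor_terminal:
  assumes T: "terminal K T" and U: "simplicial_set U"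
  shows "cotensor K U T T (\<lambda>n. \<lambda>x\<in>simplices U n. degen (Fun K T T) n (Unit K T))"
proof (rule cotensorI[OF U])
  have TO: "T \<in> Obj K" using T by (simp add: terminal_def)
  show "T \<in> Obj K" "T \<in> Obj K" by (rule TO)+
  show u: "(\<lambda>n. \<lambda>x\<in>simplices U n. degen (Fun K T T) n (Unit K T)) \<in> smap U (Fun K T T)"
    by (rule constant_homotopy) (use TO U in auto)
  show "z = z'" if "X \<in> Obj K" "z \<in> simplices (Fun K X T) n" "z' \<in> simplices (Fun K X T) n" for X n z z'
    by (rule terminal_unique[OF T that])
  fix X n \<phi> assume X: "X \<in> Obj K" and \<phi>: "\<phi> \<in> smap (sprod (std_simplex n) U) (Fun K X T)"
  obtain z where z: "z \<in> simplices (Fun K X T) n" using T X unfolding terminal_def by blast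
  have "Cmp K X T T m ((\<lambda>x\<in>simplices U m. degen (Fun K T T) m (Unit K T)) x) (act (Fun K X T) m n \<beta> z) = \<phi> m (\<beta>, x)"
    if "\<beta> \<in> Delta m n" "x \<in> simplices U m" for m \<beta> x
    by (rule terminal_unique[OF T X, where n = m]) (use X TO that z smap_closed[OF \<phi>, of "(\<beta>, x)" m] in auto)
  then show "\<exists>z\<in>simplices (Fun K X T) n. \<forall>m. \<forall>\<beta>\<in>Delta m n. \<forall>x\<in>simplices U m.
      Cmp K X T T m ((\<lambda>x\<in>simplices U m. degen (Fun K T T) m (Unit K T)) x) (act (Fun K X T) m n \<beta> z) = \<phi> m (\<beta>, x)"
    using z by blast
qed

end

context infinity_cosmos
begin

text \<open>\<kappa> is infinite, hence so is the type \<open>'u\<close> that carries it, while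
  \<open>iso_nerve\<close> has finitely many simplices in each dimension. The embeddings in
  different dimensions need not be related.\<close>

lemma interval_ex:
  obtains \<phi> :: "nat \<Rightarrow> (nat \<Rightarrow> nat) \<Rightarrow> 'u" where "\<And>n. inj_on (\<phi> n) (simplices iso_nerve n)"
proof -
  have inf: "infinite (UNIV :: 'u set)"
    using universe_cardinal_Cinfinite[OF universe] finite_subset[of "Field \<kappa>" UNIV] by (auto simp: cinfinite_def)
  have "\<exists>f :: (nat \<Rightarrow> nat) \<Rightarrow> 'u. inj_on f (simplices iso_nerve n)" for n
  proof -
    have fin: "finite (simplices iso_nerve n)" by (simp add: finite_PiE)
    obtain B :: "'u set" where "finite B" "card B = card (simplices iso_nerve n)"
      using infinite_arbitrarily_large[OF inf] by blast
    then obtain f where "bij_betw f (simplices iso_nerve n) B"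
      using finite_same_card_bij[OF fin] by metis
    then show ?thesis by (auto simp: bij_betw_def)
  qed
  then show ?thesis using that by metis
qed

lemma small_transport:
  assumes "simplicial_set S" "\<And>n. inj_on (\<phi> n) (simplices S n)" "\<And>n. finite (simplices S n)"
  shows "small_sset \<kappa> (transport_sset \<phi> S :: 'u sset)"
  unfolding small_sset_def
  by (intro conjI allI simplicial_set_transport assms(1,2) universe_cardinal_finite[OF universe]) (use assms(3) in auto)

text \<open>One embedding serves for the interval and for its boundary, so that the inclusion of
  weights is the identity on elements.\<close>

lemma interval_weights:
  obtains \<phi> :: "nat \<Rightarrow> (nat \<Rightarrow> nat) \<Rightarrow> 'u" and i where "\<And>n. inj_on (\<phi> n) (simplices iso_nerve n)"
    "\<And>n. inj_on (\<phi> n) (simplices iso_boundary n)"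
    "small_sset \<kappa> (transport_sset \<phi> iso_nerve)" "small_sset \<kappa> (transport_sset \<phi> iso_boundary)"
    "i \<in> smap (transport_sset \<phi> iso_boundary) (transport_sset \<phi> iso_nerve)"
    "\<forall>n. inj_on (i n) (simplices (transport_sset \<phi> iso_boundary) n)"
    "\<And>n x. x \<in> simplices iso_boundary n \<Longrightarrow> i n (\<phi> n x) = \<phi> n x"
proof -
  obtain \<phi> :: "nat \<Rightarrow> (nat \<Rightarrow> nat) \<Rightarrow> 'u" where \<phi>: "\<And>n. inj_on (\<phi> n) (simplices iso_nerve n)" using interval_ex by blast
  have DJ: "simplices iso_boundary n \<subseteq> simplices iso_nerve n" for n by auto
  have \<phi>D: "inj_on (\<phi> n) (simplices iso_boundary n)" for n using inj_on_subset[OF \<phi> DJ] .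
  let ?V = "transport_sset \<phi> iso_nerve" and ?U = "transport_sset \<phi> iso_boundary"
  have V: "small_sset \<kappa> ?V" by (rule small_transport[OF simplicial_set_iso_nerve \<phi>]) (simp add: finite_PiE)
  have U: "small_sset \<kappa> ?U" by (rule small_transport[OF simplicial_set_iso_boundary \<phi>D]) simp
  let ?i = "\<lambda>n. \<lambda>x\<in>simplices ?U n. x"
  have i: "?i \<in> smap ?U ?V"
  proof (rule smap_restrictI[OF small_sset_simplicial[OF U]])
    show "x \<in> simplices ?V n" if "x \<in> simplices ?U n" for n x
      using that DJ unfolding simplices_transport by blast
    fix m n \<alpha> x assume "\<alpha> \<in> Delta m n" "x \<in> simplices ?U n"
    then obtain y where "x = \<phi> n y" "y \<in> simplices iso_boundary n" unfolding simplices_transport by blast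
    then show "act ?U m n \<alpha> x = act ?V m n \<alpha> x"
      using act_transport[where \<phi> = \<phi>, OF \<phi>D, of y n] act_transport[where \<phi> = \<phi>, OF \<phi>, of y n] DJ[of n]
      by (auto simp del: simplices_iso_boundary simplices_iso_nerve)
  qed
  show ?thesis
    by (rule that[OF \<phi> \<phi>D V U i]) (auto simp: inj_on_def simp del: simplices_iso_boundary)
qed

text \<open>This is the Leibniz cotensor of the isofibration from \<open>A\<close> to the terminal
  object: the cotensors of \<open>T\<close> are \<open>T\<close>, so the pullback is
  \<open>D\<close> and the induced map is restriction along \<open>i\<close>.\<close>

lemma weight_map_Isofib:
  assumes U: "small_sset \<kappa> (U :: 'u sset)" and V: "small_sset \<kappa> V" and i: "i \<in> smap U V" "\<forall>n. inj_on (i n) (simplices U n)"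
    and v: "cotensor K V A C v" and u: "cotensor K U A D u" and c: "cotensor_weight_map K U i A C v D u c"
  shows "c \<in> Isofib K C D"
proof -
  obtain T where T: "terminal K T" using terminal_ex by blast
  then have TO: "T \<in> Obj K" by (simp add: terminal_def)
  note Us = small_sset_simplicial[OF U] and Vs = small_sset_simplicial[OF V]
  note t = cotensorD[OF v] cotensorD[OF u]
  have ca: "c \<in> arr K C D" using c by (simp add: cotensor_weight_map_def)
  obtain a where a: "a \<in> arr K A T" using terminal_arr_ex[OF T t(1)] by blast
  obtain d where d: "d \<in> arr K D T" using terminal_arr_ex[OF T t(5)] by blast
  have "cmp0 K C D T d c \<in> arr K C T" using ca d t TO by simp
  note TU = cotensor_terminal[OF T Us] and TV = cotensor_terminal[OF T Vs]
  have base: "cotensor_base_map K S A T a Z z T (\<lambda>n. \<lambda>x\<in>simplices S n. degen (Fun K T T) n (Unit K T)) b"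
    if S: "simplicial_set S" and z: "cotensor K S A Z z" and b: "b \<in> arr K Z T" for S :: "'u sset" and Z z b
    unfolding cotensor_base_map_def
  proof (intro conjI allI ballI)
    fix n x assume x: "x \<in> simplices S n"
    show "pre_map K Z T T b n ((\<lambda>x\<in>simplices S n. degen (Fun K T T) n (Unit K T)) x) = post_map K Z A T a n (z n x)"
      by (rule terminal_unique[OF T cotensorD(2)[OF z], where n = n])
        (use x b a t TO cotensorD[OF z] smap_closed[OF cotensorD(3)[OF z] x] in auto)
  qed (rule b)
  have "cotensor_weight_map K U i T T (\<lambda>n. \<lambda>x\<in>simplices V n. degen (Fun K T T) n (Unit K T))
      T (\<lambda>n. \<lambda>x\<in>simplices U n. degen (Fun K T T) n (Unit K T)) (Unit K T)"
    using TO smap_closed[OF i(1)] by (auto simp: cotensor_weight_map_def)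
  note w = this
  have pb: "is_pullback K D D T T (Unit K D) d d (Unit K T)"
    by (rule is_pullback_sym[OF is_pullback_Unit]) (use t TO d in auto)
  have "leibniz_cotensor K U V i A T a C D c"
    unfolding leibniz_cotensor_def
    by (intro exI conjI, rule v, rule u, rule TV, rule TU, rule base[OF Us u d], rule w, rule is_pullback_limit_cone[OF pb], rule ca)
      (use c ca d t TO base[OF Vs v, of "cmp0 K C D T d c"] in simp_all)
  then show ?thesis
    by (rule leibniz_Isofib[OF U V i terminal_Isofib[OF T t(1) a]])
qed

text \<open>
  A path \<open>\<theta>\<close> in \<open>E\<close> can be moved along a motion of its endpoints in \<open>E\<close> and of its image in \<open>B\<close>,
  because the Leibniz cotensor of an isofibration with the inclusion of the endpoints into the
  interval is an isofibration, so that paths lift along it.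
\<close>

lemma move_path:
  assumes p: "p \<in> Isofib K E B" and X: "X \<in> Obj K" and \<theta>: "\<theta> \<in> smap iso_nerve (Fun K X E)"
    and hB: "hB \<in> smap (sprod iso_nerve iso_nerve) (Fun K X B)"
    and h0: "h0 \<in> smap iso_nerve (Fun K X E)" and h1: "h1 \<in> smap iso_nerve (Fun K X E)"
    and ph0: "\<And>n \<tau>. \<tau> \<in> simplices iso_nerve n \<Longrightarrow> post_map K X E B p n (h0 n \<tau>) = hB n (\<lambda>i\<in>{..n}. 0, \<tau>)"
    and ph1: "\<And>n \<tau>. \<tau> \<in> simplices iso_nerve n \<Longrightarrow> post_map K X E B p n (h1 n \<tau>) = hB n (\<lambda>i\<in>{..n}. 1, \<tau>)"
    and start: "\<And>n \<sigma>. \<sigma> \<in> simplices iso_nerve n \<Longrightarrow> hB n (\<sigma>, \<lambda>i\<in>{..n}. 0) = post_map K X E B p n (\<theta> n \<sigma>)"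
    and start0: "h0 0 (\<lambda>i\<in>{..0}. 0) = \<theta> 0 (\<lambda>i\<in>{..0}. 0)" and start1: "h1 0 (\<lambda>i\<in>{..0}. 0) = \<theta> 0 (\<lambda>i\<in>{..0}. 1)"
  obtains \<theta>' where "\<theta>' \<in> smap iso_nerve (Fun K X E)"
    "\<And>n \<sigma>. \<sigma> \<in> simplices iso_nerve n \<Longrightarrow> post_map K X E B p n (\<theta>' n \<sigma>) = hB n (\<sigma>, \<lambda>i\<in>{..n}. 1)"
    "\<theta>' 0 (\<lambda>i\<in>{..0}. 0) = h0 0 (\<lambda>i\<in>{..0}. 1)" "\<theta>' 0 (\<lambda>i\<in>{..0}. 1) = h1 0 (\<lambda>i\<in>{..0}. 1)"
proof -
  \<comment> \<open>In \<open>hB\<close> the first coordinate runs along the path, the second one is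
    the time of the motion.\<close>
  let ?J = iso_nerve and ?D = iso_boundary and ?S = "iso_endpoint 0"
  note J = simplicial_set_iso_nerve and D = simplicial_set_iso_boundary and S = simplicial_set_iso_endpoint[of 0]
  have DJ: "simplices ?D n \<subseteq> simplices ?J n" for n by auto
  obtain \<phi> :: "nat \<Rightarrow> (nat \<Rightarrow> nat) \<Rightarrow> 'u" and i where \<phi>: "\<And>n. inj_on (\<phi> n) (simplices ?J n)"
    and \<phi>D: "\<And>n. inj_on (\<phi> n) (simplices ?D n)"
    and V': "small_sset \<kappa> (transport_sset \<phi> ?J)" and U': "small_sset \<kappa> (transport_sset \<phi> ?D)"
    and i': "i \<in> smap (transport_sset \<phi> ?D) (transport_sset \<phi> ?J)"
    and iinj': "\<forall>n. inj_on (i n) (simplices (transport_sset \<phi> ?D) n)"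
    and i\<phi>': "\<And>n x. x \<in> simplices ?D n \<Longrightarrow> i n (\<phi> n x) = \<phi> n x"
    using interval_weights by blast
  define V where "V = transport_sset \<phi> ?J"
  define U where "U = transport_sset \<phi> ?D"
  note V = V'[folded V_def] and U = U'[folded U_def] and i = i'[folded U_def V_def] and iinj = iinj'[folded U_def]
  note Vs = small_sset_simplicial[OF V] and Us = small_sset_simplicial[OF U]
  have i\<phi>: "i n (\<phi> n x) = \<phi> n x" "\<phi> n x \<in> simplices U n" if "x \<in> simplices ?D n" for n x
    using that i\<phi>' by (auto simp: U_def simp del: simplices_iso_boundary)
  have V\<phi>: "\<phi> n x \<in> simplices V n" if "x \<in> simplices ?J n" for n x
    using that by (auto simp: V_def simp del: simplices_iso_nerve)
  note t = IsofibD[OF p]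
  obtain EV ev where EV: "cotensor K V E EV ev" using cotensor_ex[OF t(1) V] by blast
  obtain EU eu where EU: "cotensor K U E EU eu" using cotensor_ex[OF t(1) U] by blast
  obtain BV bv where BV: "cotensor K V B BV bv" using cotensor_ex[OF t(2) V] by blast
  obtain BU bu where BU: "cotensor K U B BU bu" using cotensor_ex[OF t(2) U] by blast
  note O = cotensorD(2)[OF EV] cotensorD(2)[OF EU] cotensorD(2)[OF BV] cotensorD(2)[OF BU]
  obtain pV where pV: "cotensor_base_map K V E B p EV ev BV bv pV" using base_map_ex[OF Vs EV BV t(3)] .
  obtain pU where pU: "cotensor_base_map K U E B p EU eu BU bu pU" using base_map_ex[OF Us EU BU t(3)] .
  obtain Ei where Ei: "cotensor_weight_map K U i E EV ev EU eu Ei" using weight_map_ex[OF Us EV EU i] .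
  obtain Bi where Bi: "cotensor_weight_map K U i B BV bv BU bu Bi" using weight_map_ex[OF Us BV BU i] .
  have a: "pV \<in> arr K EV BV" "pU \<in> arr K EU BU" "Ei \<in> arr K EV EU" "Bi \<in> arr K BV BU"
    using pV pU Ei Bi by (auto simp: cotensor_base_map_def cotensor_weight_map_def)
  have pUi: "pU \<in> Isofib K EU BU" by (rule base_map_Isofib[OF U p EU BU pU])
  obtain P l r where P: "is_pullback K P EU BV BU l r pU Bi"
    using is_pullback_exists[OF O(3) a(4) pUi] is_pullback_sym by metis
  note tP = is_pullbackD[OF P]
  obtain k where k: "k \<in> arr K EV P" "cmp0 K EV P EU l k = Ei" "cmp0 K EV P BV r k = pV"
    using is_pullback_arr_ex[OF P O(1) a(3,1) base_weight_commute[OF EV EU BV BU i t(3) pV pU Ei Bi]] .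
  have "leibniz_cotensor K U V i E B p EV P k"
    unfolding leibniz_cotensor_def
    by (intro exI conjI, rule EV, rule EU, rule BV, rule BU, rule pU, rule Bi, rule is_pullback_limit_cone[OF P], rule k(1))
      (simp_all add: k(2,3) Ei pV)
  then have ki: "k \<in> Isofib K EV P" by (rule leibniz_Isofib[OF U V i iinj p])
  have dJ: "e \<in> {0, 1} \<Longrightarrow> H n (\<lambda>i\<in>{..n}. e) = H' n (\<lambda>i\<in>{..n}. e')"
    if "H \<in> smap ?J (Fun K X E)" "H' \<in> smap ?J (Fun K X E)" "H 0 (\<lambda>i\<in>{..0}. e) = H' 0 (\<lambda>i\<in>{..0}. e')" "e' \<in> {0, 1}" for H H' e e' n
    using smap_const[OF that(1), of e n] smap_const[OF that(2,4), of n] that(3) by simp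
  \<comment> \<open>The given path is the position at time 0: a map from the endpoint of time to the
    object \<open>EV\<close> of paths in \<open>E\<close>.\<close>
  have "(\<lambda>n. \<lambda>z\<in>simplices (sprod ?S ?J) n. \<theta> n (snd z)) \<in> smap (sprod ?S ?J) (Fun K X E)"
    by (rule smap_restrictI[OF simplicial_set_sprod[OF S J]]) (use smap_closed[OF \<theta>] smap_act[OF \<theta>] in auto)
  from cotensor_curry_transport[OF J \<phi> EV[unfolded V_def] X S this]
  obtain u where u: "u \<in> smap ?S (Fun K X EV)"
    "\<And>n s x. \<lbrakk>s \<in> simplices ?S n; x \<in> simplices ?J n\<rbrakk> \<Longrightarrow> Cmp K X EV E n (ev n (\<phi> n x)) (u n s) = \<theta> n x"
    by (auto simp del: simplices_iso_nerve)
  \<comment> \<open>The endpoints of the path move along \<open>h0\<close> and \<open>h1\<close>.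
    Time is the first coordinate here, since currying keeps the first factor.\<close>
  define hE where "hE n z = (if snd z = (\<lambda>i\<in>{..n}. 0) then h0 n (fst z) else h1 n (fst z))" for n and z :: "(nat \<Rightarrow> nat) \<times> (nat \<Rightarrow> nat)"
  have "(\<lambda>n. \<lambda>z\<in>simplices (sprod ?J ?D) n. hE n z) \<in> smap (sprod ?J ?D) (Fun K X E)"
  proof (rule smap_restrictI[OF simplicial_set_sprod[OF J D]])
    show "hE n z \<in> simplices (Fun K X E) n" if "z \<in> simplices (sprod ?J ?D) n" for n z
      using that smap_closed[OF h0] smap_closed[OF h1] by (auto simp: hE_def)
    fix m n \<alpha> z assume al: "\<alpha> \<in> Delta m n" and z: "z \<in> simplices (sprod ?J ?D) n"
    then show "hE m (act (sprod ?J ?D) m n \<alpha> z) = act (Fun K X E) m n \<alpha> (hE n z)"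
      using smap_act[OF h0 al] smap_act[OF h1 al] const_0_neq_1 const_0_neq_1[symmetric] by (auto simp: hE_def compose_const)
  qed
  from cotensor_curry_transport[OF D \<phi>D EU[unfolded U_def] X J this]
  obtain vE where vE: "vE \<in> smap ?J (Fun K X EU)"
    "\<And>n \<tau> x. \<lbrakk>\<tau> \<in> simplices ?J n; x \<in> simplices ?D n\<rbrakk> \<Longrightarrow> Cmp K X EU E n (eu n (\<phi> n x)) (vE n \<tau>) = hE n (\<tau>, x)"
    by (auto simp del: simplices_iso_nerve simplices_iso_boundary)
  \<comment> \<open>The coordinates of \<open>hB\<close> are exchanged, again to keep time as the
    parameter after currying.\<close>
  have "(\<lambda>n. \<lambda>z\<in>simplices (sprod ?J ?J) n. hB n (snd z, fst z)) \<in> smap (sprod ?J ?J) (Fun K X B)"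
    by (rule smap_restrictI[OF simplicial_set_sprod[OF J J]]) (use smap_closed[OF hB] smap_act[OF hB] in auto)
  from cotensor_curry_transport[OF J \<phi> BV[unfolded V_def] X J this]
  obtain vB where vB: "vB \<in> smap ?J (Fun K X BV)"
    "\<And>n \<tau> x. \<lbrakk>\<tau> \<in> simplices ?J n; x \<in> simplices ?J n\<rbrakk> \<Longrightarrow> Cmp K X BV B n (bv n (\<phi> n x)) (vB n \<tau>) = hB n (x, \<tau>)"
    by (auto simp del: simplices_iso_nerve)
  have phE: "post_map K X E B p n (hE n (\<tau>, x)) = hB n (x, \<tau>)" if "\<tau> \<in> simplices ?J n" "x \<in> simplices ?D n" for n \<tau> x
    using that ph0[OF that(1)] ph1[OF that(1)] const_0_neq_1[of n] by (auto simp: hE_def)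
  have compat: "post_map K X EU BU pU n (vE n \<tau>) = post_map K X BV BU Bi n (vB n \<tau>)" if \<tau>: "\<tau> \<in> simplices ?J n" for n \<tau>
  proof -
    have "(\<lambda>n. \<lambda>\<tau>\<in>simplices ?J n. post_map K X EU BU pU n (vE n \<tau>)) n \<tau> = (\<lambda>n. \<lambda>\<tau>\<in>simplices ?J n. post_map K X BV BU Bi n (vB n \<tau>)) n \<tau>"
    proof (rule cotensor_smap_eqI[where w = "\<lambda>n. \<lambda>\<tau>\<in>simplices ?J n. post_map K X EU BU pU n (vE n \<tau>)" and w' = "\<lambda>n. \<lambda>\<tau>\<in>simplices ?J n. post_map K X BV BU Bi n (vB n \<tau>)", OF BU X J])
      show "(\<lambda>n. \<lambda>\<tau>\<in>simplices ?J n. post_map K X EU BU pU n (vE n \<tau>)) \<in> smap ?J (Fun K X BU)"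
        by (rule smap_comp[OF J vE(1)]) (use X O a in auto)
      show "(\<lambda>n. \<lambda>\<tau>\<in>simplices ?J n. post_map K X BV BU Bi n (vB n \<tau>)) \<in> smap ?J (Fun K X BU)"
        by (rule smap_comp[OF J vB(1)]) (use X O a in auto)
      fix n \<tau> y assume \<tau>: "\<tau> \<in> simplices ?J n" and "y \<in> simplices U n"
      then obtain x where y: "y = \<phi> n x" "x \<in> simplices ?D n" unfolding U_def simplices_transport by blast
      have xJ: "x \<in> simplices ?J n" using y(2) DJ by blast
      have "Cmp K X BU B n (bu n (\<phi> n x)) (post_map K X EU BU pU n (vE n \<tau>)) = hB n (x, \<tau>)"
        using base_map_Cmp[OF EU BU pU t(3) X smap_closed[OF vE(1) \<tau>] i\<phi>(2)[OF y(2)]] vE(2)[OF \<tau> y(2)] phE[OF \<tau> y(2)] by simp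
      moreover have "Cmp K X BU B n (bu n (\<phi> n x)) (post_map K X BV BU Bi n (vB n \<tau>)) = hB n (x, \<tau>)"
        using weight_map_Cmp[OF BV BU Bi i X smap_closed[OF vB(1) \<tau>] i\<phi>(2)[OF y(2)]] vB(2)[OF \<tau> xJ] i\<phi>(1)[OF y(2)] by simp
      ultimately show "Cmp K X BU B n (bu n y) ((\<lambda>\<tau>\<in>simplices ?J n. post_map K X EU BU pU n (vE n \<tau>)) \<tau>)
          = Cmp K X BU B n (bu n y) ((\<lambda>\<tau>\<in>simplices ?J n. post_map K X BV BU Bi n (vB n \<tau>)) \<tau>)"
        using \<tau> y(1) by (simp del: simplices_iso_nerve)
    qed (rule \<tau>)
    then show ?thesis using \<tau> by (simp del: simplices_iso_nerve)
  qed
  obtain v where v: "v \<in> smap ?J (Fun K X P)" "\<And>n \<tau>. \<tau> \<in> simplices ?J n \<Longrightarrow> post_map K X P EU l n (v n \<tau>) = vE n \<tau>"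
    "\<And>n \<tau>. \<tau> \<in> simplices ?J n \<Longrightarrow> post_map K X P BV r n (v n \<tau>) = vB n \<tau>"
    using is_pullback_smap_ex[OF P X J vE(1) vB(1) compat] by blast
  have SJ: "simplices ?S n \<subseteq> simplices ?J n" for n by auto
  have restr: "(\<lambda>n. \<lambda>s\<in>simplices ?S n. f n s) \<in> smap ?S Y" if f: "f \<in> smap ?J Y" for f and Y :: "'a sset"
    by (rule smap_restrictI[OF S]) (use SJ smap_closed[OF f] smap_act[OF f] in \<open>auto simp: subset_iff simp del: simplices_iso_nerve\<close>)
  \<comment> \<open>The path at time 0 lies over the start of the motion: \<open>start0\<close> and
    \<open>start1\<close> give this on the endpoints, \<open>start\<close> on the image in
    \<open>B\<close>.\<close>
  have ks: "post_map K X EV P k n (u n s) = v n s" if s: "s \<in> simplices ?S n" for n s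
  proof (rule is_pullback_eqI[OF P X, where n = n])
    have sJ: "s \<in> simplices ?J n" using s SJ by blast
    note uc = smap_closed[OF u(1)] and vc = smap_closed[OF v(1) sJ]
    show "post_map K X EV P k n (u n s) \<in> simplices (Fun K X P) n" using X O tP k uc[OF s] by simp
    show "v n s \<in> simplices (Fun K X P) n" by (rule vc)
    have "(\<lambda>n. \<lambda>s\<in>simplices ?S n. post_map K X EV EU Ei n (u n s)) n s = (\<lambda>n. \<lambda>s\<in>simplices ?S n. vE n s) n s"
    proof (rule cotensor_smap_eqI[where w = "\<lambda>n. \<lambda>s\<in>simplices ?S n. post_map K X EV EU Ei n (u n s)" and w' = "\<lambda>n. \<lambda>s\<in>simplices ?S n. vE n s", OF EU X S])
      show "(\<lambda>n. \<lambda>s\<in>simplices ?S n. post_map K X EV EU Ei n (u n s)) \<in> smap ?S (Fun K X EU)"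
        by (rule smap_comp[OF S u(1)]) (use X O a in auto)
      show "(\<lambda>n. \<lambda>s\<in>simplices ?S n. vE n s) \<in> smap ?S (Fun K X EU)" by (rule restr[OF vE(1)])
      fix n s y assume s: "s \<in> simplices ?S n" and "y \<in> simplices U n"
      then obtain x where y: "y = \<phi> n x" "x \<in> simplices ?D n" unfolding U_def simplices_transport by blast
      have xJ: "x \<in> simplices ?J n" using y(2) DJ by blast
      have sJ: "s \<in> simplices ?J n" using s SJ by blast
      have "Cmp K X EU E n (eu n (\<phi> n x)) (post_map K X EV EU Ei n (u n s)) = \<theta> n x"
        using weight_map_Cmp[OF EV EU Ei i X uc[OF s] i\<phi>(2)[OF y(2)]] u(2)[OF s xJ] i\<phi>(1)[OF y(2)] by simp
      moreover have "hE n (s, x) = \<theta> n x"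
      proof -
        have "h0 n (\<lambda>i\<in>{..n}. 0) = \<theta> n (\<lambda>i\<in>{..n}. 0)"
          by (rule dJ[of h0 \<theta> 0 0]) (use h0 \<theta> start0 in \<open>simp_all del: atMost_0\<close>)
        moreover have "h1 n (\<lambda>i\<in>{..n}. 0) = \<theta> n (\<lambda>i\<in>{..n}. 1)"
          by (rule dJ[of h1 \<theta> 0 1]) (use h1 \<theta> start1 in \<open>simp_all del: atMost_0\<close>)
        ultimately show ?thesis
          using s y(2) const_0_neq_1[of n] by (auto simp: hE_def)
      qed
      ultimately show "Cmp K X EU E n (eu n y) ((\<lambda>s\<in>simplices ?S n. post_map K X EV EU Ei n (u n s)) s)
          = Cmp K X EU E n (eu n y) ((\<lambda>s\<in>simplices ?S n. vE n s) s)"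
        using vE(2)[OF sJ y(2)] y(1) s by simp
    qed (rule s)
    then have "post_map K X EV EU Ei n (u n s) = vE n s" using s by simp
    then show "post_map K X P EU l n (post_map K X EV P k n (u n s)) = post_map K X P EU l n (v n s)"
      using post_cmp[OF k(2), of X "u n s" n] v(2)[OF sJ] X O tP k uc[OF s] by simp
    have "(\<lambda>n. \<lambda>s\<in>simplices ?S n. post_map K X EV BV pV n (u n s)) n s = (\<lambda>n. \<lambda>s\<in>simplices ?S n. vB n s) n s"
    proof (rule cotensor_smap_eqI[where w = "\<lambda>n. \<lambda>s\<in>simplices ?S n. post_map K X EV BV pV n (u n s)" and w' = "\<lambda>n. \<lambda>s\<in>simplices ?S n. vB n s", OF BV X S])
      show "(\<lambda>n. \<lambda>s\<in>simplices ?S n. post_map K X EV BV pV n (u n s)) \<in> smap ?S (Fun K X BV)"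
        by (rule smap_comp[OF S u(1)]) (use X O a in auto)
      show "(\<lambda>n. \<lambda>s\<in>simplices ?S n. vB n s) \<in> smap ?S (Fun K X BV)" by (rule restr[OF vB(1)])
      fix n s y assume s: "s \<in> simplices ?S n" and "y \<in> simplices V n"
      then obtain x where y: "y = \<phi> n x" "x \<in> simplices ?J n" unfolding V_def simplices_transport by blast
      have sJ: "s \<in> simplices ?J n" using s SJ by blast
      have "Cmp K X BV B n (bv n (\<phi> n x)) (post_map K X EV BV pV n (u n s)) = post_map K X E B p n (\<theta> n x)"
        using base_map_Cmp[OF EV BV pV t(3) X uc[OF s] V\<phi>[OF y(2)]] u(2)[OF s y(2)] by simp
      moreover have "hB n (x, s) = post_map K X E B p n (\<theta> n x)" using start[OF y(2)] s by simp
      ultimately show "Cmp K X BV B n (bv n y) ((\<lambda>s\<in>simplices ?S n. post_map K X EV BV pV n (u n s)) s)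
          = Cmp K X BV B n (bv n y) ((\<lambda>s\<in>simplices ?S n. vB n s) s)"
        using vB(2)[OF sJ y(2)] y(1) s by simp
    qed (rule s)
    then have "post_map K X EV BV pV n (u n s) = vB n s" using s by simp
    then show "post_map K X P BV r n (post_map K X EV P k n (u n s)) = post_map K X P BV r n (v n s)"
      using post_cmp[OF k(3), of X "u n s" n] v(3)[OF sJ] X O tP k uc[OF s] by simp
  qed
  \<comment> \<open>The motion of paths, lifted along \<open>k\<close> from the position at time
    0.\<close>
  obtain w where w: "w \<in> smap ?J (Fun K X EV)" "\<And>n \<tau>. \<tau> \<in> simplices ?J n \<Longrightarrow> post_map K X EV P k n (w n \<tau>) = v n \<tau>"
  proof (rule has_rlpD[OF has_rlp_Isofib(2)[OF X ki] u(1) v(1) ks])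
    show "0 \<in> {0, 1::nat}" by simp
    fix w assume "w \<in> smap ?J (Fun K X EV)" "\<And>n \<tau>. \<tau> \<in> simplices ?J n \<Longrightarrow> post_map K X EV P k n (w n \<tau>) = v n \<tau>"
    then show thesis by (rule that)
  qed
  have wE: "post_map K X EV EU Ei n (w n \<tau>) = vE n \<tau>" "post_map K X EV BV pV n (w n \<tau>) = vB n \<tau>" if "\<tau> \<in> simplices ?J n" for n \<tau>
    using post_cmp[OF k(2), of X "w n \<tau>" n] post_cmp[OF k(3), of X "w n \<tau>" n] v(2,3)[OF that] w(2)[OF that]
      X O tP k smap_closed[OF w(1) that] by simp_all
  let ?c = "\<lambda>n::nat. \<lambda>i\<in>{..n}. 1::nat"
  have c: "?c n \<in> simplices ?J n" for n by auto
  \<comment> \<open>The moved path is obtained by uncurrying the lift at time 1.\<close>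
  let ?\<theta> = "\<lambda>n. \<lambda>\<sigma>\<in>simplices ?J n. Cmp K X EV E n (ev n (\<phi> n \<sigma>)) (w n (?c n))"
  have evc: "ev n (\<phi> n \<sigma>) \<in> simplices (Fun K EV E) n" if "\<sigma> \<in> simplices ?J n" for n \<sigma>
    by (rule smap_closed[OF cotensorD(3)[OF EV] V\<phi>[OF that]])
  have \<theta>': "?\<theta> \<in> smap ?J (Fun K X E)"
  proof (rule smap_restrictI[OF J])
    show "Cmp K X EV E n (ev n (\<phi> n \<sigma>)) (w n (?c n)) \<in> simplices (Fun K X E) n" if "\<sigma> \<in> simplices ?J n" for n \<sigma>
      using X O t evc[OF that] smap_closed[OF w(1) c] by simp
    fix m n \<alpha> \<sigma> assume al: "\<alpha> \<in> Delta m n" and \<sigma>: "\<sigma> \<in> simplices ?J n"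
    have "act V m n \<alpha> (\<phi> n \<sigma>) = \<phi> m (act ?J m n \<alpha> \<sigma>)" unfolding V_def by (rule act_transport[where \<phi> = \<phi>, OF \<phi> \<sigma>])
    then have "ev m (\<phi> m (act ?J m n \<alpha> \<sigma>)) = act (Fun K EV E) m n \<alpha> (ev n (\<phi> n \<sigma>))"
      using smap_act[OF cotensorD(3)[OF EV] al V\<phi>[OF \<sigma>]] by simp
    moreover have "w m (?c m) = act (Fun K X EV) m n \<alpha> (w n (?c n))"
      using smap_act[OF w(1) al c] compose_const[OF al, of "1::nat"] by simp
    ultimately show "Cmp K X EV E m (ev m (\<phi> m (act ?J m n \<alpha> \<sigma>))) (w m (?c m))
        = act (Fun K X E) m n \<alpha> (Cmp K X EV E n (ev n (\<phi> n \<sigma>)) (w n (?c n)))"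
      using Cmp_act[OF X O(1) t(1) al smap_closed[OF w(1) c] evc[OF \<sigma>]] by simp
  qed
  have p\<theta>': "post_map K X E B p n (?\<theta> n \<sigma>) = hB n (\<sigma>, ?c n)" if \<sigma>: "\<sigma> \<in> simplices ?J n" for n \<sigma>
    using base_map_Cmp[OF EV BV pV t(3) X smap_closed[OF w(1) c] V\<phi>[OF \<sigma>]] wE(2)[OF c] vB(2)[OF c \<sigma>] \<sigma>
    by (simp del: simplices_iso_nerve)
  have ends: "?\<theta> n x = hE n (?c n, x)" if x: "x \<in> simplices ?D n" for n x
  proof -
    have xJ: "x \<in> simplices ?J n" using x DJ by blast
    show ?thesis
      using weight_map_Cmp[OF EV EU Ei i X smap_closed[OF w(1) c] i\<phi>(2)[OF x]] wE(1)[OF c] vE(2)[OF c x] i\<phi>(1)[OF x] xJ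
      by (simp del: simplices_iso_nerve)
  qed
  have "?\<theta> 0 (\<lambda>i\<in>{..0}. 0) = hE 0 (?c 0, \<lambda>i\<in>{..0}. 0)" "?\<theta> 0 (\<lambda>i\<in>{..0}. 1) = hE 0 (?c 0, \<lambda>i\<in>{..0}. 1)"
    by (rule ends, simp)+
  moreover have "hE 0 (?c 0, \<lambda>i\<in>{..0}. 0) = h0 0 (?c 0)" "hE 0 (?c 0, \<lambda>i\<in>{..0}. 1) = h1 0 (?c 0)"
    using const_0_neq_1[of 0] by (simp_all add: hE_def del: atMost_0)
  ultimately have e: "?\<theta> 0 (\<lambda>i\<in>{..0}. 0) = h0 0 (?c 0)" "?\<theta> 0 (\<lambda>i\<in>{..0}. 1) = h1 0 (?c 0)"
    by (simp_all only:)
  show ?thesis by (rule that[of ?\<theta>, OF \<theta>' p\<theta>' e])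
qed

section \<open>Lifting and composing paths\<close>

lemma lift_path:
  assumes p: "p \<in> Isofib K E B" and X: "X \<in> Obj K" and a: "a \<in> arr K X E"
    and H: "H \<in> smap iso_nerve (Fun K X B)" "H 0 (\<lambda>i\<in>{..0}. 0) = cmp0 K X E B p a"
  obtains H' where "H' \<in> smap iso_nerve (Fun K X E)" "H' 0 (\<lambda>i\<in>{..0}. 0) = a"
    "\<And>n \<sigma>. \<sigma> \<in> simplices iso_nerve n \<Longrightarrow> post_map K X E B p n (H' n \<sigma>) = H n \<sigma>"
proof -
  note t = IsofibD[OF p]
  let ?u = "\<lambda>n. \<lambda>s\<in>simplices (iso_endpoint 0) n. degen (Fun K X E) n a"
  have u: "?u \<in> smap (iso_endpoint 0) (Fun K X E)"
    by (rule constant_homotopy[OF X t(1) a simplicial_set_iso_endpoint])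
  obtain H' where H': "H' \<in> smap iso_nerve (Fun K X E)" "\<And>n s. s \<in> simplices (iso_endpoint 0) n \<Longrightarrow> H' n s = ?u n s"
    "\<And>n \<sigma>. \<sigma> \<in> simplices iso_nerve n \<Longrightarrow> post_map K X E B p n (H' n \<sigma>) = H n \<sigma>"
  proof (rule has_rlpD[OF has_rlp_Isofib(2)[OF X p] u H(1)])
    fix n s assume s: "s \<in> simplices (iso_endpoint 0) n"
    then show "post_map K X E B p n (?u n s) = H n s"
      using smap_const[OF H(1), of 0 n] H(2) X t a by (simp add: post_degen del: atMost_0)
  qed auto
  have "H' 0 (\<lambda>i\<in>{..0}. 0) = a"
    using H'(2)[of "\<lambda>i\<in>{..0}. 0" 0] X t a by (simp del: atMost_0)
  then show ?thesis using that H' by blast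
qed

text \<open>The path from \<open>a\<close> to \<open>b\<close> is moved with its start held at
  \<open>a\<close> and its end following the path from \<open>b\<close> to \<open>c\<close>. Over
  the terminal object the image of the path imposes no condition.\<close>

lemma homotopic_trans:
  assumes ab: "homotopic K X A a b" and bc: "homotopic K X A b c" and X: "X \<in> Obj K" and A: "A \<in> Obj K"
  shows "homotopic K X A a c"
proof -
  obtain T where T: "terminal K T" using terminal_ex by blast
  obtain p where p: "p \<in> arr K A T" using terminal_arr_ex[OF T A] by blast
  have TO: "T \<in> Obj K" using T by (simp add: terminal_def)
  have pi: "p \<in> Isofib K A T" by (rule terminal_Isofib[OF T A p])
  obtain x where x: "x \<in> arr K X T" using terminal_arr_ex[OF T X] by blast
  obtain \<theta> where \<theta>: "\<theta> \<in> smap iso_nerve (Fun K X A)" "\<theta> 0 (\<lambda>i\<in>{..0}. 0) = a" "\<theta> 0 (\<lambda>i\<in>{..0}. 1) = b"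
    using ab by (auto simp: homotopic_def)
  obtain \<beta> where \<beta>: "\<beta> \<in> smap iso_nerve (Fun K X A)" "\<beta> 0 (\<lambda>i\<in>{..0}. 0) = b" "\<beta> 0 (\<lambda>i\<in>{..0}. 1) = c"
    using bc by (auto simp: homotopic_def)
  have a: "a \<in> arr K X A" using homotopic_arr[OF ab] by simp
  let ?B = "\<lambda>n. \<lambda>z\<in>simplices (sprod iso_nerve iso_nerve) n. degen (Fun K X T) n x"
  let ?h0 = "\<lambda>n. \<lambda>s\<in>simplices iso_nerve n. degen (Fun K X A) n a"
  note J = simplicial_set_iso_nerve
  have B: "?B \<in> smap (sprod iso_nerve iso_nerve) (Fun K X T)"
    by (rule constant_homotopy[OF X TO x simplicial_set_sprod[OF J J]])
  have h0: "?h0 \<in> smap iso_nerve (Fun K X A)" by (rule constant_homotopy[OF X A a J])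
  have eq: "post_map K X A T p n y = ?B n z" if "y \<in> simplices (Fun K X A) n" "z \<in> simplices (sprod iso_nerve iso_nerve) n" for n y z
    by (rule terminal_unique[OF T X, where n = n]) (use X A TO p x that smap_closed[OF B] in auto)
  obtain \<theta>' where "\<theta>' \<in> smap iso_nerve (Fun K X A)"
    "\<theta>' 0 (\<lambda>i\<in>{..0}. 0) = ?h0 0 (\<lambda>i\<in>{..0}. 1)" "\<theta>' 0 (\<lambda>i\<in>{..0}. 1) = \<beta> 0 (\<lambda>i\<in>{..0}. 1)"
  proof (rule move_path[OF pi X \<theta>(1) B h0 \<beta>(1)])
    show "post_map K X A T p n (?h0 n \<tau>) = ?B n (\<lambda>i\<in>{..n}. 0, \<tau>)" if "\<tau> \<in> simplices iso_nerve n" for n \<tau>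
      using that by (intro eq smap_closed[OF h0]) auto
    show "post_map K X A T p n (\<beta> n \<tau>) = ?B n (\<lambda>i\<in>{..n}. 1, \<tau>)" if "\<tau> \<in> simplices iso_nerve n" for n \<tau>
      using that by (intro eq smap_closed[OF \<beta>(1)]) auto
    show "?B n (\<sigma>, \<lambda>i\<in>{..n}. 0) = post_map K X A T p n (\<theta> n \<sigma>)" if "\<sigma> \<in> simplices iso_nerve n" for n \<sigma>
      using that by (intro eq[symmetric] smap_closed[OF \<theta>(1)]) auto
    show "?h0 0 (\<lambda>i\<in>{..0}. 0) = \<theta> 0 (\<lambda>i\<in>{..0}. 0)" using \<theta>(2) X A a by (auto simp del: atMost_0)
    show "\<beta> 0 (\<lambda>i\<in>{..0}. 0) = \<theta> 0 (\<lambda>i\<in>{..0}. 1)" using \<theta>(3) \<beta>(2) by simp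
  qed auto
  moreover have "?h0 0 (\<lambda>i\<in>{..0}. 1) = a" using X A a by (auto simp del: atMost_0)
  ultimately show ?thesis using \<beta>(3) by (auto simp: homotopic_def)
qed

end

section \<open>Equivalences\<close>

context simplicial_category
begin

text \<open>A homotopy of 0-arrows acts on all function complexes by whiskering. The directions of
  the two given homotopies are those demanded in \<open>qcat_equivalence\<close>.\<close>

lemma equivalenceI:
  assumes qc: "\<And>X. X \<in> Obj K \<Longrightarrow> quasi_category (Fun K X A) \<and> quasi_category (Fun K X B)"
    and t: "A \<in> Obj K" "B \<in> Obj K" "f \<in> arr K A B" "s \<in> arr K B A"
    and sf: "homotopic K A A (Unit K A) (cmp0 K A B A s f)" and fs: "homotopic K B B (cmp0 K B A B f s) (Unit K B)"
  shows "equivalence K A B f"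
  unfolding equivalence_def
proof (intro conjI ballI)
  fix X assume X: "X \<in> Obj K"
  note J = simplicial_set_iso_nerve
  have whisker: "(\<lambda>n. \<lambda>z\<in>simplices (sprod (Fun K X C) iso_nerve) n. Cmp K X C C n (H n (snd z)) (fst z)) \<in> smap (sprod (Fun K X C) iso_nerve) (Fun K X C)"
    if C: "C \<in> Obj K" and H: "H \<in> smap iso_nerve (Fun K C C)" for C H
    by (rule smap_restrictI[OF simplicial_set_sprod[OF Fun_simplicial_set[OF X C] J]])
      (use X C smap_closed[OF H] smap_act[OF H] in \<open>auto simp: Cmp_act simp del: simplices_iso_nerve act_iso_nerve\<close>)
  have ends: "Cmp K X C C n (H n (\<lambda>i\<in>{..n}. e)) x = post_map K X C C (H 0 (\<lambda>i\<in>{..0}. e)) n x"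
    if "C \<in> Obj K" "H \<in> smap iso_nerve (Fun K C C)" "e \<in> {0, 1}" "x \<in> simplices (Fun K X C) n" for C H e x n
    using smap_const[OF that(2,3), of n] that(4) by (simp add: post_map_eq)
  obtain H where H: "H \<in> smap iso_nerve (Fun K A A)" "H 0 (\<lambda>i\<in>{..0}. 0) = Unit K A" "H 0 (\<lambda>i\<in>{..0}. 1) = cmp0 K A B A s f"
    using sf by (auto simp: homotopic_def)
  obtain H' where H': "H' \<in> smap iso_nerve (Fun K B B)" "H' 0 (\<lambda>i\<in>{..0}. 0) = cmp0 K B A B f s" "H' 0 (\<lambda>i\<in>{..0}. 1) = Unit K B"
    using fs by (auto simp: homotopic_def)
  let ?H = "\<lambda>n. \<lambda>z\<in>simplices (sprod (Fun K X A) iso_nerve) n. Cmp K X A A n (H n (snd z)) (fst z)"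
  let ?H' = "\<lambda>n. \<lambda>z\<in>simplices (sprod (Fun K X B) iso_nerve) n. Cmp K X B B n (H' n (snd z)) (fst z)"
  have "?H n (x, \<lambda>i\<in>{..n}. 0) = x \<and> ?H n (x, \<lambda>i\<in>{..n}. 1) = post_map K X B A s n (post_map K X A B f n x)"
    if x: "x \<in> simplices (Fun K X A) n" for n x
    using ends[OF t(1) H(1) _ x] X t x H(2,3) by (auto simp del: atMost_0)
  moreover have "?H' n (y, \<lambda>i\<in>{..n}. 0) = post_map K X A B f n (post_map K X B A s n y) \<and> ?H' n (y, \<lambda>i\<in>{..n}. 1) = y"
    if y: "y \<in> simplices (Fun K X B) n" for n y
    using ends[OF t(2) H'(1) _ y] X t y H'(2,3) by (auto simp del: atMost_0)
  ultimately show "qcat_equivalence (Fun K X A) (Fun K X B) (post_map K X A B f)"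
    unfolding qcat_equivalence_def
    by (intro conjI bexI[of _ "post_map K X B A s"] bexI[OF _ whisker[OF t(1) H(1)]] bexI[OF _ whisker[OF t(2) H'(1)]])
      (use X t qc[OF X] in auto)
qed (use t in auto)

end

section \<open>Homotopy equivalences\<close>

context infinity_cosmos
begin

lemma equivalenceD:
  assumes "equivalence K A B f"
  shows "A \<in> Obj K" "B \<in> Obj K" "f \<in> arr K A B"
  using assms by (auto simp: equivalence_def)

text \<open>As in the Yoneda lemma, evaluating at the identity of \<open>B\<close> gives
  \<open>s\<close> and a homotopy from \<open>f s\<close> to the identity. The inverse
  \<open>G2\<close> at \<open>X = A\<close> is not assumed to be related to this \<open>s\<close>.
  But every \<open>c\<close> is homotopic to the value of \<open>G2\<close> at \<open>f c\<close>,
  and \<open>f s f\<close> is homotopic to \<open>f\<close>; so \<open>s f\<close> and the identity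
  are both homotopic to the value of \<open>G2\<close> at \<open>f\<close>.\<close>

lemma equivalence_homotopy_inverse:
  assumes eq: "equivalence K A B f"
  obtains s where "s \<in> arr K B A" "homotopic K A A (Unit K A) (cmp0 K A B A s f)" "homotopic K B B (cmp0 K B A B f s) (Unit K B)"
proof -
  note t = equivalenceD[OF eq] and J = simplicial_set_iso_nerve
  obtain G H' where G: "G \<in> smap (Fun K B B) (Fun K B A)" and H': "H' \<in> smap (sprod (Fun K B B) iso_nerve) (Fun K B B)"
    "\<forall>n. \<forall>y\<in>simplices (Fun K B B) n. H' n (y, \<lambda>i\<in>{..n}. 0) = post_map K B A B f n (G n y) \<and> H' n (y, \<lambda>i\<in>{..n}. 1) = y"
    using eq t(2) unfolding equivalence_def qcat_equivalence_def by metis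
  obtain G2 H where G2: "G2 \<in> smap (Fun K A B) (Fun K A A)" and H: "H \<in> smap (sprod (Fun K A A) iso_nerve) (Fun K A A)"
    "\<forall>n. \<forall>y\<in>simplices (Fun K A A) n. H n (y, \<lambda>i\<in>{..n}. 0) = y \<and> H n (y, \<lambda>i\<in>{..n}. 1) = G2 n (post_map K A A B f n y)"
    using eq t(1) unfolding equivalence_def qcat_equivalence_def by metis
  have path: "(\<lambda>n. \<lambda>\<sigma>\<in>simplices iso_nerve n. F n (degen (Fun K C C) n c, \<sigma>)) \<in> smap iso_nerve (Fun K C C)"
    if "C \<in> Obj K" "F \<in> smap (sprod (Fun K C C) iso_nerve) (Fun K C C)" "c \<in> arr K C C" for C F c
  proof (rule smap_restrictI[OF J])
    show "F n (degen (Fun K C C) n c, \<sigma>) \<in> simplices (Fun K C C) n" if "\<sigma> \<in> simplices iso_nerve n" for n \<sigma>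
      by (rule smap_closed[OF \<open>F \<in> _\<close>]) (use that \<open>C \<in> _\<close> \<open>c \<in> _\<close> in auto)
    show "F m (degen (Fun K C C) m c, act iso_nerve m n \<alpha> \<sigma>) = act (Fun K C C) m n \<alpha> (F n (degen (Fun K C C) n c, \<sigma>))"
      if "\<alpha> \<in> Delta m n" "\<sigma> \<in> simplices iso_nerve n" for m n \<alpha> \<sigma>
      using smap_act[OF \<open>F \<in> _\<close> that(1), of "(degen (Fun K C C) n c, \<sigma>)"] that \<open>C \<in> _\<close> \<open>c \<in> _\<close> by simp
  qed
  define s where "s = G 0 (Unit K B)"
  have s: "s \<in> arr K B A" unfolding s_def by (rule smap_closed[OF G]) (use t in simp)
  have fs: "homotopic K B B (cmp0 K B A B f s) (Unit K B)"
    by (rule homotopicI[OF path[OF t(2) H'(1), of "Unit K B"]])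
      (use t H'(2) s in \<open>auto simp: s_def post_map_0 simp del: atMost_0\<close>)
  have H_end: "homotopic K A A c (G2 0 (cmp0 K A A B f c))" if c: "c \<in> arr K A A" for c
    by (rule homotopicI[OF path[OF t(1) H(1) c]])
      (use t H(2) c in \<open>auto simp: post_map_0 simp del: atMost_0\<close>)
  have sf: "cmp0 K A B A s f \<in> arr K A A" using t s by simp
  have "homotopic K A B (cmp0 K A A B f (cmp0 K A B A s f)) f"
    using homotopic_pre[OF fs t(2,2,1,3)] t s by (simp add: Cmp_assoc)
  then obtain F where F: "F \<in> smap iso_nerve (Fun K A B)" "F 0 (\<lambda>i\<in>{..0}. 0) = cmp0 K A A B f (cmp0 K A B A s f)" "F 0 (\<lambda>i\<in>{..0}. 1) = f"
    by (auto simp: homotopic_def)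
  have "homotopic K A A (G2 0 (cmp0 K A A B f (cmp0 K A B A s f))) (G2 0 f)"
    by (rule homotopicI[OF smap_comp[OF J F(1) G2]]) (use F in \<open>auto simp del: atMost_0\<close>)
  then have "homotopic K A A (cmp0 K A B A s f) (G2 0 f)"
    using homotopic_trans[OF H_end[OF sf]] t by blast
  moreover have "homotopic K A A (Unit K A) (G2 0 f)"
    using H_end[of "Unit K A"] t by simp
  ultimately have "homotopic K A A (Unit K A) (cmp0 K A B A s f)"
    using homotopic_trans homotopic_sym t(1) by blast
  then show ?thesis using that s fs by blast
qed

text \<open>One-sided inverses agree up to homotopy, as both are homotopic to
  \<open>l f r\<close>.\<close>

lemma equivalence_two_sided:
  assumes t: "A \<in> Obj K" "B \<in> Obj K" "f \<in> arr K A B" "l \<in> arr K B A" "r \<in> arr K B A"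
    and l: "homotopic K A A (cmp0 K A B A l f) (Unit K A)" and r: "homotopic K B B (cmp0 K B A B f r) (Unit K B)"
  shows "equivalence K A B f"
proof (rule equivalenceI[OF _ t(1-4) homotopic_sym[OF l]])
  show "quasi_category (Fun K X A) \<and> quasi_category (Fun K X B)" if "X \<in> Obj K" for X
    using that t Fun_quasi_category by blast
  have "homotopic K B A (cmp0 K B B A l (cmp0 K B A B f r)) r"
    using homotopic_pre[OF l t(1,1,2,5)] t by (simp add: Cmp_assoc)
  moreover have "homotopic K B A l (cmp0 K B B A l (cmp0 K B A B f r))"
    using homotopic_post[OF homotopic_sym[OF r] t(2,2,1,4)] t by simp
  ultimately have "homotopic K B A l r"
    using homotopic_trans t(1,2) by blast
  then have "homotopic K B B (cmp0 K B A B f l) (cmp0 K B A B f r)"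
    by (rule homotopic_post) (use t in auto)
  then show "homotopic K B B (cmp0 K B A B f l) (Unit K B)"
    using homotopic_trans[OF _ r] t by blast
qed

text \<open>The inverse is \<open>s r\<close>: the inner homotopy is whiskered on both sides, then
  the outer one is appended.\<close>

lemma equivalence_comp:
  assumes f: "equivalence K A B f" and g: "equivalence K B C g"
  shows "equivalence K A C (cmp0 K A B C g f)"
proof -
  note t = equivalenceD[OF f] equivalenceD[OF g]
  obtain s where s: "s \<in> arr K B A" "homotopic K A A (Unit K A) (cmp0 K A B A s f)" "homotopic K B B (cmp0 K B A B f s) (Unit K B)"
    using equivalence_homotopy_inverse[OF f] .
  obtain r where r: "r \<in> arr K C B" "homotopic K B B (Unit K B) (cmp0 K B C B r g)" "homotopic K C C (cmp0 K C B C g r) (Unit K C)"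
    using equivalence_homotopy_inverse[OF g] .
  have "homotopic K A B (cmp0 K A B B (cmp0 K B C B r g) f) f"
    using homotopic_pre[OF homotopic_sym[OF r(2)], of A f] t by simp
  from homotopic_post[OF this, of A s] have "homotopic K A A (cmp0 K A C A (cmp0 K C B A s r) (cmp0 K A B C g f)) (cmp0 K A B A s f)"
    using t s r by (simp add: Cmp_assoc)
  then have 1: "homotopic K A A (cmp0 K A C A (cmp0 K C B A s r) (cmp0 K A B C g f)) (Unit K A)"
    using homotopic_trans[OF _ homotopic_sym[OF s(2)]] t by blast
  have "homotopic K C B (cmp0 K C B B (cmp0 K B A B f s) r) r"
    using homotopic_pre[OF s(3), of C r] t r by simp
  from homotopic_post[OF this, of C g] have "homotopic K C C (cmp0 K C A C (cmp0 K A B C g f) (cmp0 K C B A s r)) (cmp0 K C B C g r)"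
    using t s r by (simp add: Cmp_assoc)
  then have 2: "homotopic K C C (cmp0 K C A C (cmp0 K A B C g f) (cmp0 K C B A s r)) (Unit K C)"
    using homotopic_trans[OF _ r(3)] t by blast
  show ?thesis
    by (rule equivalence_two_sided[OF _ _ _ _ _ 1 2]) (use t s r in auto)
qed

text \<open>With \<open>s\<close> inverse to \<open>q k\<close>, the inverse of \<open>k\<close> is
  \<open>s q\<close>. On one side \<open>k s q\<close> is homotopic to \<open>r q k s q\<close>,
  hence to \<open>r q\<close> and to the identity.\<close>

lemma equivalence_cancel_left:
  assumes k: "k \<in> arr K A B" and g: "equivalence K A C (cmp0 K A B C q k)" and q: "equivalence K B C q"
  shows "equivalence K A B k"
proof -
  note t = equivalenceD[OF g] equivalenceD[OF q]
  let ?g = "cmp0 K A B C q k"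
  obtain s where s: "s \<in> arr K C A" "homotopic K A A (Unit K A) (cmp0 K A C A s ?g)" "homotopic K C C (cmp0 K C A C ?g s) (Unit K C)"
    using equivalence_homotopy_inverse[OF g] .
  obtain r where r: "r \<in> arr K C B" "homotopic K B B (Unit K B) (cmp0 K B C B r q)" "homotopic K C C (cmp0 K C B C q r) (Unit K C)"
    using equivalence_homotopy_inverse[OF q] .
  let ?l = "cmp0 K B C A s q"
  have l: "?l \<in> arr K B A" and kl: "cmp0 K B A B k ?l \<in> arr K B B" using t s k by simp_all
  have 1: "homotopic K A A (cmp0 K A B A ?l k) (Unit K A)"
    using homotopic_sym[OF s(2)] t s k by (simp add: Cmp_assoc)
  have "homotopic K B B (cmp0 K B A B k ?l) (cmp0 K B B B (cmp0 K B C B r q) (cmp0 K B A B k ?l))"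
    using homotopic_pre[OF r(2), of B "cmp0 K B A B k ?l"] t kl by simp
  moreover have "cmp0 K B B B (cmp0 K B C B r q) (cmp0 K B A B k ?l) = cmp0 K B C B r (cmp0 K B C C (cmp0 K C A C ?g s) q)"
    using t s r k by (simp add: Cmp_assoc)
  moreover have "homotopic K B B (cmp0 K B C B r (cmp0 K B C C (cmp0 K C A C ?g s) q)) (cmp0 K B C B r q)"
    using homotopic_post[OF homotopic_pre[OF s(3), of B q], of B r] t r by simp
  ultimately have 2: "homotopic K B B (cmp0 K B A B k ?l) (Unit K B)"
    using homotopic_trans homotopic_sym[OF r(2)] t by metis
  show ?thesis
    by (rule equivalence_two_sided[OF _ _ k l l 1 2]) (use t in auto)
qed

text \<open>With \<open>s\<close> inverse to \<open>r e\<close>, the inverse of \<open>r\<close> is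
  \<open>e s\<close>. On one side \<open>e s r\<close> is homotopic to \<open>e s r e d\<close>,
  hence to \<open>e d\<close> and to the identity.\<close>

lemma equivalence_cancel_right:
  assumes e: "equivalence K A N e" and r: "r \<in> arr K N B" and m: "equivalence K A B (cmp0 K A N B r e)"
  shows "equivalence K N B r"
proof -
  note t = equivalenceD[OF e] equivalenceD[OF m]
  let ?m = "cmp0 K A N B r e"
  obtain s where s: "s \<in> arr K B A" "homotopic K A A (Unit K A) (cmp0 K A B A s ?m)" "homotopic K B B (cmp0 K B A B ?m s) (Unit K B)"
    using equivalence_homotopy_inverse[OF m] .
  obtain d where d: "d \<in> arr K N A" "homotopic K A A (Unit K A) (cmp0 K A N A d e)" "homotopic K N N (cmp0 K N A N e d) (Unit K N)"
    using equivalence_homotopy_inverse[OF e] .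
  let ?l = "cmp0 K B A N e s"
  have l: "?l \<in> arr K B N" and lr: "cmp0 K N B N ?l r \<in> arr K N N" using t s r by simp_all
  have 2: "homotopic K B B (cmp0 K B N B r ?l) (Unit K B)"
    using s(3) t s r by (simp add: Cmp_assoc)
  have "homotopic K N N (cmp0 K N B N ?l r) (cmp0 K N N N (cmp0 K N B N ?l r) (cmp0 K N A N e d))"
    using homotopic_post[OF homotopic_sym[OF d(3)], of N "cmp0 K N B N ?l r"] t lr by simp
  moreover have "cmp0 K N N N (cmp0 K N B N ?l r) (cmp0 K N A N e d) = cmp0 K N A N e (cmp0 K N A A (cmp0 K A B A s ?m) d)"
    using t s r d by (simp add: Cmp_assoc)
  moreover have "homotopic K N N (cmp0 K N A N e (cmp0 K N A A (cmp0 K A B A s ?m) d)) (cmp0 K N A N e d)"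
    using homotopic_post[OF homotopic_pre[OF homotopic_sym[OF s(2)], of N d], of N e] t d by simp
  ultimately have 1: "homotopic K N N (cmp0 K N B N ?l r) (Unit K N)"
    using homotopic_trans d(3) t by metis
  show ?thesis
    by (rule equivalence_two_sided[OF _ _ r l l 1 2]) (use t in auto)
qed

text \<open>With \<open>s\<close> a two-sided inverse of \<open>f\<close>, the composite
  \<open>n f\<close> is homotopic to \<open>s f n f\<close>, hence to \<open>s f\<close> and to the
  identity.\<close>

lemma equivalence_right_inverse:
  assumes f: "equivalence K A B f" and n: "n \<in> arr K B A" "homotopic K B B (cmp0 K B A B f n) (Unit K B)"
  shows "equivalence K B A n"
proof -
  note t = equivalenceD[OF f]
  obtain s where s: "s \<in> arr K B A" "homotopic K A A (Unit K A) (cmp0 K A B A s f)" "homotopic K B B (cmp0 K B A B f s) (Unit K B)"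
    using equivalence_homotopy_inverse[OF f] .
  have nf: "cmp0 K A B A n f \<in> arr K A A" using t n by simp
  have "homotopic K A A (cmp0 K A B A n f) (cmp0 K A A A (cmp0 K A B A s f) (cmp0 K A B A n f))"
    using homotopic_pre[OF s(2), of A "cmp0 K A B A n f"] t nf by simp
  moreover have "cmp0 K A A A (cmp0 K A B A s f) (cmp0 K A B A n f) = cmp0 K A B A s (cmp0 K A B B (cmp0 K B A B f n) f)"
    using t s n by (simp add: Cmp_assoc)
  moreover have "homotopic K A A (cmp0 K A B A s (cmp0 K A B B (cmp0 K B A B f n) f)) (cmp0 K A B A s f)"
    using homotopic_post[OF homotopic_pre[OF n(2), of A f], of A s] t s by simp
  ultimately have 1: "homotopic K A A (cmp0 K A B A n f) (Unit K A)"
    using homotopic_trans homotopic_sym[OF s(2)] t by metis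
  show ?thesis
    by (rule equivalence_two_sided[OF t(2,1) n(1) t(3,3) n(2) 1])
qed

text \<open>
  The mapping path object: a point of \<open>N\<close> is a point of \<open>A\<close> with a path in \<open>B\<close> that starts at its image
  under \<open>f\<close>; the path is contracted along \<open>min\<close> on the interval.
\<close>

lemma isofib_factorization:
  assumes A: "A \<in> Obj K" and B: "B \<in> Obj K" and f: "f \<in> arr K A B"
  obtains N e r where "equivalence K A N e" "r \<in> Isofib K N B" "cmp0 K A N B r e = f"
proof -
  let ?J = iso_nerve and ?D = iso_boundary
  note J = simplicial_set_iso_nerve and D = simplicial_set_iso_boundary
  have DJ: "simplices ?D n \<subseteq> simplices ?J n" for n by auto
  obtain \<phi> :: "nat \<Rightarrow> (nat \<Rightarrow> nat) \<Rightarrow> 'u" and i where \<phi>: "\<And>n. inj_on (\<phi> n) (simplices ?J n)"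
    and \<phi>D: "\<And>n. inj_on (\<phi> n) (simplices ?D n)"
    and V': "small_sset \<kappa> (transport_sset \<phi> ?J)" and U': "small_sset \<kappa> (transport_sset \<phi> ?D)"
    and i': "i \<in> smap (transport_sset \<phi> ?D) (transport_sset \<phi> ?J)"
    and iinj': "\<forall>n. inj_on (i n) (simplices (transport_sset \<phi> ?D) n)"
    and i\<phi>': "\<And>n x. x \<in> simplices ?D n \<Longrightarrow> i n (\<phi> n x) = \<phi> n x"
    using interval_weights by blast
  define V where "V = transport_sset \<phi> ?J"
  define U where "U = transport_sset \<phi> ?D"
  note V = V'[folded V_def] and U = U'[folded U_def] and i = i'[folded U_def V_def] and iinj = iinj'[folded U_def]
  note Vs = small_sset_simplicial[OF V] and Us = small_sset_simplicial[OF U]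
  have i\<phi>: "i n (\<phi> n x) = \<phi> n x" "\<phi> n x \<in> simplices U n" if "x \<in> simplices ?D n" for n x
    using that i\<phi>' by (auto simp: U_def simp del: simplices_iso_boundary)
  have V\<phi>: "\<phi> n x \<in> simplices V n" if "x \<in> simplices ?J n" for n x
    using that by (auto simp: V_def simp del: simplices_iso_nerve)
  have U\<phi>: "\<exists>x\<in>simplices ?D n. y = \<phi> n x" if "y \<in> simplices U n" for n y
    using that unfolding U_def simplices_transport by blast
  have V\<phi>': "\<exists>x\<in>simplices ?J n. y = \<phi> n x" if "y \<in> simplices V n" for n y
    using that unfolding V_def simplices_transport by blast
  obtain T where T: "terminal K T" using terminal_ex by blast
  then have TO: "T \<in> Obj K" by (simp add: terminal_def)
  obtain a where a: "a \<in> arr K A T" using terminal_arr_ex[OF T A] by blast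
  obtain b where b: "b \<in> arr K B T" using terminal_arr_ex[OF T B] by blast
  have bi: "b \<in> Isofib K B T" by (rule terminal_Isofib[OF T B b])
  \<comment> \<open>A pullback over the terminal object: \<open>P\<close> is the product of
    \<open>A\<close> and \<open>B\<close>, with an isofibration to each factor.\<close>
  obtain P pA pB where P: "is_pullback K P A B T pA pB a b" using is_pullback_exists[OF A a bi] .
  note tP = is_pullbackD[OF P]
  have pBi: "pB \<in> Isofib K P B" by (rule is_pullback_Isofib'[OF P terminal_Isofib[OF T A a]])
  obtain BV bv where BV: "cotensor K V B BV bv" using cotensor_ex[OF B V] by blast
  obtain BU bu where BU: "cotensor K U B BU bu" using cotensor_ex[OF B U] by blast
  note O = cotensorD(2)[OF BV] cotensorD(2)[OF BU]
  obtain c where c: "cotensor_weight_map K U i B BV bv BU bu c" using weight_map_ex[OF Us BV BU i] .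
  have ca: "c \<in> arr K BV BU" using c by (simp add: cotensor_weight_map_def)
  have ci: "c \<in> Isofib K BV BU" by (rule weight_map_Isofib[OF U V i iinj BV BU c])
  have cu: "pre_map K BV BU B c n (bu n (\<phi> n x)) = bv n (\<phi> n x)" if "x \<in> simplices ?D n" for n x
    using c i\<phi>[OF that] by (auto simp: cotensor_weight_map_def)
  have buc: "bu n (\<phi> n x) \<in> simplices (Fun K BU B) n" if "x \<in> simplices ?D n" for n x
    by (rule smap_closed[OF cotensorD(3)[OF BU] i\<phi>(2)[OF that]])
  have bvc: "bv n (\<phi> n x) \<in> simplices (Fun K BV B) n" if "x \<in> simplices ?J n" for n x
    by (rule smap_closed[OF cotensorD(3)[OF BV] V\<phi>[OF that]])
  \<comment> \<open>The pair of \<open>f pA\<close> and \<open>pB\<close> as a family over the two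
    endpoints; 0 is the start of a path and 1 its end.\<close>
  define q where "q n x = (if x = (\<lambda>i\<in>{..n}. 0) then cmp0 K P A B f pA else pB)" for n and x :: "nat \<Rightarrow> nat"
  have q: "q n x \<in> arr K P B" for n x using tP A B f by (simp add: q_def)
  have "(\<lambda>n. \<lambda>x\<in>simplices ?D n. degen (Fun K P B) n (q n x)) \<in> smap ?D (Fun K P B)"
  proof (rule smap_restrictI[OF D])
    fix m n \<alpha> x assume al: "\<alpha> \<in> Delta m n" and x: "x \<in> simplices ?D n"
    have "q m (act ?D m n \<alpha> x) = q n x"
      using x al const_0_neq_1[of m] const_0_neq_1[of n] by (auto simp: q_def compose_const)
    then show "degen (Fun K P B) m (q m (act ?D m n \<alpha> x)) = act (Fun K P B) m n \<alpha> (degen (Fun K P B) n (q n x))"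
      using q[of n x] tP B al by simp
  qed (use q tP B in auto)
  from cotensor_arr_ex_transport[OF D \<phi>D BU[unfolded U_def] tP(1) this]
  obtain g where g: "g \<in> arr K P BU" "\<And>n x. x \<in> simplices ?D n \<Longrightarrow> pre_map K P BU B g n (bu n (\<phi> n x)) = degen (Fun K P B) n (q n x)"
    by (auto simp del: simplices_iso_boundary)
  \<comment> \<open>\<open>N\<close> is the path object of \<open>B\<close> pulled back along
    \<open>g\<close>, so a point of \<open>N\<close> is a point of \<open>A\<close>, a point of
    \<open>B\<close> and a path between its image under \<open>f\<close> and the latter.\<close>
  obtain N nP nV where N: "is_pullback K N P BV BU nP nV g c" using is_pullback_exists[OF tP(1) g(1) ci] .
  note tN = is_pullbackD[OF N]
  have nPi: "nP \<in> Isofib K N P" by (rule is_pullback_Isofib[OF N ci])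
  define r where "r = cmp0 K N P B pB nP"
  have r: "r \<in> Isofib K N B" unfolding r_def by (rule Isofib_comp[OF nPi pBi])
  have ra: "r \<in> arr K N B" using IsofibD[OF r] by simp
  \<comment> \<open>Constant paths give \<open>j\<close>; together with the graph \<open>h\<close>
    of \<open>f\<close> it defines the map \<open>d\<close> from \<open>A\<close> to
    \<open>N\<close>.\<close>
  have "(\<lambda>n. \<lambda>x\<in>simplices ?J n. degen (Fun K A B) n f) \<in> smap ?J (Fun K A B)"
    by (rule constant_homotopy[OF A B f J])
  from cotensor_arr_ex_transport[OF J \<phi> BV[unfolded V_def] A this]
  obtain j where j: "j \<in> arr K A BV" "\<And>n x. x \<in> simplices ?J n \<Longrightarrow> pre_map K A BV B j n (bv n (\<phi> n x)) = degen (Fun K A B) n f"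
    by (auto simp del: simplices_iso_nerve)
  have "cmp0 K A A T a (Unit K A) = cmp0 K A B T b f"
    by (rule terminal_unique[OF T A, where n = 0]) (use A B TO a b f in auto)
  then obtain h where h: "h \<in> arr K A P" "cmp0 K A P A pA h = Unit K A" "cmp0 K A P B pB h = f"
    using is_pullback_arr_ex[OF P A Unit_closed[OF A] f] by blast
  have qh: "cmp0 K A P B (q n x) h = f" for n x
    using h A B f tP by (simp add: q_def Cmp_assoc)
  have "cmp0 K A P BU g h = cmp0 K A BV BU c j"
  proof (rule cotensor_arr_eqI[OF BU A])
    fix n y assume "y \<in> simplices U n"
    then obtain x where x: "x \<in> simplices ?D n" "y = \<phi> n x" using U\<phi> by blast
    have xJ: "x \<in> simplices ?J n" using x DJ by blast
    have "pre_map K A BU B (cmp0 K A P BU g h) n (bu n y) = degen (Fun K A B) n f"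
      using A B O tP g(1) h(1) buc[OF x(1)] g(2)[OF x(1)] q x(2) qh by (simp add: pre_degen)
    moreover have "pre_map K A BU B (cmp0 K A BV BU c j) n (bu n y) = degen (Fun K A B) n f"
      using A B O ca j(1) buc[OF x(1)] cu[OF x(1)] j(2)[OF xJ] x(2) by simp
    ultimately show "pre_map K A BU B (cmp0 K A P BU g h) n (bu n y) = pre_map K A BU B (cmp0 K A BV BU c j) n (bu n y)" by simp
  qed (use A O tP g h ca j in auto)
  then obtain d where d: "d \<in> arr K A N" "cmp0 K A N P nP d = h" "cmp0 K A N BV nV d = j"
    using is_pullback_arr_ex[OF N A h(1) j(1)] by blast
  have rd: "cmp0 K A N B r d = f" using d h A B tN tP by (simp add: r_def Cmp_assoc)
  define t where "t = cmp0 K N P A pA nP"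
  have ta: "t \<in> arr K N A" unfolding t_def using tN tP by simp
  have td: "cmp0 K A N A t d = Unit K A" using d h A tN tP by (simp add: t_def Cmp_assoc)
  \<comment> \<open>The path that belongs to the generic point of \<open>N\<close>; it runs from
    \<open>f t\<close> to \<open>r\<close>.\<close>
  define \<beta> where "\<beta> = (\<lambda>n. \<lambda>\<sigma>\<in>simplices ?J n. pre_map K N BV B nV n (bv n (\<phi> n \<sigma>)))"
  have \<beta>: "\<beta> \<in> smap ?J (Fun K N B)" unfolding \<beta>_def
  proof (rule smap_restrictI[OF J])
    show "pre_map K N BV B nV n (bv n (\<phi> n \<sigma>)) \<in> simplices (Fun K N B) n" if "\<sigma> \<in> simplices ?J n" for n \<sigma>
      using bvc[OF that] tN O B by simp
    fix m n \<alpha> \<sigma> assume al: "\<alpha> \<in> Delta m n" and \<sigma>: "\<sigma> \<in> simplices ?J n"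
    have "act V m n \<alpha> (\<phi> n \<sigma>) = \<phi> m (act ?J m n \<alpha> \<sigma>)" unfolding V_def by (rule act_transport[where \<phi> = \<phi>, OF \<phi> \<sigma>])
    then have "bv m (\<phi> m (act ?J m n \<alpha> \<sigma>)) = act (Fun K BV B) m n \<alpha> (bv n (\<phi> n \<sigma>))"
      using smap_act[OF cotensorD(3)[OF BV] al V\<phi>[OF \<sigma>]] by simp
    then show "pre_map K N BV B nV m (bv m (\<phi> m (act ?J m n \<alpha> \<sigma>))) = act (Fun K N B) m n \<alpha> (pre_map K N BV B nV n (bv n (\<phi> n \<sigma>)))"
      using bvc[OF \<sigma>] tN O B al by (simp del: act_iso_nerve)
  qed
  have qN: "cmp0 K N P B (q n x) nP = (if x = (\<lambda>i\<in>{..n}. 0) then cmp0 K N A B f t else r)" for n x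
    using tN tP A B f by (simp add: q_def t_def r_def Cmp_assoc)
  have \<beta>_end: "\<beta> n x = degen (Fun K N B) n (if x = (\<lambda>i\<in>{..n}. 0) then cmp0 K N A B f t else r)" if x: "x \<in> simplices ?D n" for n x
  proof -
    have xJ: "x \<in> simplices ?J n" using x DJ by blast
    have "\<beta> n x = pre_map K N BV B nV n (pre_map K BV BU B c n (bu n (\<phi> n x)))"
      using xJ cu[OF x] by (simp add: \<beta>_def del: simplices_iso_nerve)
    also have "\<dots> = pre_map K N BU B (cmp0 K N P BU g nP) n (bu n (\<phi> n x))"
      using tN(9) tN O B ca buc[OF x] by simp
    also have "\<dots> = degen (Fun K N B) n (cmp0 K N P B (q n x) nP)"
      using tN(1-8) tP O B buc[OF x] g(2)[OF x] q[of n x] by (simp add: pre_degen)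
    finally show ?thesis using qN by simp
  qed
  have "(\<lambda>n. \<lambda>s\<in>simplices ?J n. degen (Fun K N A) n t) \<in> smap ?J (Fun K N A)"
    by (rule constant_homotopy[OF tN(1) A ta J])
  note const_t = this
  obtain w where w: "w \<in> smap ?J (Fun K N P)"
    "\<And>n \<sigma>. \<sigma> \<in> simplices ?J n \<Longrightarrow> post_map K N P A pA n (w n \<sigma>) = (\<lambda>s\<in>simplices ?J n. degen (Fun K N A) n t) \<sigma>"
    "\<And>n \<sigma>. \<sigma> \<in> simplices ?J n \<Longrightarrow> post_map K N P B pB n (w n \<sigma>) = \<beta> n \<sigma>"
  proof (rule is_pullback_smap_ex[OF P tN(1) J const_t \<beta>])
    fix n \<sigma> assume \<sigma>: "\<sigma> \<in> simplices ?J n"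
    show "post_map K N A T a n ((\<lambda>s\<in>simplices ?J n. degen (Fun K N A) n t) \<sigma>) = post_map K N B T b n (\<beta> n \<sigma>)"
      by (rule terminal_unique[OF T tN(1), where n = n])
        (use \<sigma> ta tN A B a b TO smap_closed[OF \<beta> \<sigma>] in \<open>auto simp del: simplices_iso_nerve\<close>)
  qed blast
  \<comment> \<open>At time \<sigma> the path is the initial part of \<beta> cut off at \<sigma>:
    constant for 0 and all of \<beta> for 1. Meanwhile, by the choice of \<open>w\<close>, the point
    of \<open>A\<close> stays at \<open>t\<close> and the end in \<open>B\<close> follows
    \<beta>.\<close>
  have "(\<lambda>n. \<lambda>z\<in>simplices (sprod ?J ?J) n. \<beta> n (vertexwise (\<lambda>a b. min a b) n (fst z) (snd z))) \<in> smap (sprod ?J ?J) (Fun K N B)"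
    by (rule smap_vertexwise[OF \<beta>]) auto
  from cotensor_curry_transport[OF J \<phi> BV[unfolded V_def] tN(1) J this]
  obtain y where y: "y \<in> smap ?J (Fun K N BV)"
    "\<And>n \<sigma> x. \<lbrakk>\<sigma> \<in> simplices ?J n; x \<in> simplices ?J n\<rbrakk> \<Longrightarrow> Cmp K N BV B n (bv n (\<phi> n x)) (y n \<sigma>) = \<beta> n (vertexwise (\<lambda>a b. min a b) n \<sigma> x)"
    by (auto simp del: simplices_iso_nerve)
  note wc = smap_closed[OF w(1)] and yc = smap_closed[OF y(1)]
  have min0: "vertexwise (\<lambda>a b. min a b) n \<sigma> (\<lambda>i\<in>{..n}. 0) = (\<lambda>i\<in>{..n}. 0)" for n \<sigma> by (auto simp: vertexwise_def)
  have min1: "vertexwise (\<lambda>a b. min a b) n \<sigma> (\<lambda>i\<in>{..n}. 1) = \<sigma>" if "\<sigma> \<in> simplices ?J n" for n \<sigma>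
    by (rule vertexwise_unit(1)) (use that in auto)
  have min0': "vertexwise (\<lambda>a b. min a b) n (\<lambda>i\<in>{..n}. 0) \<sigma> = (\<lambda>i\<in>{..n}. 0)" for n \<sigma> by (auto simp: vertexwise_def)
  have min1': "vertexwise (\<lambda>a b. min a b) n (\<lambda>i\<in>{..n}. 1) \<sigma> = \<sigma>" if "\<sigma> \<in> simplices ?J n" for n \<sigma>
    by (rule vertexwise_unit(2)) (use that in auto)
  have compat: "post_map K N P BU g n (w n \<sigma>) = post_map K N BV BU c n (y n \<sigma>)" if \<sigma>: "\<sigma> \<in> simplices ?J n" for n \<sigma>
  proof -
    let ?f = "\<lambda>n. \<lambda>\<sigma>\<in>simplices ?J n. post_map K N P BU g n (w n \<sigma>)" and ?g = "\<lambda>n. \<lambda>\<sigma>\<in>simplices ?J n. post_map K N BV BU c n (y n \<sigma>)"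
    have "?f n \<sigma> = ?g n \<sigma>"
    proof (rule cotensor_smap_eqI[where w = ?f and w' = ?g, OF BU tN(1) J])
      show "?f \<in> smap ?J (Fun K N BU)" by (rule smap_comp[OF J w(1)]) (use tN tP O g in auto)
      show "?g \<in> smap ?J (Fun K N BU)" by (rule smap_comp[OF J y(1)]) (use tN O ca in auto)
      fix n \<sigma> v assume \<sigma>: "\<sigma> \<in> simplices ?J n" and "v \<in> simplices U n"
      then obtain x where x: "x \<in> simplices ?D n" "v = \<phi> n x" using U\<phi> by blast
      have xJ: "x \<in> simplices ?J n" using x DJ by blast
      have "Cmp K N BU B n (bu n v) (post_map K N P BU g n (w n \<sigma>)) = post_map K N P B (q n x) n (w n \<sigma>)"
        using Cmp_post[OF tN(1) tP(1) O(2) B g(1) wc[OF \<sigma>] buc[OF x(1)]] g(2)[OF x(1)] x(2)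
          post_map_eq[OF wc[OF \<sigma>], of B "q n x"] by (simp del: post_comp)
      also have "\<dots> = (if x = (\<lambda>i\<in>{..n}. 0) then degen (Fun K N B) n (cmp0 K N A B f t) else \<beta> n \<sigma>)"
        using w(2,3)[OF \<sigma>] tN tP A B f wc[OF \<sigma>] ta \<sigma> by (simp add: q_def post_degen del: simplices_iso_nerve)
      also have "\<dots> = \<beta> n (vertexwise (\<lambda>a b. min a b) n \<sigma> x)"
        using x(1) min0[of n \<sigma>] min1[OF \<sigma>] \<beta>_end[of "\<lambda>i\<in>{..n}. 0" n] const_0_neq_1[of n] by auto
      also have "\<dots> = Cmp K N BU B n (bu n v) (post_map K N BV BU c n (y n \<sigma>))"
        using weight_map_Cmp[OF BV BU c i tN(1) yc[OF \<sigma>] i\<phi>(2)[OF x(1)]] y(2)[OF \<sigma> xJ] i\<phi>(1)[OF x(1)] x(2) by simp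
      finally show "Cmp K N BU B n (bu n v) (?f n \<sigma>) = Cmp K N BU B n (bu n v) (?g n \<sigma>)"
        using \<sigma> by (simp del: simplices_iso_nerve)
    qed (rule \<sigma>)
    then show ?thesis using \<sigma> by (simp del: simplices_iso_nerve)
  qed
  obtain H where H: "H \<in> smap ?J (Fun K N N)" "\<And>n \<sigma>. \<sigma> \<in> simplices ?J n \<Longrightarrow> post_map K N N P nP n (H n \<sigma>) = w n \<sigma>"
    "\<And>n \<sigma>. \<sigma> \<in> simplices ?J n \<Longrightarrow> post_map K N N BV nV n (H n \<sigma>) = y n \<sigma>"
    using is_pullback_smap_ex[OF N tN(1) J w(1) y(1) compat] by blast
  have J0: "(\<lambda>i\<in>{..0}. e) \<in> simplices ?J 0" if "e \<in> {0, 1}" for e using that by auto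
  have D0: "(\<lambda>i\<in>{..0}. e) \<in> simplices ?D 0" if "e \<in> {0, 1}" for e using that by auto
  have Ha: "H 0 (\<lambda>i\<in>{..0}. e) \<in> arr K N N" if "e \<in> {0, 1}" for e by (rule smap_closed[OF H(1) J0[OF that]])
  \<comment> \<open>The two ends of \<open>H\<close> are recognized by their three coordinates: the
    point of \<open>A\<close>, the point of \<open>B\<close> and the path.\<close>
  have H_eqI: "H 0 (\<lambda>i\<in>{..0}. e) = z"
    if e01: "e \<in> {0, 1}" and z: "z \<in> arr K N N" and zA: "cmp0 K N P A pA (cmp0 K N N P nP z) = t"
      and zB: "cmp0 K N P B pB (cmp0 K N N P nP z) = \<beta> 0 (\<lambda>i\<in>{..0}. e)"
      and zV: "\<And>n x. x \<in> simplices ?J n \<Longrightarrow> pre_map K N BV B (cmp0 K N N BV nV z) n (bv n (\<phi> n x))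
        = \<beta> n (vertexwise (\<lambda>a b. min a b) n (\<lambda>i\<in>{..n}. e) x)" for e z
  proof (rule is_pullback_arr_eqI[OF N tN(1)])
    show "H 0 (\<lambda>i\<in>{..0}. e) \<in> arr K N N" "z \<in> arr K N N" by (rule Ha[OF e01], rule z)
    have nPz: "cmp0 K N N P nP z \<in> arr K N P" using z tN by simp
    have wa: "w 0 (\<lambda>i\<in>{..0}. e) \<in> arr K N P" by (rule wc[OF J0[OF e01]])
    have "w 0 (\<lambda>i\<in>{..0}. e) = cmp0 K N N P nP z"
    proof (rule is_pullback_arr_eqI[OF P tN(1) wa nPz])
      show "cmp0 K N P A pA (w 0 (\<lambda>i\<in>{..0}. e)) = cmp0 K N P A pA (cmp0 K N N P nP z)"
        using w(2)[OF J0[OF e01]] zA tN tP wa J0[OF e01] ta A by (simp add: post_map_0 del: simplices_iso_nerve atMost_0)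
      show "cmp0 K N P B pB (w 0 (\<lambda>i\<in>{..0}. e)) = cmp0 K N P B pB (cmp0 K N N P nP z)"
        using w(3)[OF J0[OF e01]] zB tN tP wa by (simp add: post_map_0)
    qed
    then show "cmp0 K N N P nP (H 0 (\<lambda>i\<in>{..0}. e)) = cmp0 K N N P nP z"
      using H(2)[OF J0[OF e01]] tN Ha[OF e01] by (simp add: post_map_0)
    have nVz: "cmp0 K N N BV nV z \<in> arr K N BV" using z tN by simp
    have ya: "y 0 (\<lambda>i\<in>{..0}. e) \<in> arr K N BV" by (rule yc[OF J0[OF e01]])
    have "y 0 (\<lambda>i\<in>{..0}. e) = cmp0 K N N BV nV z"
    proof (rule cotensor_arr_eqI[OF BV tN(1) ya nVz])
      fix n v assume "v \<in> simplices V n"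
      then obtain x where x: "x \<in> simplices ?J n" "v = \<phi> n x" using V\<phi>' by blast
      have "pre_map K N BV B (y 0 (\<lambda>i\<in>{..0}. e)) n (bv n (\<phi> n x)) = Cmp K N BV B n (bv n (\<phi> n x)) (y n (\<lambda>i\<in>{..n}. e))"
        using bvc[OF x(1)] smap_const[OF y(1) e01, of n] by (simp add: pre_map_eq)
      then show "pre_map K N BV B (y 0 (\<lambda>i\<in>{..0}. e)) n (bv n v) = pre_map K N BV B (cmp0 K N N BV nV z) n (bv n v)"
        using y(2)[OF iso_nerve_const[OF e01] x(1)] zV[OF x(1)] x(2) by simp
    qed
    then show "cmp0 K N N BV nV (H 0 (\<lambda>i\<in>{..0}. e)) = cmp0 K N N BV nV z"
      using H(3)[OF J0[OF e01]] tN Ha[OF e01] by (simp add: post_map_0)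
  qed
  have dt: "cmp0 K N A N d t \<in> arr K N N" using tN A d ta by simp
  have H1: "H 0 (\<lambda>i\<in>{..0}. 1) = Unit K N"
  proof (rule H_eqI)
    show "cmp0 K N P B pB (cmp0 K N N P nP (Unit K N)) = \<beta> 0 (\<lambda>i\<in>{..0}. 1)"
      using \<beta>_end[OF D0[of 1]] const_0_neq_1[of 0] tN ra B by (simp add: r_def del: atMost_0)
    show "pre_map K N BV B (cmp0 K N N BV nV (Unit K N)) n (bv n (\<phi> n x)) = \<beta> n (vertexwise (\<lambda>a b. min a b) n (\<lambda>i\<in>{..n}. 1) x)"
      if "x \<in> simplices ?J n" for n x
      using min1'[OF that] that tN by (simp add: \<beta>_def del: simplices_iso_nerve)
  qed (use tN in \<open>auto simp: t_def\<close>)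
  have H0: "H 0 (\<lambda>i\<in>{..0}. 0) = cmp0 K N A N d t"
  proof (rule H_eqI)
    have nPd: "cmp0 K N N P nP (cmp0 K N A N d t) = cmp0 K N A P h t"
      using cmp_cmp[OF d(2), of N t] tN A d ta by simp
    show "cmp0 K N P A pA (cmp0 K N N P nP (cmp0 K N A N d t)) = t"
      unfolding nPd using cmp_cmp[OF h(2), of N t] tN tP A h ta by simp
    show "cmp0 K N P B pB (cmp0 K N N P nP (cmp0 K N A N d t)) = \<beta> 0 (\<lambda>i\<in>{..0}. 0)"
      unfolding nPd using cmp_cmp[OF h(3), of N t] \<beta>_end[OF D0[of 0]] tN tP A B f h ta by (simp del: atMost_0)
    show "pre_map K N BV B (cmp0 K N N BV nV (cmp0 K N A N d t)) n (bv n (\<phi> n x)) = \<beta> n (vertexwise (\<lambda>a b. min a b) n (\<lambda>i\<in>{..n}. 0) x)"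
      if x: "x \<in> simplices ?J n" for n x
    proof -
      have "cmp0 K N N BV nV (cmp0 K N A N d t) = cmp0 K N A BV j t"
        using cmp_cmp[OF d(3), of N t] tN A d ta by simp
      then have "pre_map K N BV B (cmp0 K N N BV nV (cmp0 K N A N d t)) n (bv n (\<phi> n x)) = degen (Fun K N B) n (cmp0 K N A B f t)"
        using j(2)[OF x] bvc[OF x] tN A B f j(1) ta O by (simp add: pre_degen)
      then show ?thesis using min0'[of n x] \<beta>_end[of "\<lambda>i\<in>{..n}. 0" n] by simp
    qed
  qed (use dt in auto)
  have "homotopic K N N (cmp0 K N A N d t) (Unit K N)"
    by (rule homotopicI[OF H(1) H0 H1])
  moreover have "homotopic K A A (cmp0 K A N A t d) (Unit K A)"
    unfolding td by (rule homotopic_refl) (use A in auto)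
  ultimately have "equivalence K A N d"
    by (intro equivalence_two_sided[OF A tN(1) d(1) ta ta])
  then show ?thesis by (rule that[OF _ r rd])
qed

text \<open>
  A homotopy from the identity to \<open>s f\<close> can be made constant over \<open>B\<close> by moving it along the path
  \<open>f \<theta>\<close> back to its start.
\<close>

lemma trivial_fibration_section:
  assumes f: "trivial_fibration K A B f"
  obtains s \<theta> where "s \<in> arr K B A" "cmp0 K B A B f s = Unit K B" "\<theta> \<in> smap iso_nerve (Fun K A A)"
    "\<theta> 0 (\<lambda>i\<in>{..0}. 0) = Unit K A" "\<theta> 0 (\<lambda>i\<in>{..0}. 1) = cmp0 K A B A s f"
    "\<And>n \<sigma>. \<sigma> \<in> simplices iso_nerve n \<Longrightarrow> post_map K A A B f n (\<theta> n \<sigma>) = degen (Fun K A B) n f"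
proof -
  have eq: "equivalence K A B f" and fi: "f \<in> Isofib K A B" using f by (auto simp: trivial_fibration_def)
  note t = IsofibD[OF fi] and J = simplicial_set_iso_nerve
  obtain s0 where s0: "s0 \<in> arr K B A" "homotopic K A A (Unit K A) (cmp0 K A B A s0 f)" "homotopic K B B (cmp0 K B A B f s0) (Unit K B)"
    using equivalence_homotopy_inverse[OF eq] .
  obtain H where H: "H \<in> smap iso_nerve (Fun K B B)" "H 0 (\<lambda>i\<in>{..0}. 0) = cmp0 K B A B f s0" "H 0 (\<lambda>i\<in>{..0}. 1) = Unit K B"
    using s0(3) by (auto simp: homotopic_def)
  \<comment> \<open>The homotopy from \<open>f s0\<close> to the identity is lifted starting at
    \<open>s0\<close>; the other end of the lift is a strict section.\<close>
  obtain H' where H': "H' \<in> smap iso_nerve (Fun K B A)" "H' 0 (\<lambda>i\<in>{..0}. 0) = s0"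
    "\<And>n \<sigma>. \<sigma> \<in> simplices iso_nerve n \<Longrightarrow> post_map K B A B f n (H' n \<sigma>) = H n \<sigma>"
    using lift_path[OF fi t(2) s0(1) H(1,2)] by blast
  define s where "s = H' 0 (\<lambda>i\<in>{..0}. 1)"
  have J1: "(\<lambda>i\<in>{..0}. 1) \<in> simplices iso_nerve 0" by auto
  have s: "s \<in> arr K B A" unfolding s_def by (rule smap_closed[OF H'(1) J1])
  have fs: "cmp0 K B A B f s = Unit K B"
    using H'(3)[OF J1] H(3) t s post_map_0[OF t(2,1,2,3) s] by (simp add: s_def)
  have "homotopic K B A s0 s" by (rule homotopicI[OF H'(1,2) s_def[symmetric]])
  then have "homotopic K A A (cmp0 K A B A s0 f) (cmp0 K A B A s f)"
    by (rule homotopic_pre) (use t in auto)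
  then have "homotopic K A A (Unit K A) (cmp0 K A B A s f)"
    using homotopic_trans[OF s0(2)] t by blast
  then obtain \<theta> where \<theta>: "\<theta> \<in> smap iso_nerve (Fun K A A)" "\<theta> 0 (\<lambda>i\<in>{..0}. 0) = Unit K A" "\<theta> 0 (\<lambda>i\<in>{..0}. 1) = cmp0 K A B A s f"
    by (auto simp: homotopic_def)
  have fsf: "cmp0 K A A B f (cmp0 K A B A s f) = f"
    using cmp_cmp[OF fs, of A f] t s by simp
  \<comment> \<open>At time 0 this is the whole image path, at time 1 it is constant at
    \<open>f\<close>. The start stays fixed while the end runs backwards along the image
    path.\<close>
  let ?\<phi> = "\<lambda>a b. min a (1 - b) :: nat"
  define F where "F = (\<lambda>n. \<lambda>\<sigma>\<in>simplices iso_nerve n. post_map K A A B f n (\<theta> n \<sigma>))"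
  have F: "F \<in> smap iso_nerve (Fun K A B)" unfolding F_def by (rule smap_comp[OF J \<theta>(1)]) (use t in auto)
  let ?B = "\<lambda>n. \<lambda>z\<in>simplices (sprod iso_nerve iso_nerve) n. F n (vertexwise ?\<phi> n (fst z) (snd z))"
  have B: "?B \<in> smap (sprod iso_nerve iso_nerve) (Fun K A B)"
    by (rule smap_vertexwise[OF F]) auto
  let ?h0 = "\<lambda>n. \<lambda>\<tau>\<in>simplices iso_nerve n. degen (Fun K A A) n (Unit K A)"
  have h0: "?h0 \<in> smap iso_nerve (Fun K A A)" by (rule constant_homotopy) (use t J in auto)
  \<comment> \<open>The end must move over the reversed image path; \<open>s\<close> applied to that
    path does so because \<open>f s\<close> is the identity. As \<open>f s f = f\<close>, this is a
    loop at \<open>s f\<close>, so the end of the moved path is again \<open>s f\<close>.\<close>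
  define G where "G = (\<lambda>n. \<lambda>\<sigma>\<in>simplices iso_nerve n. post_map K A B A s n (F n \<sigma>))"
  have G: "G \<in> smap iso_nerve (Fun K A A)" unfolding G_def by (rule smap_comp[OF J F]) (use t s in auto)
  let ?h1 = "\<lambda>n. \<lambda>\<tau>\<in>simplices iso_nerve n. G n (vertexwise (\<lambda>a b. 1 - a) n \<tau> \<tau>)"
  have h1: "?h1 \<in> smap iso_nerve (Fun K A A)" by (rule smap_swap[OF G])
  have F0: "F n (\<lambda>i\<in>{..n}. 0) = degen (Fun K A B) n f" for n
    using smap_const[OF \<theta>(1), of 0 n] \<theta>(2) t by (auto simp: F_def post_degen simp del: atMost_0)
  have Fc: "F n \<sigma> \<in> simplices (Fun K A B) n" if "\<sigma> \<in> simplices iso_nerve n" for n \<sigma> by (rule smap_closed[OF F that])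
  have fG: "post_map K A A B f n (G n \<sigma>) = F n \<sigma>" if "\<sigma> \<in> simplices iso_nerve n" for n \<sigma>
    using post_cmp[OF fs, of A "F n \<sigma>" n] Fc[OF that] t s that by (simp add: G_def del: simplices_iso_nerve)
  have G_end: "G 0 (\<lambda>i\<in>{..0}. e) = cmp0 K A B A s f" if e: "e \<in> {0, 1}" for e
  proof -
    have Je: "(\<lambda>i\<in>{..0}. e) \<in> simplices iso_nerve 0" using e by auto
    have "F 0 (\<lambda>i\<in>{..0}. e) = f"
      using \<theta>(2,3) e Je fsf t s by (auto simp: F_def post_map_0 simp del: atMost_0 simplices_iso_nerve)
    then show ?thesis using Je t s by (simp add: G_def post_map_0 del: atMost_0 simplices_iso_nerve)
  qed
  have sw: "vertexwise (\<lambda>a b. 1 - a) n \<tau> \<tau> \<in> simplices iso_nerve n" if "\<tau> \<in> simplices iso_nerve n" for n \<tau>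
    unfolding simplices_iso_nerve by (rule vertexwise_closed) (use that in auto)
  obtain \<theta>' where \<theta>': "\<theta>' \<in> smap iso_nerve (Fun K A A)"
    "\<And>n \<sigma>. \<sigma> \<in> simplices iso_nerve n \<Longrightarrow> post_map K A A B f n (\<theta>' n \<sigma>) = ?B n (\<sigma>, \<lambda>i\<in>{..n}. 1)"
    "\<theta>' 0 (\<lambda>i\<in>{..0}. 0) = ?h0 0 (\<lambda>i\<in>{..0}. 1)" "\<theta>' 0 (\<lambda>i\<in>{..0}. 1) = ?h1 0 (\<lambda>i\<in>{..0}. 1)"
  proof (rule move_path[OF fi t(1) \<theta>(1) B h0 h1])
    fix n \<tau> assume \<tau>: "\<tau> \<in> simplices iso_nerve n"
    have "vertexwise ?\<phi> n (\<lambda>i\<in>{..n}. 0) \<tau> = (\<lambda>i\<in>{..n}. 0)" by (auto simp: vertexwise_def)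
    then show "post_map K A A B f n (?h0 n \<tau>) = ?B n (\<lambda>i\<in>{..n}. 0, \<tau>)"
      using \<tau> F0[of n] t iso_nerve_const[of 0 n] by (simp add: post_degen del: simplices_iso_nerve)
    have "vertexwise ?\<phi> n (\<lambda>i\<in>{..n}. 1) \<tau> = vertexwise (\<lambda>a b. 1 - a) n \<tau> \<tau>" by (auto simp: vertexwise_def)
    then show "post_map K A A B f n (?h1 n \<tau>) = ?B n (\<lambda>i\<in>{..n}. 1, \<tau>)"
      using \<tau> fG[OF sw[OF \<tau>]] iso_nerve_const[of 1 n] by (simp del: simplices_iso_nerve)
    have "vertexwise ?\<phi> n \<tau> (\<lambda>i\<in>{..n}. 0) = \<tau>"
      by (rule vertexwise_unit(1)) (use \<tau> in auto)
    then show "?B n (\<tau>, \<lambda>i\<in>{..n}. 0) = post_map K A A B f n (\<theta> n \<tau>)"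
      using \<tau> iso_nerve_const[of 0 n] by (simp add: F_def del: simplices_iso_nerve)
  next
    show "?h0 0 (\<lambda>i\<in>{..0}. 0) = \<theta> 0 (\<lambda>i\<in>{..0}. 0)" using \<theta>(2) t by (auto simp del: atMost_0)
    show "?h1 0 (\<lambda>i\<in>{..0}. 0) = \<theta> 0 (\<lambda>i\<in>{..0}. 1)" using \<theta>(3) G_end[of 1] by (auto simp del: atMost_0)
  qed blast
  have e0: "\<theta>' 0 (\<lambda>i\<in>{..0}. 0) = Unit K A" using \<theta>'(3) t by (auto simp del: atMost_0)
  have e1: "\<theta>' 0 (\<lambda>i\<in>{..0}. 1) = cmp0 K A B A s f" using \<theta>'(4) G_end[of 0] by (auto simp del: atMost_0)
  have f\<theta>': "post_map K A A B f n (\<theta>' n \<sigma>) = degen (Fun K A B) n f" if \<sigma>: "\<sigma> \<in> simplices iso_nerve n" for n \<sigma>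
  proof -
    have "vertexwise ?\<phi> n \<sigma> (\<lambda>i\<in>{..n}. 1) = (\<lambda>i\<in>{..n}. 0)" by (auto simp: vertexwise_def)
    then show ?thesis using \<theta>'(2)[OF \<sigma>] \<sigma> F0[of n] iso_nerve_const[of 1 n] by (simp del: simplices_iso_nerve)
  qed
  show ?thesis by (rule that[OF s fs \<theta>'(1) e0 e1 f\<theta>'])
qed

text \<open>The section and the deformation pull back: on \<open>P\<close> the homotopy is \<theta>
  after \<open>l\<close> in \<open>A\<close> and constant at \<open>r\<close> in \<open>F\<close>.
  The two parts are compatible because \<theta> is constant over \<open>B\<close>, which an
  arbitrary homotopy from the identity to \<open>s f\<close> need not be.\<close>

lemma trivial_fibration_pullback:
  assumes P: "is_pullback K P A F B l r f q" and f: "trivial_fibration K A B f"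
  shows "trivial_fibration K P F r"
proof -
  note t = is_pullbackD[OF P]
  obtain s \<theta> where s: "s \<in> arr K B A" "cmp0 K B A B f s = Unit K B" and \<theta>: "\<theta> \<in> smap iso_nerve (Fun K A A)"
    "\<theta> 0 (\<lambda>i\<in>{..0}. 0) = Unit K A" "\<theta> 0 (\<lambda>i\<in>{..0}. 1) = cmp0 K A B A s f"
    "\<And>n \<sigma>. \<sigma> \<in> simplices iso_nerve n \<Longrightarrow> post_map K A A B f n (\<theta> n \<sigma>) = degen (Fun K A B) n f"
    using trivial_fibration_section[OF f] by blast
  note J = simplicial_set_iso_nerve
  have ri: "r \<in> Isofib K P F" by (rule is_pullback_Isofib'[OF P]) (use f in \<open>simp add: trivial_fibration_def\<close>)
  have "cmp0 K F A B f (cmp0 K F B A s q) = cmp0 K F F B q (Unit K F)"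
    using cmp_cmp[OF s(2), of F q] t s by (simp add: Cmp_assoc)
  then obtain x where x: "x \<in> arr K F P" "cmp0 K F P A l x = cmp0 K F B A s q" "cmp0 K F P F r x = Unit K F"
    using is_pullback_arr_ex[OF P t(3)] t s by (metis Cmp_closed Unit_closed)
  have pre: "(\<lambda>n. \<lambda>\<sigma>\<in>simplices iso_nerve n. pre_map K P A A l n (\<theta> n \<sigma>)) \<in> smap iso_nerve (Fun K P A)"
    by (rule smap_comp[OF J \<theta>(1)]) (use t in auto)
  have const: "(\<lambda>n. \<lambda>\<sigma>\<in>simplices iso_nerve n. degen (Fun K P F) n r) \<in> smap iso_nerve (Fun K P F)"
    by (rule constant_homotopy[OF t(1,3,6) J])
  obtain H where H: "H \<in> smap iso_nerve (Fun K P P)"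
    "\<And>n \<sigma>. \<sigma> \<in> simplices iso_nerve n \<Longrightarrow> post_map K P P A l n (H n \<sigma>) = (\<lambda>\<sigma>\<in>simplices iso_nerve n. pre_map K P A A l n (\<theta> n \<sigma>)) \<sigma>"
    "\<And>n \<sigma>. \<sigma> \<in> simplices iso_nerve n \<Longrightarrow> post_map K P P F r n (H n \<sigma>) = (\<lambda>\<sigma>\<in>simplices iso_nerve n. degen (Fun K P F) n r) \<sigma>"
  proof (rule is_pullback_smap_ex[OF P t(1) J pre const])
    fix n \<sigma> assume \<sigma>: "\<sigma> \<in> simplices iso_nerve n"
    then show "post_map K P A B f n ((\<lambda>\<sigma>\<in>simplices iso_nerve n. pre_map K P A A l n (\<theta> n \<sigma>)) \<sigma>)
        = post_map K P F B q n ((\<lambda>\<sigma>\<in>simplices iso_nerve n. degen (Fun K P F) n r) \<sigma>)"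
      using \<theta>(4)[OF \<sigma>] smap_closed[OF \<theta>(1) \<sigma>] t by (simp add: post_pre pre_degen post_degen del: simplices_iso_nerve)
  qed blast
  have J0: "(\<lambda>i\<in>{..0}. e) \<in> simplices iso_nerve 0" if "e \<in> {0, 1}" for e using that by auto
  have Ha: "H 0 (\<lambda>i\<in>{..0}. e) \<in> arr K P P" if "e \<in> {0, 1}" for e by (rule smap_closed[OF H(1) J0[OF that]])
  have He: "cmp0 K P P A l (H 0 (\<lambda>i\<in>{..0}. e)) = cmp0 K P A A (\<theta> 0 (\<lambda>i\<in>{..0}. e)) l"
    "cmp0 K P P F r (H 0 (\<lambda>i\<in>{..0}. e)) = r" if e: "e \<in> {0, 1}" for e
    using H(2)[OF J0[OF e]] H(3)[OF J0[OF e]] J0[OF e] t Ha[OF e] smap_closed[OF \<theta>(1) J0[OF e]]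
    by (simp_all add: post_map_0 pre_map_0 del: simplices_iso_nerve atMost_0)
  have "H 0 (\<lambda>i\<in>{..0}. 0) = Unit K P"
    by (rule is_pullback_arr_eqI[OF P t(1)]) (use He[of 0] Ha[of 0] t \<theta>(2) in \<open>auto simp del: atMost_0\<close>)
  moreover have "H 0 (\<lambda>i\<in>{..0}. 1) = cmp0 K P F P x r"
  proof (rule is_pullback_arr_eqI[OF P t(1)])
    show "cmp0 K P P A l (H 0 (\<lambda>i\<in>{..0}. 1)) = cmp0 K P P A l (cmp0 K P F P x r)"
      using He(1)[of 1] \<theta>(3) cmp_cmp[OF x(2), of P r] t s x by (simp add: Cmp_assoc del: atMost_0)
    show "cmp0 K P P F r (H 0 (\<lambda>i\<in>{..0}. 1)) = cmp0 K P P F r (cmp0 K P F P x r)"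
      using He(2)[of 1] cmp_cmp[OF x(3), of P r] t x by (simp del: atMost_0)
  qed (use Ha[of 1] t x in auto)
  ultimately have "homotopic K P P (Unit K P) (cmp0 K P F P x r)"
    by (rule homotopicI[OF H(1)])
  then have 1: "homotopic K P P (cmp0 K P F P x r) (Unit K P)" by (rule homotopic_sym)
  have 2: "homotopic K F F (cmp0 K F P F r x) (Unit K F)" unfolding x(3) by (rule homotopic_refl) (use t in auto)
  have "equivalence K P F r" by (rule equivalence_two_sided[OF t(1,3,6) x(1,1) 1 2])
  then show ?thesis using ri by (simp add: trivial_fibration_def)
qed

text \<open>Two out of three for \<open>g = r k\<close>, where \<open>r\<close> is a trivial
  fibration as a pullback of \<open>f\<close>.\<close>

lemma gap_equivalence_iff:
  assumes P: "is_pullback K P A F B l r f q" and f: "trivial_fibration K A B f"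
    and k: "k \<in> arr K E P" "cmp0 K E P F r k = g"
  shows "equivalence K E P k \<longleftrightarrow> equivalence K E F g"
proof -
  have r: "equivalence K P F r"
    using trivial_fibration_pullback[OF P f] by (simp add: trivial_fibration_def)
  show ?thesis
    using equivalence_comp[OF _ r, of E k] equivalence_cancel_left[OF k(1) _ r] k(2) by auto
qed

section \<open>Equivalences of squares\<close>

lemma homotopic_arrow_components:
  assumes "homotopic K2 x y m m'"
  shows "homotopic K (dm x) (dm y) (fst m) (fst m')" "homotopic K (cd x) (cd y) (snd m) (snd m')"
proof -
  obtain H where H: "H \<in> smap iso_nerve (Fun K2 x y)" "H 0 (\<lambda>i\<in>{..0}. 0) = m" "H 0 (\<lambda>i\<in>{..0}. 1) = m'"
    using assms by (auto simp: homotopic_def)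
  note c = smap_arrow_components[OF simplicial_set_iso_nerve H(1)]
  show "homotopic K (dm x) (dm y) (fst m) (fst m')"
    by (rule homotopicI[OF c(1)]) (use H in \<open>auto simp del: atMost_0\<close>)
  show "homotopic K (cd x) (cd y) (snd m) (snd m')"
    by (rule homotopicI[OF c(2)]) (use H in \<open>auto simp del: atMost_0\<close>)
qed

lemma equivalence_arrow_components:
  assumes eq: "equivalence K2 x y m"
  shows "equivalence K (dm x) (dm y) (fst m)" "equivalence K (cd x) (cd y) (snd m)"
proof -
  interpret A2: infinity_cosmos K2 \<kappa> by (rule infinity_cosmos_arrow)
  note o = A2.equivalenceD[OF eq]
  note t = Obj_arrowD[OF o(1)] Obj_arrowD[OF o(2)] and tm = arr_arrowD[OF o(3,1,2)]
  obtain s where s: "s \<in> arr K2 y x" "homotopic K2 x x (Unit K2 x) (cmp0 K2 x y x s m)"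
    "homotopic K2 y y (cmp0 K2 y x y m s) (Unit K2 y)"
    using A2.equivalence_homotopy_inverse[OF eq] .
  note ts = arr_arrowD[OF s(1) o(2,1)]
  note h = homotopic_arrow_components[OF arrow.homotopic_sym[OF s(2)], unfolded Cmp_arrow Unit_arrow fst_conv snd_conv]
    and h' = homotopic_arrow_components[OF s(3), unfolded Cmp_arrow Unit_arrow fst_conv snd_conv]
  show "equivalence K (dm x) (dm y) (fst m)"
    by (rule equivalence_two_sided[OF t(1,5) tm(1) ts(1,1) h(1) h'(1)])
  show "equivalence K (cd x) (cd y) (snd m)"
    by (rule equivalence_two_sided[OF t(2,6) tm(2) ts(2,2) h(2) h'(2)])
qed

text \<open>
  In a factorization of \<open>m\<close> as an equivalence followed by an isofibration \<open>r\<close>, the components of \<open>r\<close> and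
  its gap map are trivial fibrations, and their sections combine to a section of \<open>r\<close>.
\<close>

lemma equivalence_arrow_right_inverse:
  assumes x: "x \<in> Obj K2" and y: "y \<in> Obj K2" and m: "m \<in> arr K2 x y"
    and g: "equivalence K (dm x) (dm y) (fst m)" and f: "equivalence K (cd x) (cd y) (snd m)"
  obtains n where "n \<in> arr K2 y x" "homotopic K2 y y (cmp0 K2 y x y m n) (Unit K2 y)"
proof -
  interpret A2: infinity_cosmos K2 \<kappa> by (rule infinity_cosmos_arrow)
  obtain N e r where e: "equivalence K2 x N e" and r: "r \<in> Isofib K2 N y" and re: "cmp0 K2 x N y r e = m"
    using A2.isofib_factorization[OF x y m] .
  note a = Isofib_arrowD[OF r] and eD = A2.equivalenceD[OF e]
  note t = Obj_arrowD[OF a(1)] Obj_arrowD[OF y] and tr = arr_arrowD[OF a(3,1,2)]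
  have re': "cmp0 K (dm x) (dm N) (dm y) (fst r) (fst e) = fst m" "cmp0 K (cd x) (cd N) (cd y) (snd r) (snd e) = snd m"
    using re by (auto simp: Cmp_arrow)
  have r0: "equivalence K (dm N) (dm y) (fst r)"
    by (rule equivalence_cancel_right[OF equivalence_arrow_components(1)[OF e] tr(1)]) (simp add: re' g)
  have r1: "equivalence K (cd N) (cd y) (snd r)"
    by (rule equivalence_cancel_right[OF equivalence_arrow_components(2)[OF e] tr(2)]) (simp add: re' f)
  have r1t: "trivial_fibration K (cd N) (cd y) (snd r)" using r1 a(4) by (simp add: trivial_fibration_def)
  obtain P p q k where P: "is_pullback K P (cd N) (dm y) (cd y) p q (snd r) (ar y)" "k \<in> Isofib K (dm N) P"
    "cmp0 K (dm N) P (cd N) p k = ar N" "cmp0 K (dm N) P (dm y) q k = fst r"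
    using gap_isofibE[OF a(5)] .
  note tP = is_pullbackD[OF P(1)] IsofibD[OF P(2)]
  have kt: "trivial_fibration K (dm N) P k"
    using gap_equivalence_iff[OF P(1) r1t tP(12) P(4)] r0 P(2) by (simp add: trivial_fibration_def)
  obtain s1 where s1: "s1 \<in> arr K (cd y) (cd N)" "cmp0 K (cd y) (cd N) (cd y) (snd r) s1 = Unit K (cd y)"
    using trivial_fibration_section[OF r1t] by metis
  obtain sk where sk: "sk \<in> arr K P (dm N)" "cmp0 K P (dm N) P k sk = Unit K P"
    using trivial_fibration_section[OF kt] by metis
  \<comment> \<open>Separately chosen sections of the components need not commute with
    \<open>ar y\<close> and \<open>ar N\<close>. So \<open>s1\<close> is fixed first; with the
    identity of \<open>dm y\<close> it gives \<open>j\<close> into \<open>P\<close>, and the section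
    \<open>sk\<close> of the gap map turns \<open>j\<close> into a section over
    \<open>s1\<close>.\<close>
  have "cmp0 K (dm y) (cd N) (cd y) (snd r) (cmp0 K (dm y) (cd y) (cd N) s1 (ar y)) = cmp0 K (dm y) (dm y) (cd y) (ar y) (Unit K (dm y))"
    using cmp_cmp[OF s1(2), of "dm y" "ar y"] t tr s1 by simp
  then obtain j where j: "j \<in> arr K (dm y) P" "cmp0 K (dm y) P (cd N) p j = cmp0 K (dm y) (cd y) (cd N) s1 (ar y)"
    "cmp0 K (dm y) P (dm y) q j = Unit K (dm y)"
    using is_pullback_arr_ex[OF P(1) t(5)] t s1 by (metis Cmp_closed Unit_closed)
  define s0 where "s0 = cmp0 K (dm y) P (dm N) sk j"
  have s0: "s0 \<in> arr K (dm y) (dm N)" unfolding s0_def using t tP sk j by simp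
  have ks0: "cmp0 K (dm y) (dm N) P k s0 = j"
    unfolding s0_def using cmp_cmp[OF sk(2), of "dm y" j] t tP sk j by simp
  have "cmp0 K (dm y) (dm N) (cd N) (ar N) s0 = cmp0 K (dm y) P (cd N) p (cmp0 K (dm y) (dm N) P k s0)"
    using cmp_cmp[OF P(3), of "dm y" s0] t tP s0 by simp
  then have s: "(s0, s1) \<in> arr K2 y N"
    using arr_arrow_iff[OF y a(1)] s0 s1(1) ks0 j(2) by simp
  have "cmp0 K (dm y) (dm N) (dm y) (fst r) s0 = Unit K (dm y)"
    using cmp_cmp[OF P(4), of "dm y" s0] t tP s0 ks0 j(3) by simp
  then have rs: "cmp0 K2 y N y r (s0, s1) = Unit K2 y"
    using s1(2) by (simp add: Cmp_arrow Unit_arrow)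
  obtain d where d: "d \<in> arr K2 N x" "homotopic K2 N N (cmp0 K2 N x N e d) (Unit K2 N)"
    using A2.equivalence_homotopy_inverse[OF e] .
  \<comment> \<open>Since \<open>m\<close> is \<open>r e\<close>, the homotopy from
    \<open>e d\<close> to the identity, placed between \<open>r\<close> and its section, runs from
    \<open>m\<close> after \<open>d (s0, s1)\<close> to the identity.\<close>
  have "homotopic K2 y y (cmp0 K2 y N y r (cmp0 K2 y N N (cmp0 K2 N x N e d) (s0, s1))) (cmp0 K2 y N y r (cmp0 K2 y N N (Unit K2 N) (s0, s1)))"
    by (rule arrow.homotopic_post[OF arrow.homotopic_pre[OF d(2) a(1) a(1) y s] y a(1) y a(3)])
  moreover have "cmp0 K2 y N y r (cmp0 K2 y N N (cmp0 K2 N x N e d) (s0, s1)) = cmp0 K2 y x y m (cmp0 K2 y N x d (s0, s1))"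
    unfolding re[symmetric] using x y a eD d s by (simp add: arrow.Cmp_assoc)
  moreover have "cmp0 K2 y N y r (cmp0 K2 y N N (Unit K2 N) (s0, s1)) = Unit K2 y"
    using rs a(1) y s by simp
  ultimately have "homotopic K2 y y (cmp0 K2 y x y m (cmp0 K2 y N x d (s0, s1))) (Unit K2 y)" by simp
  moreover have "cmp0 K2 y N x d (s0, s1) \<in> arr K2 y x"
    by (rule arrow.Cmp_closed[OF y a(1) x s d(1)])
  ultimately show ?thesis using that by blast
qed

lemma equivalence_arrow_iff:
  assumes x: "x \<in> Obj K2" and y: "y \<in> Obj K2" and m: "m \<in> arr K2 x y"
  shows "equivalence K2 x y m \<longleftrightarrow> equivalence K (cd x) (cd y) (snd m) \<and> equivalence K (dm x) (dm y) (fst m)"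
proof
  assume "equivalence K2 x y m"
  then show "equivalence K (cd x) (cd y) (snd m) \<and> equivalence K (dm x) (dm y) (fst m)"
    using equivalence_arrow_components by blast
next
  assume eq: "equivalence K (cd x) (cd y) (snd m) \<and> equivalence K (dm x) (dm y) (fst m)"
  interpret A2: infinity_cosmos K2 \<kappa> by (rule infinity_cosmos_arrow)
  obtain n where n: "n \<in> arr K2 y x" "homotopic K2 y y (cmp0 K2 y x y m n) (Unit K2 y)"
    using equivalence_arrow_right_inverse[OF x y m] eq by blast
  note tn = arr_arrowD[OF n(1) y x]
    and h = homotopic_arrow_components[OF n(2), unfolded Cmp_arrow Unit_arrow fst_conv snd_conv]
  have "equivalence K (dm y) (dm x) (fst n)" "equivalence K (cd y) (cd x) (snd n)"
    using equivalence_right_inverse[OF _ tn(1) h(1)] equivalence_right_inverse[OF _ tn(2) h(2)] eq by blast+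
  then obtain l where l: "l \<in> arr K2 x y" "homotopic K2 x x (cmp0 K2 x y x n l) (Unit K2 x)"
    using equivalence_arrow_right_inverse[OF y x n(1)] by blast
  \<comment> \<open>Up to homotopy, \<open>n\<close> has \<open>m\<close> on its left and
    \<open>l\<close> on its right as inverses. Both are homotopic to \<open>m n l\<close>, so
    \<open>m\<close> may replace \<open>l\<close> in \<open>n l\<close>.\<close>
  have "homotopic K2 x y m (cmp0 K2 x x y m (cmp0 K2 x y x n l))"
    using arrow.homotopic_post[OF arrow.homotopic_sym[OF l(2)] x x y m] x y m by simp
  moreover have "homotopic K2 x y (cmp0 K2 x x y m (cmp0 K2 x y x n l)) l"
    using arrow.homotopic_pre[OF n(2) y y x l(1)] x y m n l by (simp add: arrow.Cmp_assoc)
  ultimately have "homotopic K2 x y m l"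
    using A2.homotopic_trans x y by blast
  then have "homotopic K2 x x (cmp0 K2 x y x n m) (cmp0 K2 x y x n l)"
    by (rule arrow.homotopic_post[OF _ x y x n(1)])
  then have "homotopic K2 x x (cmp0 K2 x y x n m) (Unit K2 x)"
    using A2.homotopic_trans[OF _ l(2)] x by blast
  then show "equivalence K2 x y m"
    using A2.equivalence_two_sided[OF x y m n(1,1) _ n(2)] by blast
qed

end

context infinity_cosmos
begin

text \<open>Over a trivial fibration \<open>snd m\<close>, being an equivalence is the same for the
  gap map and for \<open>fst m\<close>. This translates between equivalences, which are described by
  components, and isofibrations, which are described by gap maps.\<close>

lemma trivial_fibration_arrow_iff:
  assumes x: "x \<in> Obj K2" and y: "y \<in> Obj K2" and m: "m \<in> arr K2 x y"
  shows "trivial_fibration K2 x y m \<longleftrightarrow> trivial_fibration K (cd x) (cd y) (snd m) \<and>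
    (\<exists>P k. square_gap K x y m P k \<and> trivial_fibration K (dm x) P k)"
proof
  assume tf: "trivial_fibration K2 x y m"
  then have a: "m \<in> Isofib K2 x y" and eq: "equivalence K (cd x) (cd y) (snd m)" "equivalence K (dm x) (dm y) (fst m)"
    using equivalence_arrow_iff[OF x y m] by (auto simp: trivial_fibration_def)
  have f: "trivial_fibration K (cd x) (cd y) (snd m)"
    using eq(1) Isofib_arrowD(4)[OF a] by (simp add: trivial_fibration_def)
  obtain P l r k where P: "is_pullback K P (cd x) (dm y) (cd y) l r (snd m) (ar y)" "k \<in> Isofib K (dm x) P"
    "cmp0 K (dm x) P (cd x) l k = ar x" "cmp0 K (dm x) P (dm y) r k = fst m"
    using gap_isofibE[OF Isofib_arrowD(5)[OF a]] .
  have "trivial_fibration K (dm x) P k"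
    using gap_equivalence_iff[OF P(1) f IsofibD(3)[OF P(2)] P(4)] eq(2) P(2) by (simp add: trivial_fibration_def)
  moreover have "square_gap K x y m P k"
    unfolding square_gap_iff[OF x y m] using P IsofibD(3)[OF P(2)] by blast
  ultimately show "trivial_fibration K (cd x) (cd y) (snd m) \<and> (\<exists>P k. square_gap K x y m P k \<and> trivial_fibration K (dm x) P k)"
    using f by blast
next
  assume "trivial_fibration K (cd x) (cd y) (snd m) \<and> (\<exists>P k. square_gap K x y m P k \<and> trivial_fibration K (dm x) P k)"
  then obtain P k where f: "trivial_fibration K (cd x) (cd y) (snd m)" and sg: "square_gap K x y m P k"
    and k: "trivial_fibration K (dm x) P k" by blast
  obtain l r where P: "is_pullback K P (cd x) (dm y) (cd y) l r (snd m) (ar y)" "k \<in> arr K (dm x) P"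
    "cmp0 K (dm x) P (cd x) l k = ar x" "cmp0 K (dm x) P (dm y) r k = fst m"
    using sg unfolding square_gap_iff[OF x y m] by blast
  have "m \<in> Isofib K2 x y"
    using gap_isofibI[OF P(1) _ P(3,4)] x y m f k by (simp add: Isofib_arrow_iff trivial_fibration_def)
  moreover have "equivalence K2 x y m"
    using equivalence_arrow_iff[OF x y m] gap_equivalence_iff[OF P(1) f P(2,4)] f k by (simp add: trivial_fibration_def)
  ultimately show "trivial_fibration K2 x y m" by (simp add: trivial_fibration_def)
qed

section \<open>The projections and the final statements\<close>

lemma simplicial_functor_dom: "simplicial_functor K2 K (dom_functor K)"
  unfolding simplicial_functor_def FOb_dom
proof (intro conjI ballI allI)
  show "dm x \<in> Obj K" if "x \<in> Obj K2" for x using Obj_arrowD[OF that] by simp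
  show "FAr (dom_functor K) x y \<in> smap (Fun K2 x y) (Fun K (dm x) (dm y))" if xy: "x \<in> Obj K2" "y \<in> Obj K2" for x y
  proof (rule smapI)
    show "FAr (dom_functor K) x y n z = undefined" if "z \<notin> simplices (Fun K2 x y) n" for n z
      using that by (simp add: dom_functor_def arrow_cosmos_def restrict_def)
    show "FAr (dom_functor K) x y n z \<in> simplices (Fun K (dm x) (dm y)) n" if "z \<in> simplices (Fun K2 x y) n" for n z
      using FAr_dom[OF that] that by (simp add: Fun_arrow_iff)
    show "FAr (dom_functor K) x y m (act (Fun K2 x y) m n \<alpha> z) = act (Fun K (dm x) (dm y)) m n \<alpha> (FAr (dom_functor K) x y n z)"
      if a: "\<alpha> \<in> Delta m n" "z \<in> simplices (Fun K2 x y) n" for m n \<alpha> z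
      using FAr_dom[OF arrow.act_closed[OF xy a]] FAr_dom[OF a(2)] by (simp add: act_arrow)
  qed
  show "FAr (dom_functor K) x x 0 (Unit K2 x) = Unit K (dm x)" if "x \<in> Obj K2" for x
    using FAr_dom[OF arrow.Unit_closed[OF that]] by (simp add: Unit_arrow)
  show "FAr (dom_functor K) x z n (Cmp K2 x y z n g f)
      = Cmp K (dm x) (dm y) (dm z) n (FAr (dom_functor K) y z n g) (FAr (dom_functor K) x y n f)"
    if "x \<in> Obj K2" "y \<in> Obj K2" "z \<in> Obj K2" "f \<in> simplices (Fun K2 x y) n" "g \<in> simplices (Fun K2 y z) n" for x y z n f g
    using FAr_dom[OF arrow.Cmp_closed[OF that]] FAr_dom[OF that(4)] FAr_dom[OF that(5)] by (simp add: Cmp_arrow)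
qed

lemma simplicial_functor_cod: "simplicial_functor K2 K (cod_functor K)"
  unfolding simplicial_functor_def FOb_cod
proof (intro conjI ballI allI)
  show "cd x \<in> Obj K" if "x \<in> Obj K2" for x using Obj_arrowD[OF that] by simp
  show "FAr (cod_functor K) x y \<in> smap (Fun K2 x y) (Fun K (cd x) (cd y))" if xy: "x \<in> Obj K2" "y \<in> Obj K2" for x y
  proof (rule smapI)
    show "FAr (cod_functor K) x y n z = undefined" if "z \<notin> simplices (Fun K2 x y) n" for n z
      using that by (simp add: cod_functor_def arrow_cosmos_def restrict_def)
    show "FAr (cod_functor K) x y n z \<in> simplices (Fun K (cd x) (cd y)) n" if "z \<in> simplices (Fun K2 x y) n" for n z
      using FAr_cod[OF that] that by (simp add: Fun_arrow_iff)
    show "FAr (cod_functor K) x y m (act (Fun K2 x y) m n \<alpha> z) = act (Fun K (cd x) (cd y)) m n \<alpha> (FAr (cod_functor K) x y n z)"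
      if a: "\<alpha> \<in> Delta m n" "z \<in> simplices (Fun K2 x y) n" for m n \<alpha> z
      using FAr_cod[OF arrow.act_closed[OF xy a]] FAr_cod[OF a(2)] by (simp add: act_arrow)
  qed
  show "FAr (cod_functor K) x x 0 (Unit K2 x) = Unit K (cd x)" if "x \<in> Obj K2" for x
    using FAr_cod[OF arrow.Unit_closed[OF that]] by (simp add: Unit_arrow)
  show "FAr (cod_functor K) x z n (Cmp K2 x y z n g f)
      = Cmp K (cd x) (cd y) (cd z) n (FAr (cod_functor K) y z n g) (FAr (cod_functor K) x y n f)"
    if "x \<in> Obj K2" "y \<in> Obj K2" "z \<in> Obj K2" "f \<in> simplices (Fun K2 x y) n" "g \<in> simplices (Fun K2 y z) n" for x y z n f g
    using FAr_cod[OF arrow.Cmp_closed[OF that]] FAr_cod[OF that(4)] FAr_cod[OF that(5)] by (simp add: Cmp_arrow)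
qed

text \<open>There is only one arrow from \<open>S\<close> to \<open>T\<close>, and it is an
  isofibration since its target is terminal; so the two ends determine the object.\<close>

lemma terminal_arrow_created:
  assumes S: "terminal K S" and T: "terminal K T"
  shows "\<exists>!x. x \<in> Obj K2 \<and> dm x = S \<and> cd x = T"
    and "x \<in> Obj K2 \<and> dm x = S \<and> cd x = T \<Longrightarrow> terminal K2 x"
proof -
  have o: "S \<in> Obj K" "T \<in> Obj K" using S T by (auto simp: terminal_def)
  obtain h where h: "h \<in> arr K S T" using terminal_arr_ex[OF T o(1)] by blast
  have lim: "terminal K2 (S, T, h)" by (rule terminal_arrow[OF S T h])
  have uniq: "x = (S, T, h)" if x: "x \<in> Obj K2 \<and> dm x = S \<and> cd x = T" for x
  proof -
    have "ar x \<in> arr K S T" using x Obj_arrowD(3)[of x] by simp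
    then have "ar x = h" by (rule terminal_unique[OF T o(1) _ h])
    then show ?thesis using x by (simp add: prod_eq_iff)
  qed
  have ex: "(S, T, h) \<in> Obj K2 \<and> dm (S, T, h) = S \<and> cd (S, T, h) = T" using lim by (simp add: terminal_def)
  show "\<exists>!x. x \<in> Obj K2 \<and> dm x = S \<and> cd x = T"
    by (rule ex1I[where a = "(S, T, h)"], rule ex, rule uniq)
  show "terminal K2 x" if "x \<in> Obj K2 \<and> dm x = S \<and> cd x = T"
    using uniq[OF that] lim by (simp only:)
qed

lemma arrow_cosmos_maps:
  assumes p: "p \<in> Isofib K E A" and q: "q \<in> Isofib K F B"
  shows "(g, f) \<in> arr K2 (E, A, p) (F, B, q) \<longleftrightarrow>
      g \<in> arr K E F \<and> f \<in> arr K A B \<and> cmp0 K E F B q g = cmp0 K E A B f p"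
    and "(g, f) \<in> arr K2 (E, A, p) (F, B, q) \<Longrightarrow>
      (equivalence K2 (E, A, p) (F, B, q) (g, f) \<longleftrightarrow> equivalence K A B f \<and> equivalence K E F g) \<and>
      ((g, f) \<in> Isofib K2 (E, A, p) (F, B, q) \<longleftrightarrow>
        f \<in> Isofib K A B \<and> (\<exists>P k. square_gap K (E, A, p) (F, B, q) (g, f) P k \<and> k \<in> Isofib K E P)) \<and>
      ((g, f) \<in> Isofib K2 (E, A, p) (F, B, q) \<longrightarrow> g \<in> Isofib K E F) \<and>
      (trivial_fibration K2 (E, A, p) (F, B, q) (g, f) \<longleftrightarrow> trivial_fibration K A B f \<and>
        (\<exists>P k. square_gap K (E, A, p) (F, B, q) (g, f) P k \<and> trivial_fibration K E P k)) \<and>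
      (trivial_fibration K2 (E, A, p) (F, B, q) (g, f) \<longrightarrow> trivial_fibration K E F g)"
proof -
  have o: "(E, A, p) \<in> Obj K2" "(F, B, q) \<in> Obj K2" using p q by (auto simp: Obj_arrow_iff)
  show "(g, f) \<in> arr K2 (E, A, p) (F, B, q) \<longleftrightarrow>
      g \<in> arr K E F \<and> f \<in> arr K A B \<and> cmp0 K E F B q g = cmp0 K E A B f p"
    using arr_arrow_iff[OF o, of "(g, f)"] by simp
  assume m: "(g, f) \<in> arr K2 (E, A, p) (F, B, q)"
  have 1: "equivalence K2 (E, A, p) (F, B, q) (g, f) \<longleftrightarrow> equivalence K A B f \<and> equivalence K E F g"
    using equivalence_arrow_iff[OF o m] by simp
  have "(\<exists>P k. square_gap K (E, A, p) (F, B, q) (g, f) P k \<and> k \<in> Isofib K E P) \<longleftrightarrow> gap_isofib K E A p F B q g f"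
    unfolding square_gap_iff[OF o m] gap_isofib_def fst_conv snd_conv using IsofibD(3) by blast
  then have 2: "(g, f) \<in> Isofib K2 (E, A, p) (F, B, q) \<longleftrightarrow>
        f \<in> Isofib K A B \<and> (\<exists>P k. square_gap K (E, A, p) (F, B, q) (g, f) P k \<and> k \<in> Isofib K E P)"
    using o m Isofib_arrow_iff[of "(g, f)" "(E, A, p)" "(F, B, q)"] by simp
  have 3: "(g, f) \<in> Isofib K2 (E, A, p) (F, B, q) \<longrightarrow> g \<in> Isofib K E F"
    using Isofib_arrowD(6)[of "(g, f)" "(E, A, p)" "(F, B, q)"] by simp
  have 4: "trivial_fibration K2 (E, A, p) (F, B, q) (g, f) \<longleftrightarrow> trivial_fibration K A B f \<and>
        (\<exists>P k. square_gap K (E, A, p) (F, B, q) (g, f) P k \<and> trivial_fibration K E P k)"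
    using trivial_fibration_arrow_iff[OF o m] by simp
  have 5: "trivial_fibration K2 (E, A, p) (F, B, q) (g, f) \<longrightarrow> trivial_fibration K E F g"
    using 1 3 by (auto simp: trivial_fibration_def)
  show "(equivalence K2 (E, A, p) (F, B, q) (g, f) \<longleftrightarrow> equivalence K A B f \<and> equivalence K E F g) \<and>
      ((g, f) \<in> Isofib K2 (E, A, p) (F, B, q) \<longleftrightarrow>
        f \<in> Isofib K A B \<and> (\<exists>P k. square_gap K (E, A, p) (F, B, q) (g, f) P k \<and> k \<in> Isofib K E P)) \<and>
      ((g, f) \<in> Isofib K2 (E, A, p) (F, B, q) \<longrightarrow> g \<in> Isofib K E F) \<and>
      (trivial_fibration K2 (E, A, p) (F, B, q) (g, f) \<longleftrightarrow> trivial_fibration K A B f \<and>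
        (\<exists>P k. square_gap K (E, A, p) (F, B, q) (g, f) P k \<and> trivial_fibration K E P k)) \<and>
      (trivial_fibration K2 (E, A, p) (F, B, q) (g, f) \<longrightarrow> trivial_fibration K E F g)"
    using 1 2 3 4 5 by (intro conjI)
qed

end

theorem proposition2p1p6:
  fixes \<kappa> :: "'u rel" and K :: "('o, 'a) cosmos"
  assumes "infinity_cosmos K \<kappa>"
  shows
    "infinity_cosmos (arrow_cosmos K) \<kappa> \<and>
     Obj (arrow_cosmos K) = {(E, A, p). p \<in> Isofib K E A} \<and>
     simplicial_functor (arrow_cosmos K) K (dom_functor K) \<and>
     simplicial_functor (arrow_cosmos K) K (cod_functor K) \<and>
     (\<forall>E A p F B q. p \<in> Isofib K E A \<and> q \<in> Isofib K F B \<longrightarrow>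
       qcat_isofibration (Fun K E F) (Fun K E B) (post_map K E F B q) \<and>
       pre_map K E A B p \<in> smap (Fun K A B) (Fun K E B) \<and>
       Fun (arrow_cosmos K) (E, A, p) (F, B, q)
         = spullback (Fun K E F) (Fun K A B) (post_map K E F B q) (pre_map K E A B p) \<and>
       (\<forall>g f. (g, f) \<in> arr (arrow_cosmos K) (E, A, p) (F, B, q) \<longleftrightarrow>
         g \<in> arr K E F \<and> f \<in> arr K A B \<and> cmp0 K E F B q g = cmp0 K E A B f p) \<and>
       (\<forall>(g, f) \<in> arr (arrow_cosmos K) (E, A, p) (F, B, q).
         (equivalence (arrow_cosmos K) (E, A, p) (F, B, q) (g, f) \<longleftrightarrow>
           equivalence K A B f \<and> equivalence K E F g) \<and>
         ((g, f) \<in> Isofib (arrow_cosmos K) (E, A, p) (F, B, q) \<longleftrightarrow>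
           f \<in> Isofib K A B \<and>
           (\<exists>P k. square_gap K (E, A, p) (F, B, q) (g, f) P k \<and> k \<in> Isofib K E P)) \<and>
         ((g, f) \<in> Isofib (arrow_cosmos K) (E, A, p) (F, B, q) \<longrightarrow> g \<in> Isofib K E F) \<and>
         (trivial_fibration (arrow_cosmos K) (E, A, p) (F, B, q) (g, f) \<longleftrightarrow>
           trivial_fibration K A B f \<and>
           (\<exists>P k. square_gap K (E, A, p) (F, B, q) (g, f) P k \<and> trivial_fibration K E P k)) \<and>
         (trivial_fibration (arrow_cosmos K) (E, A, p) (F, B, q) (g, f) \<longrightarrow>
           trivial_fibration K E F g))) \<and>
     (\<forall>S T. terminal K S \<and> terminal K T \<longrightarrow>
       (\<exists>!X. X \<in> Obj (arrow_cosmos K) \<and>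
         FOb (dom_functor K) X = S \<and> FOb (cod_functor K) X = T) \<and>
       (\<forall>X. X \<in> Obj (arrow_cosmos K) \<and>
         FOb (dom_functor K) X = S \<and> FOb (cod_functor K) X = T
         \<longrightarrow> terminal (arrow_cosmos K) X)) \<and>
     (\<forall>(I :: 'u set) X. |I| <o \<kappa> \<and> (\<forall>i\<in>I. X i \<in> Obj (arrow_cosmos K)) \<longrightarrow>
       jointly_create_limit (arrow_cosmos K) K (dom_functor K) (cod_functor K)
         (product_diagram I X)) \<and>
     (\<forall>X r. (\<forall>n. r n \<in> Isofib (arrow_cosmos K) (X (Suc n)) (X n)) \<longrightarrow>
       jointly_create_limit (arrow_cosmos K) K (dom_functor K) (cod_functor K)
         (sequence_diagram X r)) \<and>
     (\<forall>X Y Z s r. X \<in> Obj (arrow_cosmos K) \<and> s \<in> arr (arrow_cosmos K) X Z \<and>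
         r \<in> Isofib (arrow_cosmos K) Y Z \<longrightarrow>
       jointly_create_limit (arrow_cosmos K) K (dom_functor K) (cod_functor K)
         (cospan X s Z r Y)) \<and>
     (\<forall>(U :: 'u sset) X. small_sset \<kappa> U \<and> X \<in> Obj (arrow_cosmos K) \<longrightarrow>
       jointly_create_cotensor (arrow_cosmos K) K (dom_functor K) (cod_functor K) U X)"
proof -
  interpret infinity_cosmos K \<kappa> by (rule assms)
  show ?thesis
  proof (intro conjI allI impI ballI, goal_cases)
    case 1 show ?case by (rule infinity_cosmos_arrow)
  next
    case 2 show ?case by (rule Obj_arrow)
  next
    case 3 show ?case by (rule simplicial_functor_dom)
  next
    case 4 show ?case by (rule simplicial_functor_cod)
  next
    case (5 E A p F B q)
    then show ?case using Fun_Isofib IsofibD by blast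
  next
    case (6 E A p F B q)
    then show ?case using IsofibD[of p E A] IsofibD[of q F B] by simp
  next
    case (7 E A p F B q)
    show ?case by (simp add: Fun_arrow)
  next
    case (8 E A p F B q g f)
    then show ?case using arrow_cosmos_maps(1) by blast
  next
    case (9 E A p F B q x)
    obtain g f where "x = (g, f)" by (cases x)
    then show ?case using 9 arrow_cosmos_maps(2)[of p E A q F B g f] by simp
  next
    case (10 S T)
    then show ?case using terminal_arrow_created(1) by simp
  next
    case (11 S T X)
    then show ?case using terminal_arrow_created(2)[of S T X] by simp
  next
    case (12 I X)
    then show ?case
      by (intro jointly_create_limit_arrow arrow.wf_product isofib_limits_product) auto
  next
    case (13 X r)
    then show ?case
      by (intro jointly_create_limit_arrow wf_sequence_arrow isofib_limits_sequence(1)) auto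
  next
    case (14 X Y Z s r)
    then show ?case
      by (intro jointly_create_limit_arrow wf_cospan_arrow isofib_limits_cospan) auto
  next
    case (15 U X)
    then show ?case by (intro jointly_create_cotensor_arrow) auto
  qed
qed

end
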